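(* Let $\gamma\in(-1,1)$ and let $p\ge0$ be an integer. A function $u\in L^2_{\gamma,+}(\partial_+S\mathbb{D})$ takes the form $u=I_{2p}d^\gamma f$ for some $f\in L^2_\gamma(\mathbb{D};S^{2p}(T^*\mathbb{D}))$ if and only if (a) for all $j>p$, $\Pi_{2j}u=0$; (b) for all $1\le j\le p$, $\Pi_{2j}u\in h^{(1+\gamma)/2}(\psi^{\gamma,+}_{n,-j},n\ge0)\oplus h^{(1+\gamma)/2}(\psi^{\gamma,+}_{n,n+j},n\ge0)$; and (c) writing $\Pi_0u=\sum_{n=0}^\infty\sum_{k=0}^nu_{n,k}\psi^{\gamma,+}_{n,k}$, we have $\displaystyle\sum_{n=0}^\infty\sum_{k=0}^n\frac{|u_{n,k}|^2}{(\sigma^\gamma_{n,k})^2}<\infty$. A function $u\in L^2_{\gamma,-}(\partial_+S\mathbb{D})$ takes the form $u=I_{2p+1}d^\gamma f$ for some $f\in L^2_\gamma(\mathbb{D};S^{2p+1}(T^*\mathbb{D}))$ if and only if (a) for all $j>p$, $\Pi_{2j+1}u=0$; (b) for all $0\le j\le p$, $\Pi_{2j+1}u\in h^{(1+\gamma)/2}(\psi^{\gamma,-}_{n,-j},n\ge0)\oplus h^{(1+\gamma)/2}(\psi^{\gamma,-}_{n,n+j+1},n\ge0)$; and (c) writing $\Pi_\perp u=\sum_{n=1}^\infty\sum_{k=1}^nu_{n,k}\psi^{\gamma,-}_{n,k}$, we have $\displaystyle\sum_{n=1}^\infty\sum_{k=1}^n\frac{|u_{n,k}|^2}{(\sigm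a^\gamma_{n,k})^2}<\infty$.
   Context: $\mathbb{D}=\{z=x+iy\in\mathbb{C}:|z|\le 1\}$, $d(z)=1-|z|^2$; functions and tensors are complex-valued. $L^2_\gamma(\mathbb{D})=L^2(\mathbb{D},d^\gamma\,\mathrm{d}x\,\mathrm{d}y)$; $L^2_\gamma(\mathbb{D};S^m(T^*\mathbb{D}))$ is the space of symmetric covariant $m$-tensor fields with all components in $L^2_\gamma(\mathbb{D})$ ($S^0$: functions). $\partial_+S\mathbb{D}=(\mathbb{R}/2\pi\mathbb{Z})_\beta\times[-\pi/2,\pi/2]_\alpha$, $\mu=\cos\alpha$, $L^2_\gamma(\partial_+S\mathbb{D})=L^2(\partial_+S\mathbb{D},\mu^{-2\gamma}\,\mathrm{d}\beta\,\mathrm{d}\alpha)$. With $\mathcal{S}_A(\beta,\alpha)=(\beta+\pi+2\alpha,-\alpha)$, $L^2_{\gamma,\pm}(\partial_+S\mathbb{D})=\{u\in L^2_\gamma(\partial_+S\mathbb{D}):u\circ\mathcal{S}_A=\pm u\}$. $I_md^\gamma f(\beta,\alpha)=\int_0^{2\cos\alpha}f_{z(t)}(v,\dots,v)\,d(z(t))^\gamma\,\mathrm{d}t$ with $z(t)=e^{i\beta}+te^{i(\beta+\pi+\alpha)}$ and $v$ the unit vector of angle $\beta+\pi+\alpha$. $\hat L^\gamma_n$ is the orthogonal polynomial of degree $n$ on $[-1,1]$ for the weight $(1-x^2)^{\gamma+1/2}$, with positive leading coefficient and norm $\sqrt{2\pi}$ in $L^2([-1,1],(1-x^2)^{\gamma+1/2}\mathrm{d}x)$.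 For $n\ge0$, $k\in\mathbb{Z}$, $$\psi^{\gamma,+}_{n,k}=\psi^\gamma_{n,k}=\frac{1}{2\pi}\mu^{2\gamma+1}e^{i(n-2k)(\beta+\alpha+\pi)}\hat L^\gamma_n(\sin\alpha),\qquad\psi^{\gamma,-}_{n,k}=e^{i(\beta+\alpha+\pi)}\psi^\gamma_{n,k};$$ $\{\psi^{\gamma,\pm}_{n,k}\}_{n\ge0,k\in\mathbb{Z}}$ is an orthonormal basis of $L^2_{\gamma,\pm}(\partial_+S\mathbb{D})$. For $n\ge0$, $0\le k\le n$, $\sigma^\gamma_{n,k}>0$ is given by $$(\sigma^\gamma_{n,k})^2=2^{2\gamma+2}\pi\binom nk\frac{(n-k+\gamma)!\,(k+\gamma)!}{(n+2\gamma+1)!},\qquad x!:=\Gamma(x+1).$$ For an orthonormal family $\{f_n\}_{n\ge0}$ and $s\ge0$, $h^s(f_n,n\ge0)=\{\sum_na_nf_n:\sum_n(n+1)^{2s}|a_n|^2<\infty\}$. The following are orthogonal projections. In $L^2_{\gamma,+}(\partial_+S\mathbb{D})$: $\Pi_0$ onto the closed span of $\{\psi^{\gamma,+}_{n,k}:n\ge0,0\le k\le n\}$, and for $j\ge1$, $\Pi_{2j}$ onto the closed span of $\{\psi^{\gamma,+}_{n,-j},\psi^{\gamma,+}_{n,n+j}:n\ge0\}$. In $L^2_{\gamma,-}(\partial_+S\mathbb{D})$: $\Pi_\perp$ onto the closed span of $\{\psi^{\gamma,-}_{n,k}:n\ge1,1\le k\le n\}$, and for $j\ge0$, $\Pi_{2j+1}$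 onto the closed span of $\{\psi^{\gamma,-}_{n,-j},\psi^{\gamma,-}_{n,n+j+1}:n\ge0\}$. *)

theory Defs
  imports "HOL-Analysis.Analysis" "HOL-Computational_Algebra.Polynomial"
begin

text \<open>
  Elements of the \<open>L\<^sup>2\<close> spaces are represented by functions; every equality in such a space is
  to be read almost everywhere with respect to the underlying measure. The Bochner integral of a
  non-integrable function is 0, so \<open>l2_norm\<close> is meaningful only on \<open>L2\<close>; hence the explicit
  membership conditions in \<open>l2_sums\<close> and \<open>closed_span\<close>.
\<close>

definition L2 :: "'a measure \<Rightarrow> ('a \<Rightarrow> complex) set" where
  "L2 M = {u \<in> borel_measurable M. integrable M (\<lambda>x. (cmod (u x))\<^sup>2)}"

definition l2_inner :: "'a measure \<Rightarrow> ('a \<Rightarrow> complex) \<Rightarrow> ('a \<Rightarrow> complex) \<Rightarrow> complex" where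
  "l2_inner M u v = (\<integral>x. u x * cnj (v x) \<partial>M)"

definition l2_norm :: "'a measure \<Rightarrow> ('a \<Rightarrow> complex) \<Rightarrow> real" where
  "l2_norm M u = sqrt (\<integral>x. (cmod (u x))\<^sup>2 \<partial>M)"

definition l2_sums :: "'a measure \<Rightarrow> (nat \<Rightarrow> 'a \<Rightarrow> complex) \<Rightarrow> ('a \<Rightarrow> complex) \<Rightarrow> bool" where
  "l2_sums M F u \<longleftrightarrow> u \<in> L2 M \<and> (\<forall>n. F n \<in> L2 M) \<and>
     (\<lambda>N. l2_norm M (\<lambda>x. u x - (\<Sum>n<N. F n x))) \<longlonglongrightarrow> 0"

definition lin_span :: "('a \<Rightarrow> complex) set \<Rightarrow> ('a \<Rightarrow> complex) set" where
  "lin_span B = {(\<lambda>x. \<Sum>b\<in>F. c b * b x) | F c. finite F \<and> F \<subseteq> B}"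

definition closed_span :: "'a measure \<Rightarrow> ('a \<Rightarrow> complex) set \<Rightarrow> ('a \<Rightarrow> complex) set" where
  "closed_span M B =
     {u \<in> L2 M. \<forall>\<epsilon>>0. \<exists>v\<in>lin_span B \<inter> L2 M. l2_norm M (\<lambda>x. u x - v x) < \<epsilon>}"

text \<open>
  The orthogonal projection is determined only up to null sets, so a representative is chosen.
\<close>

definition orth_proj ::
    "'a measure \<Rightarrow> ('a \<Rightarrow> complex) set \<Rightarrow> ('a \<Rightarrow> complex) \<Rightarrow> ('a \<Rightarrow> complex)" where
  "orth_proj M V u =
     (SOME v. v \<in> V \<and> (\<forall>w\<in>V. l2_inner M (\<lambda>x. u x - v x) w = 0))"

definition h_space ::
    "'a measure \<Rightarrow> real \<Rightarrow> (nat \<Rightarrow> 'a \<Rightarrow> complex) \<Rightarrow> ('a \<Rightarrow> complex) set" where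
  "h_space M s F =
     {u \<in> L2 M. \<exists>a :: nat \<Rightarrow> complex.
        summable (\<lambda>n. (real n + 1) powr (2 * s) * (cmod (a n))\<^sup>2) \<and>
        l2_sums M (\<lambda>n x. a n * F n x) u}"

text \<open>
  The sum below is used only for spaces spanned by mutually orthogonal families, where it is direct.
\<close>

definition sum_space :: "('a \<Rightarrow> complex) set \<Rightarrow> ('a \<Rightarrow> complex) set \<Rightarrow> ('a \<Rightarrow> complex) set" where
  "sum_space V W = {(\<lambda>x. v x + w x) | v w. v \<in> V \<and> w \<in> W}"


definition bdf :: "complex \<Rightarrow> real" where
  "bdf z = 1 - (cmod z)\<^sup>2"

definition disk_measure :: "real \<Rightarrow> complex measure" where
  "disk_measure \<gamma> =
     density (restrict_space lborel (cball 0 1)) (\<lambda>z. ennreal (bdf z powr \<gamma>))"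

text \<open>
  A complex-valued covariant tensor of order \<open>m\<close> on the plane is an \<open>\<real>\<close>-multilinear form on
  lists of \<open>m\<close> tangent vectors, a tangent vector being a complex number; \<open>linear\<close> is
  linearity over \<open>\<real>\<close>. Its components are its values on lists over \<open>Basis = {1, \<i>}\<close>.
\<close>

definition sym_tensor :: "nat \<Rightarrow> (complex list \<Rightarrow> complex) \<Rightarrow> bool" where
  "sym_tensor m T \<longleftrightarrow>
     (\<forall>vs i. length vs = m \<and> i < m \<longrightarrow> linear (\<lambda>w. T (vs[i := w]))) \<and>
     (\<forall>vs ws. length vs = m \<and> mset ws = mset vs \<longrightarrow> T ws = T vs)"

definition L2_tensor :: "real \<Rightarrow> nat \<Rightarrow> (complex \<Rightarrow> complex list \<Rightarrow> complex) set" where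
  "L2_tensor \<gamma> m =
     {f. (\<forall>z\<in>cball 0 1. sym_tensor m (f z)) \<and>
         (\<forall>es. length es = m \<and> set es \<subseteq> Basis \<longrightarrow> (\<lambda>z. f z es) \<in> L2 (disk_measure \<gamma>))}"


text \<open>
  Points of the inward boundary are pairs \<open>(\<beta>, \<alpha>)\<close>. Functions on it are functions on the plane
  that are \<open>2\<pi>\<close>-periodic in \<open>\<beta>\<close>, integrated over the fundamental domain \<open>0 \<le> \<beta> < 2\<pi>\<close>.
\<close>

definition inflow_measure :: "real \<Rightarrow> (real \<times> real) measure" where
  "inflow_measure \<gamma> =
     density (restrict_space lborel ({0..<2 * pi} \<times> {- pi / 2..pi / 2}))
       (\<lambda>x. ennreal (cos (snd x) powr (- 2 * \<gamma>)))"

definition L2_inflow :: "real \<Rightarrow> (real \<times> real \<Rightarrow> complex) set" where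
  "L2_inflow \<gamma> =
     {u \<in> L2 (inflow_measure \<gamma>).
        \<forall>\<beta>. \<forall>\<alpha>\<in>{- pi / 2..pi / 2}. u (\<beta> + 2 * pi, \<alpha>) = u (\<beta>, \<alpha>)}"

definition antipodal_scattering :: "real \<times> real \<Rightarrow> real \<times> real" where
  "antipodal_scattering = (\<lambda>(\<beta>, \<alpha>). (\<beta> + pi + 2 * \<alpha>, - \<alpha>))"

definition L2_inflow_plus :: "real \<Rightarrow> (real \<times> real \<Rightarrow> complex) set" where
  "L2_inflow_plus \<gamma> =
     {u \<in> L2_inflow \<gamma>. AE x in inflow_measure \<gamma>. u (antipodal_scattering x) = u x}"

definition L2_inflow_minus :: "real \<Rightarrow> (real \<times> real \<Rightarrow> complex) set" where
  "L2_inflow_minus \<gamma> =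
     {u \<in> L2_inflow \<gamma>. AE x in inflow_measure \<gamma>. u (antipodal_scattering x) = - u x}"

definition xray ::
    "nat \<Rightarrow> real \<Rightarrow> (complex \<Rightarrow> complex list \<Rightarrow> complex) \<Rightarrow> real \<times> real \<Rightarrow> complex" where
  "xray m \<gamma> f = (\<lambda>(\<beta>, \<alpha>).
     let v = cis (\<beta> + pi + \<alpha>); z = (\<lambda>t. cis \<beta> + complex_of_real t * v)
     in (LINT t:{0..2 * cos \<alpha>}|lborel.
           f (z t) (replicate m v) * complex_of_real (bdf (z t) powr \<gamma>)))"


definition weighted_inner :: "real \<Rightarrow> real poly \<Rightarrow> real poly \<Rightarrow> real" where
  "weighted_inner \<gamma> p q =
     (LINT x:{-1..1}|lborel. poly p x * poly q x * (1 - x\<^sup>2) powr (\<gamma> + 1/2))"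

definition Lhat :: "real \<Rightarrow> nat \<Rightarrow> real poly" where
  "Lhat \<gamma> n =
     (THE p. degree p = n \<and> lead_coeff p > 0 \<and>
        (\<forall>q. degree q < n \<longrightarrow> weighted_inner \<gamma> p q = 0) \<and>
        sqrt (weighted_inner \<gamma> p p) = sqrt (2 * pi))"

definition psi_plus :: "real \<Rightarrow> nat \<Rightarrow> int \<Rightarrow> real \<times> real \<Rightarrow> complex" where
  "psi_plus \<gamma> n k = (\<lambda>(\<beta>, \<alpha>).
     complex_of_real (1 / (2 * pi) * cos \<alpha> powr (2 * \<gamma> + 1)) *
     cis (of_int (int n - 2 * k) * (\<beta> + \<alpha> + pi)) *
     complex_of_real (poly (Lhat \<gamma> n) (sin \<alpha>)))"

definition psi_minus :: "real \<Rightarrow> nat \<Rightarrow> int \<Rightarrow> real \<times> real \<Rightarrow> complex" where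
  "psi_minus \<gamma> n k = (\<lambda>(\<beta>, \<alpha>). cis (\<beta> + \<alpha> + pi) * psi_plus \<gamma> n k (\<beta>, \<alpha>))"

definition sigma_coeff :: "real \<Rightarrow> nat \<Rightarrow> nat \<Rightarrow> real" where
  "sigma_coeff \<gamma> n k =
     sqrt (2 powr (2 * \<gamma> + 2) * pi * real (n choose k) *
       (Gamma (real n - real k + \<gamma> + 1) * Gamma (real k + \<gamma> + 1) / Gamma (real n + 2 * \<gamma> + 2)))"


text \<open>
  \<open>Pi_even \<gamma> j\<close> and \<open>Pi_odd \<gamma> j\<close> stand for \<open>\<Pi>\<close> with index \<open>2j\<close> and \<open>2j + 1\<close>. They are
  computed in the full \<open>L\<^sup>2\<close> space of the inward boundary, where they extend the projections of
  the closed subspaces of even and odd functions.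
\<close>

definition Pi_even ::
    "real \<Rightarrow> nat \<Rightarrow> (real \<times> real \<Rightarrow> complex) \<Rightarrow> (real \<times> real \<Rightarrow> complex)" where
  "Pi_even \<gamma> j = orth_proj (inflow_measure \<gamma>) (closed_span (inflow_measure \<gamma>)
     (if j = 0 then {psi_plus \<gamma> n (int k) | n k. k \<le> n}
      else {psi_plus \<gamma> n (- int j) | n. True} \<union> {psi_plus \<gamma> n (int n + int j) | n. True}))"

definition Pi_perp ::
    "real \<Rightarrow> (real \<times> real \<Rightarrow> complex) \<Rightarrow> (real \<times> real \<Rightarrow> complex)" where
  "Pi_perp \<gamma> = orth_proj (inflow_measure \<gamma>) (closed_span (inflow_measure \<gamma>)
     {psi_minus \<gamma> n (int k) | n k. 1 \<le> n \<and> 1 \<le> k \<and> k \<le> n})"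

definition Pi_odd ::
    "real \<Rightarrow> nat \<Rightarrow> (real \<times> real \<Rightarrow> complex) \<Rightarrow> (real \<times> real \<Rightarrow> complex)" where
  "Pi_odd \<gamma> j = orth_proj (inflow_measure \<gamma>) (closed_span (inflow_measure \<gamma>)
     ({psi_minus \<gamma> n (- int j) | n. True} \<union>
      {psi_minus \<gamma> n (int n + int j + 1) | n. True}))"

end

theory Submission
  imports Defs
begin

text \<open>
  A line that enters the disk at angle \<open>\<beta>\<close> with direction offset \<open>\<alpha>\<close> is determined by its direction
  \<open>v = exp (i (\<beta> + \<alpha> + \<pi>))\<close> and its signed distance \<open>s = sin \<alpha>\<close> from the origin; its points are
  \<open>v (\<tau> + i s)\<close>. In these parallel-beam coordinates the measure of the inward boundary becomes
  \<open>(1 - s\<^sup>2) powr (- \<gamma> - 1/2)\<close> on the cylinder \<open>\<bar>v\<bar> = 1\<close>, \<open>\<bar>s\<bar> \<le> 1\<close>, and both families \<open>\<psi>\<^sup>+\<close>, \<open>\<psi>\<^sup>-\<close> turn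
  into the single family \<open>fan_basis (n, l)\<close>, which is a multiple of
  \<open>(1 - s\<^sup>2) powr (\<gamma> + 1/2) * v powi l * Lhat n s\<close>. With \<open>n\<close> a natural number and \<open>l\<close> any integer this
  is an orthonormal basis of the whole space: orthogonality is that of the powers of \<open>v\<close> and of the
  Gegenbauer polynomials, and totality follows from the Stone-Weierstrass theorem. The antipodal
  scattering relation becomes \<open>(v, s) \<mapsto> (- v, - s)\<close>, which multiplies the basis element by
  \<open>(-1) ^ (n + l)\<close>. Thus even functions have coefficients with \<open>n + l\<close> even, odd functions with \<open>n + l\<close>
  odd, and every projection in the theorem selects a set of indices \<open>(n, l)\<close>.

  For functions on the disk the transform is diagonal. Fubini gives its adjoint, and the adjoint
  maps \<open>fan_basis (n, l)\<close> to a polynomial, \<open>disk_polynomial (n, l)\<close>. The weighted Radon transform of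
  that polynomial has the form \<open>v powi l * (1 - s\<^sup>2) powr (\<gamma> + 1/2) * q s\<close> with \<open>q\<close> of degree at most
  \<open>n\<close> (\<open>radon_disk_polynomial\<close>). The orthogonality of \<open>Lhat\<close> then shows that different disk polynomials
  are orthogonal and that the squared norm is read off from the top coefficient of \<open>q\<close>; this
  coefficient is a Beta integral and yields exactly \<open>(\<sigma>\<^sub>n\<^sub>,\<^sub>k)\<^sup>2\<close> for \<open>l = n - 2 k\<close>, \<open>k \<le> n\<close>, and \<open>0\<close> for
  every other \<open>l\<close> (\<open>disk_polynomial_inner\<close>).

  For a symmetric tensor of order \<open>m\<close> only the values \<open>f (v, \<dots>, v)\<close> matter. They are sums over \<open>r \<le> m\<close>
  of \<open>g\<^sub>r v ^ (m - r) * cnj v ^ r\<close> with arbitrary square-integrable functions \<open>g\<^sub>r\<close>. On the circle the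
  factor is a power of \<open>v\<close>, so it only shifts the frequency by \<open>m - 2 r\<close>. Hence the coefficient of
  \<open>u = I\<^sub>m d\<^sup>\<gamma> f\<close> at \<open>(n, l)\<close> is a sum of at most \<open>m + 1\<close> numbers \<open>\<sigma> * b\<close>, where \<open>b\<close> is a coefficient of \<open>g\<^sub>r\<close>
  and \<open>\<sigma>\<close> the singular value at the frequency \<open>l - (m - 2 r)\<close>. Three facts now give the theorem
  (\<open>xray_range_iff\<close>). A frequency \<open>l\<close> with \<open>\<bar>l\<bar> > n + m\<close> is never reached, which is condition (a).
  Singular values with the same \<open>n\<close> at frequencies a bounded distance apart are comparable uniformly
  in \<open>n\<close> (\<open>singular_value_compare\<close>), so by Bessel's inequality the coefficients divided by any nearby
  singular value are square summable. Conversely, if they are, each coefficient can be assigned to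
  one single \<open>r\<close> whose shifted frequency is admissible; the theorem of Riesz and Fischer produces
  the functions \<open>g\<^sub>r\<close>, and equality of all coefficients forces equality almost everywhere. For
  \<open>\<bar>l\<bar> \<le> n\<close> the nearby singular value may be taken as the one in condition (c). For \<open>n < \<bar>l\<bar> \<le> n + m\<close>
  it is \<open>\<sigma>\<^sub>n\<^sub>,\<^sub>0\<close>, whose square decays like \<open>(n + 1) powr (- (1 + \<gamma>))\<close> by the asymptotics of the Gamma
  function, and this is the weight of condition (b).
\<close>

section \<open>Square-integrable functions\<close>

lemma borel_measurable_cnj [measurable]: "cnj \<in> borel \<rightarrow>\<^sub>M borel"
  by (intro borel_measurable_continuous_onI continuous_intros)

lemma L2_measurable: "u \<in> L2 M \<Longrightarrow> u \<in> borel_measurable M"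
  by (simp add: L2_def)

lemma L2_integrable_sq: "u \<in> L2 M \<Longrightarrow> integrable M (\<lambda>x. (cmod (u x))\<^sup>2)"
  by (simp add: L2_def)

lemma L2_I:
  assumes "u \<in> borel_measurable M" "integrable M (\<lambda>x. (cmod (u x))\<^sup>2)"
  shows "u \<in> L2 M"
  using assms by (simp add: L2_def)

lemma L2_bound:
  assumes [measurable]: "u \<in> borel_measurable M" and "integrable M g"
    and "AE x in M. (cmod (u x))\<^sup>2 \<le> g x"
  shows "u \<in> L2 M"
proof (rule L2_I)
  show "integrable M (\<lambda>x. (cmod (u x))\<^sup>2)"
    by (rule Bochner_Integration.integrable_bound[OF assms(2)]) (use assms(3) in auto)
qed fact

lemma L2_add:
  assumes "u \<in> L2 M" "v \<in> L2 M"
  shows "(\<lambda>x. u x + v x) \<in> L2 M"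
proof (rule L2_bound[where g = "\<lambda>x. 2 * (cmod (u x))\<^sup>2 + 2 * (cmod (v x))\<^sup>2"])
  have "(cmod (a + b))\<^sup>2 \<le> 2 * (cmod a)\<^sup>2 + 2 * (cmod b)\<^sup>2" for a b
  proof -
    have "(cmod (a + b))\<^sup>2 \<le> (cmod a + cmod b)\<^sup>2"
      by (intro power_mono norm_triangle_ineq) auto
    also have "\<dots> \<le> 2 * (cmod a)\<^sup>2 + 2 * (cmod b)\<^sup>2"
      using sum_squares_bound[of "cmod a" "cmod b"] by (simp add: power2_sum)
    finally show ?thesis .
  qed
  then show "AE x in M. (cmod (u x + v x))\<^sup>2 \<le> 2 * (cmod (u x))\<^sup>2 + 2 * (cmod (v x))\<^sup>2"
    by simp
qed (use L2_integrable_sq[OF assms(1)] L2_integrable_sq[OF assms(2)]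
    L2_measurable[OF assms(1)] L2_measurable[OF assms(2)] in simp_all)

lemma L2_scale: "u \<in> L2 M \<Longrightarrow> (\<lambda>x. c * u x) \<in> L2 M"
  by (auto simp: L2_def norm_mult power_mult_distrib)

lemma L2_diff: "u \<in> L2 M \<Longrightarrow> v \<in> L2 M \<Longrightarrow> (\<lambda>x. u x - v x) \<in> L2 M"
  using L2_add[of u M "\<lambda>x. -1 * v x"] L2_scale[of v M "-1"] by simp

lemma L2_zero: "(\<lambda>_. 0) \<in> L2 M"
  by (simp add: L2_def)

lemma L2_sum: "(\<And>i. i \<in> I \<Longrightarrow> F i \<in> L2 M) \<Longrightarrow> (\<lambda>x. \<Sum>i\<in>I. F i x) \<in> L2 M"
  by (induction I rule: infinite_finite_induct) (auto intro: L2_zero L2_add)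

lemma integrable_inner:
  assumes "u \<in> L2 M" "v \<in> L2 M"
  shows "integrable M (\<lambda>x. u x * cnj (v x))"
proof (rule Bochner_Integration.integrable_bound)
  show "integrable M (\<lambda>x. (cmod (u x))\<^sup>2 + (cmod (v x))\<^sup>2)"
    using assms by (intro Bochner_Integration.integrable_add L2_integrable_sq)
  show "(\<lambda>x. u x * cnj (v x)) \<in> borel_measurable M"
    using assms[THEN L2_measurable] by measurable
  have "cmod (a * cnj b) \<le> (cmod a)\<^sup>2 + (cmod b)\<^sup>2" for a b
  proof -
    have "0 \<le> cmod a * cmod b" by simp
    then show ?thesis
      using sum_squares_bound[of "cmod a" "cmod b"] unfolding norm_mult complex_mod_cnj by linarith
  qed
  then show "AE x in M. cmod (u x * cnj (v x)) \<le> norm ((cmod (u x))\<^sup>2 + (cmod (v x))\<^sup>2)"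
    by (auto intro: order_trans)
qed

lemma l2_inner_add: "u \<in> L2 M \<Longrightarrow> v \<in> L2 M \<Longrightarrow> g \<in> L2 M \<Longrightarrow>
   l2_inner M (\<lambda>x. u x + v x) g = l2_inner M u g + l2_inner M v g"
  by (simp add: l2_inner_def distrib_right integrable_inner)

lemma l2_inner_diff: "u \<in> L2 M \<Longrightarrow> v \<in> L2 M \<Longrightarrow> g \<in> L2 M \<Longrightarrow>
   l2_inner M (\<lambda>x. u x - v x) g = l2_inner M u g - l2_inner M v g"
  by (simp add: l2_inner_def left_diff_distrib integrable_inner)

lemma l2_inner_scale: "l2_inner M (\<lambda>x. c * u x) g = c * l2_inner M u g"
  by (simp add: l2_inner_def mult.assoc)

lemma l2_inner_sum:
  assumes "\<And>i. i \<in> I \<Longrightarrow> F i \<in> L2 M" "g \<in> L2 M"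
  shows "l2_inner M (\<lambda>x. \<Sum>i\<in>I. F i x) g = (\<Sum>i\<in>I. l2_inner M (F i) g)"
  using assms
  by (simp add: l2_inner_def sum_distrib_right Bochner_Integration.integral_sum integrable_inner)

lemma l2_inner_cnj: "l2_inner M v u = cnj (l2_inner M u v)"
  unfolding l2_inner_def
  by (subst Bochner_Integration.integral_cnj[symmetric]) (simp add: mult.commute)

lemma l2_inner_cong_AE:
  assumes "u \<in> borel_measurable M" "v \<in> borel_measurable M" "g \<in> borel_measurable M"
    and "AE x in M. u x = v x"
  shows "l2_inner M u g = l2_inner M v g"
proof -
  note [measurable] = assms(1-3)
  have "AE x in M. u x * cnj (g x) = v x * cnj (g x)" using assms(4) by eventually_elim simp
  then show ?thesis unfolding l2_inner_def by (intro integral_cong_AE) measurable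
qed

lemma l2_inner_self: "l2_inner M u u = complex_of_real (\<integral>x. (cmod (u x))\<^sup>2 \<partial>M)"
  unfolding l2_inner_def integral_complex_of_real[symmetric]
  by (simp only: complex_norm_square)

lemma l2_norm_sq: "(l2_norm M u)\<^sup>2 = (\<integral>x. (cmod (u x))\<^sup>2 \<partial>M)"
  by (simp add: l2_norm_def)

lemma l2_norm_nonneg: "l2_norm M u \<ge> 0"
  by (simp add: l2_norm_def)

lemma l2_Cauchy_Schwarz:
  assumes "u \<in> L2 M" "v \<in> L2 M"
  shows "cmod (l2_inner M u v) \<le> l2_norm M u * l2_norm M v"
proof -
  have [measurable]: "u \<in> borel_measurable M" "v \<in> borel_measurable M"
    using assms by (auto dest: L2_measurable)
  have i: "integrable M (\<lambda>x. cmod (u x) * cmod (v x))"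
    using integrable_norm[OF integrable_inner[OF assms]] by (simp add: norm_mult)
  have "cmod (l2_inner M u v) \<le> (\<integral>x. cmod (u x) * cmod (v x) \<partial>M)"
    unfolding l2_inner_def by (rule order_trans[OF integral_norm_bound]) (simp add: norm_mult)
  also have "\<dots> \<le> l2_norm M u * l2_norm M v"
  proof (rule power2_le_imp_le)
    have "ennreal ((\<integral>x. cmod (u x) * cmod (v x) \<partial>M)\<^sup>2) =
        (\<integral>\<^sup>+x. ennreal (cmod (u x)) * ennreal (cmod (v x)) \<partial>M)\<^sup>2"
      by (simp add: nn_integral_eq_integral[OF i, simplified] ennreal_mult[symmetric] ennreal_power)
    also have "\<dots> \<le> (\<integral>\<^sup>+x. (ennreal (cmod (u x)))\<^sup>2 \<partial>M) * (\<integral>\<^sup>+x. (ennreal (cmod (v x)))\<^sup>2 \<partial>M)"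
      by (rule Cauchy_Schwarz_nn_integral) auto
    also have "\<dots> = ennreal ((l2_norm M u * l2_norm M v)\<^sup>2)"
      by (simp add: ennreal_power power_mult_distrib l2_norm_sq ennreal_mult
          nn_integral_eq_integral[OF L2_integrable_sq[OF assms(1)], simplified]
          nn_integral_eq_integral[OF L2_integrable_sq[OF assms(2)], simplified])
    finally show "(\<integral>x. cmod (u x) * cmod (v x) \<partial>M)\<^sup>2 \<le> (l2_norm M u * l2_norm M v)\<^sup>2"
      by (simp add: ennreal_le_iff)
  qed (auto intro: l2_norm_nonneg mult_nonneg_nonneg)
  finally show ?thesis .
qed

text \<open>
  This is the Riesz-Fischer completeness theorem, in the form needed for orthogonal series: a
  subsequence with geometrically decreasing distances converges almost everywhere, and Fatou's
  lemma transfers the Cauchy bound to its limit.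
\<close>

lemma L2_complete:
  assumes s: "\<And>n. s n \<in> L2 M"
    and Cauchy: "\<And>e. e > 0 \<Longrightarrow> \<exists>N. \<forall>i\<ge>N. \<forall>j\<ge>N. l2_norm M (\<lambda>x. s i x - s j x) < e"
  shows "\<exists>u\<in>L2 M. (\<lambda>N. l2_norm M (\<lambda>x. u x - s N x)) \<longlonglongrightarrow> 0"
proof -
  have [measurable]: "s n \<in> borel_measurable M" for n
    using s by (rule L2_measurable)
  have "\<exists>r. \<forall>n. (\<forall>i\<ge>r n. \<forall>j\<ge>r n. l2_norm M (\<lambda>x. s i x - s j x) < (1/2)^n) \<and> r n < r (Suc n)"
  proof (intro dependent_nat_choice, goal_cases)
    case 1
    show ?case using Cauchy[of "(1/2)^0"] by simp
  next
    case (2 x n)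
    obtain N where *: "\<forall>i\<ge>N. \<forall>j\<ge>N. l2_norm M (\<lambda>x. s i x - s j x) < (1/2)^Suc n"
      using Cauchy[of "(1/2)^Suc n"] by auto
    show ?case by (rule exI[of _ "max N (Suc x)"]) (use * in auto)
  qed
  then obtain r where r: "\<And>n i j. i \<ge> r n \<Longrightarrow> j \<ge> r n \<Longrightarrow> l2_norm M (\<lambda>x. s i x - s j x) < (1/2)^n"
    and mono: "strict_mono r"
    unfolding strict_mono_Suc_iff by blast
  define d where "d k x = s (r (Suc k)) x - s (r k) x" for k x
  have [measurable]: "d k \<in> borel_measurable M" for k
    unfolding d_def by measurable
  (* The factor 2^k is affordable because the distances decrease like 2^(-k). It makes
     finiteness of the sum below yield a geometric bound for d k x. *)
  have d_le: "(\<integral>\<^sup>+x. ennreal (2^k * (cmod (d k x))\<^sup>2) \<partial>M) \<le> ennreal ((1/2)^k)" for k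
  proof -
    have L: "d k \<in> L2 M" unfolding d_def by (intro L2_diff s)
    have "(\<integral>\<^sup>+x. ennreal (2^k * (cmod (d k x))\<^sup>2) \<partial>M) = ennreal (2^k * (l2_norm M (d k))\<^sup>2)"
      unfolding l2_norm_sq using L2_integrable_sq[OF L]
      by (subst nn_integral_eq_integral) auto
    also have "(l2_norm M (d k))\<^sup>2 \<le> ((1/2)^k)\<^sup>2"
      unfolding d_def
      by (intro power_mono l2_norm_nonneg less_imp_le[OF r])
         (use strict_mono_leD[OF mono, of k "Suc k"] in auto)
    then have "2^k * (l2_norm M (d k))\<^sup>2 \<le> 2^k * ((1/2)^k)\<^sup>2"
      by (intro mult_left_mono) auto
    also have "\<dots> = (1/2)^k"
      by (simp add: power2_eq_square power_one_over field_simps)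
    finally show ?thesis using ennreal_leI by blast
  qed
  have "(\<integral>\<^sup>+x. (\<Sum>k. ennreal (2^k * (cmod (d k x))\<^sup>2)) \<partial>M) =
      (\<Sum>k. \<integral>\<^sup>+x. ennreal (2^k * (cmod (d k x))\<^sup>2) \<partial>M)"
    by (intro nn_integral_suminf) measurable
  also have "\<dots> \<le> (\<Sum>k. ennreal ((1/2)^k))"
    by (intro suminf_le d_le) auto
  also have "\<dots> < \<infinity>"
    by (subst suminf_ennreal2) (auto intro: summable_geometric)
  finally have "AE x in M. (\<Sum>k. ennreal (2^k * (cmod (d k x))\<^sup>2)) \<noteq> \<infinity>"
    by (intro nn_integral_PInf_AE) (auto simp: less_top)
  then have conv: "AE x in M. convergent (\<lambda>i. s (r i) x)"
  proof (rule AE_mp, intro AE_I2 impI)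
    fix x assume "(\<Sum>k. ennreal (2^k * (cmod (d k x))\<^sup>2)) \<noteq> \<infinity>"
    then have "summable (\<lambda>k. 2^k * (cmod (d k x))\<^sup>2)"
      by (intro summable_suminf_not_top) auto
    then have "Bseq (\<lambda>k. 2^k * (cmod (d k x))\<^sup>2)"
      using summable_LIMSEQ_zero convergentI convergent_imp_Bseq by blast
    then obtain K where K: "\<And>k. \<bar>2^k * (cmod (d k x))\<^sup>2\<bar> \<le> K" "K > 0"
      unfolding Bseq_def by auto
    have "cmod (d k x) \<le> sqrt K * (1 / sqrt 2)^k" for k
    proof (rule power2_le_imp_le)
      have "(cmod (d k x))\<^sup>2 \<le> K / 2^k"
        using K(1)[of k] by (simp add: field_simps)
      also have "\<dots> = (sqrt K * (1 / sqrt 2)^k)\<^sup>2"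
        using K(2) by (simp add: power_mult_distrib power_divide real_sqrt_power[symmetric])
      finally show "(cmod (d k x))\<^sup>2 \<le> (sqrt K * (1 / sqrt 2)^k)\<^sup>2" .
    qed (use K in auto)
    moreover have "summable (\<lambda>k. sqrt K * (1 / sqrt 2)^k)"
      by (intro summable_mult summable_geometric) simp
    ultimately have "summable (\<lambda>k. d k x)"
      by (rule summable_comparison_test'[rotated])
    then have "convergent (\<lambda>n. \<Sum>k<n. d k x)"
      by (simp add: summable_iff_convergent)
    moreover have "(\<Sum>k<n. d k x) = s (r n) x - s (r 0) x" for n
      unfolding d_def by (rule sum_lessThan_telescope)
    ultimately have "convergent (\<lambda>n. s (r n) x - s (r 0) x)" by simp
    then show "convergent (\<lambda>n. s (r n) x)"
      by (simp add: convergent_diff_const_right_iff)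
  qed
  (* Where the subsequence diverges, lim is an arbitrary value; this happens on a null set. *)
  define u where "u x = lim (\<lambda>i. s (r i) x)" for x
  have [measurable]: "u \<in> borel_measurable M"
    unfolding u_def by (rule borel_measurable_lim_metric) measurable
  have lim: "AE x in M. (\<lambda>i. s (r i) x) \<longlonglongrightarrow> u x"
    using conv by eventually_elim (simp add: u_def convergent_LIMSEQ_iff)
  have *: "(\<integral>\<^sup>+x. ennreal ((cmod (u x - s N x))\<^sup>2) \<partial>M) \<le> ennreal (((1/2)^n)\<^sup>2)" if "N \<ge> r n" for n N
  proof -
    have "(\<integral>\<^sup>+x. ennreal ((cmod (u x - s N x))\<^sup>2) \<partial>M)
      = (\<integral>\<^sup>+x. liminf (\<lambda>i. ennreal ((cmod (s (r i) x - s N x))\<^sup>2)) \<partial>M)"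
    proof (rule nn_integral_cong_AE, use lim in eventually_elim)
      case (elim x)
      have "(\<lambda>i. ennreal ((cmod (s (r i) x - s N x))\<^sup>2)) \<longlonglongrightarrow> ennreal ((cmod (u x - s N x))\<^sup>2)"
        by (intro tendsto_intros elim tendsto_ennrealI)
      from lim_imp_Liminf[OF _ this] show ?case by simp
    qed
    also have "\<dots> \<le> liminf (\<lambda>i. \<integral>\<^sup>+x. ennreal ((cmod (s (r i) x - s N x))\<^sup>2) \<partial>M)"
      by (rule nn_integral_liminf) measurable
    also have "\<dots> \<le> liminf (\<lambda>i::nat. ennreal (((1/2)^n)\<^sup>2))"
    proof (rule Liminf_mono, rule eventually_sequentiallyI)
      fix i assume "i \<ge> n"
      then have "r i \<ge> r n" using strict_mono_leD[OF mono] by auto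
      then have "l2_norm M (\<lambda>x. s (r i) x - s N x) < (1/2)^n" using that by (rule r)
      then have "(l2_norm M (\<lambda>x. s (r i) x - s N x))\<^sup>2 \<le> ((1/2)^n)\<^sup>2"
        by (intro power_mono l2_norm_nonneg) auto
      then show "(\<integral>\<^sup>+x. ennreal ((cmod (s (r i) x - s N x))\<^sup>2) \<partial>M) \<le> ennreal (((1/2)^n)\<^sup>2)"
        unfolding l2_norm_sq
        by (subst nn_integral_eq_integral) (auto intro!: L2_integrable_sq L2_diff s ennreal_leI)
    qed
    finally show ?thesis by (simp add: Liminf_const)
  qed
  have L: "(\<lambda>x. u x - s N x) \<in> L2 M" if "N \<ge> r n" for n N
    by (rule L2_I) (use *[OF that] in \<open>auto simp: integrable_iff_bounded intro: le_less_trans\<close>)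
  have "u \<in> L2 M"
    using L2_add[OF L[of 0 "r 0"] s[of "r 0"]] by simp
  moreover have "(\<lambda>N. l2_norm M (\<lambda>x. u x - s N x)) \<longlonglongrightarrow> 0"
  proof (rule LIMSEQ_I)
    fix e :: real assume "e > 0"
    then obtain n where n: "(1/2)^n < e"
      using real_arch_pow_inv[of e "1/2"] by auto
    have "l2_norm M (\<lambda>x. u x - s N x) < e" if "N \<ge> r n" for N
    proof -
      have "(l2_norm M (\<lambda>x. u x - s N x))\<^sup>2 \<le> ((1/2)^n)\<^sup>2"
        unfolding l2_norm_sq using *[OF that]
        by (subst (asm) nn_integral_eq_integral) (auto intro: L2_integrable_sq L[OF that])
      then have "l2_norm M (\<lambda>x. u x - s N x) \<le> (1/2)^n"
        by (rule power2_le_imp_le) simp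
      then show ?thesis using n by simp
    qed
    then show "\<exists>no. \<forall>N\<ge>no. norm (l2_norm M (\<lambda>x. u x - s N x) - 0) < e"
      by (auto simp: l2_norm_nonneg)
  qed
  ultimately show ?thesis by blast
qed

lemma l2_sums_inner:
  assumes "l2_sums M F u" "g \<in> L2 M"
  shows "(\<lambda>n. l2_inner M (F n) g) sums l2_inner M u g"
proof -
  have u: "u \<in> L2 M" and F: "\<And>n. F n \<in> L2 M"
    and lim: "(\<lambda>N. l2_norm M (\<lambda>x. u x - (\<Sum>n<N. F n x))) \<longlonglongrightarrow> 0"
    using assms by (auto simp: l2_sums_def)
  have "(\<lambda>N. l2_inner M u g - (\<Sum>n<N. l2_inner M (F n) g)) \<longlonglongrightarrow> 0"
  proof (rule Lim_null_comparison)
    show "(\<lambda>N. l2_norm M (\<lambda>x. u x - (\<Sum>n<N. F n x)) * l2_norm M g) \<longlonglongrightarrow> 0"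
      using tendsto_mult_right[OF lim, of "l2_norm M g"] by simp
    have "cmod (l2_inner M u g - (\<Sum>n<N. l2_inner M (F n) g))
        \<le> l2_norm M (\<lambda>x. u x - (\<Sum>n<N. F n x)) * l2_norm M g" for N
      using l2_Cauchy_Schwarz[OF L2_diff[OF u L2_sum[of "{..<N}" F]] assms(2)] F
      by (simp add: l2_inner_diff l2_inner_sum L2_sum u assms(2))
    then show "\<forall>\<^sub>F N in sequentially. cmod (l2_inner M u g - (\<Sum>n<N. l2_inner M (F n) g))
        \<le> l2_norm M (\<lambda>x. u x - (\<Sum>n<N. F n x)) * l2_norm M g"
      by simp
  qed
  then have "(\<lambda>N. l2_inner M u g - (l2_inner M u g - (\<Sum>n<N. l2_inner M (F n) g)))
      \<longlonglongrightarrow> l2_inner M u g - 0"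
    by (intro tendsto_intros)
  then show ?thesis by (simp add: sums_def)
qed

lemma l2_sums_cong_AE:
  assumes "l2_sums M F v" "u \<in> L2 M" "AE x in M. v x = u x"
  shows "l2_sums M F u"
proof -
  have F: "\<And>n. F n \<in> L2 M" and v: "v \<in> L2 M" using assms(1) by (auto simp: l2_sums_def)
  note [measurable] = L2_measurable[OF F] L2_measurable[OF v] L2_measurable[OF assms(2)]
  have "l2_norm M (\<lambda>x. v x - (\<Sum>n<N. F n x)) = l2_norm M (\<lambda>x. u x - (\<Sum>n<N. F n x))" for N
    unfolding l2_norm_def
    by (intro arg_cong[where f = sqrt] integral_cong_AE) (use assms(3) in auto)
  then show ?thesis using assms by (simp add: l2_sums_def)
qed

lemma lin_span_L2: "B \<subseteq> L2 M \<Longrightarrow> v \<in> lin_span B \<Longrightarrow> v \<in> L2 M"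
  unfolding lin_span_def by (auto intro!: L2_sum L2_scale)

lemma closed_span_L2: "v \<in> closed_span M B \<Longrightarrow> v \<in> L2 M"
  by (simp add: closed_span_def)

text \<open>
  Orthogonality to \<open>B\<close> passes to limits because the inner product is continuous, by the
  Cauchy-Schwarz inequality.
\<close>

lemma closed_span_orthogonal:
  assumes v: "v \<in> closed_span M B" and B: "B \<subseteq> L2 M" and g: "g \<in> L2 M"
    and orth: "\<And>b. b \<in> B \<Longrightarrow> l2_inner M b g = 0"
  shows "l2_inner M v g = 0"
proof -
  have "cmod (l2_inner M v g) \<le> e" if "e > 0" for e
  proof -
    (* The summand 1 keeps the quotient defined when g has norm 0. *)
    define d where "d = e / (l2_norm M g + 1)"
    have "d > 0" using that l2_norm_nonneg[of M g] by (simp add: d_def)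
    then obtain w where w: "w \<in> lin_span B" "l2_norm M (\<lambda>x. v x - w x) < d"
      using v by (auto simp: closed_span_def)
    obtain F c where F: "w = (\<lambda>x. \<Sum>b\<in>F. c b * b x)" "finite F" "F \<subseteq> B"
      using w(1) by (auto simp: lin_span_def)
    have wL: "w \<in> L2 M" using lin_span_L2[OF B w(1)] .
    have "l2_inner M w g = (\<Sum>b\<in>F. l2_inner M (\<lambda>x. c b * b x) g)"
      unfolding F(1) using F(3) B g by (intro l2_inner_sum L2_scale) auto
    also have "\<dots> = 0" using F(3) orth by (intro sum.neutral) (auto simp: l2_inner_scale)
    finally have "l2_inner M v g = l2_inner M (\<lambda>x. v x - w x) g"
      using closed_span_L2[OF v] wL g by (simp add: l2_inner_diff)
    also have "cmod \<dots> \<le> l2_norm M (\<lambda>x. v x - w x) * l2_norm M g"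
      using closed_span_L2[OF v] wL g by (intro l2_Cauchy_Schwarz L2_diff)
    also have "\<dots> \<le> d * (l2_norm M g + 1)"
      using w(2) l2_norm_nonneg[of M g] \<open>d > 0\<close> by (intro mult_mono) auto
    also have "\<dots> = e" using l2_norm_nonneg[of M g] by (simp add: d_def)
    finally show ?thesis .
  qed
  then show ?thesis
    by (metis field_le_epsilon add_0 norm_le_zero_iff)
qed

section \<open>Orthonormal families\<close>

locale orthonormal_on =
  fixes M :: "'a measure" and E :: "'i \<Rightarrow> 'a \<Rightarrow> complex" and J :: "'i set"
  assumes E_L2: "i \<in> J \<Longrightarrow> E i \<in> L2 M"
    and E_inner: "i \<in> J \<Longrightarrow> j \<in> J \<Longrightarrow> l2_inner M (E i) (E j) = (if i = j then 1 else 0)"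
begin

lemma E_inj: "inj_on E J"
proof (rule inj_onI, rule ccontr)
  fix i j assume "i \<in> J" "j \<in> J" "E i = E j" "i \<noteq> j"
  then show False using E_inner[of i j] E_inner[of j j] by simp
qed

lemma finite_combination_inner:
  assumes "finite F" "F \<subseteq> J" "j \<in> J"
  shows "l2_inner M (\<lambda>x. \<Sum>i\<in>F. a i * E i x) (E j) = (if j \<in> F then a j else 0)"
proof -
  have "l2_inner M (\<lambda>x. \<Sum>i\<in>F. a i * E i x) (E j) = (\<Sum>i\<in>F. l2_inner M (\<lambda>x. a i * E i x) (E j))"
    using assms by (intro l2_inner_sum L2_scale E_L2) auto
  also have "\<dots> = (\<Sum>i\<in>F. if i = j then a i else 0)"
    using assms by (intro sum.cong) (auto simp: l2_inner_scale E_inner)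
  finally show ?thesis using assms by simp
qed

lemma finite_combination_L2: "F \<subseteq> J \<Longrightarrow> (\<lambda>x. \<Sum>i\<in>F. a i * E i x) \<in> L2 M"
  by (intro L2_sum L2_scale E_L2) auto

lemma finite_combination_norm:
  assumes "finite F" "F \<subseteq> J"
  shows "(l2_norm M (\<lambda>x. \<Sum>i\<in>F. a i * E i x))\<^sup>2 = (\<Sum>i\<in>F. (cmod (a i))\<^sup>2)"
proof -
  let ?s = "\<lambda>x. \<Sum>i\<in>F. a i * E i x"
  have "complex_of_real ((l2_norm M ?s)\<^sup>2) = l2_inner M ?s ?s"
    by (simp add: l2_inner_self l2_norm_sq)
  also have "\<dots> = (\<Sum>i\<in>F. a i * l2_inner M (E i) ?s)"
    using assms finite_combination_L2 by (subst l2_inner_sum) (auto simp: l2_inner_scale intro!: L2_scale E_L2)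
  also have "\<dots> = (\<Sum>i\<in>F. a i * cnj (a i))"
    using assms by (intro sum.cong refl, subst l2_inner_cnj, subst finite_combination_inner) auto
  also have "\<dots> = complex_of_real (\<Sum>i\<in>F. (cmod (a i))\<^sup>2)"
    by (simp add: complex_norm_square[symmetric])
  finally show ?thesis by (simp only: of_real_eq_iff)
qed

text \<open>
  The norm of the difference between \<open>u\<close> and a finite partial sum of its expansion is nonnegative;
  its square is the norm of \<open>u\<close> squared minus the sum of the squared coefficients.
\<close>

lemma Bessel:
  assumes u: "u \<in> L2 M"
  shows "(\<lambda>i. (cmod (l2_inner M u (E i)))\<^sup>2) summable_on J"
proof (rule nonneg_bdd_above_summable_on)
  have "(\<Sum>i\<in>F. (cmod (l2_inner M u (E i)))\<^sup>2) \<le> (l2_norm M u)\<^sup>2" if "F \<subseteq> J" "finite F" for F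
  proof -
    define a where "a i = l2_inner M u (E i)" for i
    define s where "s x = (\<Sum>i\<in>F. a i * E i x)" for x
    have sL: "s \<in> L2 M" unfolding s_def[abs_def] by (rule finite_combination_L2) fact
    have 1: "l2_inner M s u = complex_of_real (\<Sum>i\<in>F. (cmod (a i))\<^sup>2)"
    proof -
      have "l2_inner M s u = (\<Sum>i\<in>F. a i * l2_inner M (E i) u)"
        unfolding s_def[abs_def] using that u
        by (subst l2_inner_sum) (auto simp: l2_inner_scale intro!: L2_scale E_L2)
      also have "\<dots> = (\<Sum>i\<in>F. a i * cnj (a i))"
        by (intro sum.cong refl, subst l2_inner_cnj) (simp add: a_def)
      finally show ?thesis by (simp add: complex_norm_square[symmetric])
    qed
    have 2: "l2_inner M u s = complex_of_real (\<Sum>i\<in>F. (cmod (a i))\<^sup>2)"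
      using 1 by (subst l2_inner_cnj) simp
    have 3: "l2_inner M s s = complex_of_real (\<Sum>i\<in>F. (cmod (a i))\<^sup>2)"
      using finite_combination_norm[OF that(2,1), of a] unfolding s_def[abs_def, symmetric]
      by (simp add: l2_inner_self l2_norm_sq)
    have d: "(\<lambda>x. u x - s x) \<in> L2 M" using u sL by (rule L2_diff)
    have "l2_inner M (\<lambda>x. u x - s x) u = l2_inner M u u - l2_inner M s u"
      using u sL by (intro l2_inner_diff)
    moreover have "l2_inner M (\<lambda>x. u x - s x) s = 0"
      using u sL by (simp add: l2_inner_diff 2 3)
    moreover have "l2_inner M (\<lambda>x. u x - s x) (\<lambda>x. u x - s x)
        = l2_inner M (\<lambda>x. u x - s x) u - l2_inner M (\<lambda>x. u x - s x) s"
    proof -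
      have "l2_inner M (\<lambda>x. u x - s x) (\<lambda>x. u x - s x)
          = cnj (l2_inner M u (\<lambda>x. u x - s x) - l2_inner M s (\<lambda>x. u x - s x))"
        using u sL d by (subst l2_inner_cnj, subst l2_inner_diff[symmetric]) auto
      also have "\<dots> = l2_inner M (\<lambda>x. u x - s x) u - l2_inner M (\<lambda>x. u x - s x) s"
        unfolding complex_cnj_diff l2_inner_cnj[symmetric] ..
      finally show ?thesis .
    qed
    ultimately have "complex_of_real (\<integral>x. (cmod (u x - s x))\<^sup>2 \<partial>M)
        = complex_of_real ((l2_norm M u)\<^sup>2 - (\<Sum>i\<in>F. (cmod (a i))\<^sup>2))"
      by (simp add: l2_inner_self 1 l2_norm_sq)
    then have "(\<integral>x. (cmod (u x - s x))\<^sup>2 \<partial>M) = (l2_norm M u)\<^sup>2 - (\<Sum>i\<in>F. (cmod (a i))\<^sup>2)"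
      by (simp only: of_real_eq_iff)
    moreover have "(\<integral>x. (cmod (u x - s x))\<^sup>2 \<partial>M) \<ge> 0" by simp
    ultimately show ?thesis by (simp add: a_def)
  qed
  then show "bdd_above (sum (\<lambda>i. (cmod (l2_inner M u (E i)))\<^sup>2) ` {F. F \<subseteq> J \<and> finite F})"
    by (intro bdd_aboveI2) auto
qed auto

text \<open>
  Summation proceeds in finite blocks of indices, since the double series of the theorem are
  ordered by \<open>n\<close>.
\<close>

lemma Riesz_Fischer_sums:
  assumes fin: "\<And>n::nat. finite (I n)" and sub: "\<And>n. I n \<subseteq> J" and disj: "disjoint_family I"
    and summ: "summable (\<lambda>n. \<Sum>i\<in>I n. (cmod (a i))\<^sup>2)"
  shows "\<exists>u. l2_sums M (\<lambda>n x. \<Sum>i\<in>I n. a i * E i x) u"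
proof -
  define b where "b n = (\<Sum>i\<in>I n. (cmod (a i))\<^sup>2)" for n
  define s where "s N x = (\<Sum>n<N. \<Sum>i\<in>I n. a i * E i x)" for N x
  have sL: "s N \<in> L2 M" for N
    unfolding s_def[abs_def] by (intro L2_sum finite_combination_L2 sub)
  have tail: "(l2_norm M (\<lambda>x. s m x - s n x))\<^sup>2 = (\<Sum>k=n..<m. b k)" if "n \<le> m" for n m
  proof -
    have U: "finite (\<Union>k\<in>{n..<m}. I k)" "(\<Union>k\<in>{n..<m}. I k) \<subseteq> J" using fin sub by auto
    have un: "(\<Sum>i\<in>(\<Union>k\<in>{n..<m}. I k). g i) = (\<Sum>k=n..<m. \<Sum>i\<in>I k. g i)" for g :: "'i \<Rightarrow> 'b::comm_monoid_add"
      using fin disj by (intro sum.UNION_disjoint) (auto simp: disjoint_family_on_def)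
    have "s m x - s n x = (\<Sum>k=n..<m. \<Sum>i\<in>I k. a i * E i x)" for x
      unfolding s_def lessThan_atLeast0 using that by (subst sum_diff_nat_ivl) auto
    then have "(\<lambda>x. s m x - s n x) = (\<lambda>x. \<Sum>i\<in>(\<Union>k\<in>{n..<m}. I k). a i * E i x)"
      by (simp add: un)
    then show ?thesis unfolding b_def using finite_combination_norm[OF U] by (simp add: un)
  qed
  have sym: "l2_norm M (\<lambda>x. s m x - s n x) = l2_norm M (\<lambda>x. s n x - s m x)" for m n
    by (simp add: l2_norm_def norm_minus_commute)
  have "\<exists>u\<in>L2 M. (\<lambda>N. l2_norm M (\<lambda>x. u x - s N x)) \<longlonglongrightarrow> 0"
  proof (rule L2_complete[OF sL])
    fix e :: real assume "e > 0"
    then obtain N where N: "\<And>m n. m \<ge> N \<Longrightarrow> norm (\<Sum>k=m..<n. b k) < e\<^sup>2"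
      using summ[folded b_def] unfolding summable_Cauchy by (meson zero_less_power)
    have *: "l2_norm M (\<lambda>x. s i x - s j x) < e" if "i \<ge> j" "j \<ge> N" for i j
      by (rule power2_less_imp_less) (use tail[OF that(1)] N[OF that(2), of i] \<open>e > 0\<close> in auto)
    then show "\<exists>N. \<forall>i\<ge>N. \<forall>j\<ge>N. l2_norm M (\<lambda>x. s i x - s j x) < e"
      by (metis linorder_le_cases sym)
  qed
  then obtain u where "u \<in> L2 M" "(\<lambda>N. l2_norm M (\<lambda>x. u x - s N x)) \<longlonglongrightarrow> 0" by blast
  then show ?thesis
    unfolding l2_sums_def s_def using finite_combination_L2[OF sub] by blast
qed

lemma l2_sums_coeff:
  assumes "l2_sums M (\<lambda>n x. \<Sum>i\<in>I n. a i * E i x) u"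
    and "\<And>n::nat. finite (I n)" and "\<And>n. I n \<subseteq> J" and disj: "disjoint_family I" and "j \<in> J"
  shows "l2_inner M u (E j) = (if \<exists>n. j \<in> I n then a j else 0)"
proof -
  have "(\<lambda>n. if j \<in> I n then a j else 0) sums l2_inner M u (E j)"
    using l2_sums_inner[OF assms(1) E_L2[OF \<open>j \<in> J\<close>]] finite_combination_inner assms by simp
  moreover have "(\<lambda>n. if j \<in> I n then a j else 0) sums (if \<exists>n. j \<in> I n then a j else 0)"
  proof (cases "\<exists>n. j \<in> I n")
    case True
    then obtain n where n: "j \<in> I n" by blast
    then have "j \<in> I k \<longleftrightarrow> k = n" for k using disj by (auto simp: disjoint_family_on_def)
    then show ?thesis using sums_single[of n "\<lambda>_. a j"] by simp
  qed simp
  ultimately show ?thesis by (rule sums_unique2)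
qed

end

locale countable_orthonormal_on = orthonormal_on M E J
  for M :: "'a measure" and E :: "'i::countable \<Rightarrow> 'a \<Rightarrow> complex" and J
begin

text \<open>
  Square-summable coefficients supported in \<open>S\<close> are realized inside the closed span of the elements
  indexed by \<open>S\<close>. Besides producing functions with given coefficients, this supplies the orthogonal
  projections below.
\<close>

lemma Riesz_Fischer:
  assumes "(\<lambda>i. (cmod (a i))\<^sup>2) summable_on S" "S \<subseteq> J"
  shows "\<exists>u \<in> closed_span M (E ` S). \<forall>j\<in>J. l2_inner M u (E j) = (if j \<in> S then a j else 0)"
proof -
  (* An enumeration of the index type arranges S into blocks of at most one index each. *)
  define I where "I n = {i\<in>S. to_nat i = n}" for n
  have fin: "finite (I n)" for n
    by (rule finite_subset[of _ "{from_nat n}"]) (auto simp: I_def)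
  have sub: "I n \<subseteq> J" for n using assms by (auto simp: I_def)
  have disj: "disjoint_family I" by (auto simp: disjoint_family_on_def I_def)
  define h where "h n = (\<Sum>i\<in>I n. (cmod (a i))\<^sup>2)" for n
  have "summable h"
  proof (rule summableI_nonneg_bounded)
    show "0 \<le> h n" for n by (auto simp: h_def intro: sum_nonneg)
    fix N
    have "sum h {..<N} = (\<Sum>i\<in>(\<Union>n<N. I n). (cmod (a i))\<^sup>2)"
      unfolding h_def using fin disj
      by (subst sum.UNION_disjoint) (auto simp: disjoint_family_on_def)
    also have "\<dots> \<le> infsum (\<lambda>i. (cmod (a i))\<^sup>2) S"
      by (rule finite_sum_le_infsum[OF assms(1)]) (use fin in \<open>auto simp: I_def\<close>)
    finally show "sum h {..<N} \<le> infsum (\<lambda>i. (cmod (a i))\<^sup>2) S" .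
  qed
  then obtain u where u: "l2_sums M (\<lambda>n x. \<Sum>i\<in>I n. a i * E i x) u"
    using Riesz_Fischer_sums[OF fin sub disj] unfolding h_def by blast
  have "l2_inner M u (E j) = (if j \<in> S then a j else 0)" if "j \<in> J" for j
    using l2_sums_coeff[OF u fin sub disj that] by (simp add: I_def)
  moreover have "u \<in> closed_span M (E ` S)"
    unfolding closed_span_def
  proof (intro CollectI conjI allI impI)
    show "u \<in> L2 M" using u by (simp add: l2_sums_def)
    fix e :: real assume "e > 0"
    have "(\<lambda>N. l2_norm M (\<lambda>x. u x - (\<Sum>n<N. \<Sum>i\<in>I n. a i * E i x))) \<longlonglongrightarrow> 0"
      using u by (simp add: l2_sums_def)
    then obtain N where N: "l2_norm M (\<lambda>x. u x - (\<Sum>n<N. \<Sum>i\<in>I n. a i * E i x)) < e"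
      using \<open>e > 0\<close> order_tendstoD(2)[of _ 0 sequentially e] unfolding eventually_sequentially by blast
    define U where "U = (\<Union>n<N. I n)"
    have U: "finite U" "U \<subseteq> S" using fin by (auto simp: U_def I_def)
    have inj: "inj_on E S" using E_inj assms(2) by (rule inj_on_subset)
    have "(\<Sum>n<N. \<Sum>i\<in>I n. a i * E i x) = (\<Sum>i\<in>U. a i * E i x)" for x
      unfolding U_def using fin disj
      by (subst sum.UNION_disjoint) (auto simp: disjoint_family_on_def)
    also have "(\<Sum>i\<in>U. a i * E i x) = (\<Sum>b\<in>E ` U. a (inv_into S E b) * b x)" for x
      by (subst sum.reindex[OF inj_on_subset[OF inj U(2)]])
         (use U(2) in \<open>auto intro!: sum.cong simp: inv_into_f_f[OF inj]\<close>)
    finally have eq: "(\<lambda>x. \<Sum>n<N. \<Sum>i\<in>I n. a i * E i x) = (\<lambda>x. \<Sum>b\<in>E ` U. a (inv_into S E b) * b x)"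
      by blast
    have "(\<lambda>x. \<Sum>n<N. \<Sum>i\<in>I n. a i * E i x) \<in> lin_span (E ` S)"
      unfolding eq lin_span_def using U
      by (intro CollectI exI[of _ "E ` U"] exI[of _ "\<lambda>b. a (inv_into S E b)"]) auto
    moreover have "(\<lambda>x. \<Sum>n<N. \<Sum>i\<in>I n. a i * E i x) \<in> L2 M"
      by (intro L2_sum finite_combination_L2 sub)
    ultimately show "\<exists>v\<in>lin_span (E ` S) \<inter> L2 M. l2_norm M (\<lambda>x. u x - v x) < e"
      using N by (intro bexI[of _ "\<lambda>x. \<Sum>n<N. \<Sum>i\<in>I n. a i * E i x"]) auto
  qed
  ultimately show ?thesis by blast
qed

end

locale orthonormal_basis = countable_orthonormal_on M E UNIV
  for M :: "'a measure" and E :: "'i::countable \<Rightarrow> 'a \<Rightarrow> complex" +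
  assumes total: "u \<in> L2 M \<Longrightarrow> (\<And>i. l2_inner M u (E i) = 0) \<Longrightarrow> AE x in M. u x = 0"
begin

lemma basis_L2: "E i \<in> L2 M"
  by (rule E_L2) simp

lemma coeff_unique:
  assumes "u \<in> L2 M" "v \<in> L2 M" "\<And>i. l2_inner M u (E i) = l2_inner M v (E i)"
  shows "AE x in M. u x = v x"
proof -
  have "AE x in M. u x - v x = 0"
    by (rule total) (use assms basis_L2 in \<open>auto intro: L2_diff simp: l2_inner_diff\<close>)
  then show ?thesis by simp
qed

text \<open>
  Because the indices \<open>\<phi> n k\<close> are distinct, an expansion of \<open>u\<close> along them can only be the expansion
  by coefficients, and it exists as soon as the other coefficients of \<open>u\<close> vanish.
\<close>

lemma l2_sums_iff:
  fixes \<phi> :: "nat \<Rightarrow> 'k \<Rightarrow> 'i"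
  assumes fin: "\<And>n. finite (K n)"
    and inj: "\<And>n m k l. k \<in> K n \<Longrightarrow> l \<in> K m \<Longrightarrow> \<phi> n k = \<phi> m l \<Longrightarrow> n = m \<and> k = l"
    and u: "u \<in> L2 M"
  shows "l2_sums M (\<lambda>n x. \<Sum>k\<in>K n. a n k * E (\<phi> n k) x) u \<longleftrightarrow>
    (\<forall>n. \<forall>k\<in>K n. l2_inner M u (E (\<phi> n k)) = a n k) \<and>
    (\<forall>j. (\<forall>n. \<forall>k\<in>K n. \<phi> n k \<noteq> j) \<longrightarrow> l2_inner M u (E j) = 0)"
    (is "?L \<longleftrightarrow> ?R1 \<and> ?R2")
proof -
  define I where "I n = \<phi> n ` K n" for n
  have finI: "finite (I n)" for n using fin by (simp add: I_def)
  have injn: "inj_on (\<phi> n) (K n)" for n using inj by (intro inj_onI) blast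
  have disj: "disjoint_family I" using inj by (fastforce simp: disjoint_family_on_def I_def)
  have reindex: "(\<Sum>i\<in>I n. g i) = (\<Sum>k\<in>K n. g (\<phi> n k))" for n and g :: "'i \<Rightarrow> 'b::comm_monoid_add"
    unfolding I_def by (subst sum.reindex[OF injn]) simp
  (* The coefficients as a function of the index; by injectivity the description has a unique
     solution. *)
  define b where "b j = (if \<exists>n. j \<in> I n then (THE c. \<exists>n. \<exists>k\<in>K n. j = \<phi> n k \<and> c = a n k) else 0)" for j
  have b: "b (\<phi> n k) = a n k" if "k \<in> K n" for n k
  proof -
    have "(THE c. \<exists>n'. \<exists>k'\<in>K n'. \<phi> n k = \<phi> n' k' \<and> c = a n' k') = a n k"
      using inj that by (intro the_equality) blast+
    then show ?thesis using that by (auto simp: b_def I_def)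
  qed
  have F: "(\<lambda>n x. \<Sum>k\<in>K n. a n k * E (\<phi> n k) x) = (\<lambda>n x. \<Sum>i\<in>I n. b i * E i x)"
    unfolding reindex using b by (intro ext sum.cong) auto
  show ?thesis
  proof
    assume ?L
    then have "l2_inner M u (E j) = (if \<exists>n. j \<in> I n then b j else 0)" for j
      unfolding F by (rule l2_sums_coeff[OF _ finI _ disj]) auto
    then show "?R1 \<and> ?R2" using b by (auto simp: I_def)
  next
    assume R: "?R1 \<and> ?R2"
    have bj: "l2_inner M u (E j) = b j" for j
    proof (cases "\<exists>n. j \<in> I n")
      case True
      then show ?thesis using R b by (auto simp: I_def)
    next
      case False
      then have "b j = 0" "\<forall>n. \<forall>k\<in>K n. \<phi> n k \<noteq> j" by (auto simp: I_def b_def)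
      then show ?thesis using R by simp
    qed
    have bs: "(\<lambda>i. (cmod (b i))\<^sup>2) summable_on UNIV" using Bessel[OF u] by (simp add: bj)
    have "summable (\<lambda>n. \<Sum>i\<in>I n. (cmod (b i))\<^sup>2)"
    proof (rule summableI_nonneg_bounded)
      fix N
      have "(\<Sum>n<N. \<Sum>i\<in>I n. (cmod (b i))\<^sup>2) = (\<Sum>i\<in>(\<Union>n<N. I n). (cmod (b i))\<^sup>2)"
        using finI disj by (subst sum.UNION_disjoint) (auto simp: disjoint_family_on_def)
      also have "\<dots> \<le> infsum (\<lambda>i. (cmod (b i))\<^sup>2) UNIV"
        by (rule finite_sum_le_infsum[OF bs]) (use finI in auto)
      finally show "(\<Sum>n<N. \<Sum>i\<in>I n. (cmod (b i))\<^sup>2) \<le> infsum (\<lambda>i. (cmod (b i))\<^sup>2) UNIV" .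
    qed (auto intro: sum_nonneg)
    then obtain v where v: "l2_sums M (\<lambda>n x. \<Sum>i\<in>I n. b i * E i x) v"
      using Riesz_Fischer_sums[of I b] finI disj by blast
    have "AE x in M. v x = u x"
    proof (rule coeff_unique[OF _ u])
      show "v \<in> L2 M" using v by (simp add: l2_sums_def)
      show "l2_inner M v (E j) = l2_inner M u (E j)" for j
        using l2_sums_coeff[OF v finI _ disj, of j] by (auto simp: bj b_def)
    qed
    from l2_sums_cong_AE[OF v u this] show ?L unfolding F .
  qed
qed

text \<open>
  The choice of a representative in \<open>orth_proj\<close> is harmless: some projection exists by
  Riesz-Fischer, and every projection has the coefficients stated here.
\<close>

lemma orth_proj_coeff:
  fixes S :: "'i set"
  assumes u: "u \<in> L2 M"
  defines "P \<equiv> orth_proj M (closed_span M (E ` S)) u"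
  shows "P \<in> L2 M" and "l2_inner M P (E j) = (if j \<in> S then l2_inner M u (E j) else 0)"
proof -
  let ?V = "closed_span M (E ` S)"
  have EL2': "E ` S \<subseteq> L2 M" using basis_L2 by auto
  have off: "l2_inner M v (E j) = 0" if "v \<in> ?V" "j \<notin> S" for v j
    by (rule closed_span_orthogonal[OF that(1) EL2' basis_L2]) (use that(2) E_inner in auto)
  have EV: "E i \<in> ?V" if "i \<in> S" for i
    unfolding closed_span_def
  proof (intro CollectI conjI allI impI basis_L2)
    fix e :: real assume "e > 0"
    have "E i \<in> lin_span (E ` S)"
      unfolding lin_span_def using that
      by (intro CollectI exI[of _ "{E i}"] exI[of _ "\<lambda>_. 1"]) auto
    then show "\<exists>v\<in>lin_span (E ` S) \<inter> L2 M. l2_norm M (\<lambda>x. E i x - v x) < e"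
      using \<open>e > 0\<close> basis_L2 by (intro bexI[of _ "E i"]) (auto simp: l2_norm_def)
  qed
  have "(\<lambda>i. (cmod (l2_inner M u (E i)))\<^sup>2) summable_on S"
    using Bessel[OF u] by (rule summable_on_subset_banach) simp
  then obtain v where v: "v \<in> ?V" "\<And>j. l2_inner M v (E j) = (if j \<in> S then l2_inner M u (E j) else 0)"
    using Riesz_Fischer[of "\<lambda>i. l2_inner M u (E i)" S] by auto
  have orth: "l2_inner M (\<lambda>x. u x - v x) w = 0" if "w \<in> ?V" for w
  proof -
    have d: "(\<lambda>x. u x - v x) \<in> L2 M" using u closed_span_L2[OF v(1)] by (rule L2_diff)
    have "l2_inner M w (\<lambda>x. u x - v x) = 0"
    proof (rule closed_span_orthogonal[OF that EL2' d])
      fix b assume "b \<in> E ` S"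
      then obtain i where i: "i \<in> S" "b = E i" by blast
      have "l2_inner M (\<lambda>x. u x - v x) (E i) = 0"
        using u closed_span_L2[OF v(1)] basis_L2 v(2)[of i] i by (simp add: l2_inner_diff)
      then show "l2_inner M b (\<lambda>x. u x - v x) = 0"
        unfolding i by (subst l2_inner_cnj) simp
    qed
    then show ?thesis by (subst l2_inner_cnj) simp
  qed
  have "P \<in> ?V \<and> (\<forall>w\<in>?V. l2_inner M (\<lambda>x. u x - P x) w = 0)"
    unfolding P_def orth_proj_def by (rule someI[where x = v]) (use v(1) orth in simp)
  then have P: "P \<in> ?V" "\<And>w. w \<in> ?V \<Longrightarrow> l2_inner M (\<lambda>x. u x - P x) w = 0" by auto
  then show PL: "P \<in> L2 M" by (auto intro: closed_span_L2)
  show "l2_inner M P (E j) = (if j \<in> S then l2_inner M u (E j) else 0)"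
  proof (cases "j \<in> S")
    case True
    then show ?thesis using P(2)[OF EV[OF True]] u PL basis_L2 by (simp add: l2_inner_diff)
  qed (use off P in auto)
qed

text \<open>
  With these characterizations, membership in a sequence space becomes a condition on coefficients
  only.
\<close>

lemma h_space_iff:
  fixes \<phi> :: "nat \<Rightarrow> 'i"
  assumes "inj \<phi>"
  shows "u \<in> h_space M s (\<lambda>n. E (\<phi> n)) \<longleftrightarrow> u \<in> L2 M \<and>
    summable (\<lambda>n. (real n + 1) powr (2 * s) * (cmod (l2_inner M u (E (\<phi> n))))\<^sup>2) \<and>
    (\<forall>j. j \<notin> range \<phi> \<longrightarrow> l2_inner M u (E j) = 0)"
proof (cases "u \<in> L2 M")
  case True
  have "l2_sums M (\<lambda>n x. \<Sum>k\<in>{()}. a n * E (\<phi> n) x) u \<longleftrightarrow>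
    (\<forall>n. \<forall>k\<in>{()}. l2_inner M u (E (\<phi> n)) = a n) \<and>
    (\<forall>j. (\<forall>n. \<forall>k\<in>{()}. \<phi> n \<noteq> j) \<longrightarrow> l2_inner M u (E j) = 0)" for a
    by (rule l2_sums_iff[OF _ _ True]) (use assms in \<open>auto dest: injD\<close>)
  moreover have "(\<forall>n. \<phi> n \<noteq> j) \<longleftrightarrow> j \<notin> range \<phi>" for j by blast
  ultimately have eq: "l2_sums M (\<lambda>n x. a n * E (\<phi> n) x) u \<longleftrightarrow>
    (\<lambda>n. l2_inner M u (E (\<phi> n))) = a \<and> (\<forall>j. j \<notin> range \<phi> \<longrightarrow> l2_inner M u (E j) = 0)" for a
    by (simp add: fun_eq_iff)
  show ?thesis
  proof
    assume "u \<in> h_space M s (\<lambda>n. E (\<phi> n))"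
    then obtain a where a: "summable (\<lambda>n. (real n + 1) powr (2 * s) * (cmod (a n))\<^sup>2)"
      and l: "l2_sums M (\<lambda>n x. a n * E (\<phi> n) x) u"
      unfolding h_space_def by blast
    have c: "l2_inner M u (E (\<phi> n)) = a n" for n
      using eq[THEN iffD1, OF l] by (metis (no_types))
    show "u \<in> L2 M \<and> summable (\<lambda>n. (real n + 1) powr (2 * s) * (cmod (l2_inner M u (E (\<phi> n))))\<^sup>2) \<and>
      (\<forall>j. j \<notin> range \<phi> \<longrightarrow> l2_inner M u (E j) = 0)"
      using True a eq[THEN iffD1, OF l] by (simp only: c simp_thms)
  next
    assume "u \<in> L2 M \<and> summable (\<lambda>n. (real n + 1) powr (2 * s) * (cmod (l2_inner M u (E (\<phi> n))))\<^sup>2) \<and>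
      (\<forall>j. j \<notin> range \<phi> \<longrightarrow> l2_inner M u (E j) = 0)"
    then show "u \<in> h_space M s (\<lambda>n. E (\<phi> n))"
      unfolding h_space_def
      by (intro CollectI conjI exI[of _ "\<lambda>n. l2_inner M u (E (\<phi> n))"] eq[THEN iffD2]) auto
  qed
qed (simp add: h_space_def)

lemma sum_space_h_space_iff:
  fixes \<phi> \<eta> :: "nat \<Rightarrow> 'i"
  assumes inj: "inj \<phi>" "inj \<eta>" and disj: "range \<phi> \<inter> range \<eta> = {}" and u: "u \<in> L2 M"
  shows "u \<in> sum_space (h_space M s (\<lambda>n. E (\<phi> n))) (h_space M s (\<lambda>n. E (\<eta> n))) \<longleftrightarrow>
    summable (\<lambda>n. (real n + 1) powr (2 * s) * (cmod (l2_inner M u (E (\<phi> n))))\<^sup>2) \<and>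
    summable (\<lambda>n. (real n + 1) powr (2 * s) * (cmod (l2_inner M u (E (\<eta> n))))\<^sup>2) \<and>
    (\<forall>j. j \<notin> range \<phi> \<union> range \<eta> \<longrightarrow> l2_inner M u (E j) = 0)" (is "?L \<longleftrightarrow> ?R")
proof
  assume ?L
  then obtain v w where vw: "u = (\<lambda>x. v x + w x)" "v \<in> h_space M s (\<lambda>n. E (\<phi> n))"
    "w \<in> h_space M s (\<lambda>n. E (\<eta> n))" by (auto simp: sum_space_def)
  then have "l2_inner M u (E j) = l2_inner M v (E j) + l2_inner M w (E j)" for j
    unfolding h_space_iff[OF inj(1)] h_space_iff[OF inj(2)] using basis_L2 by (simp add: l2_inner_add)
  moreover have "l2_inner M v (E j) = 0" if "j \<notin> range \<phi>" for j
    using vw(2) that unfolding h_space_iff[OF inj(1)] by blast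
  moreover have "l2_inner M w (E j) = 0" if "j \<notin> range \<eta>" for j
    using vw(3) that unfolding h_space_iff[OF inj(2)] by blast
  moreover have "\<phi> n \<notin> range \<eta>" "\<eta> n \<notin> range \<phi>" for n
    using disj by blast+
  ultimately show ?R
    using vw(2,3) unfolding h_space_iff[OF inj(1)] h_space_iff[OF inj(2)] by simp
next
  assume R: ?R
  have "(\<lambda>i. (cmod (l2_inner M u (E i)))\<^sup>2) summable_on (range \<phi>)"
    using Bessel[OF u] by (rule summable_on_subset_banach) simp
  then obtain v where v: "v \<in> closed_span M (E ` range \<phi>)"
    "\<And>j. l2_inner M v (E j) = (if j \<in> range \<phi> then l2_inner M u (E j) else 0)"
    using Riesz_Fischer[of "\<lambda>i. l2_inner M u (E i)" "range \<phi>"] by auto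
  have vL: "v \<in> L2 M" using closed_span_L2[OF v(1)] .
  have "v \<in> h_space M s (\<lambda>n. E (\<phi> n))"
    unfolding h_space_iff[OF inj(1)] using vL v(2) R by auto
  moreover have "(\<lambda>x. u x - v x) \<in> h_space M s (\<lambda>n. E (\<eta> n))"
  proof -
    have *: "l2_inner M (\<lambda>x. u x - v x) (E j) = l2_inner M u (E j) - l2_inner M v (E j)" for j
      using u vL basis_L2 by (intro l2_inner_diff)
    have "\<eta> n \<notin> range \<phi>" for n using disj by auto
    then show ?thesis
      unfolding h_space_iff[OF inj(2)] * v(2) using R L2_diff[OF u vL] by auto
  qed
  ultimately show ?L unfolding sum_space_def
    by (rule_tac CollectI, rule_tac x = v in exI, rule_tac x = "\<lambda>x. u x - v x" in exI) simp
qed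

end

section \<open>The rotation-invariant measure on the circle\<close>

definition circle_measure :: "complex measure" where
  "circle_measure = distr (restrict_space lborel {0..<2*pi}) borel cis"

lemma cis_measurable [measurable]: "cis \<in> borel \<rightarrow>\<^sub>M borel"
  by (intro borel_measurable_continuous_onI continuous_intros)

lemma cis_measurable_restrict [measurable]: "cis \<in> restrict_space lborel {0..<2*pi} \<rightarrow>\<^sub>M borel"
  by (intro measurable_restrict_space1) simp

lemma sets_circle_measure [simp, measurable_cong]: "sets circle_measure = sets borel"
  by (simp add: circle_measure_def)

lemma space_circle_measure [simp]: "space circle_measure = UNIV"
  by (simp add: circle_measure_def)

lemma nn_integral_circle:
  assumes [measurable]: "f \<in> borel_measurable borel"
  shows "(\<integral>\<^sup>+v. f v \<partial>circle_measure) = (\<integral>\<^sup>+\<theta>. f (cis \<theta>) * indicator {0..<2*pi} \<theta> \<partial>lborel)"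
  unfolding circle_measure_def by (subst nn_integral_distr) (auto simp: nn_integral_restrict_space)

lemma emeasure_circle: "emeasure circle_measure UNIV = ennreal (2 * pi)"
proof -
  have "emeasure circle_measure UNIV = (\<integral>\<^sup>+v. indicator UNIV v \<partial>circle_measure)"
    by (subst nn_integral_indicator) auto
  also have "\<dots> = (\<integral>\<^sup>+\<theta>. indicator {0..<2*pi} \<theta> \<partial>lborel)"
    by (subst nn_integral_circle) auto
  finally show ?thesis by simp
qed

interpretation circle: finite_measure circle_measure
  by standard (simp add: emeasure_circle)

lemma AE_circle_norm: "AE v in circle_measure. cmod v = 1"
  unfolding circle_measure_def by (subst AE_distr_iff) auto

text \<open>
  After reduction of the shift modulo \<open>2\<pi>\<close>, the shifted interval is cut at \<open>2\<pi>\<close> and the overhanging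
  piece is moved back.
\<close>

lemma nn_integral_cis_shift:
  fixes f :: "complex \<Rightarrow> ennreal"
  assumes [measurable]: "f \<in> borel_measurable borel"
  shows "(\<integral>\<^sup>+\<theta>. f (cis (\<theta> + c)) * indicator {0..<2*pi} \<theta> \<partial>lborel)
    = (\<integral>\<^sup>+\<theta>. f (cis \<theta>) * indicator {0..<2*pi} \<theta> \<partial>lborel)"
proof -
  (* The shift reduced to the fundamental interval. *)
  define d where "d = c - 2*pi * of_int \<lfloor>c / (2*pi)\<rfloor>"
  have d: "0 \<le> d" "d < 2*pi"
    using floor_divide_lower[of "2*pi" c] floor_divide_upper[of "2*pi" c]
    by (auto simp: d_def algebra_simps)
  have cd: "cis (\<theta> + c) = cis (\<theta> + d)" for \<theta>
  proof -
    have "cis (\<theta> + c) = cis (\<theta> + d) * cis (2*pi * of_int \<lfloor>c / (2*pi)\<rfloor>)"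
      unfolding cis_mult d_def by simp
    also have "cis (2*pi * of_int \<lfloor>c / (2*pi)\<rfloor>) = 1" by (rule cis_multiple_2pi) simp
    finally show ?thesis by simp
  qed
  have "(\<integral>\<^sup>+\<theta>. f (cis (\<theta> + c)) * indicator {0..<2*pi} \<theta> \<partial>lborel)
      = (\<integral>\<^sup>+\<theta>. f (cis \<theta>) * indicator {d..<d+2*pi} \<theta> \<partial>lborel)"
    unfolding cd
    by (subst (2) nn_integral_real_affine[where c=1 and t=d])
       (auto intro!: nn_integral_cong simp: add.commute split: split_indicator)
  also have "\<dots> = (\<integral>\<^sup>+\<theta>. (f (cis \<theta>) * indicator {d..<2*pi} \<theta>
      + f (cis \<theta>) * indicator {2*pi..<2*pi+d} \<theta>) \<partial>lborel)"
    using d by (intro nn_integral_cong) (auto split: split_indicator)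
  also have "\<dots> = (\<integral>\<^sup>+\<theta>. f (cis \<theta>) * indicator {d..<2*pi} \<theta> \<partial>lborel)
      + (\<integral>\<^sup>+\<theta>. f (cis \<theta>) * indicator {2*pi..<2*pi+d} \<theta> \<partial>lborel)"
    by (rule nn_integral_add) auto
  also have "(\<integral>\<^sup>+\<theta>. f (cis \<theta>) * indicator {2*pi..<2*pi+d} \<theta> \<partial>lborel)
      = (\<integral>\<^sup>+\<theta>. f (cis \<theta>) * indicator {0..<d} \<theta> \<partial>lborel)"
    by (subst nn_integral_real_affine[where c=1 and t="2*pi"])
       (auto intro!: nn_integral_cong simp: cis_mult[symmetric] split: split_indicator)
  also have "(\<integral>\<^sup>+\<theta>. f (cis \<theta>) * indicator {d..<2*pi} \<theta> \<partial>lborel) + \<dots>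
      = (\<integral>\<^sup>+\<theta>. (f (cis \<theta>) * indicator {d..<2*pi} \<theta> + f (cis \<theta>) * indicator {0..<d} \<theta>) \<partial>lborel)"
    by (rule nn_integral_add[symmetric]) auto
  also have "\<dots> = (\<integral>\<^sup>+\<theta>. f (cis \<theta>) * indicator {0..<2*pi} \<theta> \<partial>lborel)"
    using d by (intro nn_integral_cong) (auto split: split_indicator)
  finally show ?thesis .
qed

lemma nn_integral_circle_rotate:
  fixes f :: "complex \<Rightarrow> ennreal"
  assumes [measurable]: "f \<in> borel_measurable borel" and "cmod w = 1"
  shows "(\<integral>\<^sup>+v. f (w * v) \<partial>circle_measure) = (\<integral>\<^sup>+v. f v \<partial>circle_measure)"
proof -
  obtain c where w: "w = cis c" using assms(2) by (metis cis_Arg_unique is_Arg_def Arg2pi_eq cis_conv_exp mult_1 of_real_1)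
  show ?thesis
    using nn_integral_cis_shift[of f c]
    by (simp add: nn_integral_circle w cis_mult add.commute)
qed

lemma distr_circle_rotate:
  assumes "cmod w = 1"
  shows "distr circle_measure borel ((*) w) = circle_measure"
proof (rule measure_eqI)
  fix A assume "A \<in> sets (distr circle_measure borel ((*) w))"
  then have [measurable]: "A \<in> sets borel" by simp
  have "emeasure (distr circle_measure borel ((*) w)) A = (\<integral>\<^sup>+v. indicator A (w * v) \<partial>circle_measure)"
    by (subst nn_integral_indicator[symmetric], simp, subst nn_integral_distr) auto
  also have "\<dots> = (\<integral>\<^sup>+v. indicator A v \<partial>circle_measure)"
    using assms by (intro nn_integral_circle_rotate) auto
  finally show "emeasure (distr circle_measure borel ((*) w)) A = emeasure circle_measure A" by simp
qed simp

text \<open>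
  A rotation by \<open>\<pi> / l\<close> preserves the measure and changes the sign of the integrand, so the integral
  vanishes for \<open>l \<noteq> 0\<close>.
\<close>

lemma integral_circle_power_int:
  "(\<integral>v. v powi l \<partial>circle_measure) = (if l = 0 then of_real (2 * pi) else 0)"
proof (cases "l = 0")
  case True
  have "measure circle_measure UNIV = 2 * pi" by (simp add: measure_def emeasure_circle)
  then show ?thesis using True by (simp add: scaleR_conv_of_real)
next
  case False
  define w where "w = cis (pi / of_int l)"
  have m: "(\<lambda>v::complex. v powi l) \<in> borel_measurable borel"
    unfolding power_int_def by measurable
  have "(\<integral>v. v powi l \<partial>circle_measure) = (\<integral>v. v powi l \<partial>distr circle_measure borel ((*) w))"
    by (subst distr_circle_rotate) (auto simp: w_def)
  also have "\<dots> = (\<integral>v. (w * v) powi l \<partial>circle_measure)"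
    using m by (subst integral_distr) auto
  also have "\<dots> = - (\<integral>v. v powi l \<partial>circle_measure)"
    using False by (simp add: power_int_mult_distrib w_def cis_power_int)
  finally show ?thesis using False by simp
qed

section \<open>Parallel-beam coordinates on the inward boundary\<close>

text \<open>
  The direction of the oriented line and its signed distance from the origin.
\<close>

definition beam_coords :: "real \<times> real \<Rightarrow> complex \<times> real" where
  "beam_coords x = (cis (fst x + snd x + pi), sin (snd x))"

definition beam_measure :: "real \<Rightarrow> (complex \<times> real) measure" where
  "beam_measure \<gamma> = density (circle_measure \<Otimes>\<^sub>M lborel)
     (\<lambda>p. ennreal ((1 - (snd p)\<^sup>2) powr (- \<gamma> - 1/2)) * indicator {-1..1} (snd p))"

abbreviation inflow_domain :: "(real \<times> real) set" where
  "inflow_domain \<equiv> {0..<2 * pi} \<times> {- pi / 2..pi / 2}"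

lemma fst_borel_measurable [measurable]: "fst \<in> borel \<rightarrow>\<^sub>M borel"
  and snd_borel_measurable [measurable]: "snd \<in> borel \<rightarrow>\<^sub>M borel"
  by (intro borel_measurable_continuous_onI continuous_intros)+

lemma borel_complex_real: "sets (circle_measure \<Otimes>\<^sub>M lborel) = sets (borel :: (complex \<times> real) measure)"
proof -
  have "sets (circle_measure \<Otimes>\<^sub>M (lborel :: real measure)) = sets (borel \<Otimes>\<^sub>M borel)"
    by (intro sets_pair_measure_cong) auto
  then show ?thesis unfolding borel_prod .
qed

lemma sets_beam_measure [simp, measurable_cong]: "sets (beam_measure \<gamma>) = sets borel"
  unfolding beam_measure_def sets_density by (rule borel_complex_real)

lemma inflow_domain_sets [measurable, simp]: "inflow_domain \<in> sets borel"
  unfolding borel_prod[symmetric] by (intro pair_measureI) auto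

lemma sets_inflow_measure: "sets (inflow_measure \<gamma>) = sets (restrict_space borel inflow_domain)"
  by (simp add: inflow_measure_def sets_restrict_space)

lemma space_inflow_measure: "space (inflow_measure \<gamma>) = inflow_domain"
  by (simp add: inflow_measure_def space_restrict_space)

lemma measurable_inflow: "f \<in> borel \<rightarrow>\<^sub>M N \<Longrightarrow> f \<in> inflow_measure \<gamma> \<rightarrow>\<^sub>M N"
  by (subst measurable_cong_sets[OF sets_inflow_measure refl]) (rule measurable_restrict_space1)

lemma beam_coords_measurable [measurable]: "beam_coords \<in> borel \<rightarrow>\<^sub>M borel"
  unfolding beam_coords_def
  by (intro borel_measurable_continuous_onI continuous_intros)

lemma beam_coords_measurable_inflow [measurable]: "beam_coords \<in> inflow_measure \<gamma> \<rightarrow>\<^sub>M borel"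
  by (intro measurable_inflow) measurable

lemma nn_integral_inflow:
  assumes [measurable]: "F \<in> borel_measurable borel"
  shows "(\<integral>\<^sup>+x. F x \<partial>inflow_measure \<gamma>) = (\<integral>\<^sup>+\<alpha>. (\<integral>\<^sup>+\<beta>. F (\<beta>, \<alpha>) * indicator {0..<2*pi} \<beta> \<partial>lborel)
     * (ennreal (cos \<alpha> powr (-2*\<gamma>)) * indicator {-pi/2..pi/2} \<alpha>) \<partial>lborel)"
proof -
  have "(\<integral>\<^sup>+x. F x \<partial>inflow_measure \<gamma>)
      = (\<integral>\<^sup>+x. ennreal (cos (snd x) powr (-2*\<gamma>)) * F x * indicator inflow_domain x \<partial>lborel)"
    unfolding inflow_measure_def
    by (subst nn_integral_density; (subst nn_integral_restrict_space)?)
       (auto intro!: measurable_restrict_space1 simp del: minus_divide_left simp: inflow_domain_sets[simplified])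
  also have "\<dots> = (\<integral>\<^sup>+\<alpha>. (\<integral>\<^sup>+\<beta>. ennreal (cos \<alpha> powr (-2*\<gamma>)) * F (\<beta>, \<alpha>) * indicator inflow_domain (\<beta>, \<alpha>) \<partial>lborel) \<partial>lborel)"
    unfolding lborel_prod[symmetric]
  proof (subst lborel_pair.nn_integral_snd[symmetric])
    show "(\<lambda>x. ennreal (cos (snd x) powr (-2*\<gamma>)) * F x * indicator inflow_domain x)
      \<in> borel_measurable (lborel \<Otimes>\<^sub>M lborel)"
      unfolding lborel_prod using inflow_domain_sets by measurable
  qed simp
  also have "\<dots> = (\<integral>\<^sup>+\<alpha>. (\<integral>\<^sup>+\<beta>. (F (\<beta>, \<alpha>) * indicator {0..<2*pi} \<beta>) *
     (ennreal (cos \<alpha> powr (-2*\<gamma>)) * indicator {-pi/2..pi/2} \<alpha>) \<partial>lborel) \<partial>lborel)"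
    by (intro nn_integral_cong) (auto simp: mult_ac split: split_indicator)
  also have "\<dots> = (\<integral>\<^sup>+\<alpha>. (\<integral>\<^sup>+\<beta>. F (\<beta>, \<alpha>) * indicator {0..<2*pi} \<beta> \<partial>lborel)
     * (ennreal (cos \<alpha> powr (-2*\<gamma>)) * indicator {-pi/2..pi/2} \<alpha>) \<partial>lborel)"
    by (intro nn_integral_cong nn_integral_multc) measurable
  finally show ?thesis .
qed

text \<open>
  With \<open>s = sin \<alpha>\<close> one has \<open>d\<alpha> = ds / cos \<alpha>\<close>, which lowers the exponent \<open>- 2 \<gamma>\<close> of \<open>cos \<alpha>\<close> by one; since
  \<open>cos \<alpha>\<close> is the square root of \<open>1 - s\<^sup>2\<close>, the new exponent is \<open>- \<gamma> - 1/2\<close>. Finiteness of \<open>H\<close> allows the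
  substitution rule for real-valued integrands to be used.
\<close>

lemma nn_integral_sin_substitution:
  fixes H :: "real \<Rightarrow> ennreal"
  assumes [measurable]: "H \<in> borel_measurable borel" and fin: "\<And>s. H s < \<infinity>"
  shows "(\<integral>\<^sup>+\<alpha>. H (sin \<alpha>) * (ennreal (cos \<alpha> powr (-2*\<gamma>)) * indicator {-pi/2..pi/2} \<alpha>) \<partial>lborel)
    = (\<integral>\<^sup>+s. H s * (ennreal ((1 - s\<^sup>2) powr (-\<gamma> - 1/2)) * indicator {-1..1} s) \<partial>lborel)"
proof -
  define f where "f s = enn2real (H s) * (1 - s\<^sup>2) powr (-\<gamma> - 1/2)" for s
  have [measurable]: "f \<in> borel_measurable borel" unfolding f_def by measurable
  have H: "ennreal (enn2real (H s)) = H s" for s using fin[of s] by (simp add: less_top)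
  have "(\<integral>\<^sup>+s. H s * (ennreal ((1 - s\<^sup>2) powr (-\<gamma> - 1/2)) * indicator {-1..1} s) \<partial>lborel)
     = (\<integral>\<^sup>+s. ennreal (f s * indicator {sin (-(pi/2))..sin (pi/2)} s) \<partial>lborel)"
    by (intro nn_integral_cong) (auto simp: f_def ennreal_mult H split: split_indicator)
  also have "\<dots> = (\<integral>\<^sup>+\<alpha>. ennreal (f (sin \<alpha>) * cos \<alpha> * indicator {-(pi/2)..pi/2} \<alpha>) \<partial>lborel)"
    by (subst nn_integral_substitution[where g = sin and g' = cos and a = "-(pi/2)" and b = "pi/2"])
       (auto intro!: derivative_eq_intros continuous_intros cos_ge_zero simp: set_borel_measurable_def)
  also have "\<dots> = (\<integral>\<^sup>+\<alpha>. H (sin \<alpha>) * (ennreal (cos \<alpha> powr (-2*\<gamma>)) * indicator {-pi/2..pi/2} \<alpha>) \<partial>lborel)"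
  proof (rule nn_integral_cong_AE)
    have "f (sin \<alpha>) * cos \<alpha> = enn2real (H (sin \<alpha>)) * cos \<alpha> powr (-2*\<gamma>)"
      if "-(pi/2) < \<alpha>" "\<alpha> < pi/2" for \<alpha>
    proof -
      have c: "cos \<alpha> > 0" using that by (intro cos_gt_zero_pi) auto
      have eq: "1 - (sin \<alpha>)\<^sup>2 = cos \<alpha> powr 2" using c by (simp add: cos_squared_eq[symmetric])
      have "(1 - (sin \<alpha>)\<^sup>2) powr (-\<gamma> - 1/2) * cos \<alpha> = cos \<alpha> powr (-2*\<gamma> - 1) * cos \<alpha> powr 1"
        unfolding eq powr_powr using c by (simp add: algebra_simps)
      also have "\<dots> = cos \<alpha> powr (-2*\<gamma>)" by (subst powr_add[symmetric]) simp
      finally show ?thesis by (simp add: f_def)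
    qed
    then have eq: "ennreal (f (sin \<alpha>) * cos \<alpha> * indicator {-(pi/2)..pi/2} \<alpha>)
        = H (sin \<alpha>) * (ennreal (cos \<alpha> powr (-2*\<gamma>)) * indicator {-pi/2..pi/2} \<alpha>)"
      if "\<alpha> \<noteq> -(pi/2)" "\<alpha> \<noteq> pi/2" for \<alpha>
      using that by (auto simp: ennreal_mult H split: split_indicator)
    show "AE \<alpha> in lborel. ennreal (f (sin \<alpha>) * cos \<alpha> * indicator {-(pi/2)..pi/2} \<alpha>)
        = H (sin \<alpha>) * (ennreal (cos \<alpha> powr (-2*\<gamma>)) * indicator {-pi/2..pi/2} \<alpha>)"
      using AE_lborel_singleton[of "-(pi/2)"] AE_lborel_singleton[of "pi/2"] by eventually_elim (rule eq)
  qed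
  finally show ?thesis by simp
qed

lemma circle_pair_sigma_finite: "pair_sigma_finite circle_measure (lborel :: 'a::euclidean_space measure)"
  by (intro pair_sigma_finite.intro) unfold_locales

interpretation circle_lborel: pair_sigma_finite circle_measure "lborel :: 'a::euclidean_space measure"
  by (rule circle_pair_sigma_finite)

text \<open>
  For fixed \<open>\<alpha>\<close> the angle \<open>\<beta>\<close> enters only through a rotation of the circle, so the change of variables
  splits into \<open>nn_integral_cis_shift\<close> and \<open>nn_integral_sin_substitution\<close>.
\<close>

theorem distr_beam_coords: "distr (inflow_measure \<gamma>) borel beam_coords = beam_measure \<gamma>"
proof (rule measure_eqI)
  fix A :: "(complex \<times> real) set" assume "A \<in> sets (distr (inflow_measure \<gamma>) borel beam_coords)"
  then have A [measurable]: "A \<in> sets borel" by simp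
  have A' [measurable]: "A \<in> sets (borel \<Otimes>\<^sub>M borel)" unfolding borel_prod by (rule A)
  define H where "H s = (\<integral>\<^sup>+v. indicator A (v, s) \<partial>circle_measure)" for s
  have Hm [measurable]: "H \<in> borel_measurable borel" unfolding H_def by measurable
  have "H s \<le> (\<integral>\<^sup>+v. 1 \<partial>circle_measure)" for s
    unfolding H_def by (intro nn_integral_mono) (auto split: split_indicator)
  then have fin: "H s < \<infinity>" for s
    by (rule le_less_trans) (simp add: emeasure_circle)
  have fibre: "(\<integral>\<^sup>+\<beta>. indicator A (beam_coords (\<beta>, \<alpha>)) * indicator {0..<2*pi} \<beta> \<partial>lborel) = H (sin \<alpha>)" for \<alpha>
  proof -
    have "(\<integral>\<^sup>+\<beta>. indicator A (beam_coords (\<beta>, \<alpha>)) * indicator {0..<2*pi} \<beta> \<partial>lborel)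
      = (\<integral>\<^sup>+\<beta>. indicator {v. (v, sin \<alpha>) \<in> A} (cis (\<beta> + (\<alpha> + pi))) * indicator {0..<2*pi} \<beta> \<partial>lborel)"
      by (intro nn_integral_cong) (auto simp: beam_coords_def add.assoc split: split_indicator)
    also have "\<dots> = (\<integral>\<^sup>+\<beta>. indicator {v. (v, sin \<alpha>) \<in> A} (cis \<beta>) * indicator {0..<2*pi} \<beta> \<partial>lborel)"
      by (rule nn_integral_cis_shift) measurable
    also have "\<dots> = (\<integral>\<^sup>+v. indicator {v. (v, sin \<alpha>) \<in> A} v \<partial>circle_measure)"
      by (rule nn_integral_circle[symmetric]) measurable
    also have "\<dots> = H (sin \<alpha>)"
      unfolding H_def by (intro nn_integral_cong) (auto split: split_indicator)
    finally show ?thesis .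
  qed
  have "emeasure (distr (inflow_measure \<gamma>) borel beam_coords) A
      = (\<integral>\<^sup>+x. indicator A (beam_coords x) \<partial>inflow_measure \<gamma>)"
    by (subst nn_integral_indicator[symmetric], simp, subst nn_integral_distr) auto
  also have "\<dots> = (\<integral>\<^sup>+\<alpha>. (\<integral>\<^sup>+\<beta>. indicator A (beam_coords (\<beta>, \<alpha>)) * indicator {0..<2*pi} \<beta> \<partial>lborel)
     * (ennreal (cos \<alpha> powr (-2*\<gamma>)) * indicator {-pi/2..pi/2} \<alpha>) \<partial>lborel)"
    by (rule nn_integral_inflow) measurable
  also have "\<dots> = (\<integral>\<^sup>+\<alpha>. H (sin \<alpha>) * (ennreal (cos \<alpha> powr (-2*\<gamma>)) * indicator {-pi/2..pi/2} \<alpha>) \<partial>lborel)"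
    by (simp only: fibre)
  also have "\<dots> = (\<integral>\<^sup>+s. H s * (ennreal ((1 - s\<^sup>2) powr (-\<gamma> - 1/2)) * indicator {-1..1} s) \<partial>lborel)"
    by (rule nn_integral_sin_substitution[OF Hm fin])
  also have "\<dots> = (\<integral>\<^sup>+s. (\<integral>\<^sup>+v. ennreal ((1 - s\<^sup>2) powr (-\<gamma> - 1/2)) * indicator {-1..1} s * indicator A (v, s)
      \<partial>circle_measure) \<partial>lborel)"
    unfolding H_def mult.commute[of "nn_integral _ _"]
    by (intro nn_integral_cong nn_integral_cmult[symmetric]) measurable
  also have "\<dots> = (\<integral>\<^sup>+p. ennreal ((1 - (snd p)\<^sup>2) powr (-\<gamma> - 1/2)) * indicator {-1..1} (snd p) * indicator A p
      \<partial>(circle_measure \<Otimes>\<^sub>M lborel))"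
    by (subst circle_lborel.nn_integral_snd[symmetric]) auto
  also have "\<dots> = emeasure (beam_measure \<gamma>) A"
    unfolding beam_measure_def by (subst emeasure_density) auto
  finally show "emeasure (distr (inflow_measure \<gamma>) borel beam_coords) A = emeasure (beam_measure \<gamma>) A" .
qed simp

lemma Arg2pi_measurable [measurable]: "Arg2pi \<in> borel_measurable borel"
proof -
  let ?P = "{z::complex. z \<in> \<real> \<and> Re z \<ge> 0}"
  have cl: "closed ?P"
  proof -
    have "?P = {z. Im z = 0} \<inter> {z. Re z \<ge> 0}" by (auto simp: complex_is_Real_iff)
    then show ?thesis by (auto intro!: closed_Int closed_Collect_eq closed_Collect_le continuous_intros)
  qed
  have "continuous_on (- ?P) Arg2pi"
    by (intro continuous_at_imp_continuous_on ballI continuous_at_Arg2pi)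
       (auto simp: complex_nonneg_Reals_iff complex_is_Real_iff)
  then have "Arg2pi \<in> borel_measurable (restrict_space borel (- ?P))"
    by (rule borel_measurable_continuous_on_restrict)
  then have "(\<lambda>z. if z \<in> - ?P then Arg2pi z else 0) \<in> borel_measurable borel"
    using cl by (subst (asm) measurable_restrict_space_iff[where c = 0]) (auto intro: borel_closed)
  moreover have "(\<lambda>z. if z \<in> - ?P then Arg2pi z else 0) = Arg2pi"
    by (auto simp: Arg2pi_eq_0 fun_eq_iff)
  ultimately show ?thesis by simp
qed

text \<open>
  This left inverse of \<open>beam_coords\<close> is total and Borel: the second coordinate is truncated to the
  domain of \<open>arcsin\<close>, and \<open>Arg2pi\<close> takes values in \<open>[0, 2\<pi>)\<close>, the fundamental domain of \<open>\<beta>\<close>.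
\<close>

definition fan_coords :: "complex \<times> real \<Rightarrow> real \<times> real" where
  "fan_coords p = (let a = arcsin (max (-1) (min 1 (snd p))) in (Arg2pi (- fst p * cis (- a)), a))"

lemma fan_coords_measurable [measurable]: "fan_coords \<in> borel \<rightarrow>\<^sub>M borel"
proof -
  have "continuous_on UNIV (\<lambda>p::complex \<times> real. arcsin (max (-1) (min 1 (snd p))))"
    by (intro continuous_intros) auto
  then have [measurable]: "(\<lambda>p::complex \<times> real. arcsin (max (-1) (min 1 (snd p)))) \<in> borel_measurable borel"
    by (rule borel_measurable_continuous_onI)
  show ?thesis unfolding fan_coords_def Let_def borel_prod[symmetric] by measurable (auto simp: borel_prod)
qed

lemma fan_beam_coords:
  assumes "x \<in> inflow_domain"
  shows "fan_coords (beam_coords x) = x"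
proof -
  obtain b a where x: "x = (b, a)" by (cases x)
  have ab: "0 \<le> b" "b < 2*pi" "-(pi/2) \<le> a" "a \<le> pi/2" using assms by (auto simp: x)
  have 1: "arcsin (sin a) = a" using ab by (intro arcsin_sin) auto
  have 2: "- cis (b + a + pi) * cis (- a) = cis b"
    by (simp add: cis_mult[symmetric] flip: cis_inverse)
  have "Arg2pi (cis b) = b" by (rule Arg2pi_unique[of 1]) (use ab in \<open>auto simp: cis_conv_exp\<close>)
  then show ?thesis
    unfolding x fan_coords_def beam_coords_def fst_conv snd_conv Let_def
    by (simp only: min.absorb2[OF sin_le_one] max.absorb2[OF sin_ge_minus_one] 1 2)
qed

text \<open>
  This lets functions on the inward boundary be treated as Borel functions of the beam
  coordinates.
\<close>

lemma beam_representative: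
  assumes u: "u \<in> borel_measurable (inflow_measure \<gamma>)"
  obtains U where "U \<in> borel_measurable borel" "\<And>x. x \<in> inflow_domain \<Longrightarrow> u x = (U (beam_coords x) :: complex)"
proof
  define u0 where "u0 x = (if x \<in> inflow_domain then u x else 0)" for x
  have "u \<in> borel_measurable (restrict_space borel inflow_domain)"
    using u by (subst (asm) measurable_cong_sets[OF sets_inflow_measure refl])
  then have [measurable]: "u0 \<in> borel_measurable borel"
    unfolding u0_def
    by (subst (asm) measurable_restrict_space_iff[where c = 0]) (use inflow_domain_sets in simp_all)
  show "(\<lambda>p. u0 (fan_coords p)) \<in> borel_measurable borel" by measurable
  show "u x = u0 (fan_coords (beam_coords x))" if "x \<in> inflow_domain" for x
    using that by (simp add: fan_beam_coords u0_def)
qed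

lemma AE_inflow_domain: "AE x in inflow_measure \<gamma>. x \<in> inflow_domain"
  using AE_space[of "inflow_measure \<gamma>"] by (simp add: space_inflow_measure)

lemma integral_inflow_beam:
  fixes F :: "complex \<times> real \<Rightarrow> 'b::{banach, second_countable_topology}"
  assumes "F \<in> borel_measurable borel"
  shows "(\<integral>x. F (beam_coords x) \<partial>inflow_measure \<gamma>) = (\<integral>p. F p \<partial>beam_measure \<gamma>)"
  using assms by (subst distr_beam_coords[symmetric], subst integral_distr) auto

lemma integrable_inflow_beam:
  fixes F :: "complex \<times> real \<Rightarrow> 'b::{banach, second_countable_topology}"
  assumes "F \<in> borel_measurable borel"
  shows "integrable (inflow_measure \<gamma>) (\<lambda>x. F (beam_coords x)) \<longleftrightarrow> integrable (beam_measure \<gamma>) F"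
  using assms by (subst distr_beam_coords[symmetric], subst integrable_distr_eq) auto

lemma AE_inflow_beam:
  assumes "{p. P p} \<in> sets borel"
  shows "(AE x in inflow_measure \<gamma>. P (beam_coords x)) \<longleftrightarrow> (AE p in beam_measure \<gamma>. P p)"
  using assms by (subst distr_beam_coords[symmetric], subst AE_distr_iff) auto

section \<open>Functions with vanishing moments\<close>

text \<open>
  By the Stone-Weierstrass theorem the integral of \<open>w\<close> against every continuous function vanishes.
  Continuous functions approximate indicators of closed sets, and closed sets generate the Borel
  sets, so the integral of \<open>w\<close> over every Borel set vanishes.
\<close>

lemma AE_zero_if_polynomial_moments_vanish:
  fixes w :: "'a::euclidean_space \<Rightarrow> complex"
  assumes sets: "sets M = sets borel" and w: "integrable M w"
    and K: "compact K" "\<And>x. x \<notin> K \<Longrightarrow> w x = 0"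
    and mom: "\<And>g. real_polynomial_function g \<Longrightarrow> (\<integral>x. of_real (g x) * w x \<partial>M) = 0"
  shows "AE x in M. w x = 0"
proof -
  have space: "space M = UNIV" using sets_eq_imp_space_eq[OF sets] by simp
  have wm [measurable]: "w \<in> borel_measurable M" using w by simp
  have Mm: "g \<in> borel_measurable borel \<Longrightarrow> g \<in> borel_measurable M" for g :: "'a \<Rightarrow> 'b::topological_space"
    by (subst measurable_cong_sets[OF sets refl])
  obtain B where B: "\<And>x. x \<in> K \<Longrightarrow> norm x \<le> B"
    using compact_imp_bounded[OF K(1)] by (auto simp: bounded_iff)
  have int: "integrable M (\<lambda>x. of_real (g x) * w x)" if g: "continuous_on UNIV g" for g :: "'a \<Rightarrow> real"
  proof -
    obtain b where b: "\<And>x. x \<in> K \<Longrightarrow> \<bar>g x\<bar> \<le> b"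
      using compact_imp_bounded[OF compact_continuous_image[OF continuous_on_subset[OF g] K(1)]]
      by (auto simp: bounded_iff)
    have [measurable]: "g \<in> borel_measurable M"
      using g by (intro Mm borel_measurable_continuous_onI)
    show ?thesis
    proof (rule Bochner_Integration.integrable_bound[of _ "\<lambda>x. of_real b * w x"])
      show "AE x in M. norm (of_real (g x) * w x) \<le> norm (of_real b * w x)"
      proof (rule AE_I2)
        fix x
        show "norm (of_real (g x) * w x) \<le> norm (of_real b * w x)"
          using b[of x] K(2)[of x] by (cases "x \<in> K") (auto simp: norm_mult intro!: mult_right_mono)
      qed
    qed (use w in auto)
  qed
  have cont: "(\<integral>x. of_real (g x) * w x \<partial>M) = 0" if g: "continuous_on UNIV g" for g :: "'a \<Rightarrow> real"
  proof -
    have "norm (\<integral>x. of_real (g x) * w x \<partial>M) \<le> e" if "e > 0" for e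
    proof -
      define I where "I = (\<integral>x. norm (w x) \<partial>M)"
      have I: "I \<ge> 0" by (simp add: I_def)
      define d where "d = e / (I + 1)"
      have d: "d > 0" using that I by (simp add: d_def)
      obtain p where p: "real_polynomial_function p" "\<And>x. x \<in> K \<Longrightarrow> \<bar>g x - p x\<bar> < d"
        using Stone_Weierstrass_real_polynomial_function[OF K(1) continuous_on_subset[OF g] d] by blast
      have pc: "continuous_on UNIV p"
        using p(1) by (intro continuous_on_polymonial_function) (simp add: real_polynomial_function_eq)
      have "(\<integral>x. of_real (g x) * w x \<partial>M) = (\<integral>x. of_real (g x) * w x \<partial>M) - (\<integral>x. of_real (p x) * w x \<partial>M)"
        using mom[OF p(1)] by simp
      also have "\<dots> = (\<integral>x. of_real (g x - p x) * w x \<partial>M)"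
        using int[OF g] int[OF pc] by (subst Bochner_Integration.integral_diff[symmetric]) (auto simp: algebra_simps)
      also have "norm \<dots> \<le> (\<integral>x. norm (of_real (g x - p x) * w x) \<partial>M)"
        by (rule integral_norm_bound)
      also have "\<dots> \<le> (\<integral>x. d * norm (w x) \<partial>M)"
      proof (rule integral_mono)
        show "integrable M (\<lambda>x. norm (of_real (g x - p x) * w x))"
          by (intro integrable_norm int continuous_intros g pc)
        show "norm (of_real (g x - p x) * w x) \<le> d * norm (w x)" for x
          using p(2)[of x] K(2)[of x]
          by (cases "x \<in> K") (auto simp: norm_mult simp flip: of_real_diff intro!: mult_right_mono)
      qed (use w in auto)
      also have "\<dots> = d * I" by (simp add: I_def)
      also have "\<dots> \<le> e" using I that by (simp add: d_def field_simps)
      finally show ?thesis .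
    qed
    then have "norm (\<integral>x. of_real (g x) * w x \<partial>M) \<le> 0" by (rule field_le_epsilon) simp
    then show ?thesis by simp
  qed
  have closed: "(LINT x:C|M. w x) = 0" if C: "closed C" for C
  proof (cases "C = {}")
    case False
    (* Decreasing continuous approximations of the indicator of C. *)
    define g where "g n x = max 0 (1 - real n * infdist x C)" for n x
    have gc: "continuous_on UNIV (g n)" for n
      unfolding g_def by (intro continuous_intros)
    have [measurable]: "C \<in> sets M" using C sets by auto
    have "(\<lambda>n. \<integral>x. of_real (g n x) * w x \<partial>M) \<longlonglongrightarrow> (\<integral>x. indicator C x *\<^sub>R w x \<partial>M)"
    proof (rule integral_dominated_convergence[where w = "\<lambda>x. norm (w x)"])
      show "AE x in M. (\<lambda>n. of_real (g n x) * w x) \<longlonglongrightarrow> indicator C x *\<^sub>R w x"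
      proof (rule AE_I2)
        fix x
        have "(\<lambda>n. g n x) \<longlonglongrightarrow> indicator C x"
        proof (cases "x \<in> C")
          case True
          then show ?thesis by (simp add: g_def)
        next
          case False
          then have pos: "infdist x C > 0"
            using C \<open>C \<noteq> {}\<close> by (metis in_closed_iff_infdist_zero infdist_nonneg less_eq_real_def)
          obtain N where N: "1 / infdist x C < real N" using reals_Archimedean2 by blast
          have "g n x = 0" if "n \<ge> N" for n
          proof -
            have "1 < real N * infdist x C" using N pos by (simp add: field_simps)
            also have "\<dots> \<le> real n * infdist x C" using that pos by (intro mult_right_mono) auto
            finally show ?thesis by (simp add: g_def)
          qed
          then have "eventually (\<lambda>n. g n x = 0) sequentially" by (rule eventually_sequentiallyI)
          then show ?thesis using False by (simp add: tendsto_eventually)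
        qed
        then have "(\<lambda>n. of_real (g n x) * w x) \<longlonglongrightarrow> of_real (indicator C x) * w x"
          by (intro tendsto_intros)
        then show "(\<lambda>n. of_real (g n x) * w x) \<longlonglongrightarrow> indicator C x *\<^sub>R w x"
          by (simp add: scaleR_conv_of_real)
      qed
      show "AE x in M. norm (of_real (g n x) * w x) \<le> norm (w x)" for n
        by (intro AE_I2) (auto simp: norm_mult g_def infdist_nonneg intro!: mult_left_le_one_le)
    qed (use w gc in \<open>auto intro!: borel_measurable_integrable[OF int]\<close>)
    then have "(\<integral>x. indicator C x *\<^sub>R w x \<partial>M) = 0"
      using cont[OF gc] by (simp add: LIMSEQ_const_iff)
    then show ?thesis by (simp add: set_lebesgue_integral_def)
  qed (simp add: set_lebesgue_integral_def)
  have wset: "set_integrable M A w" if "A \<in> sets M" for A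
    using that w unfolding set_integrable_def by (rule integrable_mult_indicator)
  have Borel: "(LINT x:A|M. w x) = 0" if "A \<in> sets M" for A
  proof -
    have A: "A \<in> sigma_sets UNIV (Collect closed)"
      using that unfolding sets borel_eq_closed by simp
    have stable: "Int_stable (Collect (closed :: 'a set \<Rightarrow> bool))"
      by (auto simp: Int_stable_def)
    have sub: "Collect (closed :: 'a set \<Rightarrow> bool) \<subseteq> Pow UNIV" by auto
    show ?thesis
      using stable sub A
    proof (induction A rule: sigma_sets_induct_disjoint)
      case (basic A)
      then show ?case using closed by auto
    next
      case empty
      show ?case by (simp add: set_lebesgue_integral_def)
    next
      case (compl A)
      have [measurable]: "A \<in> sets M" using compl(1) unfolding sets borel_eq_closed by simp
      have "(LINT x:UNIV|M. w x) = (LINT x:A|M. w x) + (LINT x:UNIV - A|M. w x)"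
      proof -
        have "UNIV - A \<in> sets M" using sets.compl_sets[of A M] by (simp add: space)
        then have "(LINT x:A \<union> (UNIV - A)|M. w x) = (LINT x:A|M. w x) + (LINT x:UNIV - A|M. w x)"
          by (intro set_integral_Un wset) auto
        then show ?thesis by simp
      qed
      then show ?case using compl(2) closed[of UNIV] by simp
    next
      case (union A)
      have m: "A i \<in> sets M" for i using union(2) unfolding sets borel_eq_closed by auto
      have "(LINT x:(\<Union>i. A i)|M. w x) = (\<Sum>i. (LINT x:A i|M. w x))"
      proof (rule lebesgue_integral_countable_add)
        show "\<And>i j. i \<noteq> j \<Longrightarrow> A i \<inter> A j = {}"
          using union(1) by (auto simp: disjoint_family_on_def)
        show "set_integrable M (\<Union>i. A i) w" using m by (intro wset) auto
      qed (rule m)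
      then show ?case using union(3) by simp
    qed
  qed
  have "AE x in M. Re (w x) = 0"
  proof (rule density_unique_real)
    fix A assume A: "A \<in> sets M"
    have "(LINT x:A|M. Re (w x)) = Re (LINT x:A|M. w x)"
      using wset[OF A] unfolding set_lebesgue_integral_def set_integrable_def
      by (subst integral_Re[symmetric]) (auto simp: scaleR_conv_of_real)
    then show "(LINT x:A|M. Re (w x)) = (LINT x:A|M. 0)" using Borel[OF A] by simp
  qed (use w in auto)
  moreover have "AE x in M. Im (w x) = 0"
  proof (rule density_unique_real)
    fix A assume A: "A \<in> sets M"
    have "(LINT x:A|M. Im (w x)) = Im (LINT x:A|M. w x)"
      using wset[OF A] unfolding set_lebesgue_integral_def set_integrable_def
      by (subst integral_Im[symmetric]) (auto simp: scaleR_conv_of_real)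
    then show "(LINT x:A|M. Im (w x)) = (LINT x:A|M. 0)" using Borel[OF A] by simp
  qed (use w in auto)
  ultimately show ?thesis by eventually_elim (simp add: complex_eq_iff)
qed

text \<open>
  The compact cylinder of directions and distances of lines that meet the closed disk.
\<close>

definition beam_domain :: "(complex \<times> real) set" where
  "beam_domain = sphere 0 1 \<times> {-1..1}"

text \<open>
  On the cylinder the real coordinates of \<open>v\<close> are linear combinations of \<open>v\<close> and its inverse. Hence
  every real polynomial in the coordinates is a combination of the functions \<open>v powi l * s ^ j\<close>, and
  the moments against polynomials vanish.
\<close>

lemma AE_zero_if_trigonometric_moments_vanish:
  assumes W: "integrable (circle_measure \<Otimes>\<^sub>M lborel) W"
    and supp: "\<And>p. p \<notin> beam_domain \<Longrightarrow> W p = 0"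
    and mom: "\<And>(l::int) (j::nat). (\<integral>p. fst p powi l * of_real (snd p)^j * W p \<partial>(circle_measure \<Otimes>\<^sub>M lborel)) = 0"
  shows "AE p in circle_measure \<Otimes>\<^sub>M lborel. W p = 0"
proof (rule AE_zero_if_polynomial_moments_vanish[OF borel_complex_real W _ supp])
  let ?M = "circle_measure \<Otimes>\<^sub>M (lborel :: real measure)"
  have Wm [measurable]: "W \<in> borel_measurable borel"
    using W by (subst measurable_cong_sets[OF borel_complex_real[symmetric] refl]) simp
  have Mm: "g \<in> borel_measurable borel \<Longrightarrow> g \<in> borel_measurable ?M" for g :: "complex \<times> real \<Rightarrow> complex"
    by (subst measurable_cong_sets[OF borel_complex_real refl])
  have pm [measurable]: "(\<lambda>p::complex \<times> real. fst p powi l) \<in> borel_measurable borel" for l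
    unfolding power_int_def by measurable
  (* Functions whose product with W has vanishing trigonometric moments. This class is closed
     under multiplication by real polynomials, by induction over their construction. *)
  define good where "good h \<longleftrightarrow> h \<in> borel_measurable borel \<and> (\<exists>B. \<forall>p\<in>beam_domain. cmod (h p) \<le> B) \<and>
     (\<forall>(l::int) (j::nat). (\<integral>p. fst p powi l * of_real (snd p)^j * h p * W p \<partial>?M) = 0)" for h :: "complex \<times> real \<Rightarrow> complex"
  have int: "integrable ?M (\<lambda>p. fst p powi l * of_real (snd p)^j * h p * W p)" if gh: "good h" for h l j
  proof -
    have [measurable]: "h \<in> borel_measurable borel" using gh by (simp add: good_def)
    obtain B where B: "\<And>p. p \<in> beam_domain \<Longrightarrow> cmod (h p) \<le> B" using gh unfolding good_def by blast
    show ?thesis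
    proof (rule Bochner_Integration.integrable_bound[of _ "\<lambda>p. of_real B * W p"])
      show "AE p in ?M. norm (fst p powi l * of_real (snd p)^j * h p * W p) \<le> norm (of_real B * W p)"
      proof (rule AE_I2)
        fix p
        show "norm (fst p powi l * of_real (snd p)^j * h p * W p) \<le> norm (of_real B * W p)"
        proof (cases "p \<in> beam_domain")
          case True
          then have "cmod (fst p) = 1" "\<bar>snd p\<bar> \<le> 1" by (auto simp: beam_domain_def)
          then have "norm (fst p powi l * of_real (snd p)^j * h p) \<le> 1 * B"
            unfolding norm_mult using B[OF True]
            by (intro mult_mono) (auto simp: norm_power_int norm_power intro: power_le_one)
          then show ?thesis by (simp add: norm_mult mult_right_mono)
        qed (simp add: supp)
      qed
    qed (use W in \<open>auto intro!: Mm\<close>)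
  qed
  have step: "good (\<lambda>p. of_real (f p) * h p)" if "real_polynomial_function f" "good h" for f h
    using that
  proof (induction arbitrary: h rule: real_polynomial_function.induct)
    case (linear f)
    (* A linear form in v and s, rewritten with v and its inverse. *)
    define a b c where "a = complex_of_real (f (1, 0))" and "b = complex_of_real (f (\<i>, 0))"
      and "c = complex_of_real (f (0, 1))"
    have fm: "f \<in> borel_measurable borel"
      using linear(1) by (intro borel_measurable_continuous_onI linear_continuous_on)
    have fe: "complex_of_real (f p) = ((a - \<i> * b) / 2) * fst p + ((a + \<i> * b) / 2) * inverse (fst p) + c * of_real (snd p)"
      if "p \<in> beam_domain" for p
    proof -
      obtain v s where p: "p = (v, s)" by (cases p)
      have n: "cmod v = 1" using that by (simp add: p beam_domain_def)
      have lin: "linear f" using linear(1) by (rule bounded_linear.linear)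
      have "(v, s) = Re v *\<^sub>R (1, 0) + Im v *\<^sub>R (\<i>, 0) + s *\<^sub>R (0, 1)"
        by (simp add: complex_eq_iff)
      then have "f (v, s) = f (Re v *\<^sub>R (1, 0) + Im v *\<^sub>R (\<i>, 0) + s *\<^sub>R (0, 1))"
        by (rule arg_cong)
      also have "\<dots> = Re v * f (1, 0) + Im v * f (\<i>, 0) + s * f (0, 1)"
        by (simp only: linear_add[OF lin] linear_scale[OF lin] real_scaleR_def)
      finally have "f (v, s) = Re v * f (1, 0) + Im v * f (\<i>, 0) + s * f (0, 1)" .
      then have 1: "complex_of_real (f p) = of_real (Re v) * a + of_real (Im v) * b + of_real s * c"
        by (simp add: p a_def b_def c_def)
      have "v * cnj v = 1" using n by (simp add: complex_norm_square[symmetric])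
      then have inv: "inverse v = cnj v" by (rule inverse_unique)
      show ?thesis unfolding 1 unfolding p fst_conv snd_conv inv by (simp add: complex_eq_iff field_simps)
    qed
    have m: "(\<lambda>p. of_real (f p) * h p) \<in> borel_measurable borel"
      using fm linear(2) by (auto simp: good_def)
    obtain B where B: "\<And>p. p \<in> beam_domain \<Longrightarrow> cmod (h p) \<le> B" using linear(2) unfolding good_def by blast
    have "bounded (f ` beam_domain)"
      unfolding beam_domain_def using linear(1)
      by (intro compact_imp_bounded compact_continuous_image compact_Times linear_continuous_on) auto
    then obtain b' where b': "\<And>p. p \<in> beam_domain \<Longrightarrow> \<bar>f p\<bar> \<le> b'" by (auto simp: bounded_iff)
    have bd: "\<exists>B. \<forall>p\<in>beam_domain. cmod (of_real (f p) * h p) \<le> B"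
    proof (intro exI ballI)
      fix p assume "p \<in> beam_domain"
      then show "cmod (of_real (f p) * h p) \<le> b' * B"
        unfolding norm_mult using b'[of p] B[of p] by (intro mult_mono) auto
    qed
    have "(\<integral>p. fst p powi l * of_real (snd p)^j * (of_real (f p) * h p) * W p \<partial>?M) = 0" for l j
    proof -
      have eq: "fst p powi l * of_real (snd p)^j * (of_real (f p) * h p) * W p =
         ((a - \<i> * b) / 2) * (fst p powi (l+1) * of_real (snd p)^j * h p * W p)
         + ((a + \<i> * b) / 2) * (fst p powi (l-1) * of_real (snd p)^j * h p * W p)
         + c * (fst p powi l * of_real (snd p)^(Suc j) * h p * W p)" for p
      proof (cases "p \<in> beam_domain")
        case True
        then have nz: "fst p \<noteq> 0" by (auto simp: beam_domain_def)
        show ?thesis unfolding fe[OF True] using nz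
          by (simp add: power_int_add power_int_diff field_simps)
      qed (simp add: supp)
      have i: "integrable ?M (\<lambda>p. d * (fst p powi l * of_real (snd p)^j * h p * W p))" for d l j
        by (intro integrable_mult_right int linear(2))
      have z: "(\<integral>p. fst p powi l * of_real (snd p)^j * h p * W p \<partial>?M) = 0" for l j
        using linear(2) unfolding good_def by blast
      show ?thesis
        unfolding eq
        by (simp only: Bochner_Integration.integral_add[OF Bochner_Integration.integrable_add[OF i i] i]
            Bochner_Integration.integral_add[OF i i] integral_mult_right_zero z)
           simp
    qed
    then show ?case using m bd by (simp add: good_def)
  next
    case (const c)
    obtain B where "\<forall>p\<in>beam_domain. cmod (h p) \<le> B" using const unfolding good_def by blast
    then have "\<forall>p\<in>beam_domain. cmod (of_real c * h p) \<le> \<bar>c\<bar> * B"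
      by (auto simp: norm_mult intro!: mult_left_mono)
    moreover have eq: "fst p powi l * of_real (snd p)^j * (of_real c * h p) * W p =
      of_real c * (fst p powi l * of_real (snd p)^j * h p * W p)" for l j p
      by (simp only: mult_ac)
    have z: "(\<integral>p. fst p powi l * of_real (snd p)^j * h p * W p \<partial>?M) = 0" for l j
      using const unfolding good_def by blast
    have "(\<integral>p. fst p powi l * of_real (snd p)^j * (of_real c * h p) * W p \<partial>?M) = 0" for l j
      unfolding eq by (simp only: integral_mult_right_zero z) simp
    moreover have "(\<lambda>p. of_real c * h p) \<in> borel_measurable borel"
      using const unfolding good_def by (intro borel_measurable_times borel_measurable_const) blast
    ultimately show ?case unfolding good_def by blast
  next
    case (add f g)
    have 1: "good (\<lambda>p. of_real (f p) * h p)" "good (\<lambda>p. of_real (g p) * h p)" using add by auto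
    then obtain B B' where "\<forall>p\<in>beam_domain. cmod (of_real (f p) * h p) \<le> B"
      "\<forall>p\<in>beam_domain. cmod (of_real (g p) * h p) \<le> B'" unfolding good_def by blast
    then have "\<forall>p\<in>beam_domain. cmod (of_real (f p) * h p + of_real (g p) * h p) \<le> B + B'"
      by (auto intro: norm_triangle_mono)
    moreover have eq: "fst p powi l * of_real (snd p)^j * (of_real (f p) * h p + of_real (g p) * h p) * W p =
      fst p powi l * of_real (snd p)^j * (of_real (f p) * h p) * W p
      + fst p powi l * of_real (snd p)^j * (of_real (g p) * h p) * W p" for l j p
      by (simp add: algebra_simps)
    have z: "(\<integral>p. fst p powi l * of_real (snd p)^j * (of_real (f p) * h p) * W p \<partial>?M) = 0"
      "(\<integral>p. fst p powi l * of_real (snd p)^j * (of_real (g p) * h p) * W p \<partial>?M) = 0" for l j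
      using 1 unfolding good_def by blast+
    have "(\<integral>p. fst p powi l * of_real (snd p)^j * (of_real (f p) * h p + of_real (g p) * h p) * W p \<partial>?M) = 0" for l j
      unfolding eq by (simp only: Bochner_Integration.integral_add[OF int[OF 1(1)] int[OF 1(2)]] z) simp
    moreover have "(\<lambda>p. of_real (f p) * h p + of_real (g p) * h p) \<in> borel_measurable borel"
      using 1 unfolding good_def by (intro borel_measurable_add) blast+
    ultimately have "good (\<lambda>p. of_real (f p) * h p + of_real (g p) * h p)"
      unfolding good_def by blast
    then show ?case by (simp add: algebra_simps)
  next
    case (mult f g)
    have "good (\<lambda>p. of_real (f p) * (of_real (g p) * h p))"
      by (intro mult.IH mult.prems)
    then show ?case by (simp add: mult_ac)
  qed
  have "good (\<lambda>_. 1)" unfolding good_def using mom by (auto intro: exI[of _ 1])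
  then show "(\<integral>p. of_real (g p) * W p \<partial>?M) = 0" if "real_polynomial_function g" for g
  proof -
    have "(\<integral>p. fst p powi 0 * of_real (snd p)^0 * (of_real (g p) * 1) * W p \<partial>?M) = 0"
      using step[OF that \<open>good (\<lambda>_. 1)\<close>] unfolding good_def by blast
    then show ?thesis by simp
  qed
qed (auto simp: beam_domain_def intro!: compact_Times)

section \<open>Gegenbauer polynomials\<close>

text \<open>
  The substitution \<open>x = 2 t - 1\<close> turns the integral into the Beta integral. Unequal exponents are
  needed for the top coefficient in \<open>coeff_chord_poly\<close>.
\<close>

lemma Jacobi_weight_integral:
  fixes a b :: real
  assumes "a > -1" "b > -1"
  shows Jacobi_weight_integrable: "integrable lborel (\<lambda>x. indicator {-1..1} x * ((1 + x) powr a * (1 - x) powr b))"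
    and "(\<integral>x. indicator {-1..1} x * ((1 + x) powr a * (1 - x) powr b) \<partial>lborel)
      = 2 powr (a + b + 1) * Beta (a + 1) (b + 1)"
proof -
  define f where "f t = indicator {0..1} t * (t powr a * (1 - t) powr b)" for t :: real
  have f1: "integrable lborel f"
    using integrable_Beta[of "a+1" "b+1"] assms unfolding f_def set_integrable_def by simp
  have f2: "(\<integral>t. f t \<partial>lborel) = Beta (a + 1) (b + 1)"
  proof -
    have "(\<integral>t. f t \<partial>lborel) = (LINT t:{0..1}|lborel. t powr a * (1 - t) powr b)"
      by (simp add: f_def set_lebesgue_integral_def)
    also have "\<dots> = integral {0..1} (\<lambda>t. t powr a * (1 - t) powr b)"
      using integrable_Beta[of "a+1" "b+1"] assms by (intro set_borel_integral_eq_integral(2)) simp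
    also have "\<dots> = Beta (a + 1) (b + 1)"
      using has_integral_Beta_real[of "a+1" "b+1"] assms by (intro integral_unique) simp
    finally show ?thesis .
  qed
  have eq: "indicator {-1..1} x * ((1 + x) powr a * (1 - x) powr b) = 2 powr (a + b) * f (1/2 + (1/2) * x)" for x
  proof (cases "x \<in> {-1..1}")
    case True
    have "(1 + x) powr a = 2 powr a * (1/2 + (1/2) * x) powr a"
      using True by (subst powr_mult[symmetric]) (auto simp: algebra_simps)
    moreover have "(1 - x) powr b = 2 powr b * (1 - (1/2 + (1/2) * x)) powr b"
      using True by (subst powr_mult[symmetric]) (auto simp: algebra_simps)
    ultimately show ?thesis using True by (simp add: f_def powr_add)
  qed (auto simp: f_def)
  show "integrable lborel (\<lambda>x. indicator {-1..1} x * ((1 + x) powr a * (1 - x) powr b))"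
    unfolding eq using lborel_integrable_real_affine[OF f1, of "1/2" "1/2"] by simp
  have "(\<integral>x. indicator {-1..1} x * ((1 + x) powr a * (1 - x) powr b) \<partial>lborel)
     = 2 powr (a + b) * (\<integral>x. f (1/2 + (1/2) * x) \<partial>lborel)"
    unfolding eq by simp
  also have "(\<integral>x. f (1/2 + (1/2) * x) \<partial>lborel) = 2 * Beta (a + 1) (b + 1)"
    using lborel_integral_real_affine[of "1/2" f "1/2"] f2 by simp
  finally show "(\<integral>x. indicator {-1..1} x * ((1 + x) powr a * (1 - x) powr b) \<partial>lborel)
      = 2 powr (a + b + 1) * Beta (a + 1) (b + 1)"
    by (simp add: powr_add)
qed

lemma one_minus_square_powr:
  "x \<in> {-1..1} \<Longrightarrow> (1 - x\<^sup>2) powr a = (1 + x) powr a * (1 - x) powr (a::real)"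
  by (subst powr_mult[symmetric]) (auto simp: algebra_simps power2_eq_square)

lemma integrable_Gegenbauer_weight:
  assumes "a > -1"
  shows "integrable lborel (\<lambda>x. indicator {-1..1} x * (1 - x\<^sup>2) powr a :: real)"
proof -
  have "indicator {-1..1} x * (1 - x\<^sup>2) powr a = indicator {-1..1} x * ((1 + x) powr a * (1 - x) powr a)" for x :: real
    by (cases "x \<in> {-1..1}") (auto simp: one_minus_square_powr)
  then show ?thesis using Jacobi_weight_integrable[OF assms assms] by (simp only:)
qed

lemma integrable_continuous_Gegenbauer:
  fixes g :: "real \<Rightarrow> 'b::{banach, second_countable_topology, real_normed_algebra_1}"
  assumes a: "a > -1" and g: "continuous_on UNIV g"
  shows "integrable lborel (\<lambda>x. g x * of_real (indicator {-1..1} x * (1 - x\<^sup>2) powr a))"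
proof -
  have "bounded (g ` {-1..1})"
    by (intro compact_imp_bounded compact_continuous_image continuous_on_subset[OF g]) auto
  then obtain B where B: "\<And>x. x \<in> {-1..1} \<Longrightarrow> norm (g x) \<le> B" unfolding bounded_iff by blast
  have [measurable]: "g \<in> borel_measurable borel" using g by (rule borel_measurable_continuous_onI)
  show ?thesis
  proof (rule Bochner_Integration.integrable_bound)
    show "integrable lborel (\<lambda>x. B * (indicator {-1..1} x * (1 - x\<^sup>2) powr a))"
      by (intro integrable_mult_right integrable_Gegenbauer_weight a)
    show "AE x in lborel. norm (g x * of_real (indicator {-1..1} x * (1 - x\<^sup>2) powr a))
      \<le> norm (B * (indicator {-1..1} x * (1 - x\<^sup>2) powr a))"
    proof (rule AE_I2)
      fix x :: real
      show "norm (g x * of_real (indicator {-1..1} x * (1 - x\<^sup>2) powr a))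
      \<le> norm (B * (indicator {-1..1} x * (1 - x\<^sup>2) powr a))"
      proof (cases "x \<in> {-1..1}")
        case True
        have "norm (g x * of_real (indicator {-1..1} x * (1 - x\<^sup>2) powr a))
           \<le> norm (g x) * norm (of_real (indicator {-1..1} x * (1 - x\<^sup>2) powr a) :: 'b)"
          by (rule norm_mult_ineq)
        also have "\<dots> \<le> B * norm (of_real (indicator {-1..1} x * (1 - x\<^sup>2) powr a) :: 'b)"
          by (intro mult_right_mono B True) simp
        also have "\<dots> \<le> norm (B * (indicator {-1..1} x * (1 - x\<^sup>2) powr a))"
          unfolding norm_of_real real_norm_def abs_mult
          by (intro mult_right_mono abs_ge_self mult_nonneg_nonneg abs_ge_zero)
        finally show ?thesis .
      qed auto
    qed
  qed measurable
qed

lemma weighted_inner_alt: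
  "weighted_inner \<gamma> p q = (\<integral>x. poly (p * q) x * (indicator {-1..1} x * (1 - x\<^sup>2) powr (\<gamma> + 1/2)) \<partial>lborel)"
  unfolding weighted_inner_def set_lebesgue_integral_def
  by (intro Bochner_Integration.integral_cong) auto

context
  fixes \<gamma> :: real
  assumes \<gamma>: "\<gamma> > -1"
begin

lemma weighted_integrable:
  "integrable lborel (\<lambda>x. poly p x * (indicator {-1..1} x * (1 - x\<^sup>2) powr (\<gamma> + 1/2)) :: real)"
  using integrable_continuous_Gegenbauer[of "\<gamma> + 1/2" "poly p"] \<gamma> by (simp add: continuous_intros)

lemma weighted_inner_add: "weighted_inner \<gamma> (p + q) r = weighted_inner \<gamma> p r + weighted_inner \<gamma> q r"
  unfolding weighted_inner_alt distrib_right poly_add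
  using weighted_integrable[of "p * r"] weighted_integrable[of "q * r"] by simp

lemma weighted_inner_smult: "weighted_inner \<gamma> (smult c p) r = c * weighted_inner \<gamma> p r"
  unfolding weighted_inner_alt by (simp add: mult.assoc)

lemma weighted_inner_commute: "weighted_inner \<gamma> p q = weighted_inner \<gamma> q p"
  unfolding weighted_inner_alt by (simp add: mult.commute)

lemma weighted_inner_zero: "weighted_inner \<gamma> 0 q = 0"
  unfolding weighted_inner_alt by simp

lemma weighted_inner_sum: "weighted_inner \<gamma> (\<Sum>i\<in>I. f i) r = (\<Sum>i\<in>I. weighted_inner \<gamma> (f i) r)"
  by (induction I rule: infinite_finite_induct) (auto simp: weighted_inner_add weighted_inner_zero)

lemma weighted_inner_diff: "weighted_inner \<gamma> (p - q) r = weighted_inner \<gamma> p r - weighted_inner \<gamma> q r"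
  using weighted_inner_add[of "p - q" q r] by simp

lemma weighted_inner_nonneg: "weighted_inner \<gamma> p p \<ge> 0"
  unfolding weighted_inner_alt by (intro integral_nonneg_AE AE_I2) auto

text \<open>
  The weight is positive inside the interval, and a nonzero polynomial vanishes only on a finite
  set.
\<close>

lemma weighted_inner_eq_0:
  assumes "weighted_inner \<gamma> p p = 0"
  shows "p = 0"
proof (rule ccontr)
  assume p: "p \<noteq> 0"
  have "AE x in lborel. poly (p * p) x * (indicator {-1..1} x * (1 - x\<^sup>2) powr (\<gamma> + 1/2)) = 0"
    using assms weighted_integrable[of "p * p"] unfolding weighted_inner_alt
    by (subst (asm) integral_nonneg_eq_0_iff_AE) auto
  moreover have "AE x in lborel. poly p x \<noteq> 0"
  proof (rule AE_I')
    show "{x. poly p x = 0} \<in> null_sets lborel"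
      using poly_roots_finite[OF p] by (intro finite_imp_null_set_lborel)
  qed auto
  ultimately have "AE x in lborel. x \<notin> {-1<..<1::real}"
  proof eventually_elim
    case (elim x)
    show ?case
    proof
      assume x: "x \<in> {-1<..<1}"
      then have "x\<^sup>2 < 1" by (auto simp: abs_square_less_1)
      then show False using elim x by auto
    qed
  qed
  then have "{-1<..<1::real} \<in> null_sets lborel" by (subst AE_iff_null_sets) auto
  then show False by (simp add: null_sets_def)
qed

end

text \<open>
  Polynomials of degrees \<open>0, \<dots>, n - 1\<close> span all polynomials of degree below \<open>n\<close>; this form of the
  statement avoids a choice of coefficients.
\<close>

lemma functional_zero_on_graded_family:
  fixes \<phi> :: "real poly \<Rightarrow> 'b::real_algebra_1"
  assumes add: "\<And>p q. \<phi> (p + q) = \<phi> p + \<phi> q" and smult: "\<And>c p. \<phi> (smult c p) = of_real c * \<phi> p"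
    and P: "\<And>m. m < n \<Longrightarrow> degree (P m) = m" "\<And>m. m < n \<Longrightarrow> P m \<noteq> 0" "\<And>m. m < n \<Longrightarrow> \<phi> (P m) = 0"
    and "degree q < n"
  shows "\<phi> q = 0"
  using assms(6)
proof (induction "degree q" arbitrary: q rule: less_induct)
  case less
  have z: "\<phi> 0 = 0" using smult[of 0 0] by simp
  define m where "m = degree q"
  define c where "c = lead_coeff q / lead_coeff (P m)"
  define r where "r = q - smult c (P m)"
  have m: "m < n" using less.prems by (simp add: m_def)
  have q: "q = r + smult c (P m)" by (simp add: r_def)
  have "\<phi> r = 0"
  proof (cases "r = 0")
    case False
    have "lead_coeff (P m) \<noteq> 0" using P(2)[OF m] by simp
    then have "coeff (P m) m \<noteq> 0" using P(1)[OF m] by simp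
    then have "coeff r m = 0"
      by (simp add: r_def c_def P(1)[OF m] flip: m_def)
    moreover have "degree r \<le> m"
      unfolding r_def using P(1)[OF m] by (intro degree_diff_le degree_smult_le[THEN order_trans]) (auto simp: m_def)
    ultimately have "degree r < m"
      using False by (metis le_neq_implies_less leading_coeff_0_iff)
    then show ?thesis using less.hyps[of r] m by (simp add: m_def)
  qed (simp add: z)
  then show ?case by (subst q) (simp add: add smult P(3)[OF m])
qed

context
  fixes \<gamma> :: real
  assumes \<gamma>: "\<gamma> > -1"
begin

text \<open>
  Gram-Schmidt orthogonalization of the monomials.
\<close>

lemma exists_monic_orthogonal:
  "\<exists>p. degree p = n \<and> lead_coeff p = 1 \<and> (\<forall>q. degree q < n \<longrightarrow> weighted_inner \<gamma> p q = 0)"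
proof (induction n rule: less_induct)
  case (less n)
  note wi_simps = weighted_inner_add[OF \<gamma>] weighted_inner_smult[OF \<gamma>] weighted_inner_diff[OF \<gamma>] weighted_inner_sum[OF \<gamma>]
  from less have "\<forall>m. \<exists>p. m < n \<longrightarrow> degree p = m \<and> lead_coeff p = 1 \<and> (\<forall>q. degree q < m \<longrightarrow> weighted_inner \<gamma> p q = 0)"
    by blast
  then obtain P where P: "\<And>m. m < n \<Longrightarrow> degree (P m) = m" "\<And>m. m < n \<Longrightarrow> lead_coeff (P m) = 1"
    "\<And>m q. m < n \<Longrightarrow> degree q < m \<Longrightarrow> weighted_inner \<gamma> (P m) q = 0"
    by metis
  define S where "S = (\<Sum>m<n. smult (weighted_inner \<gamma> (monom 1 n) (P m) / weighted_inner \<gamma> (P m) (P m)) (P m))"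
  define p where "p = monom 1 n - S"
  have orthP: "weighted_inner \<gamma> (P i) (P j) = 0" if "i < n" "j < n" "i \<noteq> j" for i j
    using P that by (metis linorder_neqE_nat weighted_inner_commute[OF \<gamma>])
  have cS: "coeff S k = 0" if "k \<ge> n" for k
    unfolding S_def coeff_sum using that P(1) by (intro sum.neutral) (auto intro!: coeff_eq_0)
  have "coeff p n = 1" "\<And>k. k > n \<Longrightarrow> coeff p k = 0" using cS by (auto simp: p_def)
  then have deg: "degree p = n" by (metis degree_le le_antisym le_degree zero_neq_one)
  have "weighted_inner \<gamma> p q = 0" if "degree q < n" for q
  proof (rule functional_zero_on_graded_family[where P = P, OF _ _ _ _ _ that])
    fix m assume m: "m < n"
    have nz: "P m \<noteq> 0" using P(2)[OF m] by auto
    then show "P m \<noteq> 0" .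
    have "weighted_inner \<gamma> S (P m) = (\<Sum>k<n. if k = m then weighted_inner \<gamma> (monom 1 n) (P m) else 0)"
      unfolding S_def wi_simps using m weighted_inner_eq_0[OF \<gamma>, of "P m"] nz
      by (intro sum.cong) (auto simp: orthP)
    also have "\<dots> = weighted_inner \<gamma> (monom 1 n) (P m)" using m by simp
    finally show "weighted_inner \<gamma> p (P m) = 0" by (simp add: p_def wi_simps)
  qed (use P in \<open>auto simp: weighted_inner_commute[OF \<gamma>, of p] wi_simps\<close>)
  then show ?case using deg \<open>coeff p n = 1\<close> by auto
qed

text \<open>
  Two normalized solutions differ, after scaling by their leading coefficients, by a polynomial of
  smaller degree that is orthogonal to itself. The uniqueness makes the definite description in
  \<open>Lhat\<close> meaningful.
\<close>

lemma Lhat_ex1: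
  "\<exists>!p. degree p = n \<and> lead_coeff p > 0 \<and>
        (\<forall>q. degree q < n \<longrightarrow> weighted_inner \<gamma> p q = 0) \<and>
        sqrt (weighted_inner \<gamma> p p) = sqrt (2 * pi)" (is "\<exists>!p. ?S p")
proof -
  note wi_simps = weighted_inner_add[OF \<gamma>] weighted_inner_smult[OF \<gamma>] weighted_inner_diff[OF \<gamma>]
  note wc = weighted_inner_commute[OF \<gamma>]
  obtain p where p: "degree p = n" "lead_coeff p = 1" "\<And>q. degree q < n \<Longrightarrow> weighted_inner \<gamma> p q = 0"
    using exists_monic_orthogonal by blast
  have pos: "weighted_inner \<gamma> p p > 0"
    using weighted_inner_nonneg[OF \<gamma>, of p] weighted_inner_eq_0[OF \<gamma>, of p] p(2) by fastforce
  define c where "c = sqrt (2 * pi / weighted_inner \<gamma> p p)"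
  have c: "c > 0" using pos by (simp add: c_def)
  have cc: "c * c * weighted_inner \<gamma> p p = 2 * pi"
    using pos by (simp add: c_def)
  have "weighted_inner \<gamma> (smult c p) (smult c p) = 2 * pi"
    unfolding wi_simps wc[of p "smult c p"] using cc by (simp add: wi_simps)
  then have ex: "?S (smult c p)"
    using c p by (simp add: wi_simps)
  moreover have "r = smult c p" if r: "?S r" for r
  proof -
    define d where "d = r - smult (lead_coeff r) p"
    have "d = 0"
    proof (rule ccontr)
      assume nz: "d \<noteq> 0"
      have "coeff d n = 0" using r p by (simp add: d_def)
      moreover have "degree d \<le> n"
        unfolding d_def using r p by (intro degree_diff_le degree_smult_le[THEN order_trans]) auto
      ultimately have dn: "degree d < n"
        using nz by (metis le_neq_implies_less leading_coeff_0_iff)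
      then have "weighted_inner \<gamma> d d = 0"
        using r p(3)[OF dn] by (subst d_def) (simp add: wi_simps)
      then show False using weighted_inner_eq_0[OF \<gamma>] nz by blast
    qed
    then have rp: "r = smult (lead_coeff r) p" by (simp add: d_def)
    define k where "k = lead_coeff r"
    have k: "k > 0" unfolding k_def using r by blast
    have rp: "r = smult k p" using rp by (simp add: k_def)
    have "weighted_inner \<gamma> r r = 2 * pi" using r by simp
    then have "k * k * weighted_inner \<gamma> p p = 2 * pi"
      unfolding rp wi_simps wc[of p "smult k p"] by (simp add: wi_simps)
    then have "k * k * weighted_inner \<gamma> p p = c * c * weighted_inner \<gamma> p p" using cc by simp
    then have "k\<^sup>2 = c\<^sup>2" using pos by (simp add: power2_eq_square)
    then have "k = c" using k c by (simp add: power2_eq_iff_nonneg)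
    then show ?thesis using rp by simp
  qed
  ultimately show ?thesis by (intro ex1I[of _ "smult c p"]) auto
qed

lemma Lhat_spec:
  shows Lhat_degree [simp]: "degree (Lhat \<gamma> n) = n" and Lhat_lead: "lead_coeff (Lhat \<gamma> n) > 0"
    and Lhat_orth: "degree q < n \<Longrightarrow> weighted_inner \<gamma> (Lhat \<gamma> n) q = 0"
    and Lhat_norm: "weighted_inner \<gamma> (Lhat \<gamma> n) (Lhat \<gamma> n) = 2 * pi"
  using theI'[OF Lhat_ex1[of n]] unfolding Lhat_def[symmetric] by (auto simp: real_sqrt_eq_iff)

lemma Lhat_orthogonality: "weighted_inner \<gamma> (Lhat \<gamma> n) (Lhat \<gamma> m) = (if n = m then 2 * pi else 0)"
  using Lhat_orth[of "Lhat \<gamma> m" n] Lhat_orth[of "Lhat \<gamma> n" m] Lhat_norm[of n]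
    weighted_inner_commute[OF \<gamma>, of "Lhat \<gamma> n" "Lhat \<gamma> m"] by (cases n m rule: linorder_cases) auto

lemma weighted_inner_reflect:
  "weighted_inner \<gamma> (pcompose p [:0, -1:]) q = weighted_inner \<gamma> p (pcompose q [:0, -1:])"
proof -
  have "weighted_inner \<gamma> (pcompose p [:0, -1:]) q = (\<integral>x. poly p (- x) * poly q x * (indicator {-1..1} x * (1 - x\<^sup>2) powr (\<gamma> + 1/2)) \<partial>lborel)"
    unfolding weighted_inner_alt by (simp add: poly_pcompose)
  also have "\<dots> = (\<integral>x. poly p (- (- x)) * poly q (- x) * (indicator {-1..1} (- x) * (1 - (- x)\<^sup>2) powr (\<gamma> + 1/2)) \<partial>lborel)"
    using lborel_integral_real_affine[of "-1" "\<lambda>x. poly p (- x) * poly q x * (indicator {-1..1} x * (1 - x\<^sup>2) powr (\<gamma> + 1/2))" 0]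
    by simp
  also have "\<dots> = weighted_inner \<gamma> p (pcompose q [:0, -1:])"
    unfolding weighted_inner_alt
    by (intro Bochner_Integration.integral_cong) (auto simp: poly_pcompose indicator_def)
  finally show ?thesis .
qed

text \<open>
  The weight is even, so the reflected polynomial with corrected sign satisfies the
  characterization of \<open>Lhat\<close>. This parity is what makes the basis elements eigenfunctions of the
  antipodal scattering relation.
\<close>

lemma Lhat_parity: "poly (Lhat \<gamma> n) (- x) = (-1)^n * poly (Lhat \<gamma> n) x"
proof -
  define p where "p = smult ((-1)^n) (pcompose (Lhat \<gamma> n) [:0, -1:])"
  note wi_simps = weighted_inner_smult[OF \<gamma>]
  note wc = weighted_inner_commute[OF \<gamma>]
  have twice: "pcompose (pcompose q [:0, -1:]) [:0, -1:] = q" for q :: "real poly"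
    by (simp add: pcompose_assoc[symmetric] pcompose_pCons)
  have dg: "degree (pcompose q [:0, -1:]) = degree q" for q :: "real poly"
    by (simp add: degree_pcompose)
  have lc: "lead_coeff p = lead_coeff (Lhat \<gamma> n)"
  proof -
    have "lead_coeff (pcompose (Lhat \<gamma> n) [:0, -1:]) = lead_coeff (Lhat \<gamma> n) * (-1)^n"
      using lead_coeff_comp[of "[:0, -1::real:]" "Lhat \<gamma> n"] by simp
    then show ?thesis by (simp add: p_def dg mult.left_commute flip: power_mult_distrib)
  qed
  have 1: "weighted_inner \<gamma> p q = 0" if "degree q < n" for q
    unfolding p_def wi_simps weighted_inner_reflect using that by (simp add: Lhat_orth dg)
  have 2: "weighted_inner \<gamma> p p = 2 * pi"
  proof -
    have "weighted_inner \<gamma> p p = (-1)^n * ((-1)^n * weighted_inner \<gamma> (pcompose (Lhat \<gamma> n) [:0, -1:]) (pcompose (Lhat \<gamma> n) [:0, -1:]))"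
      unfolding p_def wi_simps by (subst wc) (simp add: wi_simps)
    also have "\<dots> = weighted_inner \<gamma> (pcompose (Lhat \<gamma> n) [:0, -1:]) (pcompose (Lhat \<gamma> n) [:0, -1:])"
      by (simp flip: mult.assoc power_mult_distrib)
    also have "\<dots> = 2 * pi" unfolding weighted_inner_reflect twice by (rule Lhat_norm)
    finally show ?thesis .
  qed
  have "degree p = n" by (simp add: p_def dg)
  then have "p = Lhat \<gamma> n"
    using the1_equality[OF Lhat_ex1[of n], of p] 1 2 lc Lhat_lead[of n] unfolding Lhat_def[symmetric] by simp
  then have "poly (Lhat \<gamma> n) (- x) = poly p (- x)" by simp
  also have "\<dots> = (-1)^n * poly (Lhat \<gamma> n) x" by (simp add: p_def poly_pcompose)
  finally show ?thesis .
qed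

end

section \<open>The Radon transform and its adjoint\<close>

lemma Complex_measurable: "(\<lambda>p. Complex (fst p) (snd p)) \<in> borel \<rightarrow>\<^sub>M borel"
  unfolding Complex_eq by (intro borel_measurable_continuous_onI continuous_intros)

lemma Complex_measurable' [measurable (raw)]:
  assumes [measurable]: "f \<in> borel_measurable M" "g \<in> borel_measurable M"
  shows "(\<lambda>x. Complex (f x) (g x)) \<in> borel_measurable M"
  unfolding Complex_eq by measurable

text \<open>
  Lebesgue measure on the complex plane, which is defined through the Euclidean basis, is the
  product measure of the two real coordinates; this gives access to Fubini's theorem.
\<close>

lemma lborel_complex: "distr (lborel \<Otimes>\<^sub>M lborel) borel (\<lambda>p. Complex (fst p) (snd p)) = lborel"
proof (rule lborel_eqI[symmetric])
  have m [measurable]: "(\<lambda>p. Complex (fst p) (snd p)) \<in> lborel \<Otimes>\<^sub>M lborel \<rightarrow>\<^sub>M borel"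
    unfolding lborel_prod using Complex_measurable by simp
  fix l u :: complex assume le: "\<And>b. b \<in> Basis \<Longrightarrow> l \<bullet> b \<le> u \<bullet> b"
  have le': "Re l \<le> Re u" "Im l \<le> Im u" using le[of 1] le[of \<i>] by (auto simp: Basis_complex_def)
  have "(\<lambda>p. Complex (fst p) (snd p)) -` box l u \<inter> space (lborel \<Otimes>\<^sub>M lborel) = {Re l<..<Re u} \<times> {Im l<..<Im u}"
    by (auto simp: box_def Basis_complex_def space_pair_measure)
  then have "emeasure (distr (lborel \<Otimes>\<^sub>M lborel) borel (\<lambda>p. Complex (fst p) (snd p))) (box l u)
      = emeasure (lborel \<Otimes>\<^sub>M lborel) ({Re l<..<Re u} \<times> {Im l<..<Im u})"
    by (subst emeasure_distr) auto
  also have "\<dots> = ennreal (\<Prod>b\<in>Basis. (u - l) \<bullet> b)"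
    using le' by (subst lborel.emeasure_pair_measure_Times) (auto simp: Basis_complex_def ennreal_mult)
  finally show "emeasure (distr (lborel \<Otimes>\<^sub>M lborel) borel (\<lambda>p. Complex (fst p) (snd p))) (box l u) = ennreal (\<Prod>b\<in>Basis. (u - l) \<bullet> b)" .
qed simp

lemma nn_integral_complex:
  assumes [measurable]: "f \<in> borel_measurable borel"
  shows "(\<integral>\<^sup>+z. f z \<partial>lborel) = (\<integral>\<^sup>+x. (\<integral>\<^sup>+y. f (Complex x y) \<partial>lborel) \<partial>lborel)"
    and "(\<integral>\<^sup>+z. f z \<partial>lborel) = (\<integral>\<^sup>+y. (\<integral>\<^sup>+x. f (Complex x y) \<partial>lborel) \<partial>lborel)"
proof -
  have m [measurable]: "(\<lambda>p. Complex (fst p) (snd p)) \<in> lborel \<Otimes>\<^sub>M lborel \<rightarrow>\<^sub>M borel"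
    unfolding lborel_prod using Complex_measurable by simp
  have m2: "(\<lambda>p. f (Complex (fst p) (snd p))) \<in> borel_measurable (lborel \<Otimes>\<^sub>M lborel)"
    by (rule measurable_compose[OF m]) measurable
  have "(\<integral>\<^sup>+z. f z \<partial>lborel) = (\<integral>\<^sup>+p. f (Complex (fst p) (snd p)) \<partial>(lborel \<Otimes>\<^sub>M lborel))"
    by (subst lborel_complex[symmetric], subst nn_integral_distr) auto
  then show "(\<integral>\<^sup>+z. f z \<partial>lborel) = (\<integral>\<^sup>+x. (\<integral>\<^sup>+y. f (Complex x y) \<partial>lborel) \<partial>lborel)"
    "(\<integral>\<^sup>+z. f z \<partial>lborel) = (\<integral>\<^sup>+y. (\<integral>\<^sup>+x. f (Complex x y) \<partial>lborel) \<partial>lborel)"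
    using lborel.nn_integral_fst[OF m2] lborel_pair.nn_integral_snd[OF m2] by simp_all
qed

lemma nn_integral_shift:
  fixes f :: "real \<Rightarrow> ennreal"
  assumes [measurable]: "f \<in> borel_measurable borel"
  shows "(\<integral>\<^sup>+x. f (x + t) \<partial>lborel) = (\<integral>\<^sup>+x. f x \<partial>lborel)"
  by (subst (2) nn_integral_real_affine[where c=1 and t=t]) (auto simp: add.commute)

text \<open>
  Each shear is a translation in one coordinate by an amount that depends on the other one.
\<close>

lemma nn_integral_shear:
  assumes [measurable]: "f \<in> borel_measurable borel"
  shows "(\<integral>\<^sup>+z. f (Complex (Re z + a * Im z) (Im z)) \<partial>lborel) = (\<integral>\<^sup>+z. f z \<partial>lborel)"
    and "(\<integral>\<^sup>+z. f (Complex (Re z) (Im z + a * Re z)) \<partial>lborel) = (\<integral>\<^sup>+z. f z \<partial>lborel)"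
proof -
  show "(\<integral>\<^sup>+z. f (Complex (Re z + a * Im z) (Im z)) \<partial>lborel) = (\<integral>\<^sup>+z. f z \<partial>lborel)"
    using nn_integral_shift[of "\<lambda>x. f (Complex x y)" "a * y" for y]
    by (simp add: nn_integral_complex(2))
  show "(\<integral>\<^sup>+z. f (Complex (Re z) (Im z + a * Re z)) \<partial>lborel) = (\<integral>\<^sup>+z. f z \<partial>lborel)"
    using nn_integral_shift[of "\<lambda>y. f (Complex x y)" "a * x" for x]
    by (simp add: nn_integral_complex(1))
qed

text \<open>
  A rotation other than the half turn is a product of three shears.
\<close>

lemma nn_integral_lborel_rotate_neq:
  assumes f [measurable]: "f \<in> borel_measurable borel" and w: "cmod w = 1" "w \<noteq> -1"
  shows "(\<integral>\<^sup>+z. f (w * z) \<partial>lborel) = (\<integral>\<^sup>+z. f z \<partial>lborel)"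
proof -
  (* Minus the tangent of half the rotation angle. *)
  define a where "a = - Im w / (1 + Re w)"
  have sq: "(Re w)\<^sup>2 + (Im w)\<^sup>2 = 1" using w(1) by (metis cmod_power2 one_power2)
  have nz: "1 + Re w \<noteq> 0"
  proof
    assume "1 + Re w = 0"
    then have "Re w = -1" by simp
    then show False using sq w(2) by (simp add: complex_eq_iff)
  qed
  have "1 + a * Im w = (1 + Re w - (Im w)\<^sup>2) / (1 + Re w)"
    using nz by (simp add: a_def field_simps power2_eq_square)
  also have "1 + Re w - (Im w)\<^sup>2 = Re w * (1 + Re w)" using sq by (simp add: power2_eq_square algebra_simps)
  finally have ab: "1 + a * Im w = Re w" using nz by simp
  have a1: "a * (1 + Re w) = - Im w" using nz by (simp add: a_def)
  let ?S = "\<lambda>z. Complex (Re z + a * Im z) (Im z)" and ?T = "\<lambda>z. Complex (Re z) (Im z + Im w * Re z)"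
  have eq: "?S (?T (?S z)) = w * z" for z
  proof (rule complex_eqI)
    have "Re (?S (?T (?S z))) = (1 + a * Im w) * Re z + (a + a * (1 + a * Im w)) * Im z"
      by (simp add: algebra_simps)
    also have "\<dots> = Re w * Re z + (a * (1 + Re w)) * Im z" unfolding ab by (simp add: algebra_simps)
    finally show "Re (?S (?T (?S z))) = Re (w * z)" unfolding a1 by simp
    have "Im (?S (?T (?S z))) = (1 + a * Im w) * Im z + Im w * Re z"
      by (simp add: algebra_simps)
    then show "Im (?S (?T (?S z))) = Im (w * z)" unfolding ab by simp
  qed
  have "(\<integral>\<^sup>+z. f (w * z) \<partial>lborel) = (\<integral>\<^sup>+z. f (?S (?T (?S z))) \<partial>lborel)" unfolding eq ..
  also have "\<dots> = (\<integral>\<^sup>+z. f (?S (?T z)) \<partial>lborel)"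
    by (rule nn_integral_shear(1)[of "\<lambda>z. f (?S (?T z))"]) measurable
  also have "\<dots> = (\<integral>\<^sup>+z. f (?S z) \<partial>lborel)"
    by (rule nn_integral_shear(2)[of "\<lambda>z. f (?S z)"]) measurable
  also have "\<dots> = (\<integral>\<^sup>+z. f z \<partial>lborel)"
    by (rule nn_integral_shear(1)[OF f])
  finally show ?thesis .
qed

text \<open>
  The half turn is covered by writing a rotation as the square of the rotation by the principal
  square root, whose real part is nonnegative.
\<close>

lemma nn_integral_lborel_rotate:
  assumes [measurable]: "f \<in> borel_measurable borel" and w: "cmod w = 1"
  shows "(\<integral>\<^sup>+z. f (w * z) \<partial>lborel) = (\<integral>\<^sup>+z. f z \<partial>lborel)"
proof -
  define c where "c = csqrt w"
  have cc: "c * c = w" by (simp add: c_def flip: power2_eq_square)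
  have "cmod c * cmod c = 1" using cc w by (metis norm_mult)
  then have c: "cmod c = 1" by (metis norm_ge_zero power2_eq_square power2_eq_1_iff not_one_le_zero neg_0_le_iff_le)
  have c': "c \<noteq> -1" using Re_csqrt[of w] by (auto simp: c_def simp del: csqrt.simps)
  have "(\<integral>\<^sup>+z. f (w * z) \<partial>lborel) = (\<integral>\<^sup>+z. f (c * (c * z)) \<partial>lborel)"
    by (simp add: cc flip: mult.assoc)
  also have "\<dots> = (\<integral>\<^sup>+z. f (c * z) \<partial>lborel)"
    by (rule nn_integral_lborel_rotate_neq[of "\<lambda>z. f (c * z)"]) (use c c' in auto)
  also have "\<dots> = (\<integral>\<^sup>+z. f z \<partial>lborel)"
    by (rule nn_integral_lborel_rotate_neq) (use c c' in auto)
  finally show ?thesis .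
qed

abbreviation line_measure :: "(complex \<times> real) measure" where
  "line_measure \<equiv> circle_measure \<Otimes>\<^sub>M lborel"

text \<open>
  A point of the line \<open>(v, s)\<close>, with the direction of the line kept as first component.
\<close>

definition line_point :: "(complex \<times> real) \<times> real \<Rightarrow> complex \<times> complex" where
  "line_point = (\<lambda>((v, s), \<tau>). (v, v * Complex \<tau> s))"

interpretation line: sigma_finite_measure line_measure
  by (rule circle_lborel.sigma_finite_measure_axioms)

interpretation line_lborel: pair_sigma_finite line_measure "lborel :: real measure"
  by (intro pair_sigma_finite.intro) unfold_locales

lemma line_point_measurable [measurable]: "line_point \<in> line_measure \<Otimes>\<^sub>M lborel \<rightarrow>\<^sub>M circle_measure \<Otimes>\<^sub>M lborel"
  unfolding line_point_def case_prod_unfold by measurable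

text \<open>
  The lines with fixed direction foliate the plane, and rotations preserve area. So pairs (line,
  point on it) and pairs (direction, point) carry the same measure; the adjoint formula for the
  Radon transform is an instance of this.
\<close>

lemma distr_line_point:
  "distr (line_measure \<Otimes>\<^sub>M lborel) (circle_measure \<Otimes>\<^sub>M lborel) line_point = circle_measure \<Otimes>\<^sub>M lborel"
proof (rule measure_eqI)
  fix A assume "A \<in> sets (distr (line_measure \<Otimes>\<^sub>M lborel) (circle_measure \<Otimes>\<^sub>M lborel) line_point)"
  then have [measurable]: "A \<in> sets (circle_measure \<Otimes>\<^sub>M (lborel :: complex measure))" by (simp only: sets_distr)
  define F :: "complex \<times> complex \<Rightarrow> ennreal" where "F = indicator A"
  have F [measurable]: "F \<in> borel_measurable (circle_measure \<Otimes>\<^sub>M lborel)" unfolding F_def by measurable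
  have Fv [measurable]: "(\<lambda>z. F (v, z)) \<in> borel_measurable borel" for v
    using measurable_Pair2[OF F, of v] by simp
  have "emeasure (distr (line_measure \<Otimes>\<^sub>M lborel) (circle_measure \<Otimes>\<^sub>M lborel) line_point) A
      = (\<integral>\<^sup>+q. F (line_point q) \<partial>(line_measure \<Otimes>\<^sub>M lborel))"
  proof -
    have "A \<in> sets (distr (line_measure \<Otimes>\<^sub>M lborel) (circle_measure \<Otimes>\<^sub>M lborel) line_point)"
      unfolding sets_distr by fact
    then have "emeasure (distr (line_measure \<Otimes>\<^sub>M lborel) (circle_measure \<Otimes>\<^sub>M lborel) line_point) A
      = (\<integral>\<^sup>+q. F q \<partial>distr (line_measure \<Otimes>\<^sub>M lborel) (circle_measure \<Otimes>\<^sub>M lborel) line_point)"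
      unfolding F_def by (rule nn_integral_indicator[symmetric])
    also have "\<dots> = (\<integral>\<^sup>+q. F (line_point q) \<partial>(line_measure \<Otimes>\<^sub>M lborel))"
      by (subst nn_integral_distr) auto
    finally show ?thesis .
  qed
  also have "\<dots> = (\<integral>\<^sup>+p. (\<integral>\<^sup>+\<tau>. F (line_point (p, \<tau>)) \<partial>lborel) \<partial>line_measure)"
    by (rule lborel.nn_integral_fst[symmetric]) measurable
  also have "\<dots> = (\<integral>\<^sup>+v. (\<integral>\<^sup>+s. (\<integral>\<^sup>+\<tau>. F (line_point ((v, s), \<tau>)) \<partial>lborel) \<partial>lborel) \<partial>circle_measure)"
    by (rule lborel.nn_integral_fst[symmetric]) measurable
  also have "\<dots> = (\<integral>\<^sup>+v. (\<integral>\<^sup>+z. F (v, v * z) \<partial>lborel) \<partial>circle_measure)"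
    by (intro nn_integral_cong) (simp add: line_point_def nn_integral_complex(2))
  also have "\<dots> = (\<integral>\<^sup>+v. (\<integral>\<^sup>+z. F (v, z) \<partial>lborel) \<partial>circle_measure)"
    using AE_circle_norm by (intro nn_integral_cong_AE) (auto elim!: eventually_mono intro!: nn_integral_lborel_rotate)
  also have "\<dots> = (\<integral>\<^sup>+q. F q \<partial>(circle_measure \<Otimes>\<^sub>M lborel))"
    by (rule lborel.nn_integral_fst) measurable
  also have "\<dots> = emeasure (circle_measure \<Otimes>\<^sub>M lborel) A"
    unfolding F_def by (rule nn_integral_indicator) fact
  finally show "emeasure (distr (line_measure \<Otimes>\<^sub>M lborel) (circle_measure \<Otimes>\<^sub>M lborel) line_point) A
      = emeasure (circle_measure \<Otimes>\<^sub>M lborel) A" .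
qed simp

definition radon :: "(complex \<Rightarrow> complex) \<Rightarrow> complex \<times> real \<Rightarrow> complex" where
  "radon h p = (\<integral>\<tau>. h (fst p * Complex \<tau> (snd p)) \<partial>lborel)"

lemma AE_circle_fst: "AE q in circle_measure \<Otimes>\<^sub>M (lborel :: 'a::euclidean_space measure). cmod (fst q) = 1"
proof (rule circle_lborel.AE_pair_measure)
  show "AE x in circle_measure. AE y in (lborel :: 'a measure). cmod (fst (x, y)) = 1"
    using AE_circle_norm by eventually_elim simp
qed measurable

text \<open>
  Among the lines through \<open>z\<close>, the one with direction \<open>v\<close> has distance \<open>Im (z * cnj v)\<close>. The third claim
  says that \<open>h\<close> is integrable along almost every line, so that the Bochner integral in \<open>radon\<close> is the
  intended one there.
\<close>

theorem radon_adjoint: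
  fixes h :: "complex \<Rightarrow> complex" and k :: "complex \<times> real \<Rightarrow> complex"
  assumes h: "integrable lborel h" and supp: "\<And>z. cmod z > 1 \<Longrightarrow> h z = 0"
    and k: "k \<in> borel_measurable borel" and B: "\<And>v s. cmod v = 1 \<Longrightarrow> \<bar>s\<bar> \<le> 1 \<Longrightarrow> cmod (k (v, s)) \<le> B"
  shows "integrable line_measure (\<lambda>p. radon h p * k p)" (is ?I1)
    and "(\<integral>p. radon h p * k p \<partial>line_measure)
      = (\<integral>z. h z * (\<integral>v. k (v, Im (z * cnj v)) \<partial>circle_measure) \<partial>lborel)" (is ?I2)
    and "AE p in line_measure. integrable lborel (\<lambda>\<tau>. h (fst p * Complex \<tau> (snd p)))" (is ?I3)
proof -
  let ?N = "circle_measure \<Otimes>\<^sub>M (lborel :: complex measure)"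
  have km [measurable]: "k \<in> borel_measurable line_measure"
    using k by (subst measurable_cong_sets[OF borel_complex_real refl])
  have kc [measurable]: "k \<in> borel_measurable (borel \<Otimes>\<^sub>M borel)"
    using k unfolding borel_prod .
  have hm [measurable]: "h \<in> borel_measurable borel" using h by simp
  have I0: "integrable ?N (\<lambda>q. h (snd q))"
  proof (rule circle_lborel.Fubini_integrable)
    show "integrable circle_measure (\<lambda>v. \<integral>z. norm (h (snd (v, z))) \<partial>lborel)"
      using circle.integrable_const by simp
  qed (use h in auto)
  (* The integrand on pairs (direction, point), which unites both sides. *)
  define Q where "Q q = h (snd q) * k (fst q, Im (snd q * cnj (fst q)))" for q
  have Qm [measurable]: "Q \<in> borel_measurable ?N" unfolding Q_def by measurable
  have IQ: "integrable ?N Q"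
  proof (rule Bochner_Integration.integrable_bound)
    show "integrable ?N (\<lambda>q. of_real B * h (snd q))" using I0 by simp
    show "AE q in ?N. norm (Q q) \<le> norm (of_real B * h (snd q))"
      using AE_circle_fst
    proof eventually_elim
      case (elim q)
      show ?case
      proof (cases "cmod (snd q) \<le> 1")
        case True
        have "\<bar>Im (snd q * cnj (fst q))\<bar> \<le> cmod (snd q * cnj (fst q))" by (rule abs_Im_le_cmod)
        also have "\<dots> \<le> 1" using True elim by (simp add: norm_mult)
        finally have "cmod (k (fst q, Im (snd q * cnj (fst q)))) \<le> B" by (rule B[OF elim])
        also have "B \<le> \<bar>B\<bar>" by simp
        finally have "cmod (h (snd q)) * cmod (k (fst q, Im (snd q * cnj (fst q)))) \<le> cmod (h (snd q)) * \<bar>B\<bar>"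
          by (intro mult_left_mono) auto
        then show ?thesis by (simp add: Q_def norm_mult mult.commute)
      qed (simp add: Q_def supp)
    qed
  qed measurable
  have pull: "integrable (line_measure \<Otimes>\<^sub>M lborel) (\<lambda>r. F (line_point r))"
    "(\<integral>r. F (line_point r) \<partial>(line_measure \<Otimes>\<^sub>M lborel)) = (\<integral>q. F q \<partial>?N)"
    if "integrable ?N F" for F :: "complex \<times> complex \<Rightarrow> complex"
  proof -
    have [measurable]: "F \<in> borel_measurable ?N" using that by simp
    show "integrable (line_measure \<Otimes>\<^sub>M lborel) (\<lambda>r. F (line_point r))"
      using that by (subst (asm) distr_line_point[symmetric], subst (asm) integrable_distr_eq) auto
    show "(\<integral>r. F (line_point r) \<partial>(line_measure \<Otimes>\<^sub>M lborel)) = (\<integral>q. F q \<partial>?N)"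
      using integral_distr[of line_point "line_measure \<Otimes>\<^sub>M lborel" ?N F] by (simp add: distr_line_point)
  qed
  show ?I3
    using line_lborel.AE_integrable_fst'[OF pull(1)[OF I0]] by (simp add: line_point_def case_prod_unfold)
  have rm [measurable]: "radon h \<in> borel_measurable line_measure"
    unfolding radon_def by measurable
  have fibre: "AE p in line_measure. (\<integral>\<tau>. Q (line_point (p, \<tau>)) \<partial>lborel) = radon h p * k p"
    using AE_circle_fst
  proof eventually_elim
    case (elim p)
    have "fst p * cnj (fst p) = 1" using elim by (simp add: complex_norm_square[symmetric])
    then have "fst p * w * cnj (fst p) = w" for w by (metis mult.commute mult.left_commute mult_1_right)
    then have im: "Im (fst p * Complex \<tau> (snd p) * cnj (fst p)) = snd p" for \<tau>
      by (simp only: complex.sel)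
    have "Q (line_point (p, \<tau>)) = h (fst p * Complex \<tau> (snd p)) * k p" for \<tau>
      unfolding Q_def line_point_def case_prod_unfold fst_conv snd_conv im prod.collapse ..
    then show ?case by (simp add: radon_def)
  qed
  show ?I1
    by (rule integrable_cong_AE_imp[OF line_lborel.integrable_fst'[OF pull(1)[OF IQ]] _ fibre]) measurable
  have "(\<integral>p. radon h p * k p \<partial>line_measure) = (\<integral>p. (\<integral>\<tau>. Q (line_point (p, \<tau>)) \<partial>lborel) \<partial>line_measure)"
    using fibre by (intro integral_cong_AE) (auto elim!: eventually_mono)
  also have "\<dots> = (\<integral>q. Q q \<partial>?N)"
    using line_lborel.integral_fst'[OF pull(1)[OF IQ]] pull(2)[OF IQ] by simp
  also have "\<dots> = (\<integral>z. (\<integral>v. Q (v, z) \<partial>circle_measure) \<partial>lborel)"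
    using circle_lborel.integral_snd[of "\<lambda>v z. Q (v, z)"] IQ by simp
  also have "\<dots> = (\<integral>z. h z * (\<integral>v. k (v, Im (z * cnj v)) \<partial>circle_measure) \<partial>lborel)"
    by (simp add: Q_def)
  finally show ?I2 .
qed

section \<open>The weighted disk\<close>

text \<open>
  Lebesgue density of \<open>disk_measure\<close>, extended by \<open>0\<close>, so that integrals over the disk and over chords
  can be taken over the whole plane and over whole lines.
\<close>

definition disk_weight :: "real \<Rightarrow> complex \<Rightarrow> real" where
  "disk_weight \<gamma> z = indicator (cball 0 1) z * bdf z powr \<gamma>"

lemma disk_weight_measurable [measurable]: "disk_weight \<gamma> \<in> borel_measurable borel"
proof -
  have [measurable]: "cball (0::complex) 1 \<in> sets borel" by simp
  show ?thesis unfolding disk_weight_def bdf_def by measurable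
qed

lemma disk_weight_nonneg: "disk_weight \<gamma> z \<ge> 0"
  by (simp add: disk_weight_def)

lemma disk_weight_rotate: "cmod v = 1 \<Longrightarrow> disk_weight \<gamma> (v * z) = disk_weight \<gamma> z"
  by (simp add: disk_weight_def bdf_def norm_mult indicator_def)

text \<open>
  The chord at distance \<open>s\<close> has half-length \<open>sqrt (1 - s\<^sup>2)\<close>. When it is rescaled to \<open>[-1, 1]\<close>, the
  weight factors, because \<open>1 - s\<^sup>2 - (1 - s\<^sup>2) x\<^sup>2 = (1 - s\<^sup>2) (1 - x\<^sup>2)\<close>.
\<close>

lemma disk_weight_chord:
  assumes "\<bar>s\<bar> < 1"
  shows "disk_weight \<gamma> (Complex (sqrt (1 - s\<^sup>2) * x) s)
    = (1 - s\<^sup>2) powr \<gamma> * (indicator {-1..1} x * (1 - x\<^sup>2) powr \<gamma>)"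
proof -
  have s: "1 - s\<^sup>2 > 0" using assms by (simp add: abs_square_less_1)
  have n: "(cmod (Complex (sqrt (1 - s\<^sup>2) * x) s))\<^sup>2 = (1 - s\<^sup>2) * x\<^sup>2 + s\<^sup>2"
    using s by (simp add: cmod_power2 power_mult_distrib)
  then have b: "bdf (Complex (sqrt (1 - s\<^sup>2) * x) s) = (1 - s\<^sup>2) * (1 - x\<^sup>2)"
    by (simp add: bdf_def algebra_simps)
  have "cmod (Complex (sqrt (1 - s\<^sup>2) * x) s) \<le> 1 \<longleftrightarrow> bdf (Complex (sqrt (1 - s\<^sup>2) * x) s) \<ge> 0"
    unfolding bdf_def by (simp add: abs_square_le_1)
  also have "\<dots> \<longleftrightarrow> x \<in> {-1..1}"
  proof -
    have "(1 - s\<^sup>2) * (1 - x\<^sup>2) \<ge> 0 \<longleftrightarrow> 1 - x\<^sup>2 \<ge> 0" using s by (simp only: zero_le_mult_iff) linarith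
    also have "\<dots> \<longleftrightarrow> x \<in> {-1..1}" by (auto simp: abs_square_le_1 abs_le_iff)
    finally show ?thesis unfolding b .
  qed
  finally have iff: "cmod (Complex (sqrt (1 - s\<^sup>2) * x) s) \<le> 1 \<longleftrightarrow> x \<in> {-1..1}" .
  show ?thesis
  proof (cases "x \<in> {-1..1}")
    case True
    then have "x\<^sup>2 \<le> 1" by (simp add: abs_square_le_1 abs_le_iff)
    then show ?thesis
      unfolding disk_weight_def b using s iff True by (simp add: powr_mult indicator_def)
  next
    case False
    then show ?thesis using iff by (simp add: disk_weight_def indicator_def)
  qed
qed

lemma disk_weight_off_chord: "\<bar>s\<bar> > 1 \<Longrightarrow> disk_weight \<gamma> (Complex x s) = 0"
  using abs_Im_le_cmod[of "Complex x s"] by (auto simp: disk_weight_def indicator_def)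

lemma AE_abs_neq_1: "AE s in lborel. \<bar>s::real\<bar> \<noteq> 1"
  using AE_lborel_singleton[of "1::real"] AE_lborel_singleton[of "-1::real"] by eventually_elim auto

lemma integrable_disk_weight:
  assumes \<gamma>: "\<gamma> > -1"
  shows "integrable lborel (disk_weight \<gamma>)"
proof (rule integrableI_bounded)
  define m where "m = (\<integral>\<^sup>+x. ennreal (indicator {-1..1} x * (1 - x\<^sup>2) powr \<gamma>) \<partial>lborel)"
  have m: "m < \<infinity>"
    using integrable_Gegenbauer_weight[OF \<gamma>] by (simp add: m_def integrable_iff_bounded)
  have chord: "(\<integral>\<^sup>+\<tau>. ennreal (disk_weight \<gamma> (Complex \<tau> s)) \<partial>lborel)
      = ennreal (indicator {-1..1} s * (1 - s\<^sup>2) powr (\<gamma> + 1/2)) * m" if "\<bar>s\<bar> \<noteq> 1" for s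
  proof (cases "\<bar>s\<bar> < 1")
    case True
    then have s: "1 - s\<^sup>2 > 0" by (simp add: abs_square_less_1)
    have "(\<integral>\<^sup>+\<tau>. ennreal (disk_weight \<gamma> (Complex \<tau> s)) \<partial>lborel)
       = ennreal (sqrt (1 - s\<^sup>2)) * (\<integral>\<^sup>+x. ennreal (disk_weight \<gamma> (Complex (sqrt (1 - s\<^sup>2) * x) s)) \<partial>lborel)"
      using s by (subst nn_integral_real_affine[where c = "sqrt (1 - s\<^sup>2)" and t = 0]) auto
    also have "\<dots> = ennreal (sqrt (1 - s\<^sup>2)) * (ennreal ((1 - s\<^sup>2) powr \<gamma>) * m)"
      unfolding disk_weight_chord[OF True] m_def
      by (subst nn_integral_cmult[symmetric]) (auto simp: ennreal_mult)
    also have "\<dots> = ennreal (sqrt (1 - s\<^sup>2) * (1 - s\<^sup>2) powr \<gamma>) * m"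
      using s by (simp add: ennreal_mult mult.assoc)
    also have "sqrt (1 - s\<^sup>2) * (1 - s\<^sup>2) powr \<gamma> = (1 - s\<^sup>2) powr (\<gamma> + 1/2)"
      using s by (simp add: powr_add powr_half_sqrt)
    finally show ?thesis using True by (simp add: indicator_def abs_less_iff)
  next
    case False
    then have "\<bar>s\<bar> > 1" using that by simp
    then show ?thesis by (auto simp: disk_weight_off_chord indicator_def)
  qed
  have "(\<integral>\<^sup>+z. ennreal (norm (disk_weight \<gamma> z)) \<partial>lborel) = (\<integral>\<^sup>+z. ennreal (disk_weight \<gamma> z) \<partial>lborel)"
    by (simp add: disk_weight_nonneg)
  also have "\<dots> = (\<integral>\<^sup>+s. (\<integral>\<^sup>+\<tau>. ennreal (disk_weight \<gamma> (Complex \<tau> s)) \<partial>lborel) \<partial>lborel)"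
    by (rule nn_integral_complex) measurable
  also have "\<dots> = (\<integral>\<^sup>+s. ennreal (indicator {-1..1} s * (1 - s\<^sup>2) powr (\<gamma> + 1/2)) * m \<partial>lborel)"
    using AE_abs_neq_1 by (intro nn_integral_cong_AE) (auto elim!: eventually_mono simp: chord)
  also have "\<dots> = (\<integral>\<^sup>+s. ennreal (indicator {-1..1} s * (1 - s\<^sup>2) powr (\<gamma> + 1/2)) \<partial>lborel) * m"
    by (rule nn_integral_multc) measurable
  also have "\<dots> < \<infinity>"
    using integrable_Gegenbauer_weight[of "\<gamma> + 1/2"] \<gamma> m
    by (simp add: integrable_iff_bounded ennreal_mult_less_top)
  finally show "(\<integral>\<^sup>+z. ennreal (norm (disk_weight \<gamma> z)) \<partial>lborel) < \<infinity>" .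
qed measurable

lemma disk_integral:
  fixes F :: "complex \<Rightarrow> 'b::{banach, second_countable_topology}"
  assumes F: "F \<in> borel_measurable (disk_measure \<gamma>)"
  shows disk_integrable_iff: "integrable (disk_measure \<gamma>) F \<longleftrightarrow> integrable lborel (\<lambda>z. disk_weight \<gamma> z *\<^sub>R F z)"
    and "(\<integral>z. F z \<partial>disk_measure \<gamma>) = (\<integral>z. disk_weight \<gamma> z *\<^sub>R F z \<partial>lborel)"
proof -
  have Fm: "F \<in> borel_measurable (restrict_space lborel (cball 0 1))"
    using F by (simp add: disk_measure_def)
  have w: "(\<lambda>z. bdf z powr \<gamma>) \<in> borel_measurable (restrict_space lborel (cball 0 1))"
    unfolding bdf_def by (intro measurable_restrict_space1) measurable
  show "integrable (disk_measure \<gamma>) F \<longleftrightarrow> integrable lborel (\<lambda>z. disk_weight \<gamma> z *\<^sub>R F z)"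
    unfolding disk_measure_def using w Fm
    by (subst integrable_density) (auto simp: integrable_restrict_space disk_weight_def)
  show "(\<integral>z. F z \<partial>disk_measure \<gamma>) = (\<integral>z. disk_weight \<gamma> z *\<^sub>R F z \<partial>lborel)"
    unfolding disk_measure_def using w Fm
    by (subst integral_density) (auto simp: integral_restrict_space disk_weight_def)
qed

text \<open>
  The measure of the disk is finite, so square-integrable functions are integrable.
\<close>

lemma integrable_weighted_L2:
  assumes \<gamma>: "\<gamma> > -1" and g: "g \<in> L2 (disk_measure \<gamma>)"
  shows "integrable lborel (\<lambda>z. disk_weight \<gamma> z *\<^sub>R g z)"
proof -
  have gm: "g \<in> borel_measurable (disk_measure \<gamma>)" using g by (rule L2_measurable)
  have "integrable (disk_measure \<gamma>) (\<lambda>_. 1 :: real)"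
    using integrable_disk_weight[OF \<gamma>] by (subst disk_integrable_iff) auto
  then have "integrable (disk_measure \<gamma>) (\<lambda>z. 1 + (cmod (g z))\<^sup>2)"
    using L2_integrable_sq[OF g] by (rule Bochner_Integration.integrable_add)
  then have "integrable (disk_measure \<gamma>) g"
  proof (rule Bochner_Integration.integrable_bound[OF _ gm], intro AE_I2)
    fix z
    have "cmod (g z) \<le> 1 + (cmod (g z))\<^sup>2"
    proof -
      have "2 * cmod (g z) \<le> 1 + (cmod (g z))\<^sup>2" using sum_squares_bound[of 1 "cmod (g z)"] by simp
      then show ?thesis using norm_ge_zero[of "g z"] by linarith
    qed
    then show "norm (g z) \<le> norm (1 + (cmod (g z))\<^sup>2)" by simp
  qed
  then show ?thesis using disk_integrable_iff[OF gm] by simp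
qed

section \<open>The fan-beam basis\<close>

text \<open>
  The index \<open>(n, l)\<close> consists of the degree and the frequency in \<open>v\<close>; it unifies \<open>psi_plus\<close> and
  \<open>psi_minus\<close>, for which \<open>l = n - 2 k\<close> and \<open>l = n - 2 k + 1\<close>.
\<close>

definition fan_basis :: "real \<Rightarrow> nat \<times> int \<Rightarrow> real \<times> real \<Rightarrow> complex" where
  "fan_basis \<gamma> i x = complex_of_real (1 / (2 * pi) * cos (snd x) powr (2 * \<gamma> + 1)) *
     cis (of_int (snd i) * (fst x + snd x + pi)) * complex_of_real (poly (Lhat \<gamma> (fst i)) (sin (snd x)))"

lemma psi_plus_fan_basis: "psi_plus \<gamma> n k = fan_basis \<gamma> (n, int n - 2 * k)"
  by (auto simp: psi_plus_def fan_basis_def fun_eq_iff)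

lemma psi_minus_fan_basis: "psi_minus \<gamma> n k = fan_basis \<gamma> (n, int n - 2 * k + 1)"
  by (auto simp: psi_minus_def psi_plus_def fan_basis_def fun_eq_iff cis_mult algebra_simps)

definition beam_basis :: "real \<Rightarrow> nat \<times> int \<Rightarrow> complex \<times> real \<Rightarrow> complex" where
  "beam_basis \<gamma> i p = of_real (1 / (2 * pi) * (1 - (snd p)\<^sup>2) powr (\<gamma> + 1/2)) * fst p powi snd i
     * of_real (poly (Lhat \<gamma> (fst i)) (snd p))"

text \<open>
  The conjugate of \<open>beam_basis\<close> times the density of \<open>beam_measure\<close>. The two powers of \<open>1 - s\<^sup>2\<close> cancel,
  so this function is bounded on the cylinder, and \<open>radon_adjoint\<close> applies to it.
\<close>

definition beam_kernel :: "real \<Rightarrow> nat \<times> int \<Rightarrow> complex \<times> real \<Rightarrow> complex" where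
  "beam_kernel \<gamma> i p = of_real (indicator {-1..1} (snd p) / (2 * pi)) * cnj (fst p powi snd i)
     * of_real (poly (Lhat \<gamma> (fst i)) (snd p))"

lemma power_int_measurable [measurable]: "(\<lambda>z::complex. z powi l) \<in> borel_measurable borel"
  unfolding power_int_def by measurable

lemma poly_measurable [measurable]: "poly (p :: real poly) \<in> borel_measurable borel"
  by (intro borel_measurable_continuous_onI continuous_intros)

lemma beam_basis_measurable [measurable]: "beam_basis \<gamma> i \<in> borel_measurable borel"
  unfolding beam_basis_def by measurable

lemma beam_kernel_measurable [measurable]: "beam_kernel \<gamma> i \<in> borel_measurable borel"
  unfolding beam_kernel_def by measurable

lemma measurable_line: "f \<in> borel_measurable borel \<Longrightarrow> f \<in> borel_measurable line_measure"
  by (subst measurable_cong_sets[OF borel_complex_real refl])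

lemma fan_basis_beam:
  assumes "x \<in> inflow_domain"
  shows "fan_basis \<gamma> i x = beam_basis \<gamma> i (beam_coords x)"
proof -
  have c: "cos (snd x) \<ge> 0" using assms by (intro cos_ge_zero) auto
  have "(1 - (sin (snd x))\<^sup>2) powr (\<gamma> + 1/2) = cos (snd x) powr (2 * \<gamma> + 1)"
  proof (cases "cos (snd x) = 0")
    case False
    then have c: "cos (snd x) > 0" using c by simp
    have "1 - (sin (snd x))\<^sup>2 = cos (snd x) powr 2" using c by (simp add: cos_squared_eq[symmetric])
    then show ?thesis by (simp only: powr_powr) (simp add: algebra_simps)
  qed (simp add: cos_squared_eq[symmetric])
  then show ?thesis
    unfolding fan_basis_def beam_basis_def beam_coords_def by (simp add: cis_power_int)
qed

lemma beam_measure_density: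
  "beam_measure \<gamma> = density line_measure (\<lambda>p. ennreal (indicator {-1..1} (snd p) * (1 - (snd p)\<^sup>2) powr (- \<gamma> - 1/2)))"
  unfolding beam_measure_def by (intro density_cong) (auto intro!: AE_I2 simp: indicator_def)

lemma beam_density_measurable [measurable]:
  "(\<lambda>p::complex \<times> real. indicator {-1..1} (snd p) * (1 - (snd p)\<^sup>2) powr (- \<gamma> - 1/2)) \<in> borel_measurable line_measure"
  by (intro measurable_line) measurable

lemma beam_integral:
  fixes F :: "complex \<times> real \<Rightarrow> 'b::{banach, second_countable_topology}"
  assumes F: "F \<in> borel_measurable borel"
  shows beam_integrable_iff: "integrable (beam_measure \<gamma>) F \<longleftrightarrow>
      integrable line_measure (\<lambda>p. (indicator {-1..1} (snd p) * (1 - (snd p)\<^sup>2) powr (- \<gamma> - 1/2)) *\<^sub>R F p)"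
    and "(\<integral>p. F p \<partial>beam_measure \<gamma>) =
      (\<integral>p. (indicator {-1..1} (snd p) * (1 - (snd p)\<^sup>2) powr (- \<gamma> - 1/2)) *\<^sub>R F p \<partial>line_measure)"
  unfolding beam_measure_density
  by (subst integrable_density integral_density; use measurable_line[OF F] in simp)+

lemma AE_line_snd:
  assumes "AE s in lborel. P s" "{s. P s} \<in> sets borel"
  shows "AE p in line_measure. P (snd p)"
proof (rule circle_lborel.AE_pair_measure)
  have "(\<lambda>p::complex \<times> real. snd p) -` {s. P s} \<inter> space borel \<in> sets borel"
    using assms(2) by (intro measurable_sets[OF snd_borel_measurable])
  then show "{x \<in> space line_measure. P (snd x)} \<in> sets line_measure"
    unfolding borel_complex_real by (simp add: vimage_def space_pair_measure)
qed (use assms in simp)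

lemma AE_line_abs_neq_1: "AE p in line_measure. \<bar>snd p\<bar> \<noteq> 1"
  by (rule AE_line_snd[OF AE_abs_neq_1]) simp

lemma line_product:
  fixes f :: "complex \<Rightarrow> complex" and g :: "real \<Rightarrow> complex"
  assumes f: "integrable circle_measure f" and g: "integrable lborel g"
  shows line_product_integrable: "integrable line_measure (\<lambda>p. f (fst p) * g (snd p))"
    and "(\<integral>p. f (fst p) * g (snd p) \<partial>line_measure) = (\<integral>v. f v \<partial>circle_measure) * (\<integral>s. g s \<partial>lborel)"
proof -
  have [measurable]: "f \<in> borel_measurable borel" "g \<in> borel_measurable borel"
    using f g borel_measurable_integrable[OF f] by (auto simp: measurable_cong_sets[OF sets_circle_measure refl])
  show i: "integrable line_measure (\<lambda>p. f (fst p) * g (snd p))"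
  proof (rule circle_lborel.Fubini_integrable)
    show "integrable circle_measure (\<lambda>v. \<integral>s. norm (f (fst (v, s)) * g (snd (v, s))) \<partial>lborel)"
      using f by (simp add: norm_mult)
  qed (use g in auto)
  show "(\<integral>p. f (fst p) * g (snd p) \<partial>line_measure) = (\<integral>v. f v \<partial>circle_measure) * (\<integral>s. g s \<partial>lborel)"
    using circle_lborel.integral_fst'[OF i] by simp
qed

lemma integrable_circle_power_int: "integrable circle_measure (\<lambda>v. v powi l)"
proof (rule Bochner_Integration.integrable_bound[of _ "\<lambda>_. 1 :: real"])
  show "integrable circle_measure (\<lambda>_. 1 :: real)" using circle.integrable_const by simp
  show "AE v in circle_measure. norm (v powi l) \<le> norm (1 :: real)"
    using AE_circle_norm by eventually_elim (simp add: norm_power_int)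
qed measurable

lemma unit_cnj: "cmod v = 1 \<Longrightarrow> cnj v = inverse v"
  by (metis complex_norm_square inverse_unique of_real_1 one_power2)

lemma unit_powi_cnj: "cmod v = 1 \<Longrightarrow> v powi l * cnj (v powi l') = v powi (l - l')"
proof -
  assume v: "cmod v = 1"
  then have "v \<noteq> 0" by auto
  then show ?thesis
    using v by (simp add: unit_cnj power_int_diff divide_inverse power_int_inverse)
qed

context
  fixes \<gamma> :: real
  assumes \<gamma>: "\<gamma> > -1"
begin

text \<open>
  The weights disappear from the coefficient, which becomes an integral over lines against a
  bounded kernel.
\<close>

lemma fan_coeff_line_integral:
  assumes U: "U \<in> borel_measurable borel" and u: "\<And>x. x \<in> inflow_domain \<Longrightarrow> u x = U (beam_coords x)"
  shows "l2_inner (inflow_measure \<gamma>) u (fan_basis \<gamma> i) = (\<integral>p. U p * beam_kernel \<gamma> i p \<partial>line_measure)"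
proof -
  have Um [measurable]: "U \<in> borel_measurable borel" by fact
  have F: "(\<lambda>p. U p * cnj (beam_basis \<gamma> i p)) \<in> borel_measurable borel" by measurable
  have "l2_inner (inflow_measure \<gamma>) u (fan_basis \<gamma> i)
     = (\<integral>x. (\<lambda>p. U p * cnj (beam_basis \<gamma> i p)) (beam_coords x) \<partial>inflow_measure \<gamma>)"
    unfolding l2_inner_def
    by (intro Bochner_Integration.integral_cong) (auto simp: space_inflow_measure u fan_basis_beam)
  also have "\<dots> = (\<integral>p. U p * cnj (beam_basis \<gamma> i p) \<partial>beam_measure \<gamma>)"
    by (rule integral_inflow_beam[OF F])
  also have "\<dots> = (\<integral>p. (indicator {-1..1} (snd p) * (1 - (snd p)\<^sup>2) powr (- \<gamma> - 1/2)) *\<^sub>R (U p * cnj (beam_basis \<gamma> i p)) \<partial>line_measure)"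
    by (rule beam_integral(2)[OF F])
  also have "\<dots> = (\<integral>p. U p * beam_kernel \<gamma> i p \<partial>line_measure)"
  proof (rule integral_cong_AE)
    show "AE p in line_measure. (indicator {-1..1} (snd p) * (1 - (snd p)\<^sup>2) powr (- \<gamma> - 1/2)) *\<^sub>R (U p * cnj (beam_basis \<gamma> i p))
        = U p * beam_kernel \<gamma> i p"
      using AE_line_abs_neq_1
    proof eventually_elim
      case (elim p)
      show ?case
      proof (cases "\<bar>snd p\<bar> < 1")
        case True
        then have "1 - (snd p)\<^sup>2 > 0" by (simp add: abs_square_less_1)
        then have "(1 - (snd p)\<^sup>2) powr (- \<gamma> - 1/2) * (1 - (snd p)\<^sup>2) powr (\<gamma> + 1/2) = 1"
          by (simp flip: powr_add)
        then have "complex_of_real ((1 - (snd p)\<^sup>2) powr (- \<gamma> - 1/2)) * of_real ((1 - (snd p)\<^sup>2) powr (\<gamma> + 1/2)) = 1"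
          by (metis of_real_1 of_real_mult)
        then show ?thesis using True
          unfolding beam_basis_def beam_kernel_def scaleR_conv_of_real by (simp add: abs_less_iff)
      next
        case False
        then show ?thesis using elim by (auto simp: indicator_def beam_kernel_def)
      qed
    qed
  qed (auto intro!: measurable_line)
  finally show ?thesis .
qed

lemma fan_basis_measurable: "fan_basis \<gamma> i \<in> borel_measurable (inflow_measure \<gamma>)"
proof (rule measurable_inflow)
  have [measurable]: "(cos :: real \<Rightarrow> real) \<in> borel_measurable borel" "(sin :: real \<Rightarrow> real) \<in> borel_measurable borel"
    by (intro borel_measurable_continuous_onI continuous_intros)+
  show "fan_basis \<gamma> i \<in> borel_measurable borel"
    unfolding fan_basis_def by measurable
qed

lemma integrable_weighted_poly:
  "integrable lborel (\<lambda>s. complex_of_real (poly p s * (indicator {-1..1} s * (1 - s\<^sup>2) powr (\<gamma> + 1/2))))"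
  using integrable_of_real[OF weighted_integrable[OF \<gamma>]] by blast

lemma fan_basis_L2: "fan_basis \<gamma> i \<in> L2 (inflow_measure \<gamma>)"
proof (rule L2_I[OF fan_basis_measurable])
  let ?L = "Lhat \<gamma> (fst i)"
  have m: "(\<lambda>p. (cmod (beam_basis \<gamma> i p))\<^sup>2) \<in> borel_measurable borel" by measurable
  have 1: "integrable line_measure (\<lambda>p. 1 * complex_of_real (poly (?L * ?L) (snd p) * (indicator {-1..1} (snd p) * (1 - (snd p)\<^sup>2) powr (\<gamma> + 1/2))))"
    by (rule line_product_integrable[OF _ integrable_weighted_poly, of "\<lambda>_. 1"]) simp
  have "integrable line_measure (\<lambda>p. (indicator {-1..1} (snd p) * (1 - (snd p)\<^sup>2) powr (- \<gamma> - 1/2)) *\<^sub>R (cmod (beam_basis \<gamma> i p))\<^sup>2)"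
  proof (rule integrable_cong_AE_imp)
    show "integrable line_measure (\<lambda>p. (1 / (2*pi))\<^sup>2 * Re (1 * complex_of_real (poly (?L * ?L) (snd p) * (indicator {-1..1} (snd p) * (1 - (snd p)\<^sup>2) powr (\<gamma> + 1/2)))))"
      by (intro integrable_mult_right integrable_Re 1)
    show "AE p in line_measure. (1 / (2*pi))\<^sup>2 * Re (1 * complex_of_real (poly (?L * ?L) (snd p) * (indicator {-1..1} (snd p) * (1 - (snd p)\<^sup>2) powr (\<gamma> + 1/2))))
      = (indicator {-1..1} (snd p) * (1 - (snd p)\<^sup>2) powr (- \<gamma> - 1/2)) *\<^sub>R (cmod (beam_basis \<gamma> i p))\<^sup>2"
      using AE_line_abs_neq_1 AE_circle_fst
    proof eventually_elim
      case (elim p)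
      show ?case
      proof (cases "\<bar>snd p\<bar> < 1")
        case True
        then have s: "1 - (snd p)\<^sup>2 > 0" by (simp add: abs_square_less_1)
        define W where "W = (1 - (snd p)\<^sup>2) powr (\<gamma> + 1/2)"
        have "(1 - (snd p)\<^sup>2) powr (- \<gamma> - 1/2) * W = 1"
          using s by (simp add: W_def flip: powr_add)
        moreover have "cmod (beam_basis \<gamma> i p) = 1 / (2*pi) * W * \<bar>poly ?L (snd p)\<bar>"
          unfolding beam_basis_def norm_mult norm_of_real using elim(2)
          by (simp add: norm_power_int W_def abs_mult)
        moreover have "a * (1 / (2*pi) * W * \<bar>y\<bar>)\<^sup>2 = (1 / (2*pi))\<^sup>2 * (a * W) * W * y\<^sup>2" for a y
          by (simp add: power2_eq_square mult_ac)
        ultimately have "(1 - (snd p)\<^sup>2) powr (- \<gamma> - 1/2) * (cmod (beam_basis \<gamma> i p))\<^sup>2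
          = (1 / (2*pi))\<^sup>2 * W * (poly ?L (snd p))\<^sup>2"
          by (simp only:)
        then show ?thesis using True unfolding W_def by (simp add: abs_less_iff power2_eq_square mult_ac)
      next
        case False
        then show ?thesis using elim by (auto simp: indicator_def)
      qed
    qed
  qed (intro measurable_line, measurable)
  then have "integrable (inflow_measure \<gamma>) (\<lambda>x. (cmod (beam_basis \<gamma> i (beam_coords x)))\<^sup>2)"
    using beam_integrable_iff[OF m] integrable_inflow_beam[OF m] by simp
  then show "integrable (inflow_measure \<gamma>) (\<lambda>x. (cmod (fan_basis \<gamma> i x))\<^sup>2)"
    by (subst Bochner_Integration.integrable_cong[OF refl]) (auto simp: space_inflow_measure fan_basis_beam)
qed

text \<open>
  The computation behind both orthogonality relations, in the fan-beam domain and in the disk: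
  different frequencies are orthogonal on the circle, and equal ones leave an integral over \<open>s\<close>
  against \<open>Lhat\<close>.
\<close>

lemma integral_beam_kernel:
  assumes g: "integrable lborel (\<lambda>s. g s * complex_of_real (indicator {-1..1} s * poly (Lhat \<gamma> n) s))"
  shows "(\<integral>p. (fst p powi l * g (snd p)) * beam_kernel \<gamma> (n, l') p \<partial>line_measure)
    = (if l = l' then (\<integral>s. g s * of_real (indicator {-1..1} s * poly (Lhat \<gamma> n) s) \<partial>lborel) else 0)"
proof -
  let ?G = "\<lambda>s. g s * complex_of_real (indicator {-1..1} s * poly (Lhat \<gamma> n) s)"
  have [measurable]: "(\<lambda>p. ?G (snd p)) \<in> borel_measurable line_measure"
    using g by measurable
  have "(\<integral>p. (fst p powi l * g (snd p)) * beam_kernel \<gamma> (n, l') p \<partial>line_measure)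
    = (\<integral>p. 1 / (2*pi) * (fst p powi (l - l') * ?G (snd p)) \<partial>line_measure)"
  proof (rule integral_cong_AE)
    have "AE p in line_measure. 1 / (2*pi) * (fst p powi (l - l') * ?G (snd p)) = (fst p powi l * g (snd p)) * beam_kernel \<gamma> (n, l') p"
      using AE_circle_fst
    proof eventually_elim
      case (elim p)
      show ?case unfolding unit_powi_cnj[OF elim, symmetric] beam_kernel_def by (simp add: field_simps)
    qed
    then show "AE p in line_measure. (fst p powi l * g (snd p)) * beam_kernel \<gamma> (n, l') p = 1 / (2*pi) * (fst p powi (l - l') * ?G (snd p))"
      by (auto elim: eventually_mono)
    have eq: "(fst p powi l * g (snd p)) * beam_kernel \<gamma> (n, l') p = fst p powi l * cnj (fst p powi l') * ?G (snd p) / (2*pi)" for p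
      unfolding beam_kernel_def by (simp add: field_simps)
    show "(\<lambda>p. (fst p powi l * g (snd p)) * beam_kernel \<gamma> (n, l') p) \<in> borel_measurable line_measure"
      unfolding eq by measurable
  qed measurable
  also have "\<dots> = 1 / (2*pi) * ((\<integral>v. v powi (l - l') \<partial>circle_measure) * (\<integral>s. ?G s \<partial>lborel))"
    using line_product(2)[OF integrable_circle_power_int g] by simp
  finally show ?thesis by (simp add: integral_circle_power_int)
qed

lemma fan_basis_orthonormal:
  "l2_inner (inflow_measure \<gamma>) (fan_basis \<gamma> i) (fan_basis \<gamma> j) = (if i = j then 1 else 0)"
proof -
  obtain n l where i: "i = (n, l)" by (cases i)
  obtain m l' where j: "j = (m, l')" by (cases j)
  define g where "g s = complex_of_real (1 / (2*pi) * (1 - s\<^sup>2) powr (\<gamma> + 1/2) * poly (Lhat \<gamma> n) s)" for s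
  have eq: "g s * of_real (indicator {-1..1} s * poly (Lhat \<gamma> m) s)
      = of_real (1 / (2*pi)) * of_real (poly (Lhat \<gamma> n * Lhat \<gamma> m) s * (indicator {-1..1} s * (1 - s\<^sup>2) powr (\<gamma> + 1/2)))" for s
    by (simp add: g_def)
  have gi: "integrable lborel (\<lambda>s. g s * of_real (indicator {-1..1} s * poly (Lhat \<gamma> m) s))"
    unfolding eq by (intro integrable_mult_right integrable_weighted_poly)
  have "l2_inner (inflow_measure \<gamma>) (fan_basis \<gamma> i) (fan_basis \<gamma> j)
    = (\<integral>p. beam_basis \<gamma> i p * beam_kernel \<gamma> j p \<partial>line_measure)"
    by (rule fan_coeff_line_integral) (auto simp: fan_basis_beam)
  also have "\<dots> = (\<integral>p. (fst p powi l * g (snd p)) * beam_kernel \<gamma> (m, l') p \<partial>line_measure)"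
    by (simp add: i j beam_basis_def g_def mult_ac)
  also have "\<dots> = (if l = l' then (\<integral>s. g s * of_real (indicator {-1..1} s * poly (Lhat \<gamma> m) s) \<partial>lborel) else 0)"
    by (rule integral_beam_kernel[OF gi])
  also have "(\<integral>s. g s * of_real (indicator {-1..1} s * poly (Lhat \<gamma> m) s) \<partial>lborel)
     = of_real (1 / (2*pi)) * of_real (weighted_inner \<gamma> (Lhat \<gamma> n) (Lhat \<gamma> m))"
    unfolding eq weighted_inner_alt by (simp only: integral_mult_right_zero integral_complex_of_real)
  also have "\<dots> = (if n = m then 1 else 0)" by (simp add: Lhat_orthogonality[OF \<gamma>])
  finally show ?thesis by (simp add: i j)
qed

text \<open>
  For a fixed frequency, vanishing moments against all \<open>Lhat \<gamma> n\<close> mean vanishing moments against all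
  powers of \<open>s\<close>. Only integrability of \<open>U\<close> is assumed, not square integrability; this matters because
  the lemma is also applied to X-ray transforms that are only known to be integrable.
\<close>

lemma AE_zero_if_kernel_moments_vanish:
  assumes U: "U \<in> borel_measurable borel" and int: "integrable line_measure (\<lambda>p. indicator {-1..1} (snd p) *\<^sub>R U p)"
    and mom: "\<And>i. (\<integral>p. U p * beam_kernel \<gamma> i p \<partial>line_measure) = 0"
  shows "AE p in beam_measure \<gamma>. U p = (0 :: complex)"
proof -
  have [measurable]: "U \<in> borel_measurable borel" by fact
  have bd [measurable]: "beam_domain \<in> sets borel"
    unfolding beam_domain_def by (intro borel_closed closed_Times) auto
  define W where "W p = (if p \<in> beam_domain then U p else 0)" for p
  have Wm [measurable]: "W \<in> borel_measurable borel" unfolding W_def by measurable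
  have WU: "AE p in line_measure. indicator {-1..1} (snd p) *\<^sub>R U p = W p"
    using AE_circle_fst by eventually_elim (auto simp: W_def beam_domain_def indicator_def mem_Times_iff)
  have W: "integrable line_measure W"
    by (rule integrable_cong_AE_imp[OF int measurable_line[OF Wm] WU])
  have Wi: "integrable line_measure (\<lambda>p. fst p powi l * of_real (poly q (snd p)) * W p)" for l and q :: "real poly"
  proof -
    have "bounded (poly q ` {-1..1})"
      by (intro compact_imp_bounded compact_continuous_image continuous_intros) auto
    then obtain B where B: "\<And>x. x \<in> {-1..1} \<Longrightarrow> norm (poly q x) \<le> B" unfolding bounded_iff by (meson imageI)
    show ?thesis
    proof (rule Bochner_Integration.integrable_bound[of _ "\<lambda>p. of_real B * W p"])
      show "integrable line_measure (\<lambda>p. of_real B * W p)" using W by simp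
      show "(\<lambda>p. fst p powi l * of_real (poly q (snd p)) * W p) \<in> borel_measurable line_measure"
        using Wm by (intro measurable_line) measurable
      show "AE p in line_measure. norm (fst p powi l * of_real (poly q (snd p)) * W p) \<le> norm (of_real B * W p)"
      proof (rule AE_I2)
        fix p
        show "norm (fst p powi l * of_real (poly q (snd p)) * W p) \<le> norm (of_real B * W p)"
        proof (cases "p \<in> beam_domain")
          case True
          then have "cmod (fst p) = 1" "snd p \<in> {-1..1}" by (auto simp: beam_domain_def)
          then show ?thesis using B[of "snd p"]
            by (auto simp: norm_mult norm_power_int intro!: mult_right_mono)
        qed (simp add: W_def)
      qed
    qed
  qed
  define \<Psi> where "\<Psi> l q = (\<integral>p. fst p powi l * of_real (poly q (snd p)) * W p \<partial>line_measure)" for l and q :: "real poly"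
  have base: "\<Psi> l (Lhat \<gamma> n) = 0" for l n
  proof -
    have "\<Psi> l (Lhat \<gamma> n) = (\<integral>p. 2*pi * (U p * beam_kernel \<gamma> (n, -l) p) \<partial>line_measure)"
      unfolding \<Psi>_def
    proof (rule integral_cong_AE)
      show "AE p in line_measure. fst p powi l * of_real (poly (Lhat \<gamma> n) (snd p)) * W p = 2*pi * (U p * beam_kernel \<gamma> (n, -l) p)"
        using AE_circle_fst
      proof eventually_elim
        case (elim p)
        have "cnj (fst p powi - l) = fst p powi l"
          using elim by (simp add: unit_cnj power_int_inverse power_int_minus)
        then show ?case using elim
          by (auto simp: W_def beam_kernel_def beam_domain_def indicator_def mem_Times_iff)
      qed
    next
      have "(\<lambda>p. fst p powi l * of_real (poly (Lhat \<gamma> n) (snd p)) * W p) \<in> borel_measurable borel"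
        by measurable
      then show "(\<lambda>p. fst p powi l * of_real (poly (Lhat \<gamma> n) (snd p)) * W p) \<in> borel_measurable line_measure"
        by (rule measurable_line)
      have "(\<lambda>p. complex_of_real (2*pi) * (U p * beam_kernel \<gamma> (n, -l) p)) \<in> borel_measurable borel"
        by measurable
      then show "(\<lambda>p. complex_of_real (2*pi) * (U p * beam_kernel \<gamma> (n, -l) p)) \<in> borel_measurable line_measure"
        by (rule measurable_line)
    qed
    also have "\<dots> = 0" using mom[of "(n, -l)"] by simp
    finally show ?thesis .
  qed
  have \<Psi>: "\<Psi> l q = 0" for l q
  proof (rule functional_zero_on_graded_family[where n = "Suc (degree q)" and P = "Lhat \<gamma>"])
    show "\<Psi> l (p + q) = \<Psi> l p + \<Psi> l q" for p q
      unfolding \<Psi>_def using Wi[of l p] Wi[of l q] by (simp add: algebra_simps)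
    show "\<Psi> l (smult c p) = of_real c * \<Psi> l p" for c p
      unfolding \<Psi>_def integral_mult_right_zero[symmetric] by (simp add: mult_ac)
    show "Lhat \<gamma> m \<noteq> 0" for m using Lhat_lead[OF \<gamma>, of m] by auto
  qed (auto simp: base Lhat_degree[OF \<gamma>])
  have "AE p in line_measure. W p = 0"
  proof (rule AE_zero_if_trigonometric_moments_vanish[OF W])
    show "(\<integral>p. fst p powi l * of_real (snd p) ^ j * W p \<partial>line_measure) = 0" for l j
      using \<Psi>[of l "monom 1 j"] by (simp add: \<Psi>_def poly_monom)
  qed (simp add: W_def)
  then have "AE p in line_measure. 0 < ennreal (indicator {-1..1} (snd p) * (1 - (snd p)\<^sup>2) powr (- \<gamma> - 1/2)) \<longrightarrow> U p = 0"
    using WU by eventually_elim (auto simp: indicator_def split: if_splits)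
  then show ?thesis
    unfolding beam_measure_density by (subst AE_density) (auto intro: beam_density_measurable)
qed

text \<open>
  The density \<open>(1 - s\<^sup>2) powr (- \<gamma> - 1/2)\<close> and its reciprocal are both integrable against the
  appropriate factor, so square integrability gives integrability without weight.
\<close>

lemma integrable_line_if_L2_inflow:
  assumes u: "u \<in> L2 (inflow_measure \<gamma>)"
    and U [measurable]: "U \<in> borel_measurable borel" and uU: "\<And>x. x \<in> inflow_domain \<Longrightarrow> u x = U (beam_coords x)"
  shows "integrable line_measure (\<lambda>p. indicator {-1..1} (snd p) *\<^sub>R U p)"
proof -
  have m: "(\<lambda>p. (cmod (U p))\<^sup>2) \<in> borel_measurable borel" by measurable
  have "integrable (inflow_measure \<gamma>) (\<lambda>x. (cmod (U (beam_coords x)))\<^sup>2)"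
    using L2_integrable_sq[OF u]
    by (subst (asm) Bochner_Integration.integrable_cong[OF refl, of _ _ "\<lambda>x. (cmod (U (beam_coords x)))\<^sup>2"])
       (auto simp: space_inflow_measure uU)
  then have sq: "integrable line_measure (\<lambda>p. (indicator {-1..1} (snd p) * (1 - (snd p)\<^sup>2) powr (- \<gamma> - 1/2)) *\<^sub>R (cmod (U p))\<^sup>2)"
    using beam_integrable_iff[OF m] integrable_inflow_beam[OF m] by simp
  have "integrable line_measure (\<lambda>p. 1 * complex_of_real (poly 1 (snd p) * (indicator {-1..1} (snd p) * (1 - (snd p)\<^sup>2) powr (\<gamma> + 1/2))))"
    by (rule line_product_integrable[OF _ integrable_weighted_poly, of "\<lambda>_. 1"]) simp
  from integrable_Re[OF this] have w: "integrable line_measure (\<lambda>p. indicator {-1..1} (snd p) * (1 - (snd p)\<^sup>2) powr (\<gamma> + 1/2) :: real)"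
    by simp
  show ?thesis
  proof (rule Bochner_Integration.integrable_bound[OF Bochner_Integration.integrable_add[OF sq w]])
    show "(\<lambda>p. indicator {-1..1} (snd p) *\<^sub>R U p) \<in> borel_measurable line_measure"
      by (intro measurable_line) measurable
    show "AE p in line_measure. norm (indicator {-1..1} (snd p) *\<^sub>R U p)
      \<le> norm ((indicator {-1..1} (snd p) * (1 - (snd p)\<^sup>2) powr (- \<gamma> - 1/2)) *\<^sub>R (cmod (U p))\<^sup>2
          + indicator {-1..1} (snd p) * (1 - (snd p)\<^sup>2) powr (\<gamma> + 1/2))"
      using AE_line_abs_neq_1
    proof eventually_elim
      case (elim p)
      show ?case
      proof (cases "\<bar>snd p\<bar> < 1")
        case True
        then have s: "1 - (snd p)\<^sup>2 > 0" by (simp add: abs_square_less_1)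
        (* Splitting 1 = a b balances the two sides of the arithmetic-geometric mean
           inequality. *)
        define a where "a = (1 - (snd p)\<^sup>2) powr (- (\<gamma> + 1/2) / 2)"
        define b where "b = (1 - (snd p)\<^sup>2) powr ((\<gamma> + 1/2) / 2)"
        have ab: "a * b = 1" "a * a = (1 - (snd p)\<^sup>2) powr (- \<gamma> - 1/2)" "b * b = (1 - (snd p)\<^sup>2) powr (\<gamma> + 1/2)"
        proof -
          have "- (\<gamma> + 1/2) / 2 + (\<gamma> + 1/2) / 2 = 0" "- (\<gamma> + 1/2) / 2 + - (\<gamma> + 1/2) / 2 = - \<gamma> - 1/2"
            "(\<gamma> + 1/2) / 2 + (\<gamma> + 1/2) / 2 = \<gamma> + 1/2" by (simp_all add: field_simps)
          then show "a * b = 1" "a * a = (1 - (snd p)\<^sup>2) powr (- \<gamma> - 1/2)" "b * b = (1 - (snd p)\<^sup>2) powr (\<gamma> + 1/2)"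
            unfolding a_def b_def powr_add[symmetric] using s by simp_all
        qed
        have pos: "a > 0" "b > 0" using s by (simp_all add: a_def b_def)
        have "2 * cmod (U p) \<le> (a * a) * (cmod (U p))\<^sup>2 + b * b"
        proof -
          have "2 * (a * cmod (U p)) * b \<le> (a * cmod (U p))\<^sup>2 + b\<^sup>2" by (rule sum_squares_bound)
          moreover have "2 * (a * cmod (U p)) * b = 2 * cmod (U p) * (a * b)" by (simp add: mult_ac)
          moreover have "(a * cmod (U p))\<^sup>2 + b\<^sup>2 = (a * a) * (cmod (U p))\<^sup>2 + b * b"
            by (simp add: power2_eq_square mult_ac)
          ultimately show ?thesis using ab(1) by simp
        qed
        then have "cmod (U p) \<le> (a * a) * (cmod (U p))\<^sup>2 + b * b"
          using norm_ge_zero[of "U p"] by linarith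
        then show ?thesis using True unfolding ab by (simp add: abs_less_iff)
      next
        case False
        then show ?thesis using elim by (auto simp: indicator_def)
      qed
    qed
  qed
qed

lemma fan_basis_total:
  assumes u: "u \<in> L2 (inflow_measure \<gamma>)" and zero: "\<And>i. l2_inner (inflow_measure \<gamma>) u (fan_basis \<gamma> i) = 0"
  shows "AE x in inflow_measure \<gamma>. u x = 0"
proof -
  obtain U where U [measurable]: "U \<in> borel_measurable borel" and uU: "\<And>x. x \<in> inflow_domain \<Longrightarrow> u x = U (beam_coords x)"
    using beam_representative[OF L2_measurable[OF u]] by blast
  have "(\<integral>p. U p * beam_kernel \<gamma> i p \<partial>line_measure) = 0" for i
    using fan_coeff_line_integral[OF U uU, of i] zero[of i] by simp
  then have "AE p in beam_measure \<gamma>. U p = 0"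
    by (intro AE_zero_if_kernel_moments_vanish[OF U integrable_line_if_L2_inflow[OF u U uU]])
  then have "AE x in inflow_measure \<gamma>. U (beam_coords x) = 0"
    by (subst AE_inflow_beam) (auto simp: pred_def[symmetric])
  then show ?thesis using AE_inflow_domain by eventually_elim (simp add: uU)
qed

lemma fan_basis_orthonormal_basis: "orthonormal_basis (inflow_measure \<gamma>) (fan_basis \<gamma>)"
  by unfold_locales (use fan_basis_L2 fan_basis_orthonormal fan_basis_total in auto)

end

section \<open>Disk polynomials and singular values\<close>

text \<open>
  The image of the fan-beam basis under the adjoint transform: an average over the directions \<open>v\<close> of
  \<open>v powi l\<close> times \<open>Lhat\<close> at the distance of the line through \<open>z\<close> with direction \<open>v\<close>. Up to normalization
  these are the generalized Zernike polynomials.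
\<close>

definition disk_polynomial :: "real \<Rightarrow> nat \<times> int \<Rightarrow> complex \<Rightarrow> complex" where
  "disk_polynomial \<gamma> i z = of_real (1 / (2*pi)) *
     (\<integral>v. v powi snd i * of_real (poly (Lhat \<gamma> (fst i)) (Im (z * cnj v))) \<partial>circle_measure)"

lemma integral_kernel_disk_polynomial:
  assumes z: "cmod z \<le> 1"
  shows "(\<integral>v. beam_kernel \<gamma> i (v, Im (z * cnj v)) \<partial>circle_measure) = cnj (disk_polynomial \<gamma> i z)"
proof -
  have "(\<integral>v. beam_kernel \<gamma> i (v, Im (z * cnj v)) \<partial>circle_measure)
    = (\<integral>v. of_real (1 / (2*pi)) * cnj (v powi snd i * of_real (poly (Lhat \<gamma> (fst i)) (Im (z * cnj v)))) \<partial>circle_measure)"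
  proof (rule integral_cong_AE)
    show "AE v in circle_measure. beam_kernel \<gamma> i (v, Im (z * cnj v)) =
       of_real (1 / (2*pi)) * cnj (v powi snd i * of_real (poly (Lhat \<gamma> (fst i)) (Im (z * cnj v))))"
      using AE_circle_norm
    proof eventually_elim
      case (elim v)
      have "\<bar>Im (z * cnj v)\<bar> \<le> cmod (z * cnj v)" by (rule abs_Im_le_cmod)
      also have "\<dots> \<le> 1" using z elim by (simp add: norm_mult)
      finally have "Im (z * cnj v) \<in> {-1..1}" unfolding atLeastAtMost_iff by linarith
      then show ?case by (simp only: beam_kernel_def fst_conv snd_conv indicator_simps) simp
    qed
    have [measurable]: "beam_kernel \<gamma> i \<in> borel_measurable (borel \<Otimes>\<^sub>M borel)"
      using beam_kernel_measurable unfolding borel_prod .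
    show "(\<lambda>v. beam_kernel \<gamma> i (v, Im (z * cnj v))) \<in> borel_measurable circle_measure" by measurable
  qed measurable
  also have "\<dots> = of_real (1 / (2*pi)) * cnj (\<integral>v. v powi snd i * of_real (poly (Lhat \<gamma> (fst i)) (Im (z * cnj v))) \<partial>circle_measure)"
    unfolding integral_mult_right_zero by (subst Bochner_Integration.integral_cnj) (rule refl)
  finally show ?thesis by (simp add: disk_polynomial_def)
qed

text \<open>
  The coefficient of \<open>z ^ (j - k) * cnj z ^ k\<close> in the circle average of
  \<open>v powi l * Im (z * cnj v) ^ j\<close>, by the binomial theorem.
\<close>

definition disk_monomial_coeff :: "int \<Rightarrow> nat \<Rightarrow> nat \<Rightarrow> complex" where
  "disk_monomial_coeff l j k =
     (if l = int j - 2 * int k then of_nat (j choose k) * (-1)^k / (2 * \<i>)^j else 0)"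

lemma integral_Im_power:
  "integrable circle_measure (\<lambda>v. v powi l * of_real (Im (z * cnj v)) ^ j)" (is ?I)
  "(\<integral>v. v powi l * of_real (Im (z * cnj v)) ^ j \<partial>circle_measure)
    = 2 * pi * (\<Sum>k\<le>j. disk_monomial_coeff l j k * (z^(j-k) * cnj z^k))" (is ?E)
proof -
  define a where "a k = of_nat (j choose k) * (-1)^k / (2 * \<i>)^j * (z^(j-k) * cnj z^k)" for k
  have AE: "AE v in circle_measure. (\<Sum>k\<le>j. a k * v powi (l + 2 * int k - int j)) = v powi l * of_real (Im (z * cnj v)) ^ j"
    using AE_circle_norm
  proof eventually_elim
    case (elim v)
    then have v0: "v \<noteq> 0" by auto
    have "of_real (Im (z * cnj v)) = (- (cnj z * v) + z * inverse v) / (2 * \<i>)"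
    proof -
      have "of_real (Im (z * cnj v)) = (z * cnj v - cnj (z * cnj v)) / (2 * \<i>)"
      proof -
        have "of_real (Im w) = (w - cnj w) / (2 * \<i>)" for w unfolding complex_diff_cnj by (simp add: complex_eq_iff)
        then show ?thesis .
      qed
      then show ?thesis unfolding unit_cnj[OF elim, symmetric] by (simp add: mult.commute)
    qed
    then have "of_real (Im (z * cnj v)) ^ j = (\<Sum>k\<le>j. of_nat (j choose k) * (- (cnj z * v))^k * (z * inverse v)^(j-k)) / (2 * \<i>)^j"
      by (simp only: power_divide binomial_ring)
    also have "\<dots> = (\<Sum>k\<le>j. a k * v powi (2 * int k - int j))"
      unfolding sum_divide_distrib
    proof (rule sum.cong[OF refl])
      fix k assume k: "k \<in> {..j}"
      have e: "2 * int k - int j = int k - int (j - k)" using k by auto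
      have "v powi (2 * int k - int j) = v^k * inverse v ^ (j-k)"
        unfolding e using v0 by (simp add: power_int_diff power_inverse divide_inverse)
      moreover have "(- (cnj z * v))^k = (-1)^k * (cnj z * v)^k" by (rule power_minus)
      ultimately show "of_nat (j choose k) * (- (cnj z * v))^k * (z * inverse v)^(j-k) / (2 * \<i>)^j = a k * v powi (2 * int k - int j)"
        unfolding a_def by (simp only: power_mult_distrib mult_ac times_divide_eq_left times_divide_eq_right)
    qed
    finally have "v powi l * of_real (Im (z * cnj v)) ^ j = (\<Sum>k\<le>j. a k * (v powi l * v powi (2 * int k - int j)))"
      by (simp add: sum_distrib_left mult_ac)
    also have "\<dots> = (\<Sum>k\<le>j. a k * v powi (l + 2 * int k - int j))"
      using v0 by (intro sum.cong refl) (simp add: power_int_add[symmetric] add_diff_eq)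
    finally show ?case by simp
  qed
  have i: "integrable circle_measure (\<lambda>v. \<Sum>k\<le>j. a k * v powi (l + 2 * int k - int j))"
    by (intro Bochner_Integration.integrable_sum integrable_mult_right integrable_circle_power_int)
  show ?I by (rule integrable_cong_AE_imp[OF i _ AE]) measurable
  have "(\<integral>v. v powi l * of_real (Im (z * cnj v)) ^ j \<partial>circle_measure)
    = (\<integral>v. (\<Sum>k\<le>j. a k * v powi (l + 2 * int k - int j)) \<partial>circle_measure)"
    using AE by (intro integral_cong_AE) (auto elim: eventually_mono)
  also have "\<dots> = (\<Sum>k\<le>j. a k * (\<integral>v. v powi (l + 2 * int k - int j) \<partial>circle_measure))"
    by (subst Bochner_Integration.integral_sum)
       (auto intro!: integrable_mult_right integrable_circle_power_int)
  also have "\<dots> = (\<Sum>k\<le>j. 2 * pi * (disk_monomial_coeff l j k * (z^(j-k) * cnj z^k)))"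
  proof (intro sum.cong refl)
    fix k
    show "a k * (\<integral>v. v powi (l + 2 * int k - int j) \<partial>circle_measure) = 2 * pi * (disk_monomial_coeff l j k * (z^(j-k) * cnj z^k))"
      unfolding integral_circle_power_int disk_monomial_coeff_def
      by (cases "l = int j - 2 * int k") (auto simp: a_def)
  qed
  finally show ?E by (simp add: sum_distrib_left)
qed

lemma poly_altdef_le:
  fixes p :: "'a::comm_ring_1 poly"
  shows "degree p \<le> n \<Longrightarrow> poly p x = (\<Sum>i\<le>n. coeff p i * x^i)"
  unfolding poly_altdef by (intro sum.mono_neutral_left) (auto simp: coeff_eq_0)

text \<open>
  This shows that the adjoint images are polynomials in \<open>z\<close> and \<open>cnj z\<close>, whose Radon transforms can be
  computed term by term.
\<close>

lemma disk_polynomial_explicit: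
  assumes \<gamma>: "\<gamma> > -1"
  shows "disk_polynomial \<gamma> (n, l) z = (\<Sum>j\<le>n. \<Sum>k\<le>j. of_real (coeff (Lhat \<gamma> n) j) * disk_monomial_coeff l j k * (z^(j-k) * cnj z^k))"
proof -
  have "(\<integral>v. v powi l * of_real (poly (Lhat \<gamma> n) (Im (z * cnj v))) \<partial>circle_measure)
    = (\<integral>v. (\<Sum>j\<le>n. of_real (coeff (Lhat \<gamma> n) j) * (v powi l * of_real (Im (z * cnj v)) ^ j)) \<partial>circle_measure)"
    by (intro Bochner_Integration.integral_cong refl, subst poly_altdef_le[of _ n])
       (auto simp: Lhat_degree[OF \<gamma>] sum_distrib_left mult_ac simp del: times_complex.sel)
  also have "\<dots> = (\<Sum>j\<le>n. of_real (coeff (Lhat \<gamma> n) j) * (\<integral>v. v powi l * of_real (Im (z * cnj v)) ^ j \<partial>circle_measure))"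
    by (subst Bochner_Integration.integral_sum) (intro integrable_mult_right integral_Im_power, simp)
  finally show ?thesis
    unfolding disk_polynomial_def integral_Im_power by (simp add: sum_distrib_left mult_ac)
qed

definition Gegenbauer_moment :: "real \<Rightarrow> nat \<Rightarrow> real" where
  "Gegenbauer_moment \<gamma> i = (\<integral>x. x^i * (indicator {-1..1} x * (1 - x\<^sup>2) powr \<gamma>) \<partial>lborel)"

text \<open>
  On the line with direction \<open>1\<close> the monomial \<open>z ^ a * cnj z ^ b\<close> at \<open>\<tau> + i s\<close> is \<open>s ^ (a + b)\<close> times the
  value of this polynomial at \<open>\<tau> / s\<close>.
\<close>

definition chord_root_poly :: "nat \<Rightarrow> nat \<Rightarrow> complex poly" where
  "chord_root_poly a b = [:\<i>, 1:]^a * [:-\<i>, 1:]^b"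

text \<open>
  The integral of the weighted monomial \<open>z ^ a * cnj z ^ b\<close> over the chord at distance \<open>s\<close> in
  direction \<open>1\<close> is this polynomial at \<open>s\<close> times \<open>(1 - s\<^sup>2) powr (\<gamma> + 1/2)\<close>. In each term the half-length
  of the chord occurs to the power \<open>i\<close>; for even \<open>i\<close> this is a polynomial in \<open>s\<close>, and for odd \<open>i\<close> the
  moment vanishes.
\<close>

definition chord_poly :: "real \<Rightarrow> nat \<Rightarrow> nat \<Rightarrow> complex poly" where
  "chord_poly \<gamma> a b = (\<Sum>i\<le>a+b. smult (coeff (chord_root_poly a b) i * of_real (Gegenbauer_moment \<gamma> i))
     (if even i then [:1, 0, -1:]^(i div 2) * monom 1 (a + b - i) else 0))"

text \<open>
  The dependence on \<open>s\<close> of the Radon transform of \<open>disk_polynomial\<close>, see \<open>radon_disk_polynomial\<close>.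
\<close>

definition radon_profile :: "real \<Rightarrow> nat \<Rightarrow> int \<Rightarrow> complex poly" where
  "radon_profile \<gamma> n l = (\<Sum>j\<le>n. \<Sum>k\<le>j. smult (of_real (coeff (Lhat \<gamma> n) j) * disk_monomial_coeff l j k) (chord_poly \<gamma> (j - k) k))"

text \<open>
  The norm of \<open>disk_polynomial\<close>, indexed by degree and frequency instead of \<open>(n, k)\<close>. The value \<open>0\<close>
  covers the frequencies for which the disk polynomial is almost everywhere zero.
\<close>

definition singular_value :: "real \<Rightarrow> nat \<times> int \<Rightarrow> real" where
  "singular_value \<gamma> i = (case i of (n, l) \<Rightarrow>
     if \<bar>l\<bar> \<le> int n \<and> even (int n - l) then sigma_coeff \<gamma> n (nat ((int n - l) div 2)) else 0)"

lemma degree_chord_root_poly: "degree (chord_root_poly a b) = a + b"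
  unfolding chord_root_poly_def by (subst degree_mult_eq) (auto simp: degree_power_eq)

lemma disk_monomial_on_chord:
  assumes "s \<noteq> 0"
  shows "Complex y s^a * cnj (Complex y s)^b
    = (\<Sum>i\<le>a+b. coeff (chord_root_poly a b) i * (of_real (y^i) * of_real (s^(a+b-i))))"
proof -
  have "Complex y s = of_real s * (of_real (y/s) + \<i>)" "cnj (Complex y s) = of_real s * (of_real (y/s) - \<i>)"
    using assms by (simp_all add: complex_eq_iff)
  then have "Complex y s^a * cnj (Complex y s)^b = of_real s^(a+b) * poly (chord_root_poly a b) (of_real (y/s))"
    by (simp add: chord_root_poly_def power_mult_distrib power_add add.commute mult_ac)
  also have "\<dots> = of_real s^(a+b) * (\<Sum>i\<le>a+b. coeff (chord_root_poly a b) i * of_real (y/s)^i)"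
    by (subst poly_altdef_le[of _ "a+b"]) (auto simp: degree_chord_root_poly)
  also have "\<dots> = (\<Sum>i\<le>a+b. coeff (chord_root_poly a b) i * (of_real (y^i) * of_real (s^(a+b-i))))"
    unfolding sum_distrib_left
  proof (intro sum.cong refl)
    fix i assume "i \<in> {..a+b}"
    then have "s^(a+b) = s^i * s^(a+b-i)" by (simp flip: power_add)
    then have "s^(a+b) * (y/s)^i = y^i * s^(a+b-i)" using assms by (simp add: power_divide)
    then have "complex_of_real s^(a+b) * of_real (y/s)^i = of_real (y^i) * of_real (s^(a+b-i))"
      by (metis of_real_mult of_real_power)
    then show "of_real s^(a+b) * (coeff (chord_root_poly a b) i * of_real (y/s)^i)
        = coeff (chord_root_poly a b) i * (of_real (y^i) * of_real (s^(a+b-i)))"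
      by (metis mult.left_commute)
  qed
  finally show ?thesis .
qed

context
  fixes \<gamma> :: real
  assumes \<gamma>: "\<gamma> > -1"
begin

lemma Gegenbauer_integrable_power: "integrable lborel (\<lambda>x. x^i * (indicator {-1..1} x * (1 - x\<^sup>2) powr \<gamma>) :: real)"
  using integrable_continuous_Gegenbauer[OF \<gamma>, of "\<lambda>x. x^i"] by (simp add: continuous_intros)

lemma Gegenbauer_moment_odd: "odd i \<Longrightarrow> Gegenbauer_moment \<gamma> i = 0"
proof -
  assume i: "odd i"
  have "Gegenbauer_moment \<gamma> i = (\<integral>x. (- x)^i * (indicator {-1..1} (- x) * (1 - (- x)\<^sup>2) powr \<gamma>) \<partial>lborel)"
    unfolding Gegenbauer_moment_def
    using lborel_integral_real_affine[of "-1" "\<lambda>x. x^i * (indicator {-1..1} x * (1 - x\<^sup>2) powr \<gamma>)" 0] by simp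
  also have "\<dots> = (\<integral>x. - (x^i * (indicator {-1..1} x * (1 - x\<^sup>2) powr \<gamma>)) \<partial>lborel)"
    using i by (intro Bochner_Integration.integral_cong) (auto simp: indicator_def)
  finally show ?thesis by (simp add: Gegenbauer_moment_def)
qed

text \<open>
  The exclusion of \<open>s = 0\<close> comes from the division in \<open>chord_root_poly\<close> and costs only a null set of
  lines.
\<close>

lemma radon_disk_monomial:
  fixes a b :: nat
  assumes v: "cmod v = 1" and s: "\<bar>s\<bar> < 1" "s \<noteq> 0"
  defines "h \<equiv> \<lambda>z. disk_weight \<gamma> z *\<^sub>R (z^a * cnj z^b)"
  shows "integrable lborel (\<lambda>\<tau>. h (v * Complex \<tau> s))" (is ?I)
    and "radon h (v, s) = v powi (int a - int b) * (of_real ((1 - s\<^sup>2) powr (\<gamma> + 1/2)) * poly (chord_poly \<gamma> a b) (of_real s))" (is ?E)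
proof -
  define r where "r = sqrt (1 - s\<^sup>2)"
  have s1: "1 - s\<^sup>2 > 0" using s by (simp add: abs_square_less_1)
  then have r: "r > 0" "r\<^sup>2 = 1 - s\<^sup>2" by (auto simp: r_def)
  define P where "P = chord_root_poly a b"
  define H where "H \<tau> = h (v * Complex \<tau> s)" for \<tau>
  have vab: "v^a * cnj v^b = v powi (int a - int b)"
  proof -
    have "v \<noteq> 0" using v by auto
    then show ?thesis by (simp add: unit_cnj[OF v] power_int_diff power_inverse divide_inverse)
  qed
  have Hx: "H (r * x) = v powi (int a - int b) * (of_real ((1 - s\<^sup>2) powr \<gamma>) *
     (\<Sum>i\<le>a+b. coeff P i * of_real (r^i * s^(a+b-i)) * of_real (x^i * (indicator {-1..1} x * (1 - x\<^sup>2) powr \<gamma>))))" for x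
  proof -
    have "H (r * x) = disk_weight \<gamma> (Complex (r * x) s) *\<^sub>R ((v^a * cnj v^b) * (Complex (r * x) s^a * cnj (Complex (r * x) s)^b))"
      unfolding H_def h_def disk_weight_rotate[OF v] by (simp only: power_mult_distrib complex_cnj_mult mult_ac)
    also have "\<dots> = of_real ((1 - s\<^sup>2) powr \<gamma> * (indicator {-1..1} x * (1 - x\<^sup>2) powr \<gamma>)) *
        (v powi (int a - int b) * (\<Sum>i\<le>a+b. coeff P i * (of_real ((r * x)^i) * of_real (s^(a+b-i)))))"
      unfolding vab disk_monomial_on_chord[OF s(2)] P_def disk_weight_chord[OF s(1), of \<gamma> x, folded r_def] scaleR_conv_of_real ..
    also have "\<dots> = v powi (int a - int b) * (of_real ((1 - s\<^sup>2) powr \<gamma>) *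
     (\<Sum>i\<le>a+b. coeff P i * of_real (r^i * s^(a+b-i)) * of_real (x^i * (indicator {-1..1} x * (1 - x\<^sup>2) powr \<gamma>))))"
      by (simp add: sum_distrib_left power_mult_distrib mult_ac)
    finally show ?thesis .
  qed
  have gi: "integrable lborel (\<lambda>x. c * complex_of_real (x^i * (indicator {-1..1} x * (1 - x\<^sup>2) powr \<gamma>)))" for c i
    by (intro integrable_mult_right integrable_of_real Gegenbauer_integrable_power)
  have "integrable lborel (\<lambda>x. H (0 + r * x))"
    unfolding add_0 Hx by (intro integrable_mult_right Bochner_Integration.integrable_sum gi)
  then show ?I
    using r(1) unfolding H_def[symmetric] by (subst (asm) lborel_integrable_real_affine_iff) auto
  have "radon h (v, s) = (\<integral>\<tau>. H \<tau> \<partial>lborel)" by (simp add: radon_def H_def)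
  also have "\<dots> = r *\<^sub>R (\<integral>x. H (0 + r * x) \<partial>lborel)"
    using lborel_integral_real_affine[of r H 0] r(1) by simp
  also have "(\<integral>x. H (0 + r * x) \<partial>lborel) = v powi (int a - int b) * (of_real ((1 - s\<^sup>2) powr \<gamma>) *
     (\<Sum>i\<le>a+b. coeff P i * of_real (r^i * s^(a+b-i)) * of_real (Gegenbauer_moment \<gamma> i)))"
    unfolding add_0 Hx integral_mult_right_zero Gegenbauer_moment_def integral_complex_of_real[symmetric]
    by (subst Bochner_Integration.integral_sum, rule gi) (simp only: integral_mult_right_zero)
  also have "(\<Sum>i\<le>a+b. coeff P i * of_real (r^i * s^(a+b-i)) * of_real (Gegenbauer_moment \<gamma> i)) = poly (chord_poly \<gamma> a b) (of_real s)"
    unfolding chord_poly_def poly_sum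
  proof (intro sum.cong refl)
    fix i
    show "coeff P i * of_real (r^i * s^(a+b-i)) * of_real (Gegenbauer_moment \<gamma> i) =
      poly (smult (coeff (chord_root_poly a b) i * of_real (Gegenbauer_moment \<gamma> i))
        (if even i then [:1, 0, -1:]^(i div 2) * monom 1 (a + b - i) else 0)) (of_real s)"
    proof (cases "even i")
      case True
      have "r^i = (1 - s\<^sup>2)^(i div 2)" using True r(2) by (metis dvd_mult_div_cancel power_mult)
      then have "of_real (r^i * s^(a+b-i)) = poly ([:1, 0, -1:]^(i div 2) * monom 1 (a + b - i)) (complex_of_real s)"
        by (simp add: poly_monom power2_eq_square algebra_simps)
      then show ?thesis using True by (simp add: P_def)
    qed (simp add: Gegenbauer_moment_odd)
  qed
  also have "r *\<^sub>R (v powi (int a - int b) * (of_real ((1 - s\<^sup>2) powr \<gamma>) * poly (chord_poly \<gamma> a b) (of_real s)))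
     = v powi (int a - int b) * (of_real (r * (1 - s\<^sup>2) powr \<gamma>) * poly (chord_poly \<gamma> a b) (of_real s))"
    by (simp add: scaleR_conv_of_real mult_ac)
  also have "r * (1 - s\<^sup>2) powr \<gamma> = (1 - s\<^sup>2) powr (\<gamma> + 1/2)"
    using s1 by (simp add: r_def powr_add powr_half_sqrt)
  finally show ?E .
qed

lemma degree_chord_poly: "degree (chord_poly \<gamma> a b) \<le> a + b"
  unfolding chord_poly_def
proof (intro degree_sum_le)
  fix i assume "i \<in> {..a+b}"
  have "degree ([:1, 0, -1::complex:]^(i div 2) * monom 1 (a + b - i)) \<le> 2 * (i div 2) + (a + b - i)"
    by (rule order_trans[OF degree_mult_le] add_mono)+ (auto intro: degree_monom_le simp: degree_power_eq)
  also have "\<dots> \<le> a + b" using \<open>i \<in> {..a+b}\<close> by auto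
  finally show "degree (smult (coeff (chord_root_poly a b) i * of_real (Gegenbauer_moment \<gamma> i))
     (if even i then [:1, 0, -1:]^(i div 2) * monom 1 (a + b - i) else 0)) \<le> a + b"
    by (auto intro: order_trans[OF degree_smult_le])
qed auto

text \<open>
  The top coefficient collects, for every \<open>i\<close>, a coefficient of \<open>chord_root_poly\<close> times \<open>i\<close>-th powers of
  the imaginary unit and of \<open>x\<close>. The sum is the value of \<open>chord_root_poly\<close> at an imaginary argument,
  which factors into powers of \<open>1 + x\<close> and \<open>1 - x\<close>; its integral is a Beta function.
\<close>

lemma coeff_chord_poly:
  "coeff (chord_poly \<gamma> a b) (a + b) = \<i>^(a+b) * (-1)^b * of_real (2 powr (a + b + 2 * \<gamma> + 1) * Beta (a + \<gamma> + 1) (b + \<gamma> + 1))"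
proof -
  let ?P = "chord_root_poly a b"
  let ?w = "\<lambda>x::real. indicator {-1..1} x * (1 - x\<^sup>2) powr \<gamma>"
  (* The top coefficient of (1 - X^2)^(i/2) X^(a+b-i) is (-1)^(i/2) = i^i, with the imaginary
     unit as the base of the last power. *)
  have c: "coeff ([:1, 0, -1::complex:]^(i div 2) * monom 1 (a + b - i)) (a + b) = \<i>^i" if "i \<le> a + b" "even i" for i
  proof -
    have "coeff ([:1, 0, -1::complex:]^(i div 2) * monom 1 (a + b - i)) ((a + b - i) + i) = coeff ([:1, 0, -1::complex:]^(i div 2)) i"
      by (simp add: coeff_monom_mult mult.commute)
    moreover have "degree ([:1, 0, -1::complex:]^(i div 2)) = i" using that by (auto simp: degree_power_eq elim!: evenE)
    then have "coeff ([:1, 0, -1::complex:]^(i div 2)) i = lead_coeff ([:1, 0, -1::complex:]^(i div 2))" by simp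
    then have "coeff ([:1, 0, -1::complex:]^(i div 2)) i = (-1)^(i div 2)" by (simp add: lead_coeff_power)
    moreover have "\<i>^i = (-1)^(i div 2)" using that by (metis dvd_mult_div_cancel i_squared power_mult power2_eq_square)
    ultimately show ?thesis using that by simp
  qed
  have "coeff (chord_poly \<gamma> a b) (a + b) = (\<Sum>i\<le>a+b. coeff ?P i * of_real (Gegenbauer_moment \<gamma> i) * \<i>^i)"
    unfolding chord_poly_def coeff_sum
    by (intro sum.cong refl) (auto simp: c Gegenbauer_moment_odd)
  also have "\<dots> = (\<integral>x. (\<Sum>i\<le>a+b. coeff ?P i * \<i>^i * of_real (x^i * ?w x)) \<partial>lborel)"
    unfolding Gegenbauer_moment_def
    by (subst Bochner_Integration.integral_sum)
       (auto intro!: integrable_mult_right integrable_of_real Gegenbauer_integrable_power simp del: of_real_mult of_real_power simp: mult_ac)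
  also have "\<dots> = (\<integral>x. \<i>^(a+b) * (-1)^b * of_real (indicator {-1..1} x * ((1 + x) powr (a + \<gamma>) * (1 - x) powr (b + \<gamma>))) \<partial>lborel)"
  proof (rule integral_cong_AE)
    show "AE x in lborel. (\<Sum>i\<le>a+b. coeff ?P i * \<i>^i * of_real (x^i * ?w x))
       = \<i>^(a+b) * (-1)^b * of_real (indicator {-1..1} x * ((1 + x) powr (a + \<gamma>) * (1 - x) powr (b + \<gamma>)))"
      using AE_abs_neq_1
    proof eventually_elim
      case (elim x)
      show ?case
      proof (cases "\<bar>x\<bar> < 1")
        case True
        have "(\<Sum>i\<le>a+b. coeff ?P i * \<i>^i * of_real (x^i * ?w x)) = poly ?P (\<i> * of_real x) * of_real (?w x)"
          by (subst poly_altdef_le[of _ "a+b"], simp add: degree_chord_root_poly, unfold sum_distrib_right, intro sum.cong refl)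
             (simp add: power_mult_distrib mult_ac)
        also have "poly ?P (\<i> * of_real x) = (\<i> * (1 + of_real x))^a * (\<i> * (-1) * (1 - of_real x))^b"
          by (simp add: chord_root_poly_def algebra_simps)
        also have "\<dots> = \<i>^(a+b) * (-1)^b * of_real ((1 + x)^a * (1 - x)^b)"
          unfolding power_mult_distrib power_add by (simp add: mult_ac)
        finally have "(\<Sum>i\<le>a+b. coeff ?P i * \<i>^i * of_real (x^i * ?w x))
            = \<i>^(a+b) * (-1)^b * of_real ((1 + x)^a * (1 - x)^b * ?w x)" by (simp only: of_real_mult mult.assoc)
        moreover have "(1 + x)^a * (1 - x)^b * ?w x = indicator {-1..1} x * ((1 + x) powr (a + \<gamma>) * (1 - x) powr (b + \<gamma>))"
        proof -
          have x: "x \<in> {-1..1}" "1 + x > 0" "1 - x > 0" using True by auto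
          show ?thesis unfolding powr_add using x(2,3) one_minus_square_powr[OF x(1), of \<gamma>] x(1)
            by (simp add: powr_realpow)
        qed
        ultimately show ?thesis by simp
      next
        case False
        then show ?thesis using elim by (auto simp: indicator_def)
      qed
    qed
  qed measurable
  also have "\<dots> = \<i>^(a+b) * (-1)^b * of_real (\<integral>x. indicator {-1..1} x * ((1 + x) powr (a + \<gamma>) * (1 - x) powr (b + \<gamma>)) \<partial>lborel)"
    by (simp only: integral_mult_right_zero integral_complex_of_real)
  also have "(\<integral>x. indicator {-1..1} x * ((1 + x) powr (a + \<gamma>) * (1 - x) powr (b + \<gamma>)) \<partial>lborel)
     = 2 powr (a + b + 2 * \<gamma> + 1) * Beta (a + \<gamma> + 1) (b + \<gamma> + 1)"
    using \<gamma> by (subst Jacobi_weight_integral(2)) (auto simp: algebra_simps)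
  finally show ?thesis by simp
qed

lemma degree_radon_profile: "degree (radon_profile \<gamma> n l) \<le> n"
  unfolding radon_profile_def
proof (intro degree_sum_le finite_atMost)
  fix j k assume "j \<in> {..n}" "k \<in> {..j}"
  then show "degree (smult (of_real (coeff (Lhat \<gamma> n) j) * disk_monomial_coeff l j k) (chord_poly \<gamma> (j - k) k)) \<le> n"
    using degree_chord_poly[of "j - k" k] by (auto intro: order_trans[OF degree_smult_le])
qed

lemma sigma_coeff_sq:
  assumes "k \<le> n"
  shows "(sigma_coeff \<gamma> n k)\<^sup>2 = 2 powr (2 * \<gamma> + 2) * pi * (n choose k) * Beta (real (n - k) + \<gamma> + 1) (real k + \<gamma> + 1)"
    and "sigma_coeff \<gamma> n k > 0"
proof -
  have e: "real n - real k + \<gamma> + 1 = real (n - k) + \<gamma> + 1" using assms by (simp add: of_nat_diff)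
  have pos: "real (n - k) + \<gamma> + 1 > 0" "real k + \<gamma> + 1 > 0" using \<gamma> by auto
  have G: "Gamma (real n - real k + \<gamma> + 1) * Gamma (real k + \<gamma> + 1) / Gamma (real n + 2 * \<gamma> + 2)
    = Beta (real (n - k) + \<gamma> + 1) (real k + \<gamma> + 1)"
    unfolding Beta_def e using assms by (simp add: of_nat_diff algebra_simps)
  have B: "Beta (real (n - k) + \<gamma> + 1) (real k + \<gamma> + 1) > 0"
    unfolding Beta_def using pos by (auto intro!: mult_pos_pos divide_pos_pos Gamma_real_pos)
  have "2 powr (2 * \<gamma> + 2) * pi * real (n choose k) * Beta (real (n - k) + \<gamma> + 1) (real k + \<gamma> + 1) > 0"
    using B assms by (intro mult_pos_pos) auto
  then show "(sigma_coeff \<gamma> n k)\<^sup>2 = 2 powr (2 * \<gamma> + 2) * pi * (n choose k) * Beta (real (n - k) + \<gamma> + 1) (real k + \<gamma> + 1)"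
    "sigma_coeff \<gamma> n k > 0"
    unfolding sigma_coeff_def G by auto
qed

text \<open>
  Only the monomials of full degree \<open>n\<close> contribute to the top coefficient, and among them only the
  one whose frequency \<open>n - 2 k\<close> equals \<open>l\<close>. Its Beta function is the one in \<open>sigma_coeff\<close>.
\<close>

lemma coeff_radon_profile:
  "coeff (radon_profile \<gamma> n l) n * (2 * pi) = of_real (lead_coeff (Lhat \<gamma> n) * (singular_value \<gamma> (n, l))\<^sup>2)"
proof -
  let ?c = "\<lambda>k. disk_monomial_coeff l n k * coeff (chord_poly \<gamma> (n - k) k) n"
  have "coeff (radon_profile \<gamma> n l) n = (\<Sum>j\<le>n. \<Sum>k\<le>j. of_real (coeff (Lhat \<gamma> n) j) * (disk_monomial_coeff l j k * coeff (chord_poly \<gamma> (j - k) k) n))"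
    unfolding radon_profile_def by (simp add: coeff_sum mult.assoc)
  also have "\<dots> = (\<Sum>j\<le>n. if j = n then of_real (coeff (Lhat \<gamma> n) n) * (\<Sum>k\<le>n. ?c k) else 0)"
  proof (intro sum.cong refl)
    fix j assume j: "j \<in> {..n}"
    show "(\<Sum>k\<le>j. of_real (coeff (Lhat \<gamma> n) j) * (disk_monomial_coeff l j k * coeff (chord_poly \<gamma> (j - k) k) n))
      = (if j = n then of_real (coeff (Lhat \<gamma> n) n) * (\<Sum>k\<le>n. ?c k) else 0)"
    proof (cases "j = n")
      case False
      have "coeff (chord_poly \<gamma> (j - k) k) n = 0" if "k \<le> j" for k
        using degree_chord_poly[of "j - k" k] that j False by (intro coeff_eq_0) auto
      then show ?thesis using False by (auto intro!: sum.neutral)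
    qed (simp add: sum_distrib_left)
  qed
  also have "\<dots> = of_real (lead_coeff (Lhat \<gamma> n)) * (\<Sum>k\<le>n. ?c k)"
    by (simp add: Lhat_degree[OF \<gamma>])
  finally have top: "coeff (radon_profile \<gamma> n l) n = of_real (lead_coeff (Lhat \<gamma> n)) * (\<Sum>k\<le>n. ?c k)" .
  have "(\<Sum>k\<le>n. ?c k) * (2 * pi) = of_real ((singular_value \<gamma> (n, l))\<^sup>2)"
  proof -
    have ck: "?c k * (2 * pi) = (if l = int n - 2 * int k then of_real ((sigma_coeff \<gamma> n k)\<^sup>2) else 0)" if "k \<le> n" for k
    proof (cases "l = int n - 2 * int k")
      case True
      have cc: "coeff (chord_poly \<gamma> (n - k) k) n = \<i>^n * (-1)^k * of_real (2 powr (real n + 2 * \<gamma> + 1) * Beta (real (n - k) + \<gamma> + 1) (real k + \<gamma> + 1))"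
        using coeff_chord_poly[of "n - k" k] that by (simp add: of_nat_diff)
      have ii: "(-1)^k / (2 * \<i>)^n * (\<i>^n * (-1)^k) = complex_of_real (1 / 2^n)"
        by (simp add: power_mult_distrib flip: power_add)
      have two: "1 / 2^n * 2 powr (real n + 2 * \<gamma> + 1) * 2 = (2::real) powr (2 * \<gamma> + 2)"
        by (simp add: powr_add powr_realpow)
      have "?c k * (2 * pi) = of_nat (n choose k) * ((-1)^k / (2 * \<i>)^n * (\<i>^n * (-1)^k)) *
          of_real (2 powr (real n + 2 * \<gamma> + 1) * Beta (real (n - k) + \<gamma> + 1) (real k + \<gamma> + 1)) * (2 * pi)"
        unfolding cc disk_monomial_coeff_def using True by (simp add: mult_ac)
      also have "\<dots> = of_real ((1 / 2^n * 2 powr (real n + 2 * \<gamma> + 1) * 2) * pi * (n choose k) * Beta (real (n - k) + \<gamma> + 1) (real k + \<gamma> + 1))"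
        unfolding ii by (simp add: mult_ac)
      also have "\<dots> = of_real ((sigma_coeff \<gamma> n k)\<^sup>2)" unfolding two sigma_coeff_sq(1)[OF that] ..
      finally show ?thesis using True by simp
    qed (simp add: disk_monomial_coeff_def)
    have "(\<Sum>k\<le>n. ?c k) * (2 * pi) = (\<Sum>k\<le>n. if l = int n - 2 * int k then of_real ((sigma_coeff \<gamma> n k)\<^sup>2) else 0)"
      unfolding sum_distrib_right by (intro sum.cong refl ck) auto
    also have "\<dots> = of_real ((singular_value \<gamma> (n, l))\<^sup>2)"
    proof (cases "\<bar>l\<bar> \<le> int n \<and> even (int n - l)")
      case True
      define k where "k = nat ((int n - l) div 2)"
      have k: "l = int n - 2 * int k" "k \<le> n" using True by (auto simp: k_def)
      then have "(l = int n - 2 * int k') = (k' = k)" for k' by auto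
      then have "(\<Sum>k\<le>n. if l = int n - 2 * int k then complex_of_real ((sigma_coeff \<gamma> n k)\<^sup>2) else 0)
          = of_real ((sigma_coeff \<gamma> n k)\<^sup>2)"
        using k(2) by simp
      moreover have "singular_value \<gamma> (n, l) = sigma_coeff \<gamma> n k"
        using True by (simp add: singular_value_def k_def)
      ultimately show ?thesis by simp
    next
      case False
      then have "l \<noteq> int n - 2 * int k" if "k \<le> n" for k using that by auto
      then show ?thesis using False by (auto simp: singular_value_def)
    qed
    finally show ?thesis .
  qed
  then show ?thesis unfolding top by (simp only: of_real_mult mult.assoc)
qed

lemma radon_disk_polynomial:
  "AE p in line_measure. radon (\<lambda>z. disk_weight \<gamma> z *\<^sub>R disk_polynomial \<gamma> (n, l) z) p =
     fst p powi l * (of_real ((1 - (snd p)\<^sup>2) powr (\<gamma> + 1/2)) * (poly (radon_profile \<gamma> n l) (of_real (snd p)) * of_real (indicator {-1..1} (snd p))))"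
proof -
  have "AE s in lborel. s \<noteq> (0::real)" by (rule AE_lborel_singleton)
  then have "AE p in line_measure. snd p \<noteq> 0" by (rule AE_line_snd) simp
  then show ?thesis using AE_line_abs_neq_1 AE_circle_fst
  proof eventually_elim
    case (elim p)
    obtain v s where p: "p = (v, s)" by (cases p)
    have v: "cmod v = 1" and s: "s \<noteq> 0" "\<bar>s\<bar> \<noteq> 1" using elim by (auto simp: p)
    show ?case
    proof (cases "\<bar>s\<bar> < 1")
      (* Summands whose frequency is not l have coefficient 0, so all powers of v are equal. *)
      case True
      let ?h = "\<lambda>a b z. disk_weight \<gamma> z *\<^sub>R (z^a * cnj z^b)"
      let ?c = "\<lambda>j k. of_real (coeff (Lhat \<gamma> n) j) * disk_monomial_coeff l j k"
      note R = radon_disk_monomial[OF v True s(1)]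
      have "radon (\<lambda>z. disk_weight \<gamma> z *\<^sub>R disk_polynomial \<gamma> (n, l) z) p
        = (\<integral>\<tau>. (\<Sum>j\<le>n. \<Sum>k\<le>j. ?c j k * ?h (j-k) k (v * Complex \<tau> s)) \<partial>lborel)"
        unfolding radon_def p fst_conv snd_conv disk_polynomial_explicit[OF \<gamma>]
        by (simp only: scaleR_sum_right mult_scaleR_right)
      also have "\<dots> = (\<Sum>j\<le>n. \<integral>\<tau>. (\<Sum>k\<le>j. ?c j k * ?h (j-k) k (v * Complex \<tau> s)) \<partial>lborel)"
        by (intro Bochner_Integration.integral_sum Bochner_Integration.integrable_sum integrable_mult_right R(1))
      also have "\<dots> = (\<Sum>j\<le>n. \<Sum>k\<le>j. \<integral>\<tau>. ?c j k * ?h (j-k) k (v * Complex \<tau> s) \<partial>lborel)"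
        by (intro sum.cong refl Bochner_Integration.integral_sum integrable_mult_right R(1))
      also have "\<dots> = (\<Sum>j\<le>n. \<Sum>k\<le>j. ?c j k * radon (?h (j-k) k) (v, s))"
        by (simp only: integral_mult_right_zero radon_def fst_conv snd_conv)
      also have "\<dots> = (\<Sum>j\<le>n. \<Sum>k\<le>j. v powi l * (of_real ((1 - s\<^sup>2) powr (\<gamma> + 1/2)) * (?c j k * poly (chord_poly \<gamma> (j-k) k) (of_real s))))"
      proof (intro sum.cong refl)
        fix j k :: nat assume "k \<in> {..j}"
        show "?c j k * radon (?h (j-k) k) (v, s) = v powi l * (of_real ((1 - s\<^sup>2) powr (\<gamma> + 1/2)) * (?c j k * poly (chord_poly \<gamma> (j-k) k) (of_real s)))"
        proof (cases "l = int j - 2 * int k")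
          case True
          then have "int (j - k) - int k = l" using \<open>k \<in> {..j}\<close> by auto
          then show ?thesis unfolding R(2) by (simp only: mult_ac)
        qed (simp add: disk_monomial_coeff_def)
      qed
      also have "\<dots> = v powi l * (of_real ((1 - s\<^sup>2) powr (\<gamma> + 1/2)) * poly (radon_profile \<gamma> n l) (of_real s))"
        unfolding radon_profile_def poly_sum by (simp add: sum_distrib_left)
      finally show ?thesis using True by (simp add: p abs_less_iff)
    next
      case False
      then have "\<bar>s\<bar> > 1" using s by simp
      then have "disk_weight \<gamma> (v * Complex \<tau> s) = 0" for \<tau>
        by (simp only: disk_weight_rotate[OF v] disk_weight_off_chord)
      then show ?thesis using \<open>\<bar>s\<bar> > 1\<close> by (auto simp: radon_def p indicator_def)
    qed
  qed
qed

lemma disk_polynomial_continuous: "continuous_on UNIV (disk_polynomial \<gamma> i)"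
proof -
  obtain n l where i: "i = (n, l)" by (cases i)
  show ?thesis unfolding i disk_polynomial_explicit[OF \<gamma>] by (intro continuous_intros)
qed

lemma disk_continuous_L2:
  assumes "continuous_on UNIV f"
  shows "f \<in> L2 (disk_measure \<gamma>)" "integrable lborel (\<lambda>z. disk_weight \<gamma> z *\<^sub>R f z)"
proof -
  have fm: "g \<in> borel_measurable (disk_measure \<gamma>)" if "continuous_on UNIV g" for g :: "complex \<Rightarrow> 'b::topological_space"
    unfolding disk_measure_def measurable_density_eq1
    using that by (auto intro!: measurable_restrict_space1 borel_measurable_continuous_onI)
  have "bounded (f ` cball 0 1)"
    by (intro compact_imp_bounded compact_continuous_image continuous_on_subset[OF assms]) auto
  then obtain B where B: "\<And>z. z \<in> cball 0 1 \<Longrightarrow> cmod (f z) \<le> B" unfolding bounded_iff by (meson imageI)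
  show "f \<in> L2 (disk_measure \<gamma>)"
  proof (rule L2_bound[OF fm[OF assms], of "\<lambda>_. B\<^sup>2"])
    show "integrable (disk_measure \<gamma>) (\<lambda>_. B\<^sup>2)"
      by (subst disk_integrable_iff) (auto intro: integrable_disk_weight[OF \<gamma>])
    have "(cmod (f z))\<^sup>2 \<le> B\<^sup>2" if "z \<in> space (disk_measure \<gamma>)" for z
      using that B[of z] by (intro power_mono) (auto simp: disk_measure_def space_restrict_space)
    then show "AE z in disk_measure \<gamma>. (cmod (f z))\<^sup>2 \<le> B\<^sup>2" by (intro AE_I2)
  qed
  then show "integrable lborel (\<lambda>z. disk_weight \<gamma> z *\<^sub>R f z)" by (rule integrable_weighted_L2[OF \<gamma>])
qed

text \<open>
  This is the adjointness that makes \<open>disk_polynomial\<close> the adjoint image of the fan-beam basis.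
\<close>

theorem radon_kernel_moment:
  assumes h: "integrable lborel h" and supp: "\<And>z. cmod z > 1 \<Longrightarrow> h z = 0"
  shows "integrable line_measure (\<lambda>p. radon h p * beam_kernel \<gamma> i p)"
    and "(\<integral>p. radon h p * beam_kernel \<gamma> i p \<partial>line_measure) = (\<integral>z. h z * cnj (disk_polynomial \<gamma> i z) \<partial>lborel)"
proof -
  have "bounded (poly (Lhat \<gamma> (fst i)) ` {-1..1})"
    by (intro compact_imp_bounded compact_continuous_image continuous_intros) auto
  then obtain B where B: "\<And>x. x \<in> {-1..1} \<Longrightarrow> norm (poly (Lhat \<gamma> (fst i)) x) \<le> B" unfolding bounded_iff by (meson imageI)
  have bd: "cmod (beam_kernel \<gamma> i (v, s)) \<le> 1 / (2*pi) * B" if "cmod v = 1" "\<bar>s\<bar> \<le> 1" for v s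
    using that B[of s] by (auto simp: beam_kernel_def norm_mult norm_power_int norm_divide abs_le_iff intro!: divide_right_mono)
  note * = radon_adjoint[OF h supp beam_kernel_measurable bd]
  show "integrable line_measure (\<lambda>p. radon h p * beam_kernel \<gamma> i p)" by (rule *(1))
  have "(\<integral>p. radon h p * beam_kernel \<gamma> i p \<partial>line_measure)
    = (\<integral>z. h z * (\<integral>v. beam_kernel \<gamma> i (v, Im (z * cnj v)) \<partial>circle_measure) \<partial>lborel)" by (rule *(2))
  also have "\<dots> = (\<integral>z. h z * cnj (disk_polynomial \<gamma> i z) \<partial>lborel)"
  proof (rule Bochner_Integration.integral_cong[OF refl])
    fix z show "h z * (\<integral>v. beam_kernel \<gamma> i (v, Im (z * cnj v)) \<partial>circle_measure) = h z * cnj (disk_polynomial \<gamma> i z)"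
      using supp[of z] integral_kernel_disk_polynomial[of z \<gamma> i] by (cases "cmod z \<le> 1") auto
  qed
  finally show "(\<integral>p. radon h p * beam_kernel \<gamma> i p \<partial>line_measure) = (\<integral>z. h z * cnj (disk_polynomial \<gamma> i z) \<partial>lborel)" .
qed

text \<open>
  Since \<open>Lhat \<gamma> m\<close> is orthogonal to all smaller degrees, a polynomial of degree at most \<open>m\<close> is seen
  only through its coefficient at \<open>m\<close>. The leading coefficient of \<open>Lhat\<close> is kept on the left to avoid
  a division.
\<close>

lemma weighted_moment_Lhat:
  assumes "degree q \<le> m"
  defines "f \<equiv> (\<lambda>s. (of_real ((1 - s\<^sup>2) powr (\<gamma> + 1/2)) * (poly q (of_real s) * of_real (indicator {-1..1} s)))
        * complex_of_real (indicator {-1..1} s * poly (Lhat \<gamma> m) s))"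
  shows "integrable lborel f"
    and "(\<integral>s. f s \<partial>lborel) * of_real (lead_coeff (Lhat \<gamma> m)) = coeff q m * (2 * pi)"
proof -
  let ?L = "Lhat \<gamma> m"
  have f: "f s = (\<Sum>i\<le>m. coeff q i * of_real (poly (monom 1 i * ?L) s * (indicator {-1..1} s * (1 - s\<^sup>2) powr (\<gamma> + 1/2))))" for s
    unfolding f_def poly_altdef_le[OF assms(1)]
    by (cases "s \<in> {-1..1}") (auto simp: poly_monom sum_distrib_left sum_distrib_right mult_ac)
  have gi: "integrable lborel (\<lambda>s. coeff q i * complex_of_real (poly (monom 1 i * ?L) s * (indicator {-1..1} s * (1 - s\<^sup>2) powr (\<gamma> + 1/2))))" for i
    by (intro integrable_mult_right integrable_weighted_poly[OF \<gamma>])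
  show "integrable lborel f" unfolding f by (intro Bochner_Integration.integrable_sum gi)
  have wm: "weighted_inner \<gamma> (monom 1 i) ?L = 0" if "i < m" for i
    using that Lhat_orth[OF \<gamma>, of "monom 1 i" m] weighted_inner_commute[OF \<gamma>] by (simp add: degree_monom_eq)
  (* Lhat differs from its leading term by a polynomial of smaller degree, to which it is
     orthogonal. *)
  have top: "weighted_inner \<gamma> (monom 1 m) ?L * lead_coeff ?L = 2 * pi"
  proof -
    define r where "r = ?L - smult (lead_coeff ?L) (monom 1 m)"
    have "weighted_inner \<gamma> ?L r = 0"
    proof (cases "r = 0")
      case True
      then show ?thesis using weighted_inner_zero[OF \<gamma>] weighted_inner_commute[OF \<gamma>] by metis
    next
      case False
      have "coeff r m = 0" by (simp add: r_def Lhat_degree[OF \<gamma>])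
      moreover have "degree r \<le> m"
        unfolding r_def by (intro degree_diff_le degree_smult_le[THEN order_trans]) (auto simp: Lhat_degree[OF \<gamma>] intro: degree_monom_le)
      ultimately have "degree r < m" using False by (metis le_neq_implies_less leading_coeff_0_iff)
      then show ?thesis by (rule Lhat_orth[OF \<gamma>])
    qed
    then have "weighted_inner \<gamma> ?L ?L - lead_coeff ?L * weighted_inner \<gamma> (monom 1 m) ?L = 0"
      unfolding r_def using weighted_inner_commute[OF \<gamma>] weighted_inner_diff[OF \<gamma>] weighted_inner_smult[OF \<gamma>] by metis
    then show ?thesis using Lhat_norm[OF \<gamma>, of m] by (simp add: mult.commute)
  qed
  have "(\<integral>s. f s \<partial>lborel) = (\<Sum>i\<le>m. coeff q i * of_real (weighted_inner \<gamma> (monom 1 i) ?L))"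
    unfolding f weighted_inner_alt
    by (subst Bochner_Integration.integral_sum[OF gi]) (simp only: integral_mult_right_zero integral_complex_of_real)
  also have "\<dots> = (\<Sum>i\<le>m. if i = m then coeff q m * of_real (weighted_inner \<gamma> (monom 1 m) ?L) else 0)"
    by (intro sum.cong) (auto simp: wm)
  also have "\<dots> = coeff q m * of_real (weighted_inner \<gamma> (monom 1 m) ?L)" by simp
  finally have "(\<integral>s. f s \<partial>lborel) * of_real (lead_coeff ?L) = coeff q m * of_real (weighted_inner \<gamma> (monom 1 m) ?L * lead_coeff ?L)"
    by (simp only: of_real_mult mult.assoc)
  then show "(\<integral>s. f s \<partial>lborel) * of_real (lead_coeff ?L) = coeff q m * (2 * pi)" unfolding top by simp
qed

lemma disk_polynomial_L2: "disk_polynomial \<gamma> i \<in> L2 (disk_measure \<gamma>)"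
  by (rule disk_continuous_L2[OF disk_polynomial_continuous])

lemma disk_inner:
  assumes f: "f \<in> L2 (disk_measure \<gamma>)"
  shows "l2_inner (disk_measure \<gamma>) f (disk_polynomial \<gamma> i) = (\<integral>z. (disk_weight \<gamma> z *\<^sub>R f z) * cnj (disk_polynomial \<gamma> i z) \<partial>lborel)"
proof -
  have "(\<lambda>z. f z * cnj (disk_polynomial \<gamma> i z)) \<in> borel_measurable (disk_measure \<gamma>)"
    using integrable_inner[OF f disk_polynomial_L2] by simp
  then show ?thesis
    unfolding l2_inner_def using disk_integral(2)[of "\<lambda>z. f z * cnj (disk_polynomial \<gamma> i z)" \<gamma>] by simp
qed

text \<open>
  Adjointness turns the inner product into a moment of \<open>radon_profile\<close> of degree at most \<open>n\<close> against
  \<open>Lhat \<gamma> m\<close>, which explains the restriction \<open>n \<le> m\<close>.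
\<close>

lemma disk_polynomial_inner_le:
  assumes "n \<le> m"
  shows "l2_inner (disk_measure \<gamma>) (disk_polynomial \<gamma> (n, l)) (disk_polynomial \<gamma> (m, l'))
    = (if n = m \<and> l = l' then of_real ((singular_value \<gamma> (n, l))\<^sup>2) else 0)"
proof -
  let ?g = "\<lambda>s. of_real ((1 - s\<^sup>2) powr (\<gamma> + 1/2)) * (poly (radon_profile \<gamma> n l) (of_real s) * complex_of_real (indicator {-1..1} s))"
  let ?h = "\<lambda>z. disk_weight \<gamma> z *\<^sub>R disk_polynomial \<gamma> (n, l) z"
  have deg: "degree (radon_profile \<gamma> n l) \<le> m" using degree_radon_profile assms by (rule order_trans)
  have h: "integrable lborel ?h" by (rule disk_continuous_L2[OF disk_polynomial_continuous])
  have supp: "?h z = 0" if "cmod z > 1" for z using that by (simp add: disk_weight_def)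
  have lead: "lead_coeff (Lhat \<gamma> m) \<noteq> 0" using Lhat_lead[OF \<gamma>, of m] by (metis less_irrefl)
  have "l2_inner (disk_measure \<gamma>) (disk_polynomial \<gamma> (n, l)) (disk_polynomial \<gamma> (m, l'))
    = (\<integral>p. radon ?h p * beam_kernel \<gamma> (m, l') p \<partial>line_measure)"
    unfolding disk_inner[OF disk_polynomial_L2] by (rule radon_kernel_moment(2)[OF h supp, symmetric])
  also have "\<dots> = (\<integral>p. (fst p powi l * ?g (snd p)) * beam_kernel \<gamma> (m, l') p \<partial>line_measure)"
  proof (rule integral_cong_AE)
    show "AE p in line_measure. radon ?h p * beam_kernel \<gamma> (m, l') p = (fst p powi l * ?g (snd p)) * beam_kernel \<gamma> (m, l') p"
      using radon_disk_polynomial[of n l] by eventually_elim simp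
    show "(\<lambda>p. radon ?h p * beam_kernel \<gamma> (m, l') p) \<in> borel_measurable line_measure"
      using radon_kernel_moment(1)[OF h supp] by simp
    have [measurable]: "poly q \<in> borel_measurable borel" for q :: "complex poly"
      by (intro borel_measurable_continuous_onI continuous_intros)
    have "(\<lambda>p. (fst p powi l * ?g (snd p)) * beam_kernel \<gamma> (m, l') p) \<in> borel_measurable borel" by measurable
    then show "(\<lambda>p. (fst p powi l * ?g (snd p)) * beam_kernel \<gamma> (m, l') p) \<in> borel_measurable line_measure"
      by (rule measurable_line)
  qed
  also have "\<dots> = (if l = l' then (\<integral>s. ?g s * of_real (indicator {-1..1} s * poly (Lhat \<gamma> m) s) \<partial>lborel) else 0)"
    by (rule integral_beam_kernel[OF \<gamma> weighted_moment_Lhat(1)[OF deg]])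
  also have "\<dots> = (if n = m \<and> l = l' then of_real ((singular_value \<gamma> (n, l))\<^sup>2) else 0)"
  proof (cases "l = l'")
    case True
    have "(\<integral>s. ?g s * of_real (indicator {-1..1} s * poly (Lhat \<gamma> m) s) \<partial>lborel) * of_real (lead_coeff (Lhat \<gamma> m))
        = coeff (radon_profile \<gamma> n l) m * (2 * pi)"
      by (rule weighted_moment_Lhat(2)[OF deg])
    also have "\<dots> = (if n = m then of_real ((singular_value \<gamma> (n, l))\<^sup>2) else 0) * of_real (lead_coeff (Lhat \<gamma> m))"
    proof (cases "n = m")
      case True
      then show ?thesis using coeff_radon_profile[of n l] by (simp add: mult_ac)
    next
      case False
      then have "coeff (radon_profile \<gamma> n l) m = 0"
        using degree_radon_profile[of n l] assms by (intro coeff_eq_0) auto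
      then show ?thesis using False by simp
    qed
    finally show ?thesis using True lead by (simp only: mult_cancel_right of_real_eq_0_iff) simp
  qed simp
  finally show ?thesis .
qed

theorem disk_polynomial_inner:
  "l2_inner (disk_measure \<gamma>) (disk_polynomial \<gamma> i) (disk_polynomial \<gamma> j) = (if i = j then of_real ((singular_value \<gamma> i)\<^sup>2) else 0)"
proof -
  obtain n l where i: "i = (n, l)" by (cases i)
  obtain m l' where j: "j = (m, l')" by (cases j)
  show ?thesis
  proof (cases "n \<le> m")
    case True
    then show ?thesis using disk_polynomial_inner_le by (auto simp: i j)
  next
    case False
    then have "l2_inner (disk_measure \<gamma>) (disk_polynomial \<gamma> j) (disk_polynomial \<gamma> i) = 0"
      using disk_polynomial_inner_le[of m n l' l] by (auto simp: i j)
    then show ?thesis using False by (subst l2_inner_cnj) (auto simp: i j)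
  qed
qed

end

section \<open>Comparison and decay of the singular values\<close>

text \<open>
  The indices \<open>(n, n - 2 k)\<close> with \<open>k \<le> n\<close>, that is, those with a positive singular value.
\<close>

definition admissible :: "nat \<times> int \<Rightarrow> bool" where
  "admissible i \<longleftrightarrow> \<bar>snd i\<bar> \<le> int (fst i) \<and> even (int (fst i) - snd i)"

lemma admissible_sigma: "k \<le> n \<Longrightarrow> admissible (n, int n - 2 * int k)"
  by (auto simp: admissible_def)

text \<open>
  A bound, independent of \<open>n\<close> and \<open>k\<close>, for the ratio of squared singular values at neighbouring
  indices.
\<close>

definition ratio_bound :: "real \<Rightarrow> real" where
  "ratio_bound \<gamma> = max 1 (1 + \<gamma>) / min 1 (1 + \<gamma>)"

context
  fixes \<gamma> :: real
  assumes \<gamma>: "\<gamma> > -1"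
begin

text \<open>
  The ratio of consecutive squared singular values is \<open>(n - k) (k + 1 + \<gamma>) / ((k + 1) (n - k + \<gamma>))\<close>,
  by the functional equation of the Gamma function.
\<close>

lemma sigma_coeff_recurrence:
  assumes "k < n"
  shows "(sigma_coeff \<gamma> n (Suc k))\<^sup>2 * (real (k + 1) * (real (n - k) + \<gamma>))
    = (sigma_coeff \<gamma> n k)\<^sup>2 * (real (n - k) * (real (k + 1) + \<gamma>))"
proof -
  have nk: "real (n - Suc k) = real (n - k) - 1" using assms by (simp add: of_nat_diff)
  have pos: "real (n - k) + \<gamma> > 0" "real (k + 1) + \<gamma> > 0" using \<gamma> assms by auto
  have G1: "Gamma (real (n - k) + \<gamma> + 1) = (real (n - k) + \<gamma>) * Gamma (real (n - k) + \<gamma>)"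
    using pos by (intro Gamma_plus1) (auto simp: nonpos_Ints_def)
  have G2: "Gamma (real (k + 1) + \<gamma> + 1) = (real (k + 1) + \<gamma>) * Gamma (real (k + 1) + \<gamma>)"
    using pos by (intro Gamma_plus1) (auto simp: nonpos_Ints_def)
  have C: "(n choose Suc k) * (k + 1) = (n choose k) * (n - k)"
    using binomial_absorb_comp[of n k] assms
    by (metis Suc_eq_plus1 binomial_absorption mult.commute binomial_absorb_comp)
  then have C': "real (n choose Suc k) * real (k + 1) = real (n choose k) * real (n - k)"
    by (metis of_nat_mult)
  define D where "D = 2 powr (2 * \<gamma> + 2) * pi / Gamma (real n + 2 * \<gamma> + 2)"
  have B1: "(sigma_coeff \<gamma> n (Suc k))\<^sup>2 = D * real (n choose Suc k) * (Gamma (real (n - k) + \<gamma>) * Gamma (real (k + 1) + \<gamma> + 1))"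
    using sigma_coeff_sq(1)[OF \<gamma>, of "Suc k" n] assms
    unfolding Beta_def D_def nk by (simp add: of_nat_diff algebra_simps)
  have B2: "(sigma_coeff \<gamma> n k)\<^sup>2 = D * real (n choose k) * (Gamma (real (n - k) + \<gamma> + 1) * Gamma (real (k + 1) + \<gamma>))"
    using sigma_coeff_sq(1)[OF \<gamma>, of k n] assms
    unfolding Beta_def D_def by (simp add: of_nat_diff algebra_simps)
  define X where "X = D * Gamma (real (n - k) + \<gamma>) * Gamma (real (k + 1) + \<gamma>) * (real (k + 1) + \<gamma>) * (real (n - k) + \<gamma>)"
  have "(sigma_coeff \<gamma> n (Suc k))\<^sup>2 * (real (k + 1) * (real (n - k) + \<gamma>)) = (real (n choose Suc k) * real (k + 1)) * X"
    unfolding B1 G2 X_def by (simp only: mult_ac)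
  also have "\<dots> = (real (n choose k) * real (n - k)) * X" by (simp only: C')
  also have "\<dots> = (sigma_coeff \<gamma> n k)\<^sup>2 * (real (n - k) * (real (k + 1) + \<gamma>))"
    unfolding B2 G1 X_def by (simp only: mult_ac)
  finally show ?thesis .
qed

lemma ratio_bound_ge_1: "ratio_bound \<gamma> \<ge> 1"
  unfolding ratio_bound_def using \<gamma> by (simp add: le_divide_eq max_def min_def)

lemma shifted_ratio_bounds:
  assumes "x \<ge> 1"
  shows "min 1 (1 + \<gamma>) * x \<le> x + \<gamma>" "x + \<gamma> \<le> max 1 (1 + \<gamma>) * x"
proof -
  have "\<gamma> \<ge> 0 \<Longrightarrow> \<gamma> * 1 \<le> \<gamma> * x" using assms by (intro mult_left_mono) auto
  moreover have "\<gamma> \<le> 0 \<Longrightarrow> \<gamma> * x \<le> \<gamma> * 1" using assms by (intro mult_left_mono_neg) auto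
  ultimately show "min 1 (1 + \<gamma>) * x \<le> x + \<gamma>" "x + \<gamma> \<le> max 1 (1 + \<gamma>) * x"
    by (auto simp: min_def max_def algebra_simps)
qed

text \<open>
  In the recurrence, each quotient \<open>(x + \<gamma>) / x\<close> with \<open>x \<ge> 1\<close> lies between \<open>min 1 (1 + \<gamma>)\<close> and
  \<open>max 1 (1 + \<gamma>)\<close>. This is where \<open>\<gamma> > -1\<close> is essential.
\<close>

lemma sigma_coeff_step:
  assumes "k < n"
  shows "(sigma_coeff \<gamma> n (Suc k))\<^sup>2 \<le> ratio_bound \<gamma> * (sigma_coeff \<gamma> n k)\<^sup>2"
    and "(sigma_coeff \<gamma> n k)\<^sup>2 \<le> ratio_bound \<gamma> * (sigma_coeff \<gamma> n (Suc k))\<^sup>2"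
proof -
  define a b where "a = real (k + 1)" and "b = real (n - k)"
  define S T where "S = (sigma_coeff \<gamma> n (Suc k))\<^sup>2" and "T = (sigma_coeff \<gamma> n k)\<^sup>2"
  define l u where "l = min 1 (1 + \<gamma>)" and "u = max 1 (1 + \<gamma>)"
  have ab: "a \<ge> 1" "b \<ge> 1" using assms by (auto simp: a_def b_def)
  have lu: "l > 0" "u > 0" using \<gamma> by (auto simp: l_def u_def)
  have ST: "S \<ge> 0" "T \<ge> 0" by (auto simp: S_def T_def)
  have rec: "S * (a * (b + \<gamma>)) = T * (b * (a + \<gamma>))"
    using sigma_coeff_recurrence[OF assms] by (simp add: S_def T_def a_def b_def)
  note ba = shifted_ratio_bounds[OF ab(1), folded l_def u_def] shifted_ratio_bounds[OF ab(2), folded l_def u_def]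
  have "S * (a * (l * b)) \<le> S * (a * (b + \<gamma>))"
    using ba(3) ab ST by (intro mult_left_mono) auto
  also have "\<dots> \<le> T * (b * (u * a))" unfolding rec using ba(2) ab ST by (intro mult_left_mono) auto
  finally have "(a * b) * (l * S) \<le> (a * b) * (u * T)" by (simp add: mult_ac)
  then have "l * S \<le> u * T" using ab by (subst (asm) mult_le_cancel_left_pos) auto
  then show "S \<le> ratio_bound \<gamma> * T" using lu by (simp add: ratio_bound_def field_simps flip: l_def u_def)
  have "T * (b * (l * a)) \<le> T * (b * (a + \<gamma>))"
    using ba(1) ab ST by (intro mult_left_mono) auto
  also have "\<dots> \<le> S * (a * (u * b))" unfolding rec[symmetric] using ba(4) ab ST by (intro mult_left_mono) auto
  finally have "(a * b) * (l * T) \<le> (a * b) * (u * S)" by (simp add: mult_ac)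
  then have "l * T \<le> u * S" using ab by (subst (asm) mult_le_cancel_left_pos) auto
  then show "T \<le> ratio_bound \<gamma> * S" using lu by (simp add: ratio_bound_def field_simps flip: l_def u_def)
qed

lemma sigma_coeff_compare:
  assumes "k \<le> n" "k' \<le> n" "k' \<le> k + d" "k \<le> k' + d"
  shows "(sigma_coeff \<gamma> n k')\<^sup>2 \<le> ratio_bound \<gamma>^d * (sigma_coeff \<gamma> n k)\<^sup>2"
proof -
  have up: "j + e \<le> n \<Longrightarrow> (sigma_coeff \<gamma> n (j + e))\<^sup>2 \<le> ratio_bound \<gamma>^e * (sigma_coeff \<gamma> n j)\<^sup>2
      \<and> (sigma_coeff \<gamma> n j)\<^sup>2 \<le> ratio_bound \<gamma>^e * (sigma_coeff \<gamma> n (j + e))\<^sup>2" for j e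
  proof (induction e)
    case (Suc e)
    have c: "ratio_bound \<gamma> \<ge> 0" using ratio_bound_ge_1 by simp
    note st = sigma_coeff_step[of "j + e" n]
    have "(sigma_coeff \<gamma> n (j + Suc e))\<^sup>2 \<le> ratio_bound \<gamma> * (sigma_coeff \<gamma> n (j + e))\<^sup>2"
      using st Suc.prems by simp
    also have "\<dots> \<le> ratio_bound \<gamma> * (ratio_bound \<gamma>^e * (sigma_coeff \<gamma> n j)\<^sup>2)"
      using Suc c by (intro mult_left_mono) auto
    finally have 1: "(sigma_coeff \<gamma> n (j + Suc e))\<^sup>2 \<le> ratio_bound \<gamma>^Suc e * (sigma_coeff \<gamma> n j)\<^sup>2" by (simp add: mult_ac)
    have "(sigma_coeff \<gamma> n j)\<^sup>2 \<le> ratio_bound \<gamma>^e * (sigma_coeff \<gamma> n (j + e))\<^sup>2" using Suc by simp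
    also have "\<dots> \<le> ratio_bound \<gamma>^e * (ratio_bound \<gamma> * (sigma_coeff \<gamma> n (j + Suc e))\<^sup>2)"
      using st Suc.prems c by (intro mult_left_mono) auto
    finally show ?case using 1 by (simp add: mult_ac)
  qed simp
  have mono: "ratio_bound \<gamma>^e * x \<le> ratio_bound \<gamma>^d * x" if "e \<le> d" "x \<ge> 0" for e x
    using that ratio_bound_ge_1 by (intro mult_right_mono power_increasing) auto
  show ?thesis
  proof (cases "k \<le> k'")
    case True
    then have "(sigma_coeff \<gamma> n k')\<^sup>2 \<le> ratio_bound \<gamma>^(k' - k) * (sigma_coeff \<gamma> n k)\<^sup>2"
      using up[of k "k' - k"] assms by simp
    also have "\<dots> \<le> ratio_bound \<gamma>^d * (sigma_coeff \<gamma> n k)\<^sup>2" using assms by (intro mono) auto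
    finally show ?thesis .
  next
    case False
    then have "(sigma_coeff \<gamma> n k')\<^sup>2 \<le> ratio_bound \<gamma>^(k - k') * (sigma_coeff \<gamma> n k)\<^sup>2"
      using up[of k' "k - k'"] assms by simp
    also have "\<dots> \<le> ratio_bound \<gamma>^d * (sigma_coeff \<gamma> n k)\<^sup>2" using assms by (intro mono) auto
    finally show ?thesis .
  qed
qed

lemma sigma_coeff_ends: "(sigma_coeff \<gamma> n n)\<^sup>2 = (sigma_coeff \<gamma> n 0)\<^sup>2"
  using sigma_coeff_sq(1)[OF \<gamma>, of n n] sigma_coeff_sq(1)[OF \<gamma>, of 0 n] by (simp add: Beta_commute add.commute)

text \<open>
  Quotient of two instances of Euler's limit formula for the Gamma function.
\<close>

lemma Gamma_ratio_limit:
  fixes a b :: real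
  assumes "a > 0" "b > 0"
  shows "(\<lambda>n. real n powr (b - a) * (Gamma (real n + a + 1) / Gamma (real n + b + 1))) \<longlonglongrightarrow> 1"
proof -
  have ni: "a \<notin> \<int>\<^sub>\<le>\<^sub>0" "b \<notin> \<int>\<^sub>\<le>\<^sub>0" using assms by (auto simp: nonpos_Ints_def)
  have Gp: "Gamma a > 0" "Gamma b > 0" using assms by (auto intro: Gamma_real_pos)
  have "(\<lambda>n. (Gamma_series b n / Gamma_series a n) * (Gamma a / Gamma b)) \<longlonglongrightarrow> (Gamma b / Gamma a) * (Gamma a / Gamma b)"
    using Gp by (intro tendsto_intros Gamma_series_LIMSEQ) auto
  then have lim: "(\<lambda>n. (Gamma_series b n / Gamma_series a n) * (Gamma a / Gamma b)) \<longlonglongrightarrow> 1"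
    using Gp by simp
  have "eventually (\<lambda>n. (Gamma_series b n / Gamma_series a n) * (Gamma a / Gamma b)
     = real n powr (b - a) * (Gamma (real n + a + 1) / Gamma (real n + b + 1))) sequentially"
    using eventually_gt_at_top[of 0]
  proof eventually_elim
    case (elim n)
    have p: "pochhammer a (n+1) = Gamma (real n + a + 1) / Gamma a" "pochhammer b (n+1) = Gamma (real n + b + 1) / Gamma b"
      using pochhammer_Gamma[OF ni(1), of "n+1"] pochhammer_Gamma[OF ni(2), of "n+1"] by (simp_all add: add_ac)
    have pos: "Gamma (real n + a + 1) > 0" "Gamma (real n + b + 1) > 0" using assms by (auto intro: Gamma_real_pos)
    show ?case
      unfolding Gamma_series_def p powr_diff using Gp pos elim by (simp add: powr_def field_simps)
  qed
  with lim show ?thesis by (rule Lim_transform_eventually)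
qed

text \<open>
  At \<open>k = 0\<close> the squared singular value is a constant times \<open>Gamma (n + \<gamma> + 1) / Gamma (n + 2 \<gamma> + 2)\<close>,
  which behaves like \<open>n powr (- (1 + \<gamma>))\<close>.
\<close>

lemma sigma_coeff_end_bounds:
  obtains c C where "c > 0" "\<And>n. c \<le> (sigma_coeff \<gamma> n 0)\<^sup>2 * (real n + 1) powr (1 + \<gamma>)"
    "\<And>n. (sigma_coeff \<gamma> n 0)\<^sup>2 * (real n + 1) powr (1 + \<gamma>) \<le> C"
proof -
  define r where "r n = (sigma_coeff \<gamma> n 0)\<^sup>2 * (real n + 1) powr (1 + \<gamma>)" for n
  define K where "K = 2 powr (2 * \<gamma> + 2) * pi * Gamma (\<gamma> + 1)"
  have K: "K > 0" using \<gamma> by (auto simp: K_def intro!: mult_pos_pos Gamma_real_pos)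
  have pos: "r n > 0" for n
    using sigma_coeff_sq(2)[OF \<gamma>, of 0 n] by (auto simp: r_def)
  (* The shift of the index by one matches the arguments in Gamma_ratio_limit. *)
  have rn: "r (Suc n) = K * ((real n powr ((2*\<gamma>+2) - (\<gamma>+1)) * (Gamma (real n + (\<gamma>+1) + 1) / Gamma (real n + (2*\<gamma>+2) + 1)))
      * ((real n + 2) / real n) powr (1 + \<gamma>))" if "n > 0" for n
  proof -
    have "real n powr ((2*\<gamma>+2) - (\<gamma>+1)) * ((real n + 2) / real n) powr (1 + \<gamma>) = (real n + 2) powr (1 + \<gamma>)"
    proof -
      have "(2*\<gamma>+2) - (\<gamma>+1) = 1 + \<gamma>" by simp
      then show ?thesis using that by (simp only: powr_divide) simp
    qed
    moreover have "(sigma_coeff \<gamma> (Suc n) 0)\<^sup>2 = K * (Gamma (real n + (\<gamma>+1) + 1) / Gamma (real n + (2*\<gamma>+2) + 1))"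
      unfolding sigma_coeff_sq(1)[OF \<gamma>, of 0 "Suc n", simplified] Beta_def K_def by (simp add: add_ac mult_ac)
    ultimately show ?thesis unfolding r_def by (simp add: add_ac mult_ac)
  qed
  have "(\<lambda>n. 1 + 2 / real n) \<longlonglongrightarrow> 1 + 0" by (intro tendsto_intros lim_const_over_n)
  then have "(\<lambda>n. 1 + 2 / real n) \<longlonglongrightarrow> 1" by simp
  then have "(\<lambda>n. ((real n + 2) / real n)) \<longlonglongrightarrow> 1"
    by (rule Lim_transform_eventually)
       (use eventually_gt_at_top[of 0] in eventually_elim, simp add: field_simps)
  then have lim1: "(\<lambda>n. ((real n + 2) / real n) powr (1 + \<gamma>)) \<longlonglongrightarrow> 1 powr (1 + \<gamma>)"
    by (intro tendsto_powr tendsto_const) auto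
  have lim2: "(\<lambda>n. real n powr ((2*\<gamma>+2) - (\<gamma>+1)) * (Gamma (real n + (\<gamma>+1) + 1) / Gamma (real n + (2*\<gamma>+2) + 1))) \<longlonglongrightarrow> 1"
    using \<gamma> by (intro Gamma_ratio_limit) auto
  have "(\<lambda>n. K * ((real n powr ((2*\<gamma>+2) - (\<gamma>+1)) * (Gamma (real n + (\<gamma>+1) + 1) / Gamma (real n + (2*\<gamma>+2) + 1)))
      * ((real n + 2) / real n) powr (1 + \<gamma>))) \<longlonglongrightarrow> K * (1 * 1 powr (1 + \<gamma>))"
    by (intro tendsto_mult tendsto_const lim1 lim2)
  then have "(\<lambda>n. K * ((real n powr ((2*\<gamma>+2) - (\<gamma>+1)) * (Gamma (real n + (\<gamma>+1) + 1) / Gamma (real n + (2*\<gamma>+2) + 1)))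
      * ((real n + 2) / real n) powr (1 + \<gamma>))) \<longlonglongrightarrow> K" by simp
  then have "(\<lambda>n. r (Suc n)) \<longlonglongrightarrow> K"
    by (rule Lim_transform_eventually) (use eventually_gt_at_top[of 0] in eventually_elim, simp only: rn)
  then have lim: "r \<longlonglongrightarrow> K" by (simp add: filterlim_sequentially_Suc)
  then have "Bseq r" by (intro convergent_imp_Bseq) (auto simp: convergent_def)
  then obtain C where C: "\<And>n. norm (r n) \<le> C" unfolding Bseq_def by blast
  have "(\<lambda>n. inverse (r n)) \<longlonglongrightarrow> inverse K" using lim K by (intro tendsto_inverse) auto
  then have "Bseq (\<lambda>n. inverse (r n))" by (intro convergent_imp_Bseq) (auto simp: convergent_def)
  then obtain D where D: "D > 0" "\<And>n. norm (inverse (r n)) \<le> D" unfolding Bseq_def by blast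
  have "inverse D \<le> r n" for n
  proof -
    have "inverse (r n) \<le> D" using D(2)[of n] pos[of n] by simp
    then have "inverse D \<le> inverse (inverse (r n))" using pos[of n] by (intro le_imp_inverse_le) auto
    then show ?thesis by simp
  qed
  moreover have "r n \<le> C" for n using C[of n] by auto
  ultimately show thesis using that[of "inverse D" C] D(1) unfolding r_def by auto
qed

lemma singular_value_pos: "admissible i \<Longrightarrow> singular_value \<gamma> i > 0"
proof -
  assume a: "admissible i"
  obtain n l where i: "i = (n, l)" by (cases i)
  have "nat ((int n - l) div 2) \<le> n" using a by (auto simp: admissible_def i)
  then show ?thesis using a sigma_coeff_sq(2)[OF \<gamma>] by (simp add: admissible_def singular_value_def i)
qed

lemma singular_value_not_admissible: "\<not> admissible i \<Longrightarrow> singular_value \<gamma> i = 0"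
  by (cases i) (auto simp: admissible_def singular_value_def)

lemma singular_value_sigma: "k \<le> n \<Longrightarrow> singular_value \<gamma> (n, int n - 2 * int k) = sigma_coeff \<gamma> n k"
  by (auto simp: singular_value_def)

text \<open>
  Frequencies at distance \<open>2 d\<close> correspond to values of \<open>k\<close> at distance \<open>d\<close>.
\<close>

lemma singular_value_compare:
  assumes "admissible (n, l)" "\<bar>l' - l\<bar> \<le> 2 * int d"
  shows "(singular_value \<gamma> (n, l'))\<^sup>2 \<le> ratio_bound \<gamma>^d * (singular_value \<gamma> (n, l))\<^sup>2"
proof (cases "admissible (n, l')")
  case True
  define k k' where "k = nat ((int n - l) div 2)" and "k' = nat ((int n - l') div 2)"
  have "even (int n - l)" "even (int n - l')" "\<bar>l\<bar> \<le> int n" "\<bar>l'\<bar> \<le> int n"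
    using assms True by (auto simp: admissible_def)
  then have k: "l = int n - 2 * int k" "l' = int n - 2 * int k'" "k \<le> n" "k' \<le> n"
    by (auto simp: k_def k'_def)
  then have "k' \<le> k + d" "k \<le> k' + d" using assms(2) by auto
  then show ?thesis using sigma_coeff_compare[OF k(3,4)] k(3,4) by (simp add: k(1,2) singular_value_sigma)
next
  case False
  then show ?thesis using ratio_bound_ge_1 by (simp add: singular_value_not_admissible)
qed

end

section \<open>Diagonal values of symmetric tensors\<close>

text \<open>
  Polarization, one slot at a time: the vector \<open>v\<close> equals \<open>Re v * 1 + Im v * i\<close>, and both coordinates
  are combinations of \<open>v\<close> and \<open>cnj v\<close>. The remaining slots carry basis vectors, on which the tensor is
  square integrable.
\<close>

lemma tensor_partial_diagonal_expansion:
  assumes f: "f \<in> L2_tensor \<gamma> m"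
  shows "k \<le> m \<Longrightarrow> length es = m - k \<Longrightarrow> set es \<subseteq> Basis \<Longrightarrow>
    \<exists>g. (\<forall>r. g r \<in> L2 (disk_measure \<gamma>)) \<and>
      (\<forall>z\<in>cball 0 1. \<forall>v. f z (replicate k v @ es) = (\<Sum>r\<le>k. g r z * v^(k-r) * cnj v^r))"
proof (induction k arbitrary: es)
  case 0
  then have "(\<lambda>z. f z es) \<in> L2 (disk_measure \<gamma>)" using f by (simp add: L2_tensor_def)
  then show ?case by (intro exI[of _ "\<lambda>_ z. f z es"]) auto
next
  case (Suc k)
  have B: "(1::complex) \<in> Basis" "\<i> \<in> Basis" by (auto simp: Basis_complex_def)
  have len: "length (e # es) = m - k" for e using Suc.prems by auto
  have k: "k \<le> m" and s1: "set (1 # es) \<subseteq> Basis" and s2: "set (\<i> # es) \<subseteq> Basis"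
    using Suc.prems B by auto
  obtain g where g: "\<And>r. g r \<in> L2 (disk_measure \<gamma>)"
    "\<And>z v. z \<in> cball 0 1 \<Longrightarrow> f z (replicate k v @ 1 # es) = (\<Sum>r\<le>k. g r z * v^(k-r) * cnj v^r)"
    using Suc.IH[OF k len s1] by blast
  obtain h where h: "\<And>r. h r \<in> L2 (disk_measure \<gamma>)"
    "\<And>z v. z \<in> cball 0 1 \<Longrightarrow> f z (replicate k v @ \<i> # es) = (\<Sum>r\<le>k. h r z * v^(k-r) * cnj v^r)"
    using Suc.IH[OF k len s2] by blast
  (* A and B collect the parts multiplied by v and by cnj v; in G the index of the second part
     is shifted by one. *)
  define A where "A r z = g r z / 2 + h r z / (2 * \<i>)" for r z
  define B where "B r z = g r z / 2 - h r z / (2 * \<i>)" for r z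
  define G where "G r z = (if r \<le> k then A r z else 0) + (if r = 0 then 0 else B (r - 1) z)" for r z
  have AL: "A r \<in> L2 (disk_measure \<gamma>)" for r
    unfolding A_def using L2_add[OF L2_scale[OF g(1), of "1/2"] L2_scale[OF h(1), of "1 / (2 * \<i>)"]] by simp
  have BL: "B r \<in> L2 (disk_measure \<gamma>)" for r
    unfolding B_def using L2_diff[OF L2_scale[OF g(1), of "1/2"] L2_scale[OF h(1), of "1 / (2 * \<i>)"]] by simp
  have GL: "G r \<in> L2 (disk_measure \<gamma>)" for r
    unfolding G_def by (cases "r \<le> k"; cases "r = 0") (auto intro!: L2_add AL BL L2_zero)
  have "f z (replicate (Suc k) v @ es) = (\<Sum>r\<le>Suc k. G r z * v^(Suc k - r) * cnj v^r)" if z: "z \<in> cball 0 1" for z v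
  proof -
    let ?T = "\<lambda>w. f z (replicate k v @ w # es)"
    have len1: "length (replicate k v @ 1 # es) = m" using Suc.prems by auto
    have "linear (\<lambda>w. f z ((replicate k v @ 1 # es)[k := w]))"
      using f z len1 Suc.prems by (auto simp: L2_tensor_def sym_tensor_def)
    then have lin: "linear ?T" by (simp add: list_update_append)
    have "v = Re v *\<^sub>R 1 + Im v *\<^sub>R \<i>" by (simp add: complex_eq_iff)
    then have "?T v = ?T (Re v *\<^sub>R 1 + Im v *\<^sub>R \<i>)" by (rule arg_cong)
    also have "\<dots> = of_real (Re v) * ?T 1 + of_real (Im v) * ?T \<i>"
      by (simp only: linear_add[OF lin] linear_scale[OF lin]) (simp only: scaleR_conv_of_real)
    also have "complex_of_real (Re v) = (v + cnj v) / 2" by (simp add: complex_eq_iff)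
    also have "complex_of_real (Im v) = (v - cnj v) / (2 * \<i>)" by (simp add: complex_diff_cnj complex_eq_iff)
    also have "(v + cnj v) / 2 * ?T 1 + (v - cnj v) / (2 * \<i>) * ?T \<i>
       = (\<Sum>r\<le>k. (v + cnj v) / 2 * (g r z * v^(k-r) * cnj v^r) + (v - cnj v) / (2 * \<i>) * (h r z * v^(k-r) * cnj v^r))"
      by (simp only: g(2)[OF z] h(2)[OF z] sum_distrib_left sum.distrib)
    also have "\<dots> = (\<Sum>r\<le>k. A r z * v^(Suc k - r) * cnj v^r + B r z * v^(k - r) * cnj v^Suc r)"
    proof (intro sum.cong refl)
      fix r assume "r \<in> {..k}"
      then have e: "v^(Suc k - r) = v * v^(k-r)" by (simp add: Suc_diff_le)
      show "(v + cnj v) / 2 * (g r z * v^(k-r) * cnj v^r) + (v - cnj v) / (2 * \<i>) * (h r z * v^(k-r) * cnj v^r)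
        = A r z * v^(Suc k - r) * cnj v^r + B r z * v^(k - r) * cnj v^Suc r"
        unfolding e A_def B_def by (simp add: algebra_simps add_divide_distrib diff_divide_distrib)
    qed
    also have "\<dots> = (\<Sum>r\<le>k. A r z * v^(Suc k - r) * cnj v^r) + (\<Sum>r\<le>k. B r z * v^(k - r) * cnj v^Suc r)"
      by (rule sum.distrib)
    also have "(\<Sum>r\<le>k. A r z * v^(Suc k - r) * cnj v^r) = (\<Sum>r\<le>Suc k. (if r \<le> k then A r z else 0) * v^(Suc k - r) * cnj v^r)"
      by simp
    also have "(\<Sum>r\<le>k. B r z * v^(k - r) * cnj v^Suc r) = (\<Sum>r\<le>Suc k. (if r = 0 then 0 else B (r - 1) z) * v^(Suc k - r) * cnj v^r)"
      by (subst sum.atMost_Suc_shift) simp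
    also have "(\<Sum>r\<le>Suc k. (if r \<le> k then A r z else 0) * v^(Suc k - r) * cnj v^r) + (\<Sum>r\<le>Suc k. (if r = 0 then 0 else B (r - 1) z) * v^(Suc k - r) * cnj v^r)
      = (\<Sum>r\<le>Suc k. G r z * v^(Suc k - r) * cnj v^r)"
      unfolding sum.distrib[symmetric] G_def by (intro sum.cong refl) (simp only: distrib_right)
    finally show ?thesis by (simp only: replicate_Suc replicate_app_Cons_same append_Cons append.assoc)
  qed
  then show ?case using GL by blast
qed

lemma tensor_diagonal_expansion:
  assumes "f \<in> L2_tensor \<gamma> m"
  obtains g where "\<And>r. g r \<in> L2 (disk_measure \<gamma>)"
    "\<And>z v. z \<in> cball 0 1 \<Longrightarrow> f z (replicate m v) = (\<Sum>r\<le>m. g r z * v^(m-r) * cnj v^r)"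
proof -
  have "\<exists>g. (\<forall>r. g r \<in> L2 (disk_measure \<gamma>)) \<and>
      (\<forall>z\<in>cball 0 1. \<forall>v. f z (replicate m v) = (\<Sum>r\<le>m. g r z * v^(m-r) * cnj v^r))"
    using tensor_partial_diagonal_expansion[OF assms order_refl, of "[]"] by simp
  then show thesis using that by blast
qed

text \<open>
  The symmetric product of \<open>m - r\<close> copies of \<open>dz\<close> and \<open>r\<close> copies of its conjugate. The coefficient of a
  product of linear polynomials symmetrizes without a sum over permutations, and the binomial
  coefficient normalizes the diagonal.
\<close>

definition power_tensor :: "nat \<Rightarrow> nat \<Rightarrow> complex list \<Rightarrow> complex" where
  "power_tensor m r vs = coeff (prod_list (map (\<lambda>v. [:v, cnj v:]) vs)) r / of_nat (m choose r)"

lemma power_tensor_diagonal: "r \<le> m \<Longrightarrow> power_tensor m r (replicate m v) = v^(m-r) * cnj v^r"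
  by (simp add: power_tensor_def prod_list_replicate coeff_linear_poly_power)

lemma power_tensor_sym: "sym_tensor m (power_tensor m r)"
  unfolding sym_tensor_def
proof (intro conjI allI impI)
  fix vs :: "complex list" and i assume vs: "length vs = m \<and> i < m"
  define Q where "Q = prod_list (map (\<lambda>v. [:v, cnj v:]) (take i vs)) * prod_list (map (\<lambda>v. [:v, cnj v:]) (drop (Suc i) vs))"
  have "prod_list (map (\<lambda>v. [:v, cnj v:]) (vs[i := w])) = [:w, cnj w:] * Q" for w
    using vs by (simp add: upd_conv_take_nth_drop Q_def mult.left_commute del: mult_pCons_left)
  then have eq: "power_tensor m r (vs[i := w]) = (w * coeff Q r + (case r of 0 \<Rightarrow> 0 | Suc r' \<Rightarrow> cnj w * coeff Q r')) / of_nat (m choose r)" for w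
    by (simp add: power_tensor_def coeff_pCons split: nat.split)
  show "linear (\<lambda>w. power_tensor m r (vs[i := w]))"
    unfolding eq by (intro linearI) (auto simp: algebra_simps add_divide_distrib scaleR_conv_of_real split: nat.split)
next
  fix vs ws :: "complex list" assume "length vs = m \<and> mset ws = mset vs"
  then have "prod_mset (image_mset (\<lambda>v. [:v, cnj v:]) (mset ws)) = prod_mset (image_mset (\<lambda>v. [:v, cnj v:]) (mset vs))" by simp
  then have "prod_list (map (\<lambda>v. [:v, cnj v:]) ws) = prod_list (map (\<lambda>v. [:v, cnj v:]) vs)"
    by (simp flip: mset_map add: prod_mset_prod_list)
  then show "power_tensor m r ws = power_tensor m r vs" by (simp add: power_tensor_def)
qed

lemma tensor_with_diagonal:
  assumes g: "\<And>r. g r \<in> L2 (disk_measure \<gamma>)"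
  obtains f where "f \<in> L2_tensor \<gamma> m" "\<And>z v. f z (replicate m v) = (\<Sum>r\<le>m. g r z * v^(m-r) * cnj v^r)"
proof
  define f where "f z vs = (\<Sum>r\<le>m. g r z * power_tensor m r vs)" for z vs
  show "f z (replicate m v) = (\<Sum>r\<le>m. g r z * v^(m-r) * cnj v^r)" for z v
    unfolding f_def by (intro sum.cong refl) (simp add: power_tensor_diagonal mult.assoc)
  show "f \<in> L2_tensor \<gamma> m"
    unfolding L2_tensor_def
  proof (intro CollectI conjI ballI allI impI)
    fix z
    show "sym_tensor m (f z)"
      unfolding sym_tensor_def
    proof (intro conjI allI impI)
      fix vs :: "complex list" and i assume vs: "length vs = m \<and> i < m"
      have lin: "linear (\<lambda>w. power_tensor m r (vs[i := w]))" for r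
        using power_tensor_sym[of m r] vs by (auto simp: sym_tensor_def)
      have "linear (\<lambda>w. g r z * power_tensor m r (vs[i := w]))" for r
        by (intro linearI) (simp_all add: linear_add[OF lin] linear_scale[OF lin] algebra_simps)
      then show "linear (\<lambda>w. f z (vs[i := w]))" unfolding f_def by (intro linear_compose_sum) auto
    next
      fix vs ws :: "complex list" assume "length vs = m \<and> mset ws = mset vs"
      then have "power_tensor m r ws = power_tensor m r vs" for r
        using power_tensor_sym[of m r] by (auto simp: sym_tensor_def)
      then show "f z ws = f z vs" by (simp add: f_def)
    qed
  next
    fix es :: "complex list"
    show "(\<lambda>z. f z es) \<in> L2 (disk_measure \<gamma>)"
      unfolding f_def by (intro L2_sum, subst mult.commute) (rule L2_scale[OF g])
  qed
qed

section \<open>X-ray transforms of tensors in beam coordinates\<close>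

lemma AE_line_imp_inflow:
  assumes "AE p in line_measure. P p"
  shows "AE x in inflow_measure \<gamma>. P (beam_coords x)"
proof -
  have "AE p in beam_measure \<gamma>. P p"
    unfolding beam_measure_density using assms by (subst AE_density) auto
  then show ?thesis
    unfolding distr_beam_coords[symmetric] by (rule AE_distrD[OF beam_coords_measurable_inflow])
qed

lemma radon_measurable:
  assumes [measurable]: "h \<in> borel_measurable borel"
  shows "radon h \<in> borel_measurable borel"
proof -
  have "radon h \<in> borel_measurable line_measure" unfolding radon_def by measurable
  then show ?thesis by (subst measurable_cong_sets[OF borel_complex_real[symmetric] refl])
qed

text \<open>
  The X-ray transform of a tensor with diagonal \<open>\<Sum>r\<le>m. g r * v ^ (m - r) * cnj v ^ r\<close>, in beam
  coordinates.
\<close>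

definition beam_sum :: "real \<Rightarrow> nat \<Rightarrow> (nat \<Rightarrow> complex \<Rightarrow> complex) \<Rightarrow> complex \<times> real \<Rightarrow> complex" where
  "beam_sum \<gamma> m g p = (\<Sum>r\<le>m. fst p^(m-r) * cnj (fst p)^r * radon (\<lambda>z. disk_weight \<gamma> z *\<^sub>R g r z) p)"

text \<open>
  The parameter \<open>t\<close> of the line runs from the boundary point, while \<open>\<tau>\<close> is measured from the midpoint
  of the chord; they differ by \<open>cos \<alpha>\<close>. Integrability along the chord is needed to split the sum.
\<close>

lemma xray_beam_sum:
  assumes x: "x \<in> inflow_domain"
    and f: "\<And>z v. z \<in> cball 0 1 \<Longrightarrow> f z (replicate m v) = (\<Sum>r\<le>m. g r z * v^(m-r) * cnj v^r)"
    and int: "\<And>r. r \<le> m \<Longrightarrow> integrable lborel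
      (\<lambda>\<tau>. disk_weight \<gamma> (fst (beam_coords x) * Complex \<tau> (snd (beam_coords x)))
          *\<^sub>R g r (fst (beam_coords x) * Complex \<tau> (snd (beam_coords x))))"
  shows "xray m \<gamma> f x = beam_sum \<gamma> m g (beam_coords x)"
proof -
  obtain \<beta> \<alpha> where xp: "x = (\<beta>, \<alpha>)" by (cases x)
  define v where "v = cis (\<beta> + pi + \<alpha>)"
  have bc: "beam_coords x = (v, sin \<alpha>)" by (simp add: beam_coords_def xp v_def add_ac)
  have c: "cos \<alpha> \<ge> 0" using x by (intro cos_ge_zero) (auto simp: xp)
  have v: "cmod v = 1" by (simp add: v_def)
  define F where "F t = f (cis \<beta> + of_real t * v) (replicate m v) * complex_of_real (bdf (cis \<beta> + of_real t * v) powr \<gamma>)" for t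
  let ?Z = "\<lambda>\<tau>. v * Complex \<tau> (sin \<alpha>)"
  have z: "cis \<beta> + of_real (cos \<alpha> + \<tau>) * v = ?Z \<tau>" for \<tau>
  proof -
    have "cis \<beta> = v * (- cis (- \<alpha>))"
      by (simp add: v_def cis_mult complex_eq_iff)
    then have "cis \<beta> + of_real (cos \<alpha> + \<tau>) * v = v * (- cis (- \<alpha>) + of_real (cos \<alpha> + \<tau>))"
      by (simp add: algebra_simps)
    also have "- cis (- \<alpha>) + of_real (cos \<alpha> + \<tau>) = Complex \<tau> (sin \<alpha>)"
      by (simp add: complex_eq_iff)
    finally show ?thesis .
  qed
  have dom: "cos \<alpha> + \<tau> \<in> {0..2 * cos \<alpha>} \<longleftrightarrow> ?Z \<tau> \<in> cball 0 1" for \<tau>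
  proof -
    have "?Z \<tau> \<in> cball 0 1 \<longleftrightarrow> (cmod (Complex \<tau> (sin \<alpha>)))\<^sup>2 \<le> 1"
      using v by (simp add: norm_mult abs_square_le_1)
    also have "\<dots> \<longleftrightarrow> \<tau>\<^sup>2 \<le> (cos \<alpha>)\<^sup>2" by (simp add: cmod_power2 cos_squared_eq algebra_simps)
    also have "\<dots> \<longleftrightarrow> \<bar>\<tau>\<bar> \<le> \<bar>cos \<alpha>\<bar>" by (simp only: abs_le_square_iff)
    also have "\<dots> \<longleftrightarrow> cos \<alpha> + \<tau> \<in> {0..2 * cos \<alpha>}" using c by (auto simp: abs_le_iff)
    finally show ?thesis by simp
  qed
  have F: "indicator {0..2 * cos \<alpha>} (cos \<alpha> + \<tau>) *\<^sub>R F (cos \<alpha> + \<tau>)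
      = (\<Sum>r\<le>m. (v^(m-r) * cnj v^r) * (disk_weight \<gamma> (?Z \<tau>) *\<^sub>R g r (?Z \<tau>)))" for \<tau>
  proof (cases "?Z \<tau> \<in> cball 0 1")
    case True
    then have "indicator {0..2 * cos \<alpha>} (cos \<alpha> + \<tau>) = (1::real)" using dom by (simp only: indicator_simps)
    then have "indicator {0..2 * cos \<alpha>} (cos \<alpha> + \<tau>) *\<^sub>R F (cos \<alpha> + \<tau>) = F (cos \<alpha> + \<tau>)" by simp
    also have "\<dots> = (\<Sum>r\<le>m. g r (?Z \<tau>) * v^(m-r) * cnj v^r) * of_real (disk_weight \<gamma> (?Z \<tau>))"
      unfolding F_def z f[OF True] disk_weight_def using True by simp
    also have "\<dots> = (\<Sum>r\<le>m. (v^(m-r) * cnj v^r) * (disk_weight \<gamma> (?Z \<tau>) *\<^sub>R g r (?Z \<tau>)))"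
      unfolding sum_distrib_right by (intro sum.cong refl) (simp add: scaleR_conv_of_real)
    finally show ?thesis .
  next
    case False
    then have "cos \<alpha> + \<tau> \<notin> {0..2 * cos \<alpha>}" by (simp only: dom not_False_eq_True)
    then have "indicator {0..2 * cos \<alpha>} (cos \<alpha> + \<tau>) = (0::real)" by (rule indicator_simps)
    moreover have "disk_weight \<gamma> (?Z \<tau>) = 0" using False by (simp add: disk_weight_def)
    ultimately show ?thesis by simp
  qed
  have int': "integrable lborel (\<lambda>\<tau>. disk_weight \<gamma> (?Z \<tau>) *\<^sub>R g r (?Z \<tau>))" if "r \<le> m" for r
    using int[OF that] by (simp only: bc fst_conv snd_conv)
  have "xray m \<gamma> f x = (\<integral>t. indicator {0..2 * cos \<alpha>} t *\<^sub>R F t \<partial>lborel)"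
    by (simp add: xray_def xp Let_def set_lebesgue_integral_def F_def v_def)
  also have "\<dots> = (\<integral>\<tau>. indicator {0..2 * cos \<alpha>} (cos \<alpha> + \<tau>) *\<^sub>R F (cos \<alpha> + \<tau>) \<partial>lborel)"
    using lborel_integral_real_affine[of 1 "\<lambda>t. indicator {0..2 * cos \<alpha>} t *\<^sub>R F t" "cos \<alpha>"] by simp
  also have "\<dots> = (\<Sum>r\<le>m. \<integral>\<tau>. (v^(m-r) * cnj v^r) * (disk_weight \<gamma> (?Z \<tau>) *\<^sub>R g r (?Z \<tau>)) \<partial>lborel)"
    unfolding F by (intro Bochner_Integration.integral_sum integrable_mult_right int') auto
  also have "\<dots> = beam_sum \<gamma> m g (beam_coords x)"
    by (simp only: beam_sum_def bc radon_def fst_conv snd_conv integral_mult_right_zero)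
  finally show ?thesis .
qed

text \<open>
  The frequency in \<open>{- n..n}\<close> nearest to \<open>l - m mod 2\<close>. It selects the disk polynomial that has to
  produce the coefficient at \<open>(n, l)\<close>: for \<open>\<bar>l\<bar> \<le> n\<close> of the right parity it is \<open>n - 2 k\<close> with the \<open>k\<close> of
  condition (c), and for frequencies beyond \<open>n\<close> it is an endpoint.
\<close>

definition clamp_frequency :: "nat \<Rightarrow> nat \<Rightarrow> int \<Rightarrow> int" where
  "clamp_frequency m n l = max (- int n) (min (int n) (l - int (m mod 2)))"

definition normalized_disk_polynomial :: "real \<Rightarrow> nat \<times> int \<Rightarrow> complex \<Rightarrow> complex" where
  "normalized_disk_polynomial \<gamma> i z = of_real (1 / singular_value \<gamma> i) * disk_polynomial \<gamma> i z"

context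
  fixes \<gamma> :: real
  assumes \<gamma>: "\<gamma> > -1"
begin

lemma weighted_disk_function:
  assumes g: "g \<in> L2 (disk_measure \<gamma>)"
  shows "integrable lborel (\<lambda>z. disk_weight \<gamma> z *\<^sub>R g z)" "\<And>z. cmod z > 1 \<Longrightarrow> disk_weight \<gamma> z *\<^sub>R g z = 0"
    "radon (\<lambda>z. disk_weight \<gamma> z *\<^sub>R g z) \<in> borel_measurable borel"
proof -
  show i: "integrable lborel (\<lambda>z. disk_weight \<gamma> z *\<^sub>R g z)" by (rule integrable_weighted_L2[OF \<gamma> g])
  show "radon (\<lambda>z. disk_weight \<gamma> z *\<^sub>R g z) \<in> borel_measurable borel" using i by (intro radon_measurable) simp
qed (simp add: disk_weight_def)

lemma xray_eq_beam_sum_AE: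
  assumes g: "\<And>r. g r \<in> L2 (disk_measure \<gamma>)"
    and f: "\<And>z v. z \<in> cball 0 1 \<Longrightarrow> f z (replicate m v) = (\<Sum>r\<le>m. g r z * v^(m-r) * cnj v^r)"
  shows "AE x in inflow_measure \<gamma>. xray m \<gamma> f x = beam_sum \<gamma> m g (beam_coords x)"
proof -
  (* Applied with the kernel 0, for the sake of integrability along lines. *)
  have "AE p in line_measure. integrable lborel (\<lambda>\<tau>. disk_weight \<gamma> (fst p * Complex \<tau> (snd p)) *\<^sub>R g r (fst p * Complex \<tau> (snd p)))" for r
    using radon_adjoint(3)[OF weighted_disk_function(1,2)[OF g], of "\<lambda>_. 0" 0] by simp
  then have "AE p in line_measure. \<forall>r\<in>{..m}. integrable lborel (\<lambda>\<tau>. disk_weight \<gamma> (fst p * Complex \<tau> (snd p)) *\<^sub>R g r (fst p * Complex \<tau> (snd p)))"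
    by (intro AE_finite_allI) auto
  from AE_line_imp_inflow[OF this] AE_inflow_domain show ?thesis
    by eventually_elim (rule xray_beam_sum[OF _ f], auto)
qed

lemma beam_sum_measurable:
  assumes g: "\<And>r. g r \<in> L2 (disk_measure \<gamma>)"
  shows "beam_sum \<gamma> m g \<in> borel_measurable borel"
proof -
  have [measurable]: "radon (\<lambda>z. disk_weight \<gamma> z *\<^sub>R g r z) \<in> borel_measurable borel" for r
    by (rule weighted_disk_function[OF g])
  show ?thesis unfolding beam_sum_def by measurable
qed

text \<open>
  On the circle \<open>cnj v\<close> is the inverse of \<open>v\<close>, so the factor that comes from the tensor is
  \<open>v powi (m - 2 r)\<close>.
\<close>

lemma beam_kernel_shift:
  assumes v: "cmod (fst p) = 1" and "r \<le> m"
  shows "fst p^(m-r) * cnj (fst p)^r * beam_kernel \<gamma> (n, l) p = beam_kernel \<gamma> (n, l - (int m - 2 * int r)) p"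
proof -
  have nz: "fst p \<noteq> 0" using v by auto
  have e: "int m - 2 * int r = int (m - r) - int r" using assms by (simp add: of_nat_diff)
  have "fst p^(m-r) * cnj (fst p)^r = fst p powi (int m - 2 * int r)"
    unfolding e unit_cnj[OF v] using nz by (simp add: power_int_diff power_inverse divide_inverse)
  then have "fst p^(m-r) * cnj (fst p)^r * cnj (fst p powi l) = cnj (fst p powi (l - (int m - 2 * int r)))"
    using unit_powi_cnj[OF v, of "int m - 2 * int r" l] unit_powi_cnj[OF v, of 0 "l - (int m - 2 * int r)"]
    by simp
  then show ?thesis by (simp add: beam_kernel_def mult_ac)
qed

text \<open>
  Each component contributes by adjointness, after its power of \<open>v\<close> has been absorbed into the
  frequency of the kernel.
\<close>

lemma beam_sum_kernel_moment:
  assumes g: "\<And>r. g r \<in> L2 (disk_measure \<gamma>)"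
  shows "integrable line_measure (\<lambda>p. beam_sum \<gamma> m g p * beam_kernel \<gamma> (n, l) p)"
    and "(\<integral>p. beam_sum \<gamma> m g p * beam_kernel \<gamma> (n, l) p \<partial>line_measure)
      = (\<Sum>r\<le>m. l2_inner (disk_measure \<gamma>) (g r) (disk_polynomial \<gamma> (n, l - (int m - 2 * int r))))"
proof -
  let ?h = "\<lambda>r z. disk_weight \<gamma> z *\<^sub>R g r z"
  let ?k = "\<lambda>r. beam_kernel \<gamma> (n, l - (int m - 2 * int r))"
  note h = weighted_disk_function[OF g]
  have i: "integrable line_measure (\<lambda>p. radon (?h r) p * ?k r p)" for r
    by (rule radon_kernel_moment(1)[OF \<gamma> h(1,2)])
  have si: "integrable line_measure (\<lambda>p. \<Sum>r\<le>m. radon (?h r) p * ?k r p)"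
    by (intro Bochner_Integration.integrable_sum i)
  have AE: "AE p in line_measure. (\<Sum>r\<le>m. radon (?h r) p * ?k r p) = beam_sum \<gamma> m g p * beam_kernel \<gamma> (n, l) p"
    using AE_circle_fst
  proof eventually_elim
    case (elim p)
    show ?case unfolding beam_sum_def sum_distrib_right
    proof (intro sum.cong refl)
      fix r assume "r \<in> {..m}"
      then have "fst p^(m-r) * cnj (fst p)^r * beam_kernel \<gamma> (n, l) p = ?k r p"
        using elim by (intro beam_kernel_shift) auto
      then show "radon (?h r) p * ?k r p = fst p^(m-r) * cnj (fst p)^r * radon (?h r) p * beam_kernel \<gamma> (n, l) p"
        by (metis mult.commute mult.left_commute)
    qed
  qed
  have m: "(\<lambda>p. beam_sum \<gamma> m g p * beam_kernel \<gamma> (n, l) p) \<in> borel_measurable line_measure"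
    by (intro measurable_line borel_measurable_times beam_sum_measurable g beam_kernel_measurable)
  show "integrable line_measure (\<lambda>p. beam_sum \<gamma> m g p * beam_kernel \<gamma> (n, l) p)"
    by (rule integrable_cong_AE_imp[OF si m AE])
  have "(\<integral>p. beam_sum \<gamma> m g p * beam_kernel \<gamma> (n, l) p \<partial>line_measure) = (\<integral>p. (\<Sum>r\<le>m. radon (?h r) p * ?k r p) \<partial>line_measure)"
    using AE si m by (intro integral_cong_AE) (auto elim: eventually_mono)
  also have "\<dots> = (\<Sum>r\<le>m. \<integral>p. radon (?h r) p * ?k r p \<partial>line_measure)"
    by (rule Bochner_Integration.integral_sum[OF i])
  also have "\<dots> = (\<Sum>r\<le>m. l2_inner (disk_measure \<gamma>) (g r) (disk_polynomial \<gamma> (n, l - (int m - 2 * int r))))"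
    by (simp only: radon_kernel_moment(2)[OF \<gamma> h(1,2)] disk_inner[OF \<gamma> g])
  finally show "(\<integral>p. beam_sum \<gamma> m g p * beam_kernel \<gamma> (n, l) p \<partial>line_measure)
      = (\<Sum>r\<le>m. l2_inner (disk_measure \<gamma>) (g r) (disk_polynomial \<gamma> (n, l - (int m - 2 * int r))))" .
qed

lemma beam_sum_integrable:
  assumes g: "\<And>r. g r \<in> L2 (disk_measure \<gamma>)"
  shows "integrable line_measure (\<lambda>p. indicator {-1..1} (snd p) *\<^sub>R beam_sum \<gamma> m g p)"
proof -
  have i: "integrable line_measure (\<lambda>p. radon (\<lambda>z. disk_weight \<gamma> z *\<^sub>R g r z) p * (of_real (indicator {-1..1} (snd p)) * (fst p^(m-r) * cnj (fst p)^r)))" for r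
  proof (rule radon_adjoint(1)[OF weighted_disk_function(1,2)[OF g]])
    show "(\<lambda>p::complex \<times> real. complex_of_real (indicator {-1..1} (snd p)) * (fst p^(m-r) * cnj (fst p)^r)) \<in> borel_measurable borel"
      by measurable
    show "cmod (complex_of_real (indicator {-1..1} (snd (v, s))) * (fst (v, s)^(m-r) * cnj (fst (v, s))^r)) \<le> 1"
      if "cmod v = 1" "\<bar>s\<bar> \<le> 1" for v s
      using that by (auto simp: norm_mult norm_power indicator_def)
  qed
  have "integrable line_measure (\<lambda>p. \<Sum>r\<le>m. radon (\<lambda>z. disk_weight \<gamma> z *\<^sub>R g r z) p * (of_real (indicator {-1..1} (snd p)) * (fst p^(m-r) * cnj (fst p)^r)))"
    by (intro Bochner_Integration.integrable_sum i)
  then show ?thesis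
    by (simp add: beam_sum_def scaleR_conv_of_real sum_distrib_left mult_ac)
qed

lemma fan_coeff_beam_sum:
  assumes u: "u \<in> L2 (inflow_measure \<gamma>)" and g: "\<And>r. g r \<in> L2 (disk_measure \<gamma>)"
    and eq: "AE x in inflow_measure \<gamma>. u x = beam_sum \<gamma> m g (beam_coords x)"
  shows "l2_inner (inflow_measure \<gamma>) u (fan_basis \<gamma> (n, l))
    = (\<Sum>r\<le>m. l2_inner (disk_measure \<gamma>) (g r) (disk_polynomial \<gamma> (n, l - (int m - 2 * int r))))"
proof -
  note m = beam_sum_measurable[OF g, of m]
  have "l2_inner (inflow_measure \<gamma>) u (fan_basis \<gamma> (n, l)) = l2_inner (inflow_measure \<gamma>) (\<lambda>x. beam_sum \<gamma> m g (beam_coords x)) (fan_basis \<gamma> (n, l))"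
    by (rule l2_inner_cong_AE[OF L2_measurable[OF u] _ fan_basis_measurable[OF \<gamma>] eq])
       (rule measurable_compose[OF beam_coords_measurable_inflow m])
  also have "\<dots> = (\<integral>p. beam_sum \<gamma> m g p * beam_kernel \<gamma> (n, l) p \<partial>line_measure)"
    by (rule fan_coeff_line_integral[OF \<gamma> m]) simp
  finally show ?thesis by (simp only: beam_sum_kernel_moment[OF g])
qed

text \<open>
  The transform on the right is only known to be integrable, so its coefficients are compared as
  integrals against \<open>beam_kernel\<close> and not as inner products in \<open>L2\<close>.
\<close>

lemma eq_beam_sum_if_coeff_eq:
  assumes u: "u \<in> L2 (inflow_measure \<gamma>)" and g: "\<And>r. g r \<in> L2 (disk_measure \<gamma>)"
    and coeff: "\<And>n l. l2_inner (inflow_measure \<gamma>) u (fan_basis \<gamma> (n, l))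
      = (\<Sum>r\<le>m. l2_inner (disk_measure \<gamma>) (g r) (disk_polynomial \<gamma> (n, l - (int m - 2 * int r))))"
  shows "AE x in inflow_measure \<gamma>. u x = beam_sum \<gamma> m g (beam_coords x)"
proof -
  note m = beam_sum_measurable[OF g, of m]
  obtain U where U: "U \<in> borel_measurable borel" and uU: "\<And>x. x \<in> inflow_domain \<Longrightarrow> u x = U (beam_coords x)"
    using beam_representative[OF L2_measurable[OF u]] by blast
  note iU = integrable_line_if_L2_inflow[OF \<gamma> u U uU]
  have iUk: "integrable line_measure (\<lambda>p. U p * beam_kernel \<gamma> i p)" for i
  proof -
    have "bounded (poly (Lhat \<gamma> (fst i)) ` {-1..1})"
      by (intro compact_imp_bounded compact_continuous_image continuous_intros) auto
    then obtain B where B: "\<And>x. x \<in> {-1..1} \<Longrightarrow> norm (poly (Lhat \<gamma> (fst i)) x) \<le> B" unfolding bounded_iff by (meson imageI)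
    show ?thesis
    proof (rule Bochner_Integration.integrable_bound)
      show "integrable line_measure (\<lambda>p. of_real B * (indicator {-1..1} (snd p) *\<^sub>R U p))" by (intro integrable_mult_right iU)
      show "(\<lambda>p. U p * beam_kernel \<gamma> i p) \<in> borel_measurable line_measure"
        by (intro measurable_line borel_measurable_times U beam_kernel_measurable)
      show "AE p in line_measure. norm (U p * beam_kernel \<gamma> i p) \<le> norm (of_real B * (indicator {-1..1} (snd p) *\<^sub>R U p))"
        using AE_circle_fst
      proof eventually_elim
        case (elim p)
        show ?case
        proof (cases "snd p \<in> {-1..1}")
          case True
          have "cmod (beam_kernel \<gamma> i p) = 1 / (2*pi) * norm (poly (Lhat \<gamma> (fst i)) (snd p))"
            using elim True by (simp add: beam_kernel_def norm_mult norm_power_int norm_divide)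
          also have "\<dots> \<le> 1 * B" using B[OF True] pi_ge_two by (intro mult_mono) (auto simp: divide_simps)
          also have "\<dots> \<le> \<bar>B\<bar>" by simp
          finally have "cmod (beam_kernel \<gamma> i p) \<le> \<bar>B\<bar>" .
          from mult_left_mono[OF this norm_ge_zero[of "U p"]] show ?thesis
            using True by (simp add: norm_mult mult.commute)
        next
          case False
          then have "beam_kernel \<gamma> i p = 0" by (simp only: beam_kernel_def indicator_simps) simp
          then show ?thesis by simp
        qed
      qed
    qed
  qed
  have "AE p in beam_measure \<gamma>. U p - beam_sum \<gamma> m g p = 0"
  proof (rule AE_zero_if_kernel_moments_vanish[OF \<gamma>])
    show "(\<lambda>p. U p - beam_sum \<gamma> m g p) \<in> borel_measurable borel" using U m by simp
    show "integrable line_measure (\<lambda>p. indicator {-1..1} (snd p) *\<^sub>R (U p - beam_sum \<gamma> m g p))"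
      unfolding scaleR_diff_right by (intro Bochner_Integration.integrable_diff iU beam_sum_integrable g)
    fix i :: "nat \<times> int"
    obtain n l where i: "i = (n, l)" by (cases i)
    have "(\<integral>p. (U p - beam_sum \<gamma> m g p) * beam_kernel \<gamma> i p \<partial>line_measure)
      = (\<integral>p. U p * beam_kernel \<gamma> i p \<partial>line_measure) - (\<integral>p. beam_sum \<gamma> m g p * beam_kernel \<gamma> i p \<partial>line_measure)"
      unfolding left_diff_distrib i
      by (rule Bochner_Integration.integral_diff[OF iUk beam_sum_kernel_moment(1)[OF g]])
    also have "\<dots> = 0"
      using fan_coeff_line_integral[OF \<gamma> U uU, of i] beam_sum_kernel_moment(2)[where g = g and m = m and n = n and l = l, OF g] coeff[of n l] by (simp add: i)
    finally show "(\<integral>p. (U p - beam_sum \<gamma> m g p) * beam_kernel \<gamma> i p \<partial>line_measure) = 0" .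
  qed
  then have "AE p in distr (inflow_measure \<gamma>) borel beam_coords. U p - beam_sum \<gamma> m g p = 0"
    unfolding distr_beam_coords .
  from AE_distrD[OF beam_coords_measurable_inflow this] AE_inflow_domain show ?thesis
    by eventually_elim (simp add: uU)
qed

section \<open>The range in terms of coefficients\<close>

lemma normalized_disk_polynomial_orthonormal: "countable_orthonormal_on (disk_measure \<gamma>) (normalized_disk_polynomial \<gamma>) {i. admissible i}"
proof
  fix i assume "i \<in> {i. admissible i}"
  show "normalized_disk_polynomial \<gamma> i \<in> L2 (disk_measure \<gamma>)"
    unfolding normalized_disk_polynomial_def by (intro L2_scale disk_polynomial_L2[OF \<gamma>])
  fix j assume "j \<in> {i. admissible i}"
  have "l2_inner (disk_measure \<gamma>) (normalized_disk_polynomial \<gamma> i) (normalized_disk_polynomial \<gamma> j)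
    = of_real (1 / singular_value \<gamma> i) * cnj (of_real (1 / singular_value \<gamma> j) * l2_inner (disk_measure \<gamma>) (disk_polynomial \<gamma> j) (disk_polynomial \<gamma> i))"
    unfolding normalized_disk_polynomial_def l2_inner_scale by (subst l2_inner_cnj, subst l2_inner_scale) simp
  also have "\<dots> = (if i = j then 1 else 0)"
    using singular_value_pos[OF \<gamma>, of i] \<open>i \<in> _\<close>
    by (auto simp: disk_polynomial_inner[OF \<gamma>] power2_eq_square simp flip: of_real_mult)
  finally show "l2_inner (disk_measure \<gamma>) (normalized_disk_polynomial \<gamma> i) (normalized_disk_polynomial \<gamma> j) = (if i = j then 1 else 0)" .
qed

text \<open>
  A disk polynomial with singular value \<open>0\<close> has norm \<open>0\<close> and contributes nothing.
\<close>

lemma inner_disk_polynomial: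
  assumes g: "g \<in> L2 (disk_measure \<gamma>)"
  shows "l2_inner (disk_measure \<gamma>) g (disk_polynomial \<gamma> i)
    = (if admissible i then of_real (singular_value \<gamma> i) * l2_inner (disk_measure \<gamma>) g (normalized_disk_polynomial \<gamma> i) else 0)"
proof (cases "admissible i")
  case True
  then have "singular_value \<gamma> i \<noteq> 0" using singular_value_pos[OF \<gamma>] by (metis less_irrefl)
  then have "disk_polynomial \<gamma> i = (\<lambda>z. of_real (singular_value \<gamma> i) * normalized_disk_polynomial \<gamma> i z)" by (simp add: normalized_disk_polynomial_def)
  then have "l2_inner (disk_measure \<gamma>) g (disk_polynomial \<gamma> i) = of_real (singular_value \<gamma> i) * l2_inner (disk_measure \<gamma>) g (normalized_disk_polynomial \<gamma> i)"
    by (subst l2_inner_cnj, simp only: l2_inner_scale) (subst (2) l2_inner_cnj, simp)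
  then show ?thesis using True by simp
next
  case False
  have "l2_inner (disk_measure \<gamma>) (disk_polynomial \<gamma> i) (disk_polynomial \<gamma> i) = 0"
    using False by (simp add: disk_polynomial_inner[OF \<gamma>] singular_value_not_admissible[OF \<gamma>])
  then have "l2_norm (disk_measure \<gamma>) (disk_polynomial \<gamma> i) = 0"
    by (simp add: l2_inner_self l2_norm_def)
  then show ?thesis using l2_Cauchy_Schwarz[OF g disk_polynomial_L2[OF \<gamma>], of i] False by simp
qed

text \<open>
  By Bessel's inequality the coefficients of all \<open>g r\<close> are square summable. The majorant \<open>H\<close> sums
  their squares over the shifts, and comparability allows division by any singular value within
  distance \<open>m\<close>.
\<close>

lemma xray_coeff_bounds:
  assumes u: "u \<in> L2 (inflow_measure \<gamma>)" and f: "f \<in> L2_tensor \<gamma> m"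
    and uf: "AE x in inflow_measure \<gamma>. u x = xray m \<gamma> f x"
  obtains H where "H summable_on UNIV" "\<And>i. H i \<ge> 0"
    "\<And>n l l0. admissible (n, l0) \<Longrightarrow> \<bar>l - l0\<bar> \<le> int m \<Longrightarrow>
       (cmod (l2_inner (inflow_measure \<gamma>) u (fan_basis \<gamma> (n, l))))\<^sup>2 / (singular_value \<gamma> (n, l0))\<^sup>2 \<le> H (n, l)"
    "\<And>n l. \<bar>l\<bar> > int n + int m \<Longrightarrow> l2_inner (inflow_measure \<gamma>) u (fan_basis \<gamma> (n, l)) = 0"
proof -
  interpret countable_orthonormal_on "disk_measure \<gamma>" "normalized_disk_polynomial \<gamma>" "{i. admissible i}"
    by (rule normalized_disk_polynomial_orthonormal)
  obtain g where g: "\<And>r. g r \<in> L2 (disk_measure \<gamma>)"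
    and fg: "\<And>z v. z \<in> cball 0 1 \<Longrightarrow> f z (replicate m v) = (\<Sum>r\<le>m. g r z * v^(m-r) * cnj v^r)"
    using tensor_diagonal_expansion[OF f] by blast
  have ub: "AE x in inflow_measure \<gamma>. u x = beam_sum \<gamma> m g (beam_coords x)"
  proof -
    have "AE x in inflow_measure \<gamma>. xray m \<gamma> f x = beam_sum \<gamma> m g (beam_coords x)"
      by (rule xray_eq_beam_sum_AE[OF g]) (rule fg)
    with uf show ?thesis by eventually_elim simp
  qed
  define e where "e r = int m - 2 * int r" for r
  define b where "b r i = l2_inner (disk_measure \<gamma>) (g r) (normalized_disk_polynomial \<gamma> i)" for r i
  define G where "G r i = (if admissible i then (cmod (b r i))\<^sup>2 else 0)" for r i
  (* The factor m + 1 comes from the Cauchy-Schwarz inequality for a sum of m + 1 terms. *)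
  define K where "K = real (Suc m) * ratio_bound \<gamma>^m"
  define H where "H i = K * (\<Sum>r\<le>m. G r (fst i, snd i - e r))" for i
  have rb: "ratio_bound \<gamma>^m \<ge> 1" using ratio_bound_ge_1[OF \<gamma>] by (rule one_le_power)
  have K: "K \<ge> 0" using rb by (simp add: K_def)
  have c: "l2_inner (inflow_measure \<gamma>) u (fan_basis \<gamma> (n, l))
      = (\<Sum>r\<le>m. if admissible (n, l - e r) then of_real (singular_value \<gamma> (n, l - e r)) * b r (n, l - e r) else 0)" for n l
    unfolding fan_coeff_beam_sum[OF u g ub] inner_disk_polynomial[OF g] b_def e_def ..
  have "G r summable_on UNIV" for r
  proof -
    have "(\<lambda>i. (cmod (b r i))\<^sup>2) summable_on {i. admissible i}" unfolding b_def by (rule Bessel[OF g])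
    then show ?thesis by (subst (asm) summable_on_cong_neutral[of UNIV _ "G r"]) (auto simp: G_def)
  qed
  then have "(\<lambda>i. G r (fst i, snd i - e r)) summable_on UNIV" for r
  proof -
    have "bij (\<lambda>i::nat \<times> int. (fst i, snd i - e r))"
      by (rule bij_betw_byWitness[of _ "\<lambda>i. (fst i, snd i + e r)"]) auto
    from summable_on_reindex_bij_betw[OF this, of "G r"] \<open>G r summable_on UNIV\<close> show ?thesis by simp
  qed
  then have "(\<lambda>i. \<Sum>r\<le>k. G r (fst i, snd i - e r)) summable_on UNIV" for k
    by (induction k) (auto intro: summable_on_add)
  then have "H summable_on UNIV" unfolding H_def by (rule summable_on_cmult_right)
  moreover have "H i \<ge> 0" for i using K by (auto simp: H_def G_def intro!: mult_nonneg_nonneg sum_nonneg)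
  moreover have "(cmod (l2_inner (inflow_measure \<gamma>) u (fan_basis \<gamma> (n, l))))\<^sup>2 / (singular_value \<gamma> (n, l0))\<^sup>2 \<le> H (n, l)"
    if adm: "admissible (n, l0)" and close: "\<bar>l - l0\<bar> \<le> int m" for n l l0
  proof -
    let ?s = "\<lambda>r. if admissible (n, l - e r) then singular_value \<gamma> (n, l - e r) * cmod (b r (n, l - e r)) else 0"
    have pos: "singular_value \<gamma> (n, l0) > 0" by (rule singular_value_pos[OF \<gamma> adm])
    have "cmod (l2_inner (inflow_measure \<gamma>) u (fan_basis \<gamma> (n, l))) \<le> (\<Sum>r\<le>m. ?s r)"
      unfolding c using singular_value_pos[OF \<gamma>]
      by (intro sum_norm_le) (auto simp: norm_mult less_imp_le abs_of_pos)
    then have "(cmod (l2_inner (inflow_measure \<gamma>) u (fan_basis \<gamma> (n, l))))\<^sup>2 \<le> (\<Sum>r\<le>m. ?s r)\<^sup>2"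
      by (intro power_mono) auto
    also have "\<dots> \<le> (\<Sum>r\<le>m. (?s r)\<^sup>2) * real (Suc m)"
      using sum_squared_le_sum_of_squares[of ?s "{..m}"] by simp
    also have "(\<Sum>r\<le>m. (?s r)\<^sup>2) \<le> (\<Sum>r\<le>m. ratio_bound \<gamma>^m * (singular_value \<gamma> (n, l0))\<^sup>2 * G r (n, l - e r))"
    proof (intro sum_mono)
      fix r assume "r \<in> {..m}"
      then have "\<bar>(l - e r) - l0\<bar> \<le> 2 * int m" using close by (auto simp: e_def)
      then have "(singular_value \<gamma> (n, l - e r))\<^sup>2 \<le> ratio_bound \<gamma>^m * (singular_value \<gamma> (n, l0))\<^sup>2"
        by (rule singular_value_compare[OF \<gamma> adm])
      then show "(?s r)\<^sup>2 \<le> ratio_bound \<gamma>^m * (singular_value \<gamma> (n, l0))\<^sup>2 * G r (n, l - e r)"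
        by (auto simp: G_def power_mult_distrib intro!: mult_right_mono)
    qed
    also have "(\<Sum>r\<le>m. ratio_bound \<gamma>^m * (singular_value \<gamma> (n, l0))\<^sup>2 * G r (n, l - e r)) * real (Suc m) = H (n, l) * (singular_value \<gamma> (n, l0))\<^sup>2"
      by (simp only: H_def K_def sum_distrib_left[symmetric] fst_conv snd_conv) (simp only: mult_ac)
    finally show ?thesis using pos by (simp add: divide_le_eq)
  qed
  moreover have "l2_inner (inflow_measure \<gamma>) u (fan_basis \<gamma> (n, l)) = 0" if "\<bar>l\<bar> > int n + int m" for n l
  proof -
    have "\<not> admissible (n, l - e r)" if "r \<le> m" for r
    proof -
      have "\<bar>e r\<bar> \<le> int m" using that by (simp add: e_def abs_le_iff)
      then have "\<bar>l - e r\<bar> > int n" using \<open>\<bar>l\<bar> > int n + int m\<close> by linarith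
      then show ?thesis by (simp add: admissible_def)
    qed
    then show ?thesis unfolding c by (intro sum.neutral) auto
  qed
  ultimately show thesis by (rule that)
qed

text \<open>
  The support condition says that \<open>(n, l)\<close> can be reached from its clamped frequency by one of the
  shifts \<open>m - 2 r\<close>. So each coefficient is produced by exactly one component \<open>g r\<close>, and the components
  are given by Riesz-Fischer.
\<close>

lemma xray_range_if_weighted_coeffs_summable:
  assumes u: "u \<in> L2 (inflow_measure \<gamma>)"
  defines "c \<equiv> \<lambda>i. l2_inner (inflow_measure \<gamma>) u (fan_basis \<gamma> i)"
  assumes supp: "\<And>n l. c (n, l) \<noteq> 0 \<Longrightarrow> even (int n + l + int m) \<and> \<bar>l\<bar> \<le> int n + int m"
    and summ: "(\<lambda>i. (cmod (c i))\<^sup>2 / (singular_value \<gamma> (fst i, clamp_frequency m (fst i) (snd i)))\<^sup>2) summable_on UNIV"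
  shows "\<exists>f\<in>L2_tensor \<gamma> m. AE x in inflow_measure \<gamma>. u x = xray m \<gamma> f x"
proof -
  interpret countable_orthonormal_on "disk_measure \<gamma>" "normalized_disk_polynomial \<gamma>" "{i. admissible i}"
    by (rule normalized_disk_polynomial_orthonormal)
  define D where "D i = (cmod (c i))\<^sup>2 / (singular_value \<gamma> (fst i, clamp_frequency m (fst i) (snd i)))\<^sup>2" for i
  define e where "e r = int m - 2 * int r" for r
  (* Coefficients of g r in the orthonormal family: the coefficient of u at the shifted
     frequency divided by the singular value, provided that this frequency is assigned to the
     present index. *)
  define a where "a r i = (if admissible i \<and> snd i = clamp_frequency m (fst i) (snd i + e r)
      then c (fst i, snd i + e r) / of_real (singular_value \<gamma> i) else 0)" for r i
  have "\<exists>h. h \<in> L2 (disk_measure \<gamma>) \<and> (\<forall>i. admissible i \<longrightarrow> l2_inner (disk_measure \<gamma>) h (normalized_disk_polynomial \<gamma> i) = a r i)" for r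
  proof -
    have "bij (\<lambda>i::nat \<times> int. (fst i, snd i + e r))"
      by (rule bij_betw_byWitness[of _ "\<lambda>i. (fst i, snd i - e r)"]) auto
    then have "(\<lambda>i. D (fst i, snd i + e r)) summable_on UNIV"
      using summable_on_reindex_bij_betw[of "\<lambda>i::nat \<times> int. (fst i, snd i + e r)" UNIV UNIV D] summ
      unfolding D_def by simp
    then have "(\<lambda>i. D (fst i, snd i + e r)) summable_on {i. admissible i}"
      by (rule summable_on_subset_banach) simp
    then have "(\<lambda>i. (cmod (a r i))\<^sup>2) summable_on {i. admissible i}"
    proof (rule summable_on_comparison_test)
      fix i :: "nat \<times> int"
      show "(cmod (a r i))\<^sup>2 \<le> D (fst i, snd i + e r)"
        by (auto simp: a_def D_def norm_divide power_divide)
    qed simp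
    from Riesz_Fischer[OF this subset_refl] show ?thesis by (auto dest: closed_span_L2)
  qed
  then obtain g where g: "\<And>r. g r \<in> L2 (disk_measure \<gamma>)"
    and ga: "\<And>r i. admissible i \<Longrightarrow> l2_inner (disk_measure \<gamma>) (g r) (normalized_disk_polynomial \<gamma> i) = a r i"
    by metis
  obtain f where f: "f \<in> L2_tensor \<gamma> m" and fg: "\<And>z v. f z (replicate m v) = (\<Sum>r\<le>m. g r z * v^(m-r) * cnj v^r)"
    using tensor_with_diagonal[where g = g and m = m, OF g] by blast
  have "c (n, l) = (\<Sum>r\<le>m. l2_inner (disk_measure \<gamma>) (g r) (disk_polynomial \<gamma> (n, l - e r)))" for n l
  proof -
    have t: "l2_inner (disk_measure \<gamma>) (g r) (disk_polynomial \<gamma> (n, l - e r))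
       = (if admissible (n, l - e r) \<and> l - e r = clamp_frequency m n l then c (n, l) else 0)" for r
    proof (cases "admissible (n, l - e r)")
      case True
      then have nz: "singular_value \<gamma> (n, l - e r) \<noteq> 0" using singular_value_pos[OF \<gamma>] by (metis less_irrefl)
      have ar: "a r (n, l - e r) = (if l - e r = clamp_frequency m n l then c (n, l) / of_real (singular_value \<gamma> (n, l - e r)) else 0)"
        by (simp only: a_def fst_conv snd_conv diff_add_cancel True simp_thms)
      show ?thesis
      proof (cases "l - e r = clamp_frequency m n l")
        case hit: True
        show ?thesis
          unfolding inner_disk_polynomial[OF g] ga[OF True] if_P[OF True] ar if_P[OF hit] if_P[OF conjI[OF True hit]]
          using nz by simp
      next
        case False
        then show ?thesis
          unfolding inner_disk_polynomial[OF g] ga[OF True] if_P[OF True] ar by simp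
      qed
    qed (simp add: inner_disk_polynomial[OF g])
    show ?thesis
    proof (cases "c (n, l) = 0")
      case False
      then have l: "even (int n + l + int m)" "\<bar>l\<bar> \<le> int n + int m" using supp by auto
      define k where "k = clamp_frequency m n l"
      have m2: "int (m mod 2) = int m mod 2" by (simp add: zmod_int)
      have k: "\<bar>k\<bar> \<le> int n" "even (int n - k)" "even (int m - (l - k))" "\<bar>l - k\<bar> \<le> int m"
      proof -
        have "m mod 2 \<le> m" by (rule mod_less_eq_dividend)
        then have "int (m mod 2) \<le> int m" by (simp only: of_nat_le_iff)
        then have le: "int m mod 2 \<le> int m" "int m mod 2 \<ge> 0" unfolding m2 by simp_all
        have par: "even (int m - int m mod 2)" by (simp add: even_iff_mod_2_eq_zero mod_diff_eq[symmetric])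
        have c3: "(l - int m mod 2 > int n \<and> k = int n) \<or> (l - int m mod 2 < - int n \<and> k = - int n)
          \<or> (\<bar>l - int m mod 2\<bar> \<le> int n \<and> k = l - int m mod 2)"
          unfolding k_def clamp_frequency_def m2 by linarith
        obtain q where q: "q = int m mod 2" by simp
        have 1: "\<bar>k\<bar> \<le> int n \<and> \<bar>l - k\<bar> \<le> int m \<and> even (int n - k) \<and> even (int m - (l - k))"
          if "l - q > int n" "k = int n"
        proof -
          have "\<bar>l - k\<bar> \<le> int m" using that l le unfolding q by linarith
          moreover have "int m - (l - k) = (int n + l + int m) - 2 * l" using that by simp
          then have "even (int m - (l - k))" using l(1) by (metis dvd_diff dvd_triv_left)
          ultimately show ?thesis using that by simp
        qed
        have 2: "\<bar>k\<bar> \<le> int n \<and> \<bar>l - k\<bar> \<le> int m \<and> even (int n - k) \<and> even (int m - (l - k))"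
          if "l - q < - int n" "k = - int n"
        proof -
          have "\<bar>l - k\<bar> \<le> int m" using that l le unfolding q by linarith
          moreover have "int m - (l - k) = (int n + l + int m) - 2 * (l + int n)" using that by simp
          then have "even (int m - (l - k))" using l(1) by (metis dvd_diff dvd_triv_left)
          ultimately show ?thesis using that by simp
        qed
        have 3: "\<bar>k\<bar> \<le> int n \<and> \<bar>l - k\<bar> \<le> int m \<and> even (int n - k) \<and> even (int m - (l - k))"
          if "\<bar>l - q\<bar> \<le> int n" "k = l - q"
        proof -
          have "\<bar>l - k\<bar> \<le> int m" using that le unfolding q by linarith
          moreover have lkq: "l - k = q" using that by simp
          then have "even (int m - (l - k))" using par unfolding q by metis
          moreover have "int n - k = (int n + l + int m) - (int m - q) - 2 * l" using that by simp
          then have "even (int n - k)" using l(1) par unfolding q by (metis dvd_diff dvd_triv_left)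
          ultimately show ?thesis using that by blast
        qed
        show "\<bar>k\<bar> \<le> int n" "even (int n - k)" "even (int m - (l - k))" "\<bar>l - k\<bar> \<le> int m"
          using c3 1 2 3 unfolding q by blast+
      qed
      (* The only component whose shift carries the clamped frequency to l. *)
      define r0 where "r0 = nat ((int m - (l - k)) div 2)"
      have r0: "r0 \<le> m" "e r0 = l - k" using k by (auto simp: r0_def e_def)
      have "(\<Sum>r\<le>m. l2_inner (disk_measure \<gamma>) (g r) (disk_polynomial \<gamma> (n, l - e r))) = (\<Sum>r\<le>m. if r = r0 then c (n, l) else 0)"
      proof (intro sum.cong refl)
        fix r assume "r \<in> {..m}"
        have "l - e r = clamp_frequency m n l \<longleftrightarrow> r = r0" using r0 by (auto simp: k_def[symmetric] e_def)
        moreover have "admissible (n, l - e r0)" using k r0 by (simp add: admissible_def)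
        ultimately show "l2_inner (disk_measure \<gamma>) (g r) (disk_polynomial \<gamma> (n, l - e r)) = (if r = r0 then c (n, l) else 0)"
          unfolding t by auto
      qed
      then show ?thesis using r0(1) by simp
    next
      case True
      have "(\<Sum>r\<le>m. l2_inner (disk_measure \<gamma>) (g r) (disk_polynomial \<gamma> (n, l - e r))) = (\<Sum>r\<le>m. 0)"
        by (intro sum.cong refl) (simp only: t True if_cancel)
      with True show ?thesis by simp
    qed
  qed
  then have "AE x in inflow_measure \<gamma>. u x = beam_sum \<gamma> m g (beam_coords x)"
    unfolding c_def e_def by (intro eq_beam_sum_if_coeff_eq u g)
  then have "AE x in inflow_measure \<gamma>. u x = xray m \<gamma> f x"
  proof -
    have "AE x in inflow_measure \<gamma>. xray m \<gamma> f x = beam_sum \<gamma> m g (beam_coords x)"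
      by (rule xray_eq_beam_sum_AE[OF g]) (rule fg)
    with \<open>AE x in inflow_measure \<gamma>. u x = beam_sum \<gamma> m g (beam_coords x)\<close>
    show ?thesis by eventually_elim simp
  qed
  then show ?thesis using f by blast
qed

end

section \<open>Splitting the index set\<close>

text \<open>
  The theorem uses series over \<open>n\<close> of finite sums, while the estimates are made on index sets; for
  nonnegative terms both notions of summability agree.
\<close>

lemma summable_on_blocks:
  fixes h :: "'i \<Rightarrow> real"
  assumes fin: "\<And>n::nat. finite (K n)" and nonneg: "\<And>i. h i \<ge> 0"
    and inj: "\<And>n m k l. k \<in> K n \<Longrightarrow> l \<in> K m \<Longrightarrow> \<phi> n k = \<phi> m l \<Longrightarrow> n = m \<and> k = l"
  shows "h summable_on (\<Union>n. \<phi> n ` K n) \<longleftrightarrow> summable (\<lambda>n. \<Sum>k\<in>K n. h (\<phi> n k))"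
proof -
  have bij: "bij_betw (\<lambda>(n, k). \<phi> n k) (Sigma UNIV K) (\<Union>n. \<phi> n ` K n)"
    using inj by (auto simp: bij_betw_def inj_on_def image_iff)
  have s: "(\<lambda>n. \<Sum>k\<in>K n. h (\<phi> n k)) summable_on UNIV \<longleftrightarrow> summable (\<lambda>n. \<Sum>k\<in>K n. h (\<phi> n k))"
    by (rule summable_on_UNIV_nonneg_real_iff) (auto intro: sum_nonneg nonneg)
  have "h summable_on (\<Union>n. \<phi> n ` K n) \<longleftrightarrow> (\<lambda>x. h ((\<lambda>(n, k). \<phi> n k) x)) summable_on Sigma UNIV K"
    by (rule summable_on_reindex_bij_betw[OF bij, symmetric])
  also have "\<dots> \<longleftrightarrow> (\<lambda>n. \<Sum>k\<in>K n. h (\<phi> n k)) summable_on UNIV"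
  proof
    assume "(\<lambda>n. \<Sum>k\<in>K n. h (\<phi> n k)) summable_on UNIV"
    then show "(\<lambda>x. h ((\<lambda>(n, k). \<phi> n k) x)) summable_on Sigma UNIV K"
      by (rule summable_on_SigmaI[rotated]) (use fin nonneg in \<open>auto intro: has_sum_finite\<close>)
  next
    assume S: "(\<lambda>x. h ((\<lambda>(n, k). \<phi> n k) x)) summable_on Sigma UNIV K"
    show "(\<lambda>n. \<Sum>k\<in>K n. h (\<phi> n k)) summable_on UNIV"
      unfolding s
    proof (rule summableI_nonneg_bounded)
      fix N
      have "(\<Sum>n<N. \<Sum>k\<in>K n. h (\<phi> n k)) = (\<Sum>x\<in>Sigma {..<N} K. h ((\<lambda>(n, k). \<phi> n k) x))"
        using fin by (subst sum.Sigma) (auto simp: case_prod_unfold)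
      also have "\<dots> \<le> infsum (\<lambda>x. h ((\<lambda>(n, k). \<phi> n k) x)) (Sigma UNIV K)"
        by (rule finite_sum_le_infsum[OF S]) (use fin nonneg in auto)
      finally show "(\<Sum>n<N. \<Sum>k\<in>K n. h (\<phi> n k)) \<le> infsum (\<lambda>x. h ((\<lambda>(n, k). \<phi> n k) x)) (Sigma UNIV K)" .
    qed (auto intro: sum_nonneg nonneg)
  qed
  finally show ?thesis unfolding s .
qed

lemma summable_on_range_iff:
  fixes h :: "'i \<Rightarrow> real"
  assumes "inj \<phi>" "\<And>i. h i \<ge> 0"
  shows "h summable_on (range \<phi>) \<longleftrightarrow> summable (\<lambda>n::nat. h (\<phi> n))"
proof -
  have "h summable_on (\<Union>n. (\<lambda>_. \<phi> n) ` {()}) \<longleftrightarrow> summable (\<lambda>n. \<Sum>k\<in>{()}. h (\<phi> n))"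
    by (rule summable_on_blocks) (use assms in \<open>auto dest: injD\<close>)
  moreover have "(\<Union>n. (\<lambda>_. \<phi> n) ` {()}) = range \<phi>" by auto
  ultimately show ?thesis by simp
qed

lemma summable_on_Un:
  fixes h :: "'i \<Rightarrow> real"
  assumes "h summable_on A" "h summable_on B"
  shows "h summable_on (A \<union> B)"
proof -
  have "h summable_on (B - A)" using assms(2) by (rule summable_on_subset_banach) auto
  then have "h summable_on (A \<union> (B - A))" using assms(1) by (intro summable_on_Un_disjoint) auto
  then show ?thesis by simp
qed

lemma summable_on_finite_Union:
  fixes h :: "'i \<Rightarrow> real"
  assumes "finite F" "\<And>e. e \<in> F \<Longrightarrow> h summable_on (B e)"
  shows "h summable_on (\<Union>e\<in>F. B e)"
  using assms by (induction F rule: finite_induct) (auto intro: summable_on_Un)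

context
  fixes \<gamma> :: real
  assumes \<gamma>: "\<gamma> > -1"
begin

text \<open>
  This turns division by the outermost singular values into the weights of \<open>h_space\<close>.
\<close>

lemma summable_end_weight_iff:
  fixes x :: "nat \<Rightarrow> real"
  assumes x: "\<And>n. x n \<ge> 0"
  shows "summable (\<lambda>n. x n / (sigma_coeff \<gamma> n 0)\<^sup>2) \<longleftrightarrow> summable (\<lambda>n. (real n + 1) powr (1 + \<gamma>) * x n)"
proof -
  obtain c C where c: "c > 0" and lo: "\<And>n. c \<le> (sigma_coeff \<gamma> n 0)\<^sup>2 * (real n + 1) powr (1 + \<gamma>)"
    and hi: "\<And>n. (sigma_coeff \<gamma> n 0)\<^sup>2 * (real n + 1) powr (1 + \<gamma>) \<le> C"
    using sigma_coeff_end_bounds[OF \<gamma>] by blast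
  have s: "(sigma_coeff \<gamma> n 0)\<^sup>2 > 0" for n using sigma_coeff_sq(2)[OF \<gamma>, of 0 n] by simp
  show ?thesis
  proof
    assume "summable (\<lambda>n. x n / (sigma_coeff \<gamma> n 0)\<^sup>2)"
    then have "summable (\<lambda>n. C * (x n / (sigma_coeff \<gamma> n 0)\<^sup>2))" by (rule summable_mult)
    then show "summable (\<lambda>n. (real n + 1) powr (1 + \<gamma>) * x n)"
    proof (rule summable_comparison_test'[where N = 0])
      fix n
      have "((sigma_coeff \<gamma> n 0)\<^sup>2 * (real n + 1) powr (1 + \<gamma>)) * (x n / (sigma_coeff \<gamma> n 0)\<^sup>2) \<le> C * (x n / (sigma_coeff \<gamma> n 0)\<^sup>2)"
        using x s[of n] by (intro mult_right_mono hi divide_nonneg_pos) auto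
      then show "norm ((real n + 1) powr (1 + \<gamma>) * x n) \<le> C * (x n / (sigma_coeff \<gamma> n 0)\<^sup>2)"
        using x[of n] s[of n] by simp
    qed
  next
    assume "summable (\<lambda>n. (real n + 1) powr (1 + \<gamma>) * x n)"
    then have "summable (\<lambda>n. inverse c * ((real n + 1) powr (1 + \<gamma>) * x n))" by (rule summable_mult)
    then show "summable (\<lambda>n. x n / (sigma_coeff \<gamma> n 0)\<^sup>2)"
    proof (rule summable_comparison_test'[where N = 0])
      fix n
      have "c * (x n / (sigma_coeff \<gamma> n 0)\<^sup>2) \<le> ((sigma_coeff \<gamma> n 0)\<^sup>2 * (real n + 1) powr (1 + \<gamma>)) * (x n / (sigma_coeff \<gamma> n 0)\<^sup>2)"
        using x s[of n] by (intro mult_right_mono lo divide_nonneg_pos) auto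
      also have "\<dots> = (real n + 1) powr (1 + \<gamma>) * x n" using s[of n] by simp
      finally show "norm (x n / (sigma_coeff \<gamma> n 0)\<^sup>2) \<le> inverse c * ((real n + 1) powr (1 + \<gamma>) * x n)"
        using x[of n] s[of n] c by (simp add: field_simps)
    qed
  qed
qed

lemma singular_value_ends:
  "(singular_value \<gamma> (n, int n))\<^sup>2 = (sigma_coeff \<gamma> n 0)\<^sup>2" "(singular_value \<gamma> (n, - int n))\<^sup>2 = (sigma_coeff \<gamma> n 0)\<^sup>2"
  using singular_value_sigma[OF \<gamma>, of 0 n] singular_value_sigma[OF \<gamma>, of n n] sigma_coeff_ends[OF \<gamma>, of n] by auto

text \<open>
  Both parts of the theorem at once, with \<open>e\<close> the distance of a frequency from the interval
  \<open>{- n..n}\<close>. For even \<open>m\<close> the last sum runs over \<open>l = n - 2 k\<close> with \<open>k \<ge> 0\<close>; for odd \<open>m\<close> over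
  \<open>l = n - 2 k + 1\<close> with \<open>k \<ge> 1\<close>.
\<close>

theorem xray_range_iff:
  assumes u: "u \<in> L2 (inflow_measure \<gamma>)"
  defines "c \<equiv> \<lambda>i. l2_inner (inflow_measure \<gamma>) u (fan_basis \<gamma> i)"
  assumes parity: "\<And>n l. odd (int n + l + int m) \<Longrightarrow> c (n, l) = 0"
  shows "(\<exists>f\<in>L2_tensor \<gamma> m. AE x in inflow_measure \<gamma>. u x = xray m \<gamma> f x) \<longleftrightarrow>
    (\<forall>e>m. even (e + m) \<longrightarrow> (\<forall>n. c (n, int n + int e) = 0 \<and> c (n, - int n - int e) = 0)) \<and>
    (\<forall>e. 1 \<le> e \<and> e \<le> m \<and> even (e + m) \<longrightarrow>
       summable (\<lambda>n. (real n + 1) powr (1 + \<gamma>) * (cmod (c (n, int n + int e)))\<^sup>2) \<and>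
       summable (\<lambda>n. (real n + 1) powr (1 + \<gamma>) * (cmod (c (n, - int n - int e)))\<^sup>2)) \<and>
    summable (\<lambda>n. \<Sum>k=m mod 2..n. (cmod (c (n, int n - 2 * int k + int (m mod 2))))\<^sup>2 / (sigma_coeff \<gamma> n k)\<^sup>2)"
    (is "?L \<longleftrightarrow> ?A \<and> ?B \<and> ?C")
proof
  assume ?L
  then obtain f where f: "f \<in> L2_tensor \<gamma> m" "AE x in inflow_measure \<gamma>. u x = xray m \<gamma> f x" by blast
  obtain H where H: "H summable_on UNIV" "\<And>i. H i \<ge> 0"
    and bound: "\<And>n l l0. admissible (n, l0) \<Longrightarrow> \<bar>l - l0\<bar> \<le> int m \<Longrightarrow> (cmod (c (n, l)))\<^sup>2 / (singular_value \<gamma> (n, l0))\<^sup>2 \<le> H (n, l)"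
    and zero: "\<And>n l. \<bar>l\<bar> > int n + int m \<Longrightarrow> c (n, l) = 0"
    using xray_coeff_bounds[OF \<gamma> u f] unfolding c_def by metis
  have Hs: "H summable_on A" for A using H(1) by (rule summable_on_subset_banach) simp
  have ?A using zero by auto
  moreover have ?B
  proof (intro allI impI)
    fix e assume e: "1 \<le> e \<and> e \<le> m \<and> even (e + m)"
    have adm: "admissible (n, int n)" "admissible (n, - int n)" for n by (auto simp: admissible_def)
    have "summable (\<lambda>n. H (n, int n + int e))" "summable (\<lambda>n. H (n, - int n - int e))"
      using summable_on_range_iff[of "\<lambda>n. (n, int n + int e)" H] summable_on_range_iff[of "\<lambda>n. (n, - int n - int e)" H] Hs H(2)
      by (auto simp: inj_def)
    moreover have "(cmod (c (n, int n + int e)))\<^sup>2 / (sigma_coeff \<gamma> n 0)\<^sup>2 \<le> H (n, int n + int e)"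
      "(cmod (c (n, - int n - int e)))\<^sup>2 / (sigma_coeff \<gamma> n 0)\<^sup>2 \<le> H (n, - int n - int e)" for n
      using bound[OF adm(1), of "int n + int e"] bound[OF adm(2), of "- int n - int e"] e
      by (simp_all add: singular_value_ends)
    ultimately have "summable (\<lambda>n. (cmod (c (n, int n + int e)))\<^sup>2 / (sigma_coeff \<gamma> n 0)\<^sup>2) \<and>
      summable (\<lambda>n. (cmod (c (n, - int n - int e)))\<^sup>2 / (sigma_coeff \<gamma> n 0)\<^sup>2)"
      by (intro conjI; elim summable_comparison_test'[where N = 0]) simp_all
    then show "summable (\<lambda>n. (real n + 1) powr (1 + \<gamma>) * (cmod (c (n, int n + int e)))\<^sup>2) \<and>
       summable (\<lambda>n. (real n + 1) powr (1 + \<gamma>) * (cmod (c (n, - int n - int e)))\<^sup>2)"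
      by (simp add: summable_end_weight_iff)
  qed
  moreover have ?C
  proof (rule summable_comparison_test'[where N = 0])
    let ?\<phi> = "\<lambda>n k. (n, int n - 2 * int k + int (m mod 2))"
    show "summable (\<lambda>n. \<Sum>k\<in>{m mod 2..n}. H (?\<phi> n k))"
      using summable_on_blocks[of "\<lambda>n. {m mod 2..n}" H ?\<phi>] Hs H(2) by auto
    fix n
    have "(\<Sum>k=m mod 2..n. (cmod (c (?\<phi> n k)))\<^sup>2 / (sigma_coeff \<gamma> n k)\<^sup>2) \<le> (\<Sum>k\<in>{m mod 2..n}. H (?\<phi> n k))"
    proof (rule sum_mono)
      fix k assume k: "k \<in> {m mod 2..n}"
      have "\<bar>(int n - 2 * int k + int (m mod 2)) - (int n - 2 * int k)\<bar> \<le> int m" by simp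
      from bound[OF admissible_sigma this] show "(cmod (c (?\<phi> n k)))\<^sup>2 / (sigma_coeff \<gamma> n k)\<^sup>2 \<le> H (?\<phi> n k)"
        using k by (simp add: singular_value_sigma[OF \<gamma>])
    qed
    then show "norm (\<Sum>k=m mod 2..n. (cmod (c (?\<phi> n k)))\<^sup>2 / (sigma_coeff \<gamma> n k)\<^sup>2) \<le> (\<Sum>k\<in>{m mod 2..n}. H (?\<phi> n k))"
      by (simp add: sum_nonneg)
  qed
  ultimately show "?A \<and> ?B \<and> ?C" by blast
next
  assume ABC: "?A \<and> ?B \<and> ?C"
  define D where "D i = (cmod (c i))\<^sup>2 / (singular_value \<gamma> (fst i, clamp_frequency m (fst i) (snd i)))\<^sup>2" for i
  have D0: "D i \<ge> 0" for i by (simp add: D_def)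
  define Mid where "Mid = (\<Union>n. (\<lambda>k. (n, int n - 2 * int k + int (m mod 2))) ` {m mod 2..n})"
  define Edge where "Edge e = range (\<lambda>n. (n, int n + int e)) \<union> range (\<lambda>n. (n, - int n - int e))" for e
  define E where "E = {e. 1 \<le> e \<and> e \<le> m \<and> even (e + m)}"
  have clampM: "clamp_frequency m n (int n - 2 * int k + int (m mod 2)) = int n - 2 * int k" if "k \<le> n" for n k
    using that by (simp add: clamp_frequency_def)
  have clampE: "clamp_frequency m n (int n + int e) = int n" "clamp_frequency m n (- int n - int e) = - int n" if "1 \<le> e" for n e
  proof -
    have "m mod 2 \<le> 1" by simp
    then show "clamp_frequency m n (int n + int e) = int n" "clamp_frequency m n (- int n - int e) = - int n"
      using that unfolding clamp_frequency_def by linarith+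
  qed
  have "D summable_on Mid"
  proof -
    have "summable (\<lambda>n. \<Sum>k\<in>{m mod 2..n}. D (n, int n - 2 * int k + int (m mod 2)))"
    proof (rule iffD1[OF summable_cong])
      show "eventually (\<lambda>n. (\<Sum>k=m mod 2..n. (cmod (c (n, int n - 2 * int k + int (m mod 2))))\<^sup>2 / (sigma_coeff \<gamma> n k)\<^sup>2)
          = (\<Sum>k\<in>{m mod 2..n}. D (n, int n - 2 * int k + int (m mod 2)))) sequentially"
        by (intro always_eventually allI sum.cong refl) (simp add: D_def clampM singular_value_sigma[OF \<gamma>])
    qed (use ABC in blast)
    then show ?thesis unfolding Mid_def by (subst summable_on_blocks) (auto simp: D0)
  qed
  moreover have "D summable_on (\<Union>e\<in>E. Edge e)"
  proof (rule summable_on_finite_Union)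
    show "finite E" by (rule finite_subset[of _ "{..m}"]) (auto simp: E_def)
    fix e assume e: "e \<in> E"
    then have "summable (\<lambda>n. D (n, int n + int e))" "summable (\<lambda>n. D (n, - int n - int e))"
      using ABC summable_end_weight_iff[of "\<lambda>n. (cmod (c (n, int n + int e)))\<^sup>2"] summable_end_weight_iff[of "\<lambda>n. (cmod (c (n, - int n - int e)))\<^sup>2"]
      by (auto simp: D_def E_def clampE singular_value_ends)
    then show "D summable_on Edge e"
      unfolding Edge_def by (intro summable_on_Un) (auto simp: summable_on_range_iff inj_def D0)
  qed
  ultimately have "D summable_on (Mid \<union> (\<Union>e\<in>E. Edge e))" by (rule summable_on_Un)
  moreover have cover: "c (n, l) = 0 \<or> (n, l) \<in> Mid \<union> (\<Union>e\<in>E. Edge e)" for n l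
  proof (cases "c (n, l) = 0")
    case False
    then have par: "even (int n + l + int m)" using parity by blast
    show ?thesis
    proof (cases "\<bar>l\<bar> \<le> int n")
      case True
      define k where "k = nat ((int n - l + int (m mod 2)) div 2)"
      have "m = 2 * (m div 2) + m mod 2" by (rule mult_div_mod_eq[symmetric])
      then have "int m = 2 * int (m div 2) + int (m mod 2)" by linarith
      then have "int n - l + int (m mod 2) = (int n + l + int m) - 2 * l - 2 * int (m div 2)" by linarith
      then have "even (int n - l + int (m mod 2))" using par by (metis dvd_diff dvd_triv_left)
      then have k: "l = int n - 2 * int k + int (m mod 2)" using True by (auto simp: k_def)
      have "m mod 2 \<le> k \<and> k \<le> n"
      proof (cases "even m")
        case True
        then show ?thesis using k \<open>\<bar>l\<bar> \<le> int n\<close> by auto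
      next
        case False
        then have m1: "m mod 2 = 1" by (simp add: odd_iff_mod_2_eq_one)
        have "l \<noteq> int n" "l \<noteq> - int n" using par False by auto
        then show ?thesis using k \<open>\<bar>l\<bar> \<le> int n\<close> unfolding m1 by auto
      qed
      then have "(n, l) \<in> (\<lambda>k. (n, int n - 2 * int k + int (m mod 2))) ` {m mod 2..n}"
        using k by (intro image_eqI[of _ _ k]) auto
      then show ?thesis unfolding Mid_def by blast
    next
      case False
      define e where "e = nat (\<bar>l\<bar> - int n)"
      have l: "l = int n + int e \<or> l = - int n - int e" and e1: "1 \<le> e" using False by (auto simp: e_def)
      have ev: "even (e + m)" using par l by auto
      have "e \<le> m"
      proof (rule ccontr)
        assume "\<not> e \<le> m"
        then have "c (n, int n + int e) = 0 \<and> c (n, - int n - int e) = 0" using ABC ev by auto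
        then show False using l \<open>c (n, l) \<noteq> 0\<close> by auto
      qed
      then have "e \<in> E" using e1 ev by (simp add: E_def)
      moreover have "(n, l) \<in> Edge e" using l by (auto simp: Edge_def)
      ultimately show ?thesis by blast
    qed
  qed simp
  ultimately have "D summable_on UNIV"
    by (subst summable_on_cong_neutral[of "Mid \<union> (\<Union>e\<in>E. Edge e)" UNIV D D]) (auto simp: D_def)
  moreover have "even (int n + l + int m) \<and> \<bar>l\<bar> \<le> int n + int m" if "c (n, l) \<noteq> 0" for n l
  proof
    show "even (int n + l + int m)" using that parity by blast
    have "m mod 2 \<le> m" by (rule mod_less_eq_dividend)
    moreover have "(n, l) \<in> Mid \<union> (\<Union>e\<in>E. Edge e)" using cover[of n l] that by blast
    ultimately show "\<bar>l\<bar> \<le> int n + int m" by (auto simp: Mid_def Edge_def E_def)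
  qed
  ultimately show ?L unfolding D_def c_def by (intro xray_range_if_weighted_coeffs_summable[OF \<gamma> u]) auto
qed

end

section \<open>Projections, parity and the range theorem\<close>

context orthonormal_basis
begin

lemma orth_proj_AE_zero_iff:
  assumes u: "u \<in> L2 M"
  shows "(AE x in M. orth_proj M (closed_span M (E ` S)) u x = 0) \<longleftrightarrow> (\<forall>i\<in>S. l2_inner M u (E i) = 0)"
proof -
  let ?P = "orth_proj M (closed_span M (E ` S)) u"
  note P = orth_proj_coeff[OF u, where S = S]
  have z: "l2_inner M (\<lambda>_. 0) (E i) = 0" for i by (simp add: l2_inner_def)
  show ?thesis
  proof
    assume "AE x in M. ?P x = 0"
    then have "l2_inner M ?P (E i) = 0" for i
      using l2_inner_cong_AE[of ?P M "\<lambda>_. 0" "E i"] L2_measurable[OF P(1)] L2_measurable[OF basis_L2] z by simp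
    then show "\<forall>i\<in>S. l2_inner M u (E i) = 0" using P(2) by metis
  next
    assume "\<forall>i\<in>S. l2_inner M u (E i) = 0"
    then show "AE x in M. ?P x = 0"
      by (intro coeff_unique P(1) L2_zero) (simp add: P(2) z)
  qed
qed

lemma orth_proj_h_space_iff:
  fixes \<phi> \<eta> :: "nat \<Rightarrow> 'i"
  assumes "inj \<phi>" "inj \<eta>" "range \<phi> \<inter> range \<eta> = {}" and u: "u \<in> L2 M"
  shows "orth_proj M (closed_span M (E ` (range \<phi> \<union> range \<eta>))) u
      \<in> sum_space (h_space M s (\<lambda>n. E (\<phi> n))) (h_space M s (\<lambda>n. E (\<eta> n))) \<longleftrightarrow>
    summable (\<lambda>n. (real n + 1) powr (2 * s) * (cmod (l2_inner M u (E (\<phi> n))))\<^sup>2) \<and>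
    summable (\<lambda>n. (real n + 1) powr (2 * s) * (cmod (l2_inner M u (E (\<eta> n))))\<^sup>2)"
  using sum_space_h_space_iff[OF assms(1-3) orth_proj_coeff(1)[OF u], of "range \<phi> \<union> range \<eta>"]
  by (simp add: orth_proj_coeff(2)[OF u])

lemma orth_proj_l2_sums_iff:
  fixes \<phi> :: "nat \<Rightarrow> 'k \<Rightarrow> 'i" and w :: "nat \<Rightarrow> 'k \<Rightarrow> real"
  assumes fin: "\<And>n. finite (K n)"
    and inj: "\<And>n m k l. k \<in> K n \<Longrightarrow> l \<in> K m \<Longrightarrow> \<phi> n k = \<phi> m l \<Longrightarrow> n = m \<and> k = l"
    and u: "u \<in> L2 M"
  shows "(\<exists>a. l2_sums M (\<lambda>n x. \<Sum>k\<in>K n. a n k * E (\<phi> n k) x) (orth_proj M (closed_span M (E ` (\<Union>n. \<phi> n ` K n))) u) \<and>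
      summable (\<lambda>n. \<Sum>k\<in>K n. (cmod (a n k))\<^sup>2 / w n k)) \<longleftrightarrow>
    summable (\<lambda>n. \<Sum>k\<in>K n. (cmod (l2_inner M u (E (\<phi> n k))))\<^sup>2 / w n k)"
proof -
  let ?S = "\<Union>n. \<phi> n ` K n"
  let ?P = "orth_proj M (closed_span M (E ` ?S)) u"
  note P = orth_proj_coeff[OF u, where S = ?S]
  have "l2_inner M ?P (E (\<phi> n k)) = l2_inner M u (E (\<phi> n k))" if "k \<in> K n" for n k
    unfolding P(2) using that by auto
  moreover have "l2_inner M ?P (E j) = 0" if "\<forall>n. \<forall>k\<in>K n. \<phi> n k \<noteq> j" for j
    unfolding P(2) using that by auto
  ultimately have iff: "l2_sums M (\<lambda>n x. \<Sum>k\<in>K n. a n k * E (\<phi> n k) x) ?P \<longleftrightarrow>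
    (\<forall>n. \<forall>k\<in>K n. l2_inner M u (E (\<phi> n k)) = a n k)" for a
    by (subst l2_sums_iff[OF fin _ P(1)]) (erule (2) inj, simp)
  show ?thesis
  proof
    assume "\<exists>a. l2_sums M (\<lambda>n x. \<Sum>k\<in>K n. a n k * E (\<phi> n k) x) ?P \<and> summable (\<lambda>n. \<Sum>k\<in>K n. (cmod (a n k))\<^sup>2 / w n k)"
    then obtain a where "\<forall>n. \<forall>k\<in>K n. l2_inner M u (E (\<phi> n k)) = a n k" "summable (\<lambda>n. \<Sum>k\<in>K n. (cmod (a n k))\<^sup>2 / w n k)"
      unfolding iff by blast
    then show "summable (\<lambda>n. \<Sum>k\<in>K n. (cmod (l2_inner M u (E (\<phi> n k))))\<^sup>2 / w n k)"
      by (simp cong: sum.cong)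
  next
    assume "summable (\<lambda>n. \<Sum>k\<in>K n. (cmod (l2_inner M u (E (\<phi> n k))))\<^sup>2 / w n k)"
    then show "\<exists>a. l2_sums M (\<lambda>n x. \<Sum>k\<in>K n. a n k * E (\<phi> n k) x) ?P \<and> summable (\<lambda>n. \<Sum>k\<in>K n. (cmod (a n k))\<^sup>2 / w n k)"
      unfolding iff by (intro exI[of _ "\<lambda>n k. l2_inner M u (E (\<phi> n k))"]) auto
  qed
qed

end

lemma nn_integral_line_reflect:
  assumes F: "F \<in> borel_measurable line_measure"
  shows "(\<integral>\<^sup>+p. F (- p) \<partial>line_measure) = (\<integral>\<^sup>+p. F p \<partial>line_measure)"
proof -
  have Fm [measurable]: "F \<in> borel_measurable (circle_measure \<Otimes>\<^sub>M lborel)" by fact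
  have Fs [measurable]: "(\<lambda>v. F (v, s)) \<in> borel_measurable borel" for s
    using measurable_Pair1[OF F, of s] by (simp add: measurable_cong_sets[OF sets_circle_measure refl])
  have [measurable]: "(\<lambda>p. F (- fst p, - snd p)) \<in> borel_measurable line_measure"
    by (rule measurable_compose[OF _ F]) measurable
  have "(\<integral>\<^sup>+p. F (- p) \<partial>line_measure) = (\<integral>\<^sup>+p. F (- fst p, - snd p) \<partial>line_measure)"
    by (simp add: uminus_prod_def case_prod_unfold)
  also have "\<dots> = (\<integral>\<^sup>+s. (\<integral>\<^sup>+v. F (- v, - s) \<partial>circle_measure) \<partial>lborel)"
    by (subst circle_lborel.nn_integral_snd[symmetric]) simp_all
  also have "\<dots> = (\<integral>\<^sup>+s. (\<integral>\<^sup>+v. F (v, - s) \<partial>circle_measure) \<partial>lborel)"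
    using nn_integral_circle_rotate[of "\<lambda>v. F (v, - s)" "-1" for s] by simp
  also have "\<dots> = (\<integral>\<^sup>+s. (\<integral>\<^sup>+v. F (v, s) \<partial>circle_measure) \<partial>lborel)"
    using nn_integral_real_affine[of "\<lambda>s. (\<integral>\<^sup>+v. F (v, s) \<partial>circle_measure)" "-1" 0] by simp
  also have "\<dots> = (\<integral>\<^sup>+p. F p \<partial>line_measure)"
    by (rule circle_lborel.nn_integral_snd) measurable
  finally show ?thesis .
qed

lemma uminus_borel_measurable: "(uminus :: complex \<times> real \<Rightarrow> _) \<in> borel \<rightarrow>\<^sub>M borel"
  by (intro borel_measurable_continuous_onI continuous_intros)

lemma distr_beam_reflect: "distr (beam_measure \<gamma>) borel uminus = beam_measure \<gamma>"
proof (rule measure_eqI)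
  note [measurable] = uminus_borel_measurable
  fix A :: "(complex \<times> real) set" assume "A \<in> sets (distr (beam_measure \<gamma>) borel uminus)"
  then have A [measurable]: "A \<in> sets borel" by simp
  define d where "d p = ennreal (indicator {-1..1} (snd p) * (1 - (snd p)\<^sup>2) powr (- \<gamma> - 1/2))" for p :: "complex \<times> real"
  have dm: "d \<in> borel_measurable line_measure" unfolding d_def by measurable
  have d: "beam_measure \<gamma> = density line_measure d" unfolding d_def beam_measure_density ..
  have dneg: "d (- p) = d p" for p by (cases p) (auto simp: d_def indicator_def)
  have Am: "(\<lambda>p. indicator A p :: ennreal) \<in> borel_measurable line_measure"
    "(\<lambda>p. indicator A (- p) :: ennreal) \<in> borel_measurable line_measure"
    by (rule measurable_line, (intro borel_measurable_indicator A | rule measurable_compose[OF uminus_borel_measurable borel_measurable_indicator[OF A]]))+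
  have "emeasure (distr (beam_measure \<gamma>) borel uminus) A = (\<integral>\<^sup>+p. indicator A p \<partial>distr (beam_measure \<gamma>) borel uminus)"
    by simp
  also have "\<dots> = (\<integral>\<^sup>+p. indicator A (- p) \<partial>beam_measure \<gamma>)"
    by (subst nn_integral_distr) auto
  also have "\<dots> = (\<integral>\<^sup>+p. d (- p) * indicator A (- p) \<partial>line_measure)"
    unfolding d dneg by (rule nn_integral_density[OF dm Am(2)])
  also have "\<dots> = (\<integral>\<^sup>+p. d p * indicator A p \<partial>line_measure)"
    by (rule nn_integral_line_reflect[of "\<lambda>p. d p * indicator A p"]) (intro borel_measurable_times_ennreal dm Am)
  also have "\<dots> = (\<integral>\<^sup>+p. indicator A p \<partial>beam_measure \<gamma>)"
    unfolding d by (rule nn_integral_density[OF dm Am(1), symmetric])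
  finally show "emeasure (distr (beam_measure \<gamma>) borel uminus) A = emeasure (beam_measure \<gamma>) A" by simp
qed simp

text \<open>
  The scattering relation leaves the fundamental domain of \<open>\<beta>\<close>; periodicity brings its values back
  into it.
\<close>

lemma periodic_representative:
  assumes per: "\<And>\<beta>. u (\<beta> + 2 * pi, \<alpha>) = u (\<beta>, \<alpha>)"
  shows "\<exists>\<beta>'. 0 \<le> \<beta>' \<and> \<beta>' < 2 * pi \<and> u (\<beta>', \<alpha>) = u (\<beta>, \<alpha>) \<and> (\<forall>t. cis (\<beta>' + t) = cis (\<beta> + t))"
proof -
  have n: "u (\<beta> + 2 * pi * real n, \<alpha>) = u (\<beta>, \<alpha>)" for \<beta> n
  proof (induction n)
    case (Suc n)
    then show ?case using per[of "\<beta> + 2 * pi * real n"] by (simp add: algebra_simps)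
  qed simp
  define k where "k = \<lfloor>\<beta> / (2*pi)\<rfloor>"
  define \<beta>' where "\<beta>' = \<beta> - 2 * pi * of_int k"
  have r: "0 \<le> \<beta>'" "\<beta>' < 2 * pi"
    using floor_divide_lower[of "2*pi" \<beta>] floor_divide_upper[of "2*pi" \<beta>]
    by (auto simp: \<beta>'_def k_def algebra_simps)
  have "u (\<beta>', \<alpha>) = u (\<beta>, \<alpha>)"
  proof (cases "k \<ge> 0")
    case True
    then show ?thesis using n[of \<beta>' "nat k"] by (simp add: \<beta>'_def)
  next
    case False
    then show ?thesis using n[of \<beta> "nat (- k)"] by (simp add: \<beta>'_def)
  qed
  moreover have "cis (\<beta>' + t) = cis (\<beta> + t)" for t
  proof -
    have "cis (\<beta> + t) = cis (\<beta>' + t) * cis (2 * pi * of_int k)" unfolding cis_mult \<beta>'_def by (simp add: add_ac)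
    also have "cis (2 * pi * of_int k) = 1" by (rule cis_multiple_2pi) simp
    finally show ?thesis by simp
  qed
  ultimately show ?thesis using r by blast
qed

context
  fixes \<gamma> :: real
  assumes \<gamma>: "\<gamma> > -1"
begin

lemma beam_basis_reflect: "beam_basis \<gamma> (n, l) (- p) = (-1) powi (int n + l) * beam_basis \<gamma> (n, l) p"
proof -
  have "(- fst p) powi l = (-1) powi l * fst p powi l"
    using power_int_mult_distrib[of "-1" "fst p" l] by simp
  moreover have "(-1 :: complex) powi (int n + l) = (-1)^n * (-1) powi l" by (subst power_int_add) simp_all
  ultimately show ?thesis
    by (simp add: beam_basis_def Lhat_parity[OF \<gamma>])
qed

text \<open>
  The map \<open>(v, s) \<mapsto> (- v, - s)\<close> preserves the measure. It multiplies \<open>u\<close> by \<open>\<epsilon>\<close> and the basis element by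
  \<open>(-1) powi (n + l)\<close>; when these signs differ, the coefficient equals its own negative.
\<close>

lemma fan_coeff_zero_by_parity:
  assumes u: "u \<in> L2_inflow \<gamma>" and sym: "AE x in inflow_measure \<gamma>. u (antipodal_scattering x) = \<epsilon> * u x"
    and odd: "\<epsilon> * (-1) powi (int n + l) = -1"
  shows "l2_inner (inflow_measure \<gamma>) u (fan_basis \<gamma> (n, l)) = 0"
proof -
  note [measurable] = uminus_borel_measurable
  have uL: "u \<in> L2 (inflow_measure \<gamma>)" and per: "\<And>\<beta> \<alpha>. \<alpha> \<in> {-pi/2..pi/2} \<Longrightarrow> u (\<beta> + 2 * pi, \<alpha>) = u (\<beta>, \<alpha>)"
    using u by (auto simp: L2_inflow_def)
  obtain U where U [measurable]: "U \<in> borel_measurable borel" and uU: "\<And>x. x \<in> inflow_domain \<Longrightarrow> u x = U (beam_coords x)"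
    using beam_representative[OF L2_measurable[OF uL]] by blast
  have flip: "u (antipodal_scattering x) = U (- beam_coords x)" if x: "x \<in> inflow_domain" for x
  proof -
    obtain \<beta> \<alpha> where xp: "x = (\<beta>, \<alpha>)" by (cases x)
    have a: "- \<alpha> \<in> {-pi/2..pi/2}" using x by (auto simp: xp)
    obtain \<beta>' where b: "0 \<le> \<beta>'" "\<beta>' < 2 * pi" "u (\<beta>', - \<alpha>) = u (\<beta> + pi + 2 * \<alpha>, - \<alpha>)"
      "\<And>t. cis (\<beta>' + t) = cis (\<beta> + pi + 2 * \<alpha> + t)"
      using periodic_representative[of u "- \<alpha>" "\<beta> + pi + 2 * \<alpha>"] per[OF a] by blast
    have "(\<beta>', - \<alpha>) \<in> inflow_domain" using b a by auto
    from uU[OF this] have "u (antipodal_scattering x) = U (beam_coords (\<beta>', - \<alpha>))"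
      using b(3) by (simp add: antipodal_scattering_def xp)
    also have "beam_coords (\<beta>', - \<alpha>) = - beam_coords x"
    proof -
      have "cis (\<beta>' + - \<alpha> + pi) = cis (\<beta> + pi + 2 * \<alpha> + (- \<alpha> + pi))" using b(4)[of "- \<alpha> + pi"] by (simp only: add.assoc)
      also have "\<dots> = - cis (\<beta> + \<alpha> + pi)" by (simp add: complex_eq_iff algebra_simps cos_add sin_add)
      finally show ?thesis by (simp add: beam_coords_def xp)
    qed
    finally show ?thesis .
  qed
  have "AE x in inflow_measure \<gamma>. U (- beam_coords x) = \<epsilon> * U (beam_coords x)"
    using sym AE_inflow_domain by eventually_elim (simp add: flip uU)
  moreover have "{p. U (- p) = \<epsilon> * U p} \<in> sets borel"
  proof -
    have "{p \<in> space borel. U (- p) = \<epsilon> * U p} \<in> sets borel" by measurable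
    then show ?thesis by simp
  qed
  ultimately have UAE: "AE p in beam_measure \<gamma>. U (- p) = \<epsilon> * U p"
    using AE_inflow_beam[of "\<lambda>p. U (- p) = \<epsilon> * U p" \<gamma>] by blast
  let ?F = "\<lambda>p. U p * cnj (beam_basis \<gamma> (n, l) p)"
  have Fm: "?F \<in> borel_measurable borel" by measurable
  have "l2_inner (inflow_measure \<gamma>) u (fan_basis \<gamma> (n, l)) = (\<integral>x. ?F (beam_coords x) \<partial>inflow_measure \<gamma>)"
    unfolding l2_inner_def
    by (intro Bochner_Integration.integral_cong) (auto simp: space_inflow_measure uU fan_basis_beam)
  also have "\<dots> = (\<integral>p. ?F p \<partial>beam_measure \<gamma>)" by (rule integral_inflow_beam[OF Fm])
  finally have I: "l2_inner (inflow_measure \<gamma>) u (fan_basis \<gamma> (n, l)) = (\<integral>p. ?F p \<partial>beam_measure \<gamma>)" .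
  have "(\<integral>p. ?F p \<partial>beam_measure \<gamma>) = (\<integral>p. ?F p \<partial>distr (beam_measure \<gamma>) borel uminus)"
    by (simp only: distr_beam_reflect)
  also have "\<dots> = (\<integral>p. ?F (- p) \<partial>beam_measure \<gamma>)"
    by (rule integral_distr[OF _ Fm]) measurable
  also have "\<dots> = (\<integral>p. - ?F p \<partial>beam_measure \<gamma>)"
  proof (rule integral_cong_AE)
    show "AE p in beam_measure \<gamma>. ?F (- p) = - ?F p"
      using UAE
    proof eventually_elim
      case (elim p)
      have "?F (- p) = (\<epsilon> * (-1) powi (int n + l)) * ?F p"
        unfolding elim beam_basis_reflect by simp
      then show ?case unfolding odd by simp
    qed
  qed (use Fm in measurable)
  finally have "(\<integral>p. ?F p \<partial>beam_measure \<gamma>) = - (\<integral>p. ?F p \<partial>beam_measure \<gamma>)" by simp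
  then show ?thesis unfolding I by simp
qed

end

theorem theorem9:
  fixes \<gamma> :: real and p :: nat
  assumes "-1 < \<gamma>" and "\<gamma> < 1"
  shows
    "(\<forall>u \<in> L2_inflow_plus \<gamma>.
        (\<exists>f \<in> L2_tensor \<gamma> (2 * p). AE x in inflow_measure \<gamma>. u x = xray (2 * p) \<gamma> f x)
        \<longleftrightarrow>
        (\<forall>j>p. AE x in inflow_measure \<gamma>. Pi_even \<gamma> j u x = 0) \<and>
        (\<forall>j. 1 \<le> j \<and> j \<le> p \<longrightarrow>
           Pi_even \<gamma> j u \<in> sum_space
             (h_space (inflow_measure \<gamma>) ((1 + \<gamma>) / 2) (\<lambda>n. psi_plus \<gamma> n (- int j)))
             (h_space (inflow_measure \<gamma>) ((1 + \<gamma>) / 2) (\<lambda>n. psi_plus \<gamma> n (int n + int j)))) \<and>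
        (\<exists>a :: nat \<Rightarrow> nat \<Rightarrow> complex.
           l2_sums (inflow_measure \<gamma>)
             (\<lambda>n x. \<Sum>k=0..n. a n k * psi_plus \<gamma> n (int k) x) (Pi_even \<gamma> 0 u) \<and>
           summable (\<lambda>n. \<Sum>k=0..n. (cmod (a n k))\<^sup>2 / (sigma_coeff \<gamma> n k)\<^sup>2)))
     \<and>
     (\<forall>u \<in> L2_inflow_minus \<gamma>.
        (\<exists>f \<in> L2_tensor \<gamma> (2 * p + 1). AE x in inflow_measure \<gamma>. u x = xray (2 * p + 1) \<gamma> f x)
        \<longleftrightarrow>
        (\<forall>j>p. AE x in inflow_measure \<gamma>. Pi_odd \<gamma> j u x = 0) \<and>
        (\<forall>j. 0 \<le> j \<and> j \<le> p \<longrightarrow>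
           Pi_odd \<gamma> j u \<in> sum_space
             (h_space (inflow_measure \<gamma>) ((1 + \<gamma>) / 2) (\<lambda>n. psi_minus \<gamma> n (- int j)))
             (h_space (inflow_measure \<gamma>) ((1 + \<gamma>) / 2) (\<lambda>n. psi_minus \<gamma> n (int n + int j + 1)))) \<and>
        (\<exists>a :: nat \<Rightarrow> nat \<Rightarrow> complex.
           l2_sums (inflow_measure \<gamma>)
             (\<lambda>n x. \<Sum>k=1..n. a n k * psi_minus \<gamma> n (int k) x) (Pi_perp \<gamma> u) \<and>
           summable (\<lambda>n. \<Sum>k=1..n. (cmod (a n k))\<^sup>2 / (sigma_coeff \<gamma> n k)\<^sup>2)))"
proof -
  have \<gamma>: "\<gamma> > -1" by fact
  let ?M = "inflow_measure \<gamma>"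
  interpret orthonormal_basis ?M "fan_basis \<gamma>" by (rule fan_basis_orthonormal_basis[OF \<gamma>])
  (* The index sets of the projections beyond {-n..n}. In the notation of the theorem, k = -j
     lies above and k = n + j (or n + j + 1) below. *)
  define up dn where "up e n = (n, int n + int e)" and "dn e n = (n, - int n - int e)" for e n :: nat
  have edge: "inj (up e)" "inj (dn e)" "1 \<le> e \<Longrightarrow> range (up e) \<inter> range (dn e) = {}" for e
    by (auto simp: up_def dn_def inj_def)
  have s: "2 * ((1 + \<gamma>) / 2) = 1 + \<gamma>" by simp
  show ?thesis
  proof (intro conjI ballI)
    fix u assume u: "u \<in> L2_inflow_plus \<gamma>"
    then have ui: "u \<in> L2_inflow \<gamma>" and uL: "u \<in> L2 ?M" by (auto simp: L2_inflow_plus_def L2_inflow_def)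
    define c where "c i = l2_inner ?M u (fan_basis \<gamma> i)" for i
    have par: "c (n, l) = 0" if "odd (int n + l + int (2 * p))" for n l
      unfolding c_def by (rule fan_coeff_zero_by_parity[OF \<gamma> ui, of 1]) (use u that in \<open>auto simp: L2_inflow_plus_def power_int_minus_one_minus\<close>)
    have psi: "psi_plus \<gamma> n (- int j) = fan_basis \<gamma> (up (2 * j) n)" "psi_plus \<gamma> n (int n + int j) = fan_basis \<gamma> (dn (2 * j) n)" for n j
      by (simp_all add: psi_plus_fan_basis up_def dn_def)
    have Pj: "Pi_even \<gamma> j u = orth_proj ?M (closed_span ?M (fan_basis \<gamma> ` (range (up (2 * j)) \<union> range (dn (2 * j))))) u" if "1 \<le> j" for j
    proof -
      have "{psi_plus \<gamma> n (- int j) | n. True} \<union> {psi_plus \<gamma> n (int n + int j) | n. True}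
        = fan_basis \<gamma> ` (range (up (2 * j)) \<union> range (dn (2 * j)))"
        unfolding psi by auto
      then show ?thesis using that by (simp add: Pi_even_def)
    qed
    have P0: "Pi_even \<gamma> 0 u = orth_proj ?M (closed_span ?M (fan_basis \<gamma> ` (\<Union>n. (\<lambda>k. (n, int n - 2 * int k)) ` {0..n}))) u"
    proof -
      have "{psi_plus \<gamma> n (int k) | n k. k \<le> n} = fan_basis \<gamma> ` (\<Union>n. (\<lambda>k. (n, int n - 2 * int k)) ` {0..n})"
        unfolding psi_plus_fan_basis by (auto simp: image_iff) blast?
      then show ?thesis by (simp add: Pi_even_def)
    qed
    have A: "(\<forall>j>p. AE x in ?M. Pi_even \<gamma> j u x = 0) \<longleftrightarrow>
      (\<forall>e>2 * p. even (e + 2 * p) \<longrightarrow> (\<forall>n. c (n, int n + int e) = 0 \<and> c (n, - int n - int e) = 0))"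
    proof -
      have "(AE x in ?M. Pi_even \<gamma> j u x = 0) \<longleftrightarrow> (\<forall>n. c (up (2 * j) n) = 0 \<and> c (dn (2 * j) n) = 0)" if "j > p" for j
        using that Pj[of j] by (auto simp: orth_proj_AE_zero_iff[OF uL] c_def)
      then have "(\<forall>j>p. AE x in ?M. Pi_even \<gamma> j u x = 0) \<longleftrightarrow> (\<forall>j>p. \<forall>n. c (up (2 * j) n) = 0 \<and> c (dn (2 * j) n) = 0)" by blast
      also have "\<dots> \<longleftrightarrow> (\<forall>e>2 * p. even e \<longrightarrow> (\<forall>n. c (up e n) = 0 \<and> c (dn e n) = 0))"
        by (auto elim!: evenE)
      finally show ?thesis by (simp add: up_def dn_def)
    qed
    have B: "(\<forall>j. 1 \<le> j \<and> j \<le> p \<longrightarrow> Pi_even \<gamma> j u \<in> sum_space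
             (h_space ?M ((1 + \<gamma>) / 2) (\<lambda>n. psi_plus \<gamma> n (- int j)))
             (h_space ?M ((1 + \<gamma>) / 2) (\<lambda>n. psi_plus \<gamma> n (int n + int j)))) \<longleftrightarrow>
      (\<forall>e. 1 \<le> e \<and> e \<le> 2 * p \<and> even (e + 2 * p) \<longrightarrow>
       summable (\<lambda>n. (real n + 1) powr (1 + \<gamma>) * (cmod (c (n, int n + int e)))\<^sup>2) \<and>
       summable (\<lambda>n. (real n + 1) powr (1 + \<gamma>) * (cmod (c (n, - int n - int e)))\<^sup>2))" (is "?B1 \<longleftrightarrow> ?B2")
    proof -
      define Q where "Q e \<longleftrightarrow> summable (\<lambda>n. (real n + 1) powr (1 + \<gamma>) * (cmod (c (up e n)))\<^sup>2) \<and>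
       summable (\<lambda>n. (real n + 1) powr (1 + \<gamma>) * (cmod (c (dn e n)))\<^sup>2)" for e
      have "Pi_even \<gamma> j u \<in> sum_space
             (h_space ?M ((1 + \<gamma>) / 2) (\<lambda>n. psi_plus \<gamma> n (- int j)))
             (h_space ?M ((1 + \<gamma>) / 2) (\<lambda>n. psi_plus \<gamma> n (int n + int j))) \<longleftrightarrow> Q (2 * j)" if "1 \<le> j" for j
        unfolding Pj[OF that] psi Q_def c_def using that
        by (subst orth_proj_h_space_iff[OF edge uL]) (simp, simp only: s)
      then have "?B1 \<longleftrightarrow> (\<forall>j. 1 \<le> j \<and> j \<le> p \<longrightarrow> Q (2 * j))" by blast
      also have "\<dots> \<longleftrightarrow> (\<forall>e. 1 \<le> e \<and> e \<le> 2 * p \<and> even (e + 2 * p) \<longrightarrow> Q e)"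
        by (auto elim!: evenE)
      finally show ?thesis by (simp add: Q_def up_def dn_def)
    qed
    have C: "(\<exists>a. l2_sums ?M (\<lambda>n x. \<Sum>k=0..n. a n k * psi_plus \<gamma> n (int k) x) (Pi_even \<gamma> 0 u) \<and>
           summable (\<lambda>n. \<Sum>k=0..n. (cmod (a n k))\<^sup>2 / (sigma_coeff \<gamma> n k)\<^sup>2)) \<longleftrightarrow>
      summable (\<lambda>n. \<Sum>k=2 * p mod 2..n. (cmod (c (n, int n - 2 * int k + int (2 * p mod 2))))\<^sup>2 / (sigma_coeff \<gamma> n k)\<^sup>2)"
      unfolding P0 psi_plus_fan_basis c_def
      by (subst orth_proj_l2_sums_iff[OF _ _ uL]) auto
    show "(\<exists>f \<in> L2_tensor \<gamma> (2 * p). AE x in ?M. u x = xray (2 * p) \<gamma> f x)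
        \<longleftrightarrow>
        (\<forall>j>p. AE x in ?M. Pi_even \<gamma> j u x = 0) \<and>
        (\<forall>j. 1 \<le> j \<and> j \<le> p \<longrightarrow>
           Pi_even \<gamma> j u \<in> sum_space
             (h_space ?M ((1 + \<gamma>) / 2) (\<lambda>n. psi_plus \<gamma> n (- int j)))
             (h_space ?M ((1 + \<gamma>) / 2) (\<lambda>n. psi_plus \<gamma> n (int n + int j)))) \<and>
        (\<exists>a. l2_sums ?M
             (\<lambda>n x. \<Sum>k=0..n. a n k * psi_plus \<gamma> n (int k) x) (Pi_even \<gamma> 0 u) \<and>
           summable (\<lambda>n. \<Sum>k=0..n. (cmod (a n k))\<^sup>2 / (sigma_coeff \<gamma> n k)\<^sup>2))"
      unfolding A B C unfolding c_def by (rule xray_range_iff[OF \<gamma> uL par[unfolded c_def]])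
  next
    fix u assume u: "u \<in> L2_inflow_minus \<gamma>"
    then have ui: "u \<in> L2_inflow \<gamma>" and uL: "u \<in> L2 ?M" by (auto simp: L2_inflow_minus_def L2_inflow_def)
    define c where "c i = l2_inner ?M u (fan_basis \<gamma> i)" for i
    have par: "c (n, l) = 0" if "odd (int n + l + int (2 * p + 1))" for n l
      unfolding c_def by (rule fan_coeff_zero_by_parity[OF \<gamma> ui, of "-1"]) (use u that in \<open>auto simp: L2_inflow_minus_def power_int_minus_one_minus\<close>)
    have psi: "psi_minus \<gamma> n (- int j) = fan_basis \<gamma> (up (2 * j + 1) n)" "psi_minus \<gamma> n (int n + int j + 1) = fan_basis \<gamma> (dn (2 * j + 1) n)" for n j
      by (auto simp: psi_minus_fan_basis up_def dn_def intro!: arg_cong[where f = "fan_basis \<gamma>"])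
    have Pj: "Pi_odd \<gamma> j u = orth_proj ?M (closed_span ?M (fan_basis \<gamma> ` (range (up (2 * j + 1)) \<union> range (dn (2 * j + 1))))) u" for j
    proof -
      have "{psi_minus \<gamma> n (- int j) | n. True} \<union> {psi_minus \<gamma> n (int n + int j + 1) | n. True}
        = fan_basis \<gamma> ` (range (up (2 * j + 1)) \<union> range (dn (2 * j + 1)))"
        unfolding psi by auto
      then show ?thesis by (simp add: Pi_odd_def)
    qed
    have P0: "Pi_perp \<gamma> u = orth_proj ?M (closed_span ?M (fan_basis \<gamma> ` (\<Union>n. (\<lambda>k. (n, int n - 2 * int k + 1)) ` {1..n}))) u"
    proof -
      have "{psi_minus \<gamma> n (int k) | n k. 1 \<le> n \<and> 1 \<le> k \<and> k \<le> n} = fan_basis \<gamma> ` (\<Union>n. (\<lambda>k. (n, int n - 2 * int k + 1)) ` {1..n})"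
      proof (intro equalityI subsetI)
        fix g assume "g \<in> {psi_minus \<gamma> n (int k) | n k. 1 \<le> n \<and> 1 \<le> k \<and> k \<le> n}"
        then show "g \<in> fan_basis \<gamma> ` (\<Union>n. (\<lambda>k. (n, int n - 2 * int k + 1)) ` {1..n})"
          unfolding psi_minus_fan_basis by fastforce
      next
        fix g assume "g \<in> fan_basis \<gamma> ` (\<Union>n. (\<lambda>k. (n, int n - 2 * int k + 1)) ` {1..n})"
        then obtain n k where "1 \<le> k" "k \<le> n" "g = fan_basis \<gamma> (n, int n - 2 * int k + 1)" by auto
        then show "g \<in> {psi_minus \<gamma> n (int k) | n k. 1 \<le> n \<and> 1 \<le> k \<and> k \<le> n}"
          unfolding psi_minus_fan_basis by (intro CollectI exI[of _ n] exI[of _ k]) auto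
      qed
      then show ?thesis by (simp add: Pi_perp_def)
    qed
    have m2: "(2 * p + 1) mod 2 = 1" by simp
    have A: "(\<forall>j>p. AE x in ?M. Pi_odd \<gamma> j u x = 0) \<longleftrightarrow>
      (\<forall>e>2 * p + 1. even (e + (2 * p + 1)) \<longrightarrow> (\<forall>n. c (n, int n + int e) = 0 \<and> c (n, - int n - int e) = 0))"
    proof -
      have "(AE x in ?M. Pi_odd \<gamma> j u x = 0) \<longleftrightarrow> (\<forall>n. c (up (2 * j + 1) n) = 0 \<and> c (dn (2 * j + 1) n) = 0)" for j
        unfolding Pj by (auto simp: orth_proj_AE_zero_iff[OF uL] c_def)
      then have "(\<forall>j>p. AE x in ?M. Pi_odd \<gamma> j u x = 0) \<longleftrightarrow> (\<forall>j>p. \<forall>n. c (up (2 * j + 1) n) = 0 \<and> c (dn (2 * j + 1) n) = 0)" by blast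
      also have "\<dots> \<longleftrightarrow> (\<forall>e>2 * p + 1. odd e \<longrightarrow> (\<forall>n. c (up e n) = 0 \<and> c (dn e n) = 0))"
        by (auto elim!: oddE)
      finally show ?thesis by (simp add: up_def dn_def)
    qed
    have B: "(\<forall>j. 0 \<le> j \<and> j \<le> p \<longrightarrow> Pi_odd \<gamma> j u \<in> sum_space
             (h_space ?M ((1 + \<gamma>) / 2) (\<lambda>n. psi_minus \<gamma> n (- int j)))
             (h_space ?M ((1 + \<gamma>) / 2) (\<lambda>n. psi_minus \<gamma> n (int n + int j + 1)))) \<longleftrightarrow>
      (\<forall>e. 1 \<le> e \<and> e \<le> 2 * p + 1 \<and> even (e + (2 * p + 1)) \<longrightarrow>
       summable (\<lambda>n. (real n + 1) powr (1 + \<gamma>) * (cmod (c (n, int n + int e)))\<^sup>2) \<and>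
       summable (\<lambda>n. (real n + 1) powr (1 + \<gamma>) * (cmod (c (n, - int n - int e)))\<^sup>2))" (is "?B1 \<longleftrightarrow> ?B2")
    proof -
      define Q where "Q e \<longleftrightarrow> summable (\<lambda>n. (real n + 1) powr (1 + \<gamma>) * (cmod (c (up e n)))\<^sup>2) \<and>
       summable (\<lambda>n. (real n + 1) powr (1 + \<gamma>) * (cmod (c (dn e n)))\<^sup>2)" for e
      have "Pi_odd \<gamma> j u \<in> sum_space
             (h_space ?M ((1 + \<gamma>) / 2) (\<lambda>n. psi_minus \<gamma> n (- int j)))
             (h_space ?M ((1 + \<gamma>) / 2) (\<lambda>n. psi_minus \<gamma> n (int n + int j + 1))) \<longleftrightarrow> Q (2 * j + 1)" for j
        unfolding Pj psi Q_def c_def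
        by (subst orth_proj_h_space_iff[OF edge uL]) (simp, simp only: s)
      then have "?B1 \<longleftrightarrow> (\<forall>j. j \<le> p \<longrightarrow> Q (2 * j + 1))" by simp
      also have "\<dots> \<longleftrightarrow> (\<forall>e. 1 \<le> e \<and> e \<le> 2 * p + 1 \<and> even (e + (2 * p + 1)) \<longrightarrow> Q e)"
        by (auto elim!: oddE)
      finally show ?thesis by (simp add: Q_def up_def dn_def)
    qed
    have C: "(\<exists>a. l2_sums ?M (\<lambda>n x. \<Sum>k=1..n. a n k * psi_minus \<gamma> n (int k) x) (Pi_perp \<gamma> u) \<and>
           summable (\<lambda>n. \<Sum>k=1..n. (cmod (a n k))\<^sup>2 / (sigma_coeff \<gamma> n k)\<^sup>2)) \<longleftrightarrow>
      summable (\<lambda>n. \<Sum>k=(2 * p + 1) mod 2..n. (cmod (c (n, int n - 2 * int k + int ((2 * p + 1) mod 2))))\<^sup>2 / (sigma_coeff \<gamma> n k)\<^sup>2)"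
      unfolding P0 psi_minus_fan_basis c_def m2
      by (subst orth_proj_l2_sums_iff[OF _ _ uL]) auto
    show "(\<exists>f \<in> L2_tensor \<gamma> (2 * p + 1). AE x in ?M. u x = xray (2 * p + 1) \<gamma> f x)
        \<longleftrightarrow>
        (\<forall>j>p. AE x in ?M. Pi_odd \<gamma> j u x = 0) \<and>
        (\<forall>j. 0 \<le> j \<and> j \<le> p \<longrightarrow>
           Pi_odd \<gamma> j u \<in> sum_space
             (h_space ?M ((1 + \<gamma>) / 2) (\<lambda>n. psi_minus \<gamma> n (- int j)))
             (h_space ?M ((1 + \<gamma>) / 2) (\<lambda>n. psi_minus \<gamma> n (int n + int j + 1)))) \<and>
        (\<exists>a. l2_sums ?M
             (\<lambda>n x. \<Sum>k=1..n. a n k * psi_minus \<gamma> n (int k) x) (Pi_perp \<gamma> u) \<and>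
           summable (\<lambda>n. \<Sum>k=1..n. (cmod (a n k))\<^sup>2 / (sigma_coeff \<gamma> n k)\<^sup>2))"
      unfolding A B C unfolding c_def by (rule xray_range_iff[OF \<gamma> uL par[unfolded c_def]])
  qed
qed

end
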